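(* Let $(a^*,b^* )$, $a^*<b^*$, be the unique pair of real numbers satisfying $v^{f'}_{a^*,b^*}(a^* )=-C_U$ and $v^{f'}_{a^*,b^*}(b^* )=C_D$. Then the strategy $\pi_{a^*,b^*}$ is optimal, with $$v_{a^*,b^*}(x)=\inf_{\pi\in\Pi}v^\pi(x),\qquad x\in\mathbb{R}.$$
   Context: Fix $q>0$, $r>0$. $X=(X(t);t\ge 0)$ is a one-dimensional spectrally negative Lévy process (only downward jumps); $\mathbb{P}_x,\mathbb{E}_x$ denote law and expectation when $X(0)=x$ (no subscript if $x=0$). Its Laplace exponent is $\psi(s)=\log\mathbb{E}[e^{sX(1)}]=\gamma_0 s+\frac{\sigma^2}{2}s^2+\int_{(-\infty,0)}(e^{sz}-1-sz1_{\{z>-1\}})\,\mu(\mathrm{d}z)$, $s\ge0$, with $\gamma_0\in\mathbb{R}$, $\sigma\ge0$, $\int_{(-\infty,0)}(1\wedge z^2)\,\mu(\mathrm{d}z)<\infty$. $X$ is not the negative of a subordinator, and there is $\theta>0$ with $\int_{(-\infty,-1]}e^{\theta|y|}\,\mu(\mathrm{d}y)<\infty$. $C_U,C_D\in\mathbb{R}$ with $C_U+C_D>0$. The running cost $f:\mathbb{R}\to\mathbb{R}$ satisfies: (1) $f$ is convex and piecewise continuously differentiable, and it is slowly or regularly varying as $x\to\infty$ (resp. $x\to-\infty$) if $\lim_{x\to\infty}|f(x)|=\infty$ (resp. $\lim_{x\to-\infty}|f(x)|=\infty$), i.e. for some $c\in\mathbb{R}$, $f(\alpha x)/f(x)\to\alpha^c$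 for all $\alpha>0$ ($c=0$: slowly varying); (2) with $\tilde f(x):=f(x)+qC_Ux$, the number $\bar a:=\inf\{a:\tilde f'(a)\ge0\}$ is finite and $\tilde f$ is strictly decreasing on $(-\infty,\bar a)$ and non-decreasing on $(\bar a,\infty)$; (3) $\bar{\bar a}:=\inf\{a:f'(a)-qC_D>0\}$ is finite. Let $N^r$ be a Poisson process of rate $r$ independent of $X$ with arrival times $T(1)<T(2)<\cdots$, and $\mathbb{F}$ the completed filtration generated by $(X,N^r)$. A strategy $\pi=(R^\pi,L^\pi)$ is a pair of non-decreasing, càdlàg, $\mathbb{F}$-adapted processes with $R^\pi(0-)=L^\pi(0-)=0$ such that $L^\pi(t)=\int_{[0,t]}\nu^\pi(s)\,\mathrm{d}N^r(s)$ for some $\mathbb{F}$-adapted càglàd process $\nu^\pi$. The controlled process is $Y^\pi=X+R^\pi-L^\pi$. The net present value (NPV) of costs is $v^\pi(x)=\mathbb{E}_x\big[\int_0^\infty e^{-qt}f(Y^\pi(t))\,\mathrm{d}t+\int_{[0,\infty)}e^{-qt}(C_U\,\mathrm{d}R^\pi(t)+C_D\,\mathrm{d}L^\pi(t))\big]$. $\Pi$ is the set of admissible strategies: those with $\mathbb{E}_x[\int_0^\infty e^{-qs}|f(Y^\pi(s))|\,\mathrm{d}s]<\infty$ and $\mathbb{E}_x[\int_{[0,\infty)}e^{-qs}(\mathrm{d}R^\pi(s)+\mathrm{d}L^\pi(s))]<\infty$. For $a<b$, the periodic-classical (double-)barrier strategy $\pi_{a,b}=(R^{a,b},L^{a,b})$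 has controlled process $Y^{a,b}=X+R^{a,b}-L^{a,b}$ reflected upward at $a$ in the classical way, continuously in time, and pushed down to $b$ at each $T(i)$ at which it is observed above $b$: $R^{a,b}(t)=\sup_{0\le s\le t}(a-X(s)+L^{a,b}(s))^+$ and $L^{a,b}(t)=\sum_{i\ge1,\,T(i)\le t}(Y^{a,b}(T(i)-)-b)^+$. Write $v_{a,b}:=v^{\pi_{a,b}}$ and, for measurable $h$, $v^h_{a,b}(x):=\mathbb{E}_x[\int_0^\infty e^{-qt}h(Y^{a,b}(t))\,\mathrm{d}t]$ (with $h=f'$, the derivative of $f$ where it exists). It is known that the pair $(a^*,b^* )$ in the claim exists and is unique. *)

theory Defs
  imports "HOL-Probability.Probability"
begin

section \<open>Paths\<close>

text \<open>
  Time is \<open>real\<close>, and only times \<open>t \<ge> 0\<close> are ever constrained.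
\<close>

definition cadlag :: "(real \<Rightarrow> real) \<Rightarrow> bool" where
  "cadlag g \<longleftrightarrow> (\<forall>t\<ge>0. continuous (at_right t) g) \<and> (\<forall>t>0. \<exists>l. (g \<longlongrightarrow> l) (at_left t))"

definition caglad :: "(real \<Rightarrow> real) \<Rightarrow> bool" where
  "caglad g \<longleftrightarrow> (\<forall>t>0. continuous (at_left t) g) \<and> (\<forall>t\<ge>0. \<exists>l. (g \<longlongrightarrow> l) (at_right t))"

text \<open>
  The Lebesgue--Stieltjes measure of a non-decreasing right-continuous \<open>g\<close> on \<open>[0, \<infinity>)\<close> with the
  convention \<open>g(0-) = 0\<close>: it has an atom of mass \<open>g 0\<close> at \<open>0\<close>.
\<close>

definition stieltjes :: "(real \<Rightarrow> real) \<Rightarrow> real measure" where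
  "stieltjes g = interval_measure (\<lambda>t. if t < 0 then 0 else g t)"

section \<open>The driving processes\<close>

definition levy_process :: "'w measure \<Rightarrow> (real \<Rightarrow> 'w \<Rightarrow> real) \<Rightarrow> bool" where
  "levy_process M X \<longleftrightarrow>
     (\<forall>t\<ge>0. X t \<in> borel_measurable M) \<and>
     (AE \<omega> in M. X 0 \<omega> = 0) \<and>
     (AE \<omega> in M. cadlag (\<lambda>t. X t \<omega>)) \<and>
     (\<forall>(ts :: nat \<Rightarrow> real) n. mono ts \<longrightarrow> 0 \<le> ts 0 \<longrightarrow>
        prob_space.indep_vars M (\<lambda>_. borel) (\<lambda>i \<omega>. X (ts (Suc i)) \<omega> - X (ts i) \<omega>) {..<n}) \<and>
     (\<forall>s t. 0 \<le> s \<longrightarrow> s \<le> t \<longrightarrow>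
        distr M borel (\<lambda>\<omega>. X t \<omega> - X s \<omega>) = distr M borel (X (t - s)))"

definition no_upward_jumps :: "'w measure \<Rightarrow> (real \<Rightarrow> 'w \<Rightarrow> real) \<Rightarrow> bool" where
  "no_upward_jumps M X \<longleftrightarrow>
     (AE \<omega> in M. \<forall>t>0. X t \<omega> \<le> Lim (at_left t) (\<lambda>s. X s \<omega>))"

definition subordinator :: "'w measure \<Rightarrow> (real \<Rightarrow> 'w \<Rightarrow> real) \<Rightarrow> bool" where
  "subordinator M X \<longleftrightarrow>
     levy_process M X \<and> (AE \<omega> in M. mono_on {0..} (\<lambda>t. X t \<omega>))"

definition levy_measure_neg :: "real measure \<Rightarrow> bool" where
  "levy_measure_neg \<mu> \<longleftrightarrow>
     sets \<mu> = sets borel \<and> emeasure \<mu> {0..} = 0 \<and>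
     (\<integral>\<^sup>+z\<in>{..<0}. ennreal (min 1 (z\<^sup>2)) \<partial>\<mu>) < \<infinity>"

definition laplace_exponent :: "real \<Rightarrow> real \<Rightarrow> real measure \<Rightarrow> real \<Rightarrow> real" where
  "laplace_exponent \<gamma> \<sigma> \<mu> s =
     \<gamma> * s + \<sigma>\<^sup>2 / 2 * s\<^sup>2 +
     (LINT z:{..<0}|\<mu>. exp (s * z) - 1 - s * z * indicator {-1<..} z)"

definition has_laplace_exponent ::
    "'w measure \<Rightarrow> (real \<Rightarrow> 'w \<Rightarrow> real) \<Rightarrow> (real \<Rightarrow> real) \<Rightarrow> bool" where
  "has_laplace_exponent M X \<psi> \<longleftrightarrow>
     (\<forall>s\<ge>0. integrable M (\<lambda>\<omega>. exp (s * X 1 \<omega>)) \<and>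
            ln (LINT \<omega>|M. exp (s * X 1 \<omega>)) = \<psi> s)"

definition poisson_process :: "'w measure \<Rightarrow> real \<Rightarrow> (real \<Rightarrow> 'w \<Rightarrow> nat) \<Rightarrow> bool" where
  "poisson_process M r N \<longleftrightarrow>
     (\<forall>t\<ge>0. N t \<in> M \<rightarrow>\<^sub>M count_space UNIV) \<and>
     (AE \<omega> in M. N 0 \<omega> = 0) \<and>
     (AE \<omega> in M. mono_on {0..} (\<lambda>t. N t \<omega>) \<and> cadlag (\<lambda>t. real (N t \<omega>))) \<and>
     (\<forall>(ts :: nat \<Rightarrow> real) n. mono ts \<longrightarrow> 0 \<le> ts 0 \<longrightarrow>
        prob_space.indep_vars M (\<lambda>_. count_space UNIV)
          (\<lambda>i \<omega>. N (ts (Suc i)) \<omega> - N (ts i) \<omega>) {..<n}) \<and>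
     (\<forall>s t. 0 \<le> s \<longrightarrow> s < t \<longrightarrow>
        distr M (count_space UNIV) (\<lambda>\<omega>. N t \<omega> - N s \<omega>) = poisson_pmf (r * (t - s)))"

definition indep_processes ::
    "'w measure \<Rightarrow> (real \<Rightarrow> 'w \<Rightarrow> real) \<Rightarrow> (real \<Rightarrow> 'w \<Rightarrow> nat) \<Rightarrow> bool" where
  "indep_processes M X N \<longleftrightarrow>
     prob_space.indep_var M
       (\<Pi>\<^sub>M t\<in>{0..}. borel) (\<lambda>\<omega>. \<lambda>t\<in>{0..}. X t \<omega>)
       (\<Pi>\<^sub>M t\<in>{0..}. count_space UNIV) (\<lambda>\<omega>. \<lambda>t\<in>{0..}. N t \<omega>)"

text \<open>The arrival times \<open>T(1) < T(2) < \<dots>\<close>; the value at index \<open>0\<close> is not used.\<close>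

definition arrival :: "(real \<Rightarrow> 'w \<Rightarrow> nat) \<Rightarrow> 'w \<Rightarrow> nat \<Rightarrow> real" where
  "arrival N \<omega> i = Inf {t. 0 \<le> t \<and> i \<le> N t \<omega>}"

text \<open>The filtration generated by \<open>(X, N)\<close>, completed by all null sets of \<open>M\<close>.\<close>

definition generated_filtration ::
    "'w measure \<Rightarrow> (real \<Rightarrow> 'w \<Rightarrow> real) \<Rightarrow> (real \<Rightarrow> 'w \<Rightarrow> nat) \<Rightarrow> real \<Rightarrow> 'w measure" where
  "generated_filtration M X N t =
     sigma (space M)
       ({X s -` A \<inter> space M |s A. s \<in> {0..t} \<and> A \<in> sets borel} \<union>
        {N s -` A \<inter> space M |s A. s \<in> {0..t} \<and> A \<in> sets (count_space UNIV)} \<union>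
        null_sets M)"

definition adapted ::
    "'w measure \<Rightarrow> (real \<Rightarrow> 'w \<Rightarrow> real) \<Rightarrow> (real \<Rightarrow> 'w \<Rightarrow> nat) \<Rightarrow> (real \<Rightarrow> 'w \<Rightarrow> real) \<Rightarrow> bool" where
  "adapted M X N Z \<longleftrightarrow> (\<forall>t\<ge>0. Z t \<in> borel_measurable (generated_filtration M X N t))"

section \<open>Running cost\<close>

definition regularly_varying_at :: "real filter \<Rightarrow> (real \<Rightarrow> real) \<Rightarrow> bool" where
  "regularly_varying_at F f \<longleftrightarrow>
     (\<exists>c::real. \<forall>\<alpha>>0. ((\<lambda>x. f (\<alpha> * x) / f x) \<longlongrightarrow> \<alpha> powr c) F)"

definition finite_inf :: "real set \<Rightarrow> bool" where
  "finite_inf A \<longleftrightarrow> A \<noteq> {} \<and> bdd_below A"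

text \<open>
  In the two infima below, only points where the derivative exists are considered. Exceptional
  points of a piecewise continuously differentiable function may accumulate only at \<open>\<plusminus>\<infinity>\<close>.
\<close>

definition running_cost :: "real \<Rightarrow> real \<Rightarrow> real \<Rightarrow> (real \<Rightarrow> real) \<Rightarrow> bool" where
  "running_cost q C\<^sub>U C\<^sub>D f \<longleftrightarrow>
     convex_on UNIV f \<and> (\<forall>u v. f piecewise_C1_differentiable_on {u..v}) \<and>
     (filterlim (\<lambda>x. \<bar>f x\<bar>) at_top at_top \<longrightarrow> regularly_varying_at at_top f) \<and>
     (filterlim (\<lambda>x. \<bar>f x\<bar>) at_top at_bot \<longrightarrow> regularly_varying_at at_bot f) \<and>
     (let g = (\<lambda>x. f x + q * C\<^sub>U * x);
          A = {a. g differentiable (at a) \<and> 0 \<le> deriv g a}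
      in finite_inf A \<and> strict_antimono_on {..<Inf A} g \<and> mono_on {Inf A<..} g) \<and>
     finite_inf {a. f differentiable (at a) \<and> 0 < deriv f a - q * C\<^sub>D}"

section \<open>Strategies and costs\<close>

text \<open>
  The law \<open>\<P>\<^sub>x\<close> is realised on \<open>M\<close> by the process \<open>x + X\<close>, where \<open>X\<close> starts at \<open>0\<close>.
  A strategy is a pair \<open>(R, L)\<close>.
\<close>

type_synonym 'w strategy = "(real \<Rightarrow> 'w \<Rightarrow> real) \<times> (real \<Rightarrow> 'w \<Rightarrow> real)"

definition controlled ::
    "(real \<Rightarrow> 'w \<Rightarrow> real) \<Rightarrow> real \<Rightarrow> 'w strategy \<Rightarrow> real \<Rightarrow> 'w \<Rightarrow> real" where
  "controlled X x = (\<lambda>(R, L) t \<omega>. x + X t \<omega> + R t \<omega> - L t \<omega>)"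

text \<open>
  Since \<open>R(0-) = L(0-) = 0\<close>, monotonicity on \<open>[0, \<infinity>)\<close> together with the jump at time \<open>0\<close> being
  non-negative is the monotonicity required of a strategy.
\<close>

definition is_strategy ::
    "'w measure \<Rightarrow> (real \<Rightarrow> 'w \<Rightarrow> real) \<Rightarrow> (real \<Rightarrow> 'w \<Rightarrow> nat) \<Rightarrow> 'w strategy \<Rightarrow> bool" where
  "is_strategy M X N = (\<lambda>(R, L).
     adapted M X N R \<and> adapted M X N L \<and>
     (AE \<omega> in M. 0 \<le> R 0 \<omega> \<and> mono_on {0..} (\<lambda>t. R t \<omega>) \<and> cadlag (\<lambda>t. R t \<omega>)) \<and>
     (AE \<omega> in M. 0 \<le> L 0 \<omega> \<and> mono_on {0..} (\<lambda>t. L t \<omega>) \<and> cadlag (\<lambda>t. L t \<omega>)) \<and>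
     (\<exists>\<nu>. adapted M X N \<nu> \<and> (AE \<omega> in M. caglad (\<lambda>t. \<nu> t \<omega>)) \<and>
        (AE \<omega> in M. \<forall>t\<ge>0. L t \<omega> = (LINT s:{0..t}|stieltjes (\<lambda>u. real (N u \<omega>)). \<nu> s \<omega>))))"

text \<open>
  For \<open>h = deriv f\<close>, the value of \<open>deriv f\<close> at the countably many kinks of \<open>f\<close> is an arbitrary
  constant; a barrier-controlled path spends Lebesgue-null time at each of them.
\<close>

definition npv_running ::
    "'w measure \<Rightarrow> (real \<Rightarrow> 'w \<Rightarrow> real) \<Rightarrow> real \<Rightarrow> (real \<Rightarrow> real) \<Rightarrow> real \<Rightarrow> 'w strategy \<Rightarrow> real" where
  "npv_running M X q h x \<pi> =
     (LINT \<omega>|M. (LINT t:{0..}|lborel. exp (- q * t) * h (controlled X x \<pi> t \<omega>)))"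

definition npv ::
    "'w measure \<Rightarrow> (real \<Rightarrow> 'w \<Rightarrow> real) \<Rightarrow> real \<Rightarrow> real \<Rightarrow> real \<Rightarrow> (real \<Rightarrow> real) \<Rightarrow> real \<Rightarrow>
     'w strategy \<Rightarrow> real" where
  "npv M X q C\<^sub>U C\<^sub>D f x \<pi> =
     (LINT \<omega>|M.
        (LINT t:{0..}|lborel. exp (- q * t) * f (controlled X x \<pi> t \<omega>)) +
        (C\<^sub>U * (LINT t:{0..}|stieltjes (\<lambda>t. fst \<pi> t \<omega>). exp (- q * t)) +
         C\<^sub>D * (LINT t:{0..}|stieltjes (\<lambda>t. snd \<pi> t \<omega>). exp (- q * t))))"

definition admissible ::
    "'w measure \<Rightarrow> (real \<Rightarrow> 'w \<Rightarrow> real) \<Rightarrow> (real \<Rightarrow> 'w \<Rightarrow> nat) \<Rightarrow> real \<Rightarrow> (real \<Rightarrow> real) \<Rightarrow> real \<Rightarrow>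
     'w strategy set" where
  "admissible M X N q f x =
     {\<pi>. is_strategy M X N \<pi> \<and>
        (\<integral>\<^sup>+\<omega>. (\<integral>\<^sup>+t\<in>{0..}. ennreal (exp (- q * t) * \<bar>f (controlled X x \<pi> t \<omega>)\<bar>) \<partial>lborel) \<partial>M) < \<infinity> \<and>
        (\<integral>\<^sup>+\<omega>. (\<integral>\<^sup>+t\<in>{0..}. ennreal (exp (- q * t)) \<partial>stieltjes (\<lambda>t. fst \<pi> t \<omega>)) +
              (\<integral>\<^sup>+t\<in>{0..}. ennreal (exp (- q * t)) \<partial>stieltjes (\<lambda>t. snd \<pi> t \<omega>)) \<partial>M) < \<infinity>}"

section \<open>Periodic-classical barrier strategies\<close>

definition reflect_up :: "real \<Rightarrow> (real \<Rightarrow> real) \<Rightarrow> (real \<Rightarrow> real) \<Rightarrow> real \<Rightarrow> real" where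
  "reflect_up a \<xi> l t = (SUP s\<in>{0..t}. max 0 (a - \<xi> s + l s))"

definition reflected :: "real \<Rightarrow> (real \<Rightarrow> real) \<Rightarrow> (real \<Rightarrow> real) \<Rightarrow> real \<Rightarrow> real" where
  "reflected a \<xi> l t = \<xi> t + reflect_up a \<xi> l t - l t"

text \<open>
  The defining equations of \<open>R\<close> and \<open>L\<close> refer to each other; they are resolved by recursion over the
  arrival times \<open>\<tau> 1 < \<tau> 2 < \<dots>\<close>. In \<open>push_down a b \<xi> \<tau> n\<close> only the first \<open>n\<close> arrivals are acted
  upon. Here \<open>\<xi>\<close> is the uncontrolled path.
\<close>

primrec push_down ::
    "real \<Rightarrow> real \<Rightarrow> (real \<Rightarrow> real) \<Rightarrow> (nat \<Rightarrow> real) \<Rightarrow> nat \<Rightarrow> real \<Rightarrow> real" where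
  "push_down a b \<xi> \<tau> 0 = (\<lambda>t. 0)"
| "push_down a b \<xi> \<tau> (Suc n) = (\<lambda>t. push_down a b \<xi> \<tau> n t +
     (if \<tau> (Suc n) \<le> t
      then max 0 (Lim (at_left (\<tau> (Suc n))) (reflected a \<xi> (push_down a b \<xi> \<tau> n)) - b) else 0))"

definition barrier_L ::
    "real \<Rightarrow> real \<Rightarrow> (real \<Rightarrow> real) \<Rightarrow> (nat \<Rightarrow> real) \<Rightarrow> real \<Rightarrow> real" where
  "barrier_L a b \<xi> \<tau> t = push_down a b \<xi> \<tau> (card {i. 1 \<le> i \<and> \<tau> i \<le> t}) t"

definition barrier_R ::
    "real \<Rightarrow> real \<Rightarrow> (real \<Rightarrow> real) \<Rightarrow> (nat \<Rightarrow> real) \<Rightarrow> real \<Rightarrow> real" where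
  "barrier_R a b \<xi> \<tau> = reflect_up a \<xi> (barrier_L a b \<xi> \<tau>)"

definition barrier_strategy ::
    "(real \<Rightarrow> 'w \<Rightarrow> real) \<Rightarrow> (real \<Rightarrow> 'w \<Rightarrow> nat) \<Rightarrow> real \<Rightarrow> real \<Rightarrow> real \<Rightarrow> 'w strategy" where
  "barrier_strategy X N a b x =
     ((\<lambda>t \<omega>. barrier_R a b (\<lambda>s. x + X s \<omega>) (arrival N \<omega>) t),
      (\<lambda>t \<omega>. barrier_L a b (\<lambda>s. x + X s \<omega>) (arrival N \<omega>) t))"

text \<open>
  The recursion solves the implicit equations, and on \<open>[0, \<infinity>)\<close> it is their only solution.
  (The equation \<open>R = reflect_up a \<xi> L\<close> is the definition of \<open>barrier_R\<close>.)
\<close>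

lemma reflect_up_cong:
  assumes "\<And>s. 0 \<le> s \<Longrightarrow> s \<le> t \<Longrightarrow> l s = l' s"
  shows "reflect_up a \<xi> l t = reflect_up a \<xi> l' t"
  unfolding reflect_up_def using assms by (intro SUP_cong) auto

lemma Lim_reflected_cong:
  assumes "0 < u" "\<And>s. 0 \<le> s \<Longrightarrow> s < u \<Longrightarrow> l s = l' s"
  shows "Lim (at_left u) (reflected a \<xi> l) = Lim (at_left u) (reflected a \<xi> l')"
proof -
  have "\<forall>\<^sub>F s in at_left u. 0 < s \<and> s < u"
    using assms(1) eventually_at_left_field by blast
  then have ev: "\<forall>\<^sub>F s in at_left u. reflected a \<xi> l s = reflected a \<xi> l' s"
  proof eventually_elim
    case (elim s)
    then show ?case
      using assms(2) reflect_up_cong[of s l l' a \<xi>] by (auto simp: reflected_def)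
  qed
  show ?thesis
    unfolding t2_space_class.Lim_def by (simp only: tendsto_cong[OF ev])
qed

context
  fixes a b :: real and \<xi> :: "real \<Rightarrow> real" and \<tau> :: "nat \<Rightarrow> real"
  assumes pos: "0 < \<tau> (Suc 0)" and incr: "\<And>i. 1 \<le> i \<Longrightarrow> \<tau> i < \<tau> (Suc i)"
    and unbdd: "\<And>t. \<exists>i\<ge>1. t < \<tau> i"
begin

private lemma tau_mono: "1 \<le> i \<Longrightarrow> i \<le> j \<Longrightarrow> \<tau> i \<le> \<tau> j"
  by (rotate_tac, induction j rule: dec_induct) (use incr in \<open>auto intro: order.trans less_imp_le\<close>)

private lemma tau_pos: "1 \<le> i \<Longrightarrow> 0 < \<tau> i"
  using tau_mono[of 1 i] pos by simp

private lemma arrivals_upto: "{i. 1 \<le> i \<and> \<tau> i \<le> t} = {1..card {i. 1 \<le> i \<and> \<tau> i \<le> t}}"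
proof -
  define m where "m = (LEAST m. t < \<tau> (Suc m))"
  have "\<exists>m. t < \<tau> (Suc m)"
    using unbdd[of t] by (metis One_nat_def Suc_le_D)
  then have m: "t < \<tau> (Suc m)" and least: "\<And>k. k < m \<Longrightarrow> \<tau> (Suc k) \<le> t"
    unfolding m_def by (auto intro: LeastI_ex dest: not_less_Least)
  have "{i. 1 \<le> i \<and> \<tau> i \<le> t} = {1..m}"
  proof (intro set_eqI iffI)
    fix i assume i: "i \<in> {i. 1 \<le> i \<and> \<tau> i \<le> t}"
    then have "\<not> Suc m \<le> i" using tau_mono[of "Suc m" i] m by force
    then show "i \<in> {1..m}" using i by simp
  next
    fix i assume "i \<in> {1..m}"
    then show "i \<in> {i. 1 \<le> i \<and> \<tau> i \<le> t}" using least[of "i - 1"] by auto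
  qed
  then show ?thesis by simp
qed

private lemma push_down_beyond:
  assumes "card {i. 1 \<le> i \<and> \<tau> i \<le> t} \<le> n"
  shows "push_down a b \<xi> \<tau> n t = barrier_L a b \<xi> \<tau> t"
  using assms
proof (induction n rule: dec_induct)
  case base
  then show ?case by (simp add: barrier_L_def)
next
  case (step n)
  have "Suc n \<notin> {i. 1 \<le> i \<and> \<tau> i \<le> t}"
    using step(1) by (subst arrivals_upto) simp
  then show ?case using step by simp
qed

private lemma card_before: "s < \<tau> (Suc n) \<Longrightarrow> card {i. 1 \<le> i \<and> \<tau> i \<le> s} \<le> n"
proof (rule ccontr)
  assume s: "s < \<tau> (Suc n)" and "\<not> card {i. 1 \<le> i \<and> \<tau> i \<le> s} \<le> n"
  then have "Suc n \<in> {i. 1 \<le> i \<and> \<tau> i \<le> s}" by (subst arrivals_upto) simp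
  then show False using s by simp
qed

private lemma push_down_sum:
  "push_down a b \<xi> \<tau> n t =
     (\<Sum>i\<in>{i. i \<in> {1..n} \<and> \<tau> i \<le> t}.
        max 0 (Lim (at_left (\<tau> i)) (reflected a \<xi> (barrier_L a b \<xi> \<tau>)) - b))"
proof (induction n)
  case (Suc n)
  have "Lim (at_left (\<tau> (Suc n))) (reflected a \<xi> (push_down a b \<xi> \<tau> n)) =
        Lim (at_left (\<tau> (Suc n))) (reflected a \<xi> (barrier_L a b \<xi> \<tau>))"
    by (intro Lim_reflected_cong tau_pos push_down_beyond card_before) auto
  moreover have "{i. i \<in> {1..Suc n} \<and> \<tau> i \<le> t} =
      (if \<tau> (Suc n) \<le> t then insert (Suc n) {i. i \<in> {1..n} \<and> \<tau> i \<le> t}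
       else {i. i \<in> {1..n} \<and> \<tau> i \<le> t})"
    by (auto simp: le_Suc_eq)
  ultimately show ?case using Suc by simp
qed simp

lemma barrier_L_eq:
  "barrier_L a b \<xi> \<tau> t =
     (\<Sum>i\<in>{i. 1 \<le> i \<and> \<tau> i \<le> t}.
        max 0 (Lim (at_left (\<tau> i)) (reflected a \<xi> (barrier_L a b \<xi> \<tau>)) - b))"
proof -
  have "{i. i \<in> {1..card {i. 1 \<le> i \<and> \<tau> i \<le> t}} \<and> \<tau> i \<le> t} = {i. 1 \<le> i \<and> \<tau> i \<le> t}"
    using arrivals_upto by blast
  then show ?thesis
    using push_down_sum[of "card {i. 1 \<le> i \<and> \<tau> i \<le> t}" t] by (simp add: barrier_L_def)
qed

lemma barrier_L_unique:
  assumes l: "\<And>t. 0 \<le> t \<Longrightarrow>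
     l t = (\<Sum>i\<in>{i. 1 \<le> i \<and> \<tau> i \<le> t}. max 0 (Lim (at_left (\<tau> i)) (reflected a \<xi> l) - b))"
  shows "0 \<le> t \<Longrightarrow> l t = barrier_L a b \<xi> \<tau> t"
proof -
  let ?L = "barrier_L a b \<xi> \<tau>"
  have "\<forall>t. 0 \<le> t \<longrightarrow> t < \<tau> (Suc n) \<longrightarrow> l t = ?L t" for n
  proof (induction n)
    case 0
    have "{i. 1 \<le> i \<and> \<tau> i \<le> t} = {}" if "t < \<tau> (Suc 0)" for t
      using card_before[OF that] by (subst arrivals_upto) simp
    then show ?case using l barrier_L_eq by (metis (no_types, lifting) sum.empty)
  next
    case (Suc n)
    show ?case
    proof (intro allI impI)
      fix t assume t: "0 \<le> t" "t < \<tau> (Suc (Suc n))"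
      have "Lim (at_left (\<tau> i)) (reflected a \<xi> l) = Lim (at_left (\<tau> i)) (reflected a \<xi> ?L)"
        if "i \<in> {i. 1 \<le> i \<and> \<tau> i \<le> t}" for i
      proof -
        have "i \<in> {1..card {i. 1 \<le> i \<and> \<tau> i \<le> t}}"
          using that by (subst (asm) arrivals_upto)
        then have i: "1 \<le> i" "i \<le> Suc n" using card_before[OF t(2)] by auto
        show ?thesis
          using Suc tau_mono[OF i] i by (intro Lim_reflected_cong tau_pos) auto
      qed
      then show "l t = ?L t"
        unfolding l[OF t(1)] by (subst barrier_L_eq) (auto intro!: sum.cong)
    qed
  qed
  then show "0 \<le> t \<Longrightarrow> l t = ?L t"
    using unbdd[of t] by (metis One_nat_def Suc_le_D)
qed

end

end

theory Submission
  imports Defs "HOL-Real_Asymp.Real_Asymp"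
begin

text \<open>
  A verification argument that works with the resolvent of the optimally controlled process \<open>Y\<close>
  instead of its generator. By convexity, \<open>f (Y') \<ge> f Y + f' Y * (Y' - Y)\<close> for every other controlled
  process \<open>Y'\<close>, and \<open>Y' - Y\<close> is a difference of controls. For a non-decreasing adapted \<open>Z\<close>, the
  Markov property turns the discounted mean of \<open>\<integral>f' (Y t) * Z t dt\<close> into that of \<open>\<integral>g (Y t) dZ t\<close>,
  where \<open>g\<close> is the potential of \<open>f'\<close>. Now \<open>g\<close> is monotone with \<open>g a = - C\<^sub>U\<close> and \<open>g b = C\<^sub>D\<close>. As
  \<open>Y \<ge> a\<close> always, \<open>Y = a\<close> when the reflection grows, \<open>Y \<le> b\<close> at every arrival, and \<open>Y = b\<close> when \<open>Y\<close>
  is pushed down, the four signs combine to the claim. Since \<open>f'\<close> is neither bounded nor continuous,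
  it is first truncated; for \<open>g\<close> to be continuous, \<open>Y\<close> must not spend time at any point, which
  follows from \<open>X\<close> being positive with non-vanishing probability at arbitrarily small times.
\<close>

section \<open>Cadlag functions\<close>

text \<open>The obstacle is the Markov property. The strategy is a pathwise recursion over random
  arrival times, so nothing about \<open>Y\<close> is Markov by construction, and independence is
  available only for increments of \<open>X\<close> and \<open>N\<close> at fixed times. Hence
  \<open>Y\<close> is approached by a reflected and observed random walk, a function of the
  increments over a grid. The walk is Lipschitz in its starting point, so a walk restarted at time s
  from Y(s) still converges to Y(s + u), and independent increments give the Markov property in the
  limit. The same walk carries the moment bounds. Costs are integrated by parts: the integral of exp
  (- q * t) dZ is q times that of exp (- q * t) * Z t dt, so everything becomes a discounted time
  integral, and a constant potential \<open>u\<close> belongs to the constant running cost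
  \<open>q * u\<close>. This is the origin of the factors \<open>q * U \<phi> a\<close> and
  \<open>q * U \<phi> b\<close>. Exponents are budgeted so that all moments grow at most like exp (q
  * t / 2), which the discount beats.\<close>

lemma cadlag_at_right: "cadlag g ==> 0 <= t ==> (g \<longlongrightarrow> g t) (at_right t)"
 by (auto simp: cadlag_def continuous_within)

lemma cadlag_at_left: "cadlag g ==> 0 < t ==> (g \<longlongrightarrow> Lim (at_left t) g) (at_left t)"
 unfolding cadlag_def by (metis tendsto_Lim trivial_limit_at_left_real)

lemma cadlagI:
 assumes "!!t. 0 <= t ==> (g \<longlongrightarrow> g t) (at_right t)" "!!t. 0 < t ==> EX l. (g \<longlongrightarrow> l) (at_left t)"
 shows "cadlag g"
 using assms by (auto simp: cadlag_def continuous_within)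

lemma cadlag_right_ball:
 assumes "cadlag g" "0 <= t" "0 < e"
 shows "\<exists>d>0. \<forall>s\<in>{t..<t+d}. \<bar>g s - g t\<bar> < e"
proof -
 have "\<forall>\<^sub>F s in at_right t. dist (g s) (g t) < e"
  using cadlag_at_right[OF assms(1,2)] assms(3) tendstoD by blast
 then obtain c where c: "c > t" "!!s. t < s ==> s < c ==> dist (g s) (g t) < e"
  unfolding eventually_at_right_field by auto
 show ?thesis
 proof (intro exI[of _ "c - t"] conjI ballI)
  fix s assume "s \<in> {t..<t + (c - t)}"
  then show "\<bar>g s - g t\<bar> < e"
   using c(2)[of s] assms(3) by (cases "s = t") (auto simp: dist_real_def)
 qed (use c in auto)
qed

lemma at_left_ball:
 fixes g :: "real => real"
 assumes "(g \<longlongrightarrow> l) (at_left t)" "0 < e"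
 shows "\<exists>d>0. \<forall>s\<in>{t-d<..<t}. \<bar>g s - l\<bar> < e"
proof -
 have "\<forall>\<^sub>F s in at_left t. dist (g s) l < e"
  using assms tendstoD by blast
 then obtain c where c: "c < t" "!!s. c < s ==> s < t ==> dist (g s) l < e"
  unfolding eventually_at_left_field by auto
 show ?thesis
  by (rule exI[of _ "t - c"]) (use c in \<open>auto simp: dist_real_def\<close>)
qed

lemma tendsto_at_left_from_0:
 fixes g :: "real => real"
 assumes "0 < t" "(g \<longlongrightarrow> l) (at_left t)" "!!s. 0 <= s ==> s < t ==> g s = h s"
 shows "(h \<longlongrightarrow> l) (at_left t)"
proof -
 have "\<forall>\<^sub>F s in at_left t. 0 < s & s < t"
  using assms(1) eventually_at_left_field by blast
 then have "\<forall>\<^sub>F s in at_left t. g s = h s"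
  by eventually_elim (use assms(3) in auto)
 then show ?thesis using assms(2) by (metis tendsto_cong)
qed

lemma cadlag_add: "cadlag f ==> cadlag g ==> cadlag (%t. f t + g t)"
 by (rule cadlagI; blast intro: tendsto_add cadlag_at_right cadlag_at_left)

lemma cadlag_diff: "cadlag f ==> cadlag g ==> cadlag (%t. f t - g t)"
 by (rule cadlagI; blast intro: tendsto_diff cadlag_at_right cadlag_at_left)

lemma cadlag_const: "cadlag (%t. c)"
 by (auto intro!: cadlagI tendsto_const)

lemma cadlag_bounded:
 assumes g: "cadlag g" and t: "0 <= t"
 shows "EX B. \<forall>s\<in>{0..t}. \<bar>g s\<bar> <= B"
proof -
 \<comment> \<open>The guard \<open>0 <= s\<close> matters for the intervals around 0 that the
   bisection also tests: below 0 the path is unconstrained.\<close>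
 have "EX B. \<forall>s\<in>{0..t}. 0 <= s --> \<bar>g s\<bar> <= B"
 proof (rule Bolzano[where P="%u v. EX B. \<forall>s\<in>{u..v}. 0 <= s --> \<bar>g s\<bar> <= B", OF t])
  fix u v wt assume "EX B. \<forall>s\<in>{u..v}. 0 <= s --> \<bar>g s\<bar> <= B" "EX B. \<forall>s\<in>{v..wt}. 0 <= s --> \<bar>g s\<bar> <= B"
  then obtain B C where B: "\<forall>s\<in>{u..v}. 0 <= s --> \<bar>g s\<bar> <= B"
   and C: "\<forall>s\<in>{v..wt}. 0 <= s --> \<bar>g s\<bar> <= C"
   by blast
  show "EX B. \<forall>s\<in>{u..wt}. 0 <= s --> \<bar>g s\<bar> <= B"
  proof (intro exI ballI impI)
   fix s assume s: "s \<in> {u..wt}" "0 <= s"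
   then have "\<bar>g s\<bar> <= B \<or> \<bar>g s\<bar> <= C"
    using B[rule_format, of s] C[rule_format, of s] by (cases "s <= v") simp_all
   then show "\<bar>g s\<bar> <= max B C" by linarith
  qed
 next
  fix x assume local: "0 <= x" "x <= t"
  obtain d1 where d1: "d1 > 0" "\<forall>s\<in>{x..<x+d1}. \<bar>g s - g x\<bar> < 1"
   using cadlag_right_ball[OF g local(1), of 1] by auto
  obtain d2 l where d2: "d2 > 0" "\<forall>s\<in>{x-d2<..<x}. 0 <= s --> \<bar>g s - l\<bar> < 1"
  proof (cases "x = 0")
   case True
   then show ?thesis using that[of 1] by auto
  next
   case False
   then have "0 < x" using local by simp
   from at_left_ball[OF cadlag_at_left[OF g this], of 1] show ?thesis
    using that[of _ "Lim (at_left x) g"] by auto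
  qed
  have "\<bar>g s\<bar> <= 1 + \<bar>g x\<bar> + \<bar>l\<bar>"
   if "u <= x & x <= v & v - u < min d1 d2" "s \<in> {u..v}" "0 <= s" for u v s
  proof (cases "s < x")
   case True
   then have "\<bar>g s - l\<bar> < 1" using d2 that by auto
   then show ?thesis by linarith
  next
   case False
   then have "\<bar>g s - g x\<bar> < 1" using d1 that by auto
   then show ?thesis by linarith
  qed
  then have "ALL u v. u <= x & x <= v & v - u < min d1 d2 -->
    (\<forall>s\<in>{u..v}. 0 <= s --> \<bar>g s\<bar> <= 1 + \<bar>g x\<bar> + \<bar>l\<bar>)" by blast
  moreover have "0 < min d1 d2" using d1(1) d2(1) by simp
  ultimately show "\<exists>d>0. ALL u v. u <= x & x <= v & v - u < d --> (EX B. \<forall>s\<in>{u..v}. 0 <= s --> \<bar>g s\<bar> <= B)"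
   by meson
 qed
 then show ?thesis by auto
qed

text \<open>Jumps go upwards only, so passing a point \<open>x\<close> from the left limit
  \<open>l\<close> to \<open>p x \<ge> l\<close> cannot create a drop; near \<open>x\<close> the two
  one-sided limits control the rest. A Lebesgue number of the cover by these neighbourhoods makes
  the bound uniform. The lemma replaces uniform continuity when the reflection term is
  studied.\<close>

lemma one_sided_modulus:
 assumes p: "cadlag p" and t: "0 <= t" and e: "0 < e"
  and up: "!!s. 0 < s ==> s <= t ==> Lim (at_left s) p <= p s"
 shows "\<exists>h>0. ALL s u. 0 <= s --> s <= u --> u <= t --> u < s + h --> p s - p u <= e"
proof -
 have "\<exists>d>0. ALL s u. 0 <= s & s <= u & u <= t & x - d < s & u < x + d --> p s - p u <= e"
  if x: "x \<in> {0..t}" for x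
 proof -
  obtain d1 where d1: "d1 > 0" "\<forall>s\<in>{x..<x+d1}. \<bar>p s - p x\<bar> < e/2"
   using cadlag_right_ball[OF p, of x "e/2"] e x by auto
  obtain d2 l where d2: "d2 > 0" "\<forall>s\<in>{x-d2<..<x}. 0 <= s --> \<bar>p s - l\<bar> < e/2" "l <= p x"
  proof (cases "x = 0")
   case True
   then show ?thesis using that[of 1] by auto
  next
   case False
   then have "0 < x" using x by simp
   from at_left_ball[OF cadlag_at_left[OF p this], of "e/2"] show ?thesis
    using that[of _ "Lim (at_left x) p"] up[of x] \<open>0 < x\<close> x e by auto
  qed
  show ?thesis
  proof (intro exI[of _ "min d1 d2"] conjI allI impI)
   fix s u assume *: "0 <= s & s <= u & u <= t & x - min d1 d2 < s & u < x + min d1 d2"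
   have "s < x ==> \<bar>p s - l\<bar> < e/2" "u < x ==> \<bar>p u - l\<bar> < e/2"
    "x <= s ==> \<bar>p s - p x\<bar> < e/2" "x <= u ==> \<bar>p u - p x\<bar> < e/2"
    using d1 d2 * by auto
   then show "p s - p u <= e" using d2(3) * by argo
  qed (use d1 d2 in auto)
 qed
 then obtain d where d: "!!x. x \<in> {0..t} ==> d x > 0"
  "!!x s u. x \<in> {0..t} ==> 0 <= s & s <= u & u <= t & x - d x < s & u < x + d x ==> p s - p u <= e"
  by metis
 \<comment> \<open>The local radii \<open>d x\<close> become one radius \<open>h\<close>: every ball
   of radius \<open>h\<close> around a point of the interval lies in one of the local balls.\<close>
 have "{0..t} \<subseteq> \<Union>((%x. ball x (d x)) ` {0..t})"
 proof
  fix x assume "x \<in> {0..t}"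
  then show "x \<in> \<Union>((%x. ball x (d x)) ` {0..t})" using d(1)[of x] by (intro UN_I[of x]) auto
 qed
 then obtain h where h: "h > 0" "!!x. x \<in> {0..t} ==> \<exists>G\<in>(%x. ball x (d x)) ` {0..t}. ball x h \<subseteq> G"
  by (rule Heine_Borel_lemma[OF compact_Icc]) auto
 show ?thesis
 proof (intro exI[of _ h] conjI allI impI)
  fix s u assume *: "0 <= s" "s <= u" "u <= t" "u < s + h"
  then obtain x where x: "x \<in> {0..t}" "ball s h \<subseteq> ball x (d x)"
   using h(2)[of s] by auto
  have "s \<in> ball s h" "u \<in> ball s h" using * h by (auto simp: dist_real_def)
  then have "s \<in> ball x (d x)" "u \<in> ball x (d x)" using x(2) by blast+
  then have "x - d x < s" "u < x + d x" by (auto simp: dist_real_def)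
  then show "p s - p u <= e" using d(2)[OF x(1), of s u] * by auto
 qed (use h in auto)
qed

section \<open>The reflected and observed random walk\<close>

text \<open>The arguments \<open>d\<close> and \<open>m\<close> hold the increments of the path and
  of the counting process over the cells of a grid. The push acts on the value before the increment
  is added because the strategy observes the left limit at an arrival; only the sign of
  \<open>m k\<close> counts.\<close>

primrec chain :: "real => real => real => (nat => real) => (nat => real) => nat => real" where
 "chain a b y d m 0 = max a y"
| "chain a b y d m (Suc k) =
   max a ((if 0 < m k then min b (chain a b y d m k) else chain a b y d m k) + d k)"

primrec chain_push :: "real => real => real => (nat => real) => (nat => real) => nat => real" where
 "chain_push a b y d m 0 = 0"
| "chain_push a b y d m (Suc k) =
   chain_push a b y d m k + (if 0 < m k then max 0 (chain a b y d m k - b) else 0)"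

lemma chain_ge: "a <= chain a b y d m k"
 by (cases k) auto

lemma chain_mono: "y <= z ==> chain a b y d m k <= chain a b z d m k"
 by (induction k) (auto simp: max_def min_def)

lemma chain_Lipschitz: "\<bar>chain a b y d m k - chain a b z d m k\<bar> <= \<bar>y - z\<bar>"
proof (induction k)
 case (Suc k)
 have "\<bar>max a (u + d k) - max a (v + d k)\<bar> <= \<bar>u - v\<bar>" "\<bar>min b u - min b v\<bar> <= \<bar>u - v\<bar>" for u v
  by (auto simp: max_def min_def)
 from this(1)[of "if 0 < m k then min b (chain a b y d m k) else chain a b y d m k"
   "if 0 < m k then min b (chain a b z d m k) else chain a b z d m k"] this(2)[of "chain a b y d m k" "chain a b z d m k"]
 show ?case using Suc by (auto split: if_splits)
qed auto

lemma chain_cong: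
 "(!!i. i < k ==> d i = d' i) ==> (!!i. i < k ==> (0 < m i) = (0 < m' i)) ==>
  chain a b y d m k = chain a b y d' m' k"
 by (induction k) auto

lemma chain_push_cong:
 "(!!i. i < k ==> d i = d' i) ==> (!!i. i < k ==> (0 < m i) = (0 < m' i)) ==>
  chain_push a b y d m k = chain_push a b y d' m' k"
 by (induction k) (auto cong: chain_cong)

lemma chain_append:
 "chain a b y d m (k + j) = chain a b (chain a b y d m k) (%i. d (k + i)) (%i. m (k + i)) j"
 by (induction j) (auto simp: max_absorb2 chain_ge)

lemma chain_push_nonneg: "0 <= chain_push a b y d m k"
 by (induction k) auto

text \<open>Each step takes a maximum with \<open>a\<close>, so an induction turns the recursion
  into the running-maximum formula by which the reflection is defined in continuous time. In this
  form the walk and the process can be compared through their unreflected parts.\<close>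

lemma chain_eq_Skorokhod:
 fixes a b y :: real and d m :: "nat => real"
 defines "h \<equiv> %k. y + (\<Sum>i<k. d i) - chain_push a b y d m k"
 shows "chain a b y d m k = h k + Max ((%i. max 0 (a - h i)) ` {..k})"
proof (induction k)
 case (Suc k)
 have "chain a b y d m (Suc k) = max a (chain a b y d m k + (h (Suc k) - h k))"
  by (auto simp: h_def max_def min_def)
 also have "... = max a (h (Suc k) + Max ((%i. max 0 (a - h i)) ` {..k}))"
  using Suc by simp
 also have "... = h (Suc k) + max (a - h (Suc k)) (Max ((%i. max 0 (a - h i)) ` {..k}))"
  by linarith
 also have "max (a - h (Suc k)) (Max ((%i. max 0 (a - h i)) ` {..k})) =
  max (max 0 (a - h (Suc k))) (Max ((%i. max 0 (a - h i)) ` {..k}))"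
 proof -
  have "0 <= Max ((%i. max 0 (a - h i)) ` {..k})"
   by (rule order.trans[of _ "max 0 (a - h 0)"], simp, rule Max_ge) auto
  then show ?thesis by linarith
 qed
 also have "... = Max ((%i. max 0 (a - h i)) ` {..Suc k})"
  by (simp add: atMost_Suc)
 finally show ?case .
qed (auto simp: h_def max_def)

lemma Max_diff_le:
 fixes f g :: "nat => real"
 assumes "!!i. i <= k ==> \<bar>f i - g i\<bar> <= e"
 shows "\<bar>Max (f ` {..k}) - Max (g ` {..k})\<bar> <= e"
proof -
 have "Max (f ` {..k}) <= Max (g ` {..k}) + e" if "!!i. i <= k ==> \<bar>f i - g i\<bar> <= e" for f g :: "nat => real"
 proof (subst Max_le_iff; clarsimp)
  fix i assume "i <= k"
  then have "g i <= Max (g ` {..k})" "\<bar>f i - g i\<bar> <= e" using that by auto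
  then show "f i <= Max (g ` {..k}) + e" by linarith
 qed
 from this[of f g] this[of g f] assms
 have "Max (f ` {..k}) <= Max (g ` {..k}) + e" "Max (g ` {..k}) <= Max (f ` {..k}) + e"
  by (simp_all add: abs_minus_commute)
 then show ?thesis by linarith
qed

section \<open>The barrier strategy along a path\<close>

text \<open>\<open>n_unit\<close> says that jumps have size one, phrased without left limits. It
  makes the arrival times strictly increasing, as the recursion \<open>push_down\<close>
  requires.\<close>

locale counting_path =
 fixes n :: "real => nat"
 assumes n_mono: "!!s t. 0 <= s ==> s <= t ==> n s <= n t"
  and n_cadlag: "cadlag (%t. real (n t))"
  and n_0: "n 0 = 0"
  and n_unit: "!!t. 0 < t ==> EX s. 0 <= s & s < t & n t <= n s + 1"
  and n_unbounded: "!!k. \<exists>t\<ge>0. k <= n t"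
begin

definition "\<tau> i = Inf {t. 0 <= t & i <= n t}"

lemma n_right: "0 <= t ==> \<exists>d>0. \<forall>s\<in>{t..<t+d}. n s = n t"
 using cadlag_right_ball[OF n_cadlag, of t 1] by fastforce

lemma tau_le_iff:
 assumes "0 <= t" shows "\<tau> i <= t \<longleftrightarrow> i <= n t"
proof
 assume "i <= n t"
 then show "\<tau> i <= t"
  unfolding \<tau>_def using assms by (intro cInf_lower) (auto intro: bdd_belowI[of _ 0])
next
 assume t: "\<tau> i <= t"
 obtain d where d: "d > 0" "\<forall>s\<in>{t..<t+d}. n s = n t" using n_right[OF assms] by auto
 have lt: "Inf {t. 0 <= t & i <= n t} < t + d" using t d by (simp add: \<tau>_def)
 have ne: "{t. 0 <= t & i <= n t} ~= {}" using n_unbounded[of i] by auto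
 from cInf_lessD[OF ne lt] obtain s where s: "0 <= s" "i <= n s" "s < t + d" by blast
 then have "n (max s t) = n t" using d(1) by (intro d(2)[rule_format]) auto
 moreover have "n s <= n (max s t)" using n_mono s by auto
 ultimately show "i <= n t" using s by simp
qed

lemma tau_nonneg: "0 <= \<tau> i"
 unfolding \<tau>_def using n_unbounded[of i] by (intro cInf_greatest) auto

lemma tau_pos: "1 <= i ==> 0 < \<tau> i"
 using tau_nonneg[of i] tau_le_iff[of 0 i] n_0 by (cases "\<tau> i <= 0") auto

lemma le_n_tau: "i <= n (\<tau> i)"
 using tau_le_iff[OF tau_nonneg] by blast

lemma n_tau_eq:
 assumes "1 <= i" shows "n (\<tau> i) = i"
proof -
 obtain s where s: "0 <= s" "s < \<tau> i" "n (\<tau> i) <= n s + 1" using n_unit[OF tau_pos[OF assms]] by auto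
 then have "n s < i" using tau_le_iff[of s i] by auto
 then show ?thesis using s le_n_tau[of i] by simp
qed

lemma tau_incr: "1 <= i ==> \<tau> i < \<tau> (Suc i)"
 using tau_le_iff[OF tau_nonneg[of i], of "Suc i"] n_tau_eq[of i] by auto

lemma tau_unbounded: "\<exists>i\<ge>1. t < \<tau> i"
proof -
 have "\<not> \<tau> (Suc (n (max 0 t))) <= max 0 t" by (subst tau_le_iff) auto
 then show ?thesis by (intro exI[of _ "Suc (n (max 0 t))"]) auto
qed

lemma arrivals_eq: "0 <= t ==> {i. 1 <= i & \<tau> i <= t} = {1..n t}"
 using tau_le_iff by auto

lemma arrival_between: "0 <= s ==> n s < n t ==> s <= t ==> \<exists>i\<in>{1..n t}. s < \<tau> i & \<tau> i <= t"
 by (rule bexI[of _ "n t"]) (use tau_le_iff[of s "n t"] tau_le_iff[of t "n t"] in auto)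

text \<open>Integers within 1/2 of a common left limit coincide.\<close>

lemma n_left: "0 < t ==> EX k. \<exists>d>0. \<forall>s\<in>{t-d<..<t}. 0 <= s & n s = k"
proof -
 assume t: "0 < t"
 then obtain d where d: "d > 0" "\<forall>s\<in>{t-d<..<t}. \<bar>real (n s) - Lim (at_left t) (%t. real (n t))\<bar> < 1/2"
  using at_left_ball[OF cadlag_at_left[OF n_cadlag], of t "1/2"] by auto
 define d' where "d' = min d t"
 have "n s = n (t - d'/2)" if "s \<in> {t - d'<..<t}" for s
 proof -
  have "\<bar>real (n s) - Lim (at_left t) (%t. real (n t))\<bar> < 1/2"
   "\<bar>real (n (t - d'/2)) - Lim (at_left t) (%t. real (n t))\<bar> < 1/2"
   using d t that by (auto simp: d'_def min_def split: if_splits)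
  then show ?thesis by linarith
 qed
 then show ?thesis
  by (intro exI[of _ "n (t - d'/2)"] exI[of _ d']) (use d t in \<open>auto simp: d'_def\<close>)
qed

lemma cadlag_compose_n: "cadlag (%t. g (n t))" for g :: "nat => real"
proof (rule cadlagI)
 fix t :: real assume "0 <= t"
 then obtain d where d: "d > 0" "\<forall>s\<in>{t..<t+d}. n s = n t" using n_right by auto
 have "\<forall>\<^sub>F s in at_right t. s \<in> {t<..<t+d}" using d by (intro eventually_at_right_real) simp
 then have "\<forall>\<^sub>F s in at_right t. g (n s) = g (n t)"
 proof eventually_elim
  case (elim s)
  have "n s = n t" by (rule d(2)[rule_format]) (use elim in auto)
  then show ?case by simp
 qed
 then show "((%t. g (n t)) \<longlongrightarrow> g (n t)) (at_right t)" by (rule tendsto_eventually)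
next
 fix t :: real assume "0 < t"
 then obtain k d where d: "d > 0" "\<forall>s\<in>{t-d<..<t}. 0 <= s & n s = k" using n_left by blast
 have "\<forall>\<^sub>F s in at_left t. s \<in> {t-d<..<t}" using d by (intro eventually_at_left_real) simp
 then have "\<forall>\<^sub>F s in at_left t. g (n s) = g k" by eventually_elim (use d in auto)
 then show "EX l. ((%t. g (n t)) \<longlongrightarrow> l) (at_left t)" by (intro exI tendsto_eventually)
qed

end

locale barrier_path = counting_path +
 fixes a b :: real and \<xi> :: "real => real"
 assumes ab: "a < b" and xi: "cadlag \<xi>"
begin

definition "L = barrier_L a b \<xi> \<tau>"
text \<open>The path after the pushes and before the reflection. \<open>R\<close> is the running
  maximum of the positive part of \<open>a - \<eta>\<close>, so the reflection is a Skorokhod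
  problem driven by \<open>\<eta>\<close> alone.\<close>

definition "\<eta> t = \<xi> t - L t"
definition "R = barrier_R a b \<xi> \<tau>"
definition "Y t = \<xi> t + R t - L t"
definition "c i = max 0 (Lim (at_left (\<tau> i)) Y - b)"

lemma Y_reflected: "Y = reflected a \<xi> L"
 by (auto simp: Y_def R_def L_def barrier_R_def reflected_def)

lemma L_eq: "0 <= t ==> L t = (\<Sum>i=1..n t. c i)"
 unfolding L_def c_def Y_reflected
 using barrier_L_eq[OF tau_pos[of "Suc 0"] tau_incr tau_unbounded, of a b \<xi> t]
 by (simp add: arrivals_eq[simplified])

lemma c_nonneg: "0 <= c i" by (simp add: c_def)

lemma L_mono: "0 <= s ==> s <= t ==> L s <= L t"
 using n_mono[of s t] by (auto simp: L_eq intro!: sum_mono2 c_nonneg)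

lemma L_nonneg: "0 <= t ==> 0 <= L t"
 by (auto simp: L_eq intro!: sum_nonneg c_nonneg)

lemma L_0: "L 0 = 0" by (simp add: L_eq n_0)

lemma cadlag_cong: 
 assumes "cadlag f" "!!t. 0 <= t ==> f t = g t" shows "cadlag g"
proof (rule cadlagI)
 fix t :: real assume t: "0 <= t"
 have "\<forall>\<^sub>F s in at_right t. f s = g s"
  using t assms(2) by (intro eventually_at_rightI[of t "t+1"]) auto
 then show "(g \<longlongrightarrow> g t) (at_right t)"
  using cadlag_at_right[OF assms(1) t] assms(2)[OF t] tendsto_cong by fastforce
next
 fix t :: real assume t: "0 < t"
 then show "EX l. (g \<longlongrightarrow> l) (at_left t)"
  using tendsto_at_left_from_0[OF t cadlag_at_left[OF assms(1) t], of g] assms(2) by blast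
qed

lemma L_cadlag: "cadlag L"
 by (rule cadlag_cong[OF cadlag_compose_n[of "%k. \<Sum>i=1..k. c i"]]) (simp add: L_eq)

lemma eta_cadlag: "cadlag \<eta>"
 unfolding \<eta>_def by (intro cadlag_diff xi L_cadlag)

lemma R_eq: "R t = (SUP s\<in>{0..t}. max 0 (a - \<eta> s))"
 by (simp add: R_def barrier_R_def reflect_up_def \<eta>_def L_def algebra_simps)

lemma bdd_eta: "bdd_above ((%s. max 0 (a - \<eta> s)) ` {0..t})"
proof (cases "0 <= t")
 case True
 then obtain B where "\<forall>s\<in>{0..t}. \<bar>\<eta> s\<bar> <= B" using cadlag_bounded[OF eta_cadlag] by blast
 then show ?thesis by (intro bdd_aboveI[of _ "\<bar>a\<bar> + B + 1"]) fastforce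
qed auto

lemma R_ge: "0 <= s ==> s <= t ==> max 0 (a - \<eta> s) <= R t"
 unfolding R_eq by (intro cSUP_upper bdd_eta) auto

lemma R_leI: "0 <= t ==> (!!s. 0 <= s ==> s <= t ==> max 0 (a - \<eta> s) <= B) ==> R t <= B"
 unfolding R_eq by (intro cSUP_least) auto

lemma R_mono: "0 <= s ==> s <= t ==> R s <= R t"
 unfolding R_eq by (intro cSUP_subset_mono bdd_eta) auto

lemma R_nonneg: "0 <= t ==> 0 <= R t"
 using R_ge[of 0 t] by linarith

lemma R_approx: "0 <= t ==> B < R t ==> \<exists>s\<in>{0..t}. B < max 0 (a - \<eta> s)"
 unfolding R_eq by (subst (asm) less_cSUP_iff) (auto intro: bdd_eta)

lemma Y_eq: "Y t = \<eta> t + R t" by (simp add: Y_def \<eta>_def)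

lemma Y_ge: "0 <= t ==> a <= Y t"
 using R_ge[of t t] by (auto simp: Y_eq)

lemma R_at_left: "0 < t ==> EX l. (R \<longlongrightarrow> l) (at_left t) & (ALL s. 0 <= s --> s < t --> R s <= l) &
  (\<forall>e>0. EX s. 0 <= s & s < t & l - e < R s)"
proof -
 assume t: "0 < t"
 define l where "l = (SUP s\<in>{0..<t}. R s)"
 have bdd: "bdd_above (R ` {0..<t})" using R_mono t by (intro bdd_aboveI[of _ "R t"]) auto
 have up: "R s <= l" if "0 <= s" "s < t" for s
  unfolding l_def using that by (intro cSUP_upper bdd) auto
 have low: "EX s. 0 <= s & s < t & l - e < R s" if "e > 0" for e
 proof -
  have "l - e < l" using that by simp
  then show ?thesis unfolding l_def using t by (subst (asm) less_cSUP_iff) (auto intro: bdd)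
 qed
 have "(R \<longlongrightarrow> l) (at_left t)"
 proof (rule order_tendstoI)
  fix y assume "y < l"
  then obtain s where s: "0 <= s" "s < t" "y < R s" using low[of "l - y"] by auto
  then have "\<forall>\<^sub>F u in at_left t. u \<in> {s<..<t}" by (intro eventually_at_left_real) simp
  then show "\<forall>\<^sub>F u in at_left t. y < R u"
   by eventually_elim (use s R_mono in \<open>auto intro: less_le_trans\<close>)
 next
  fix y assume "l < y"
  have "\<forall>\<^sub>F u in at_left t. u \<in> {0<..<t}" using t by (intro eventually_at_left_real) simp
  then show "\<forall>\<^sub>F u in at_left t. R u < y"
  proof eventually_elim
   case (elim u)
   then show ?case using up[of u] \<open>l < y\<close> by simp
  qed
 qed
 then show ?thesis using up low by blast
qed

lemma R_cadlag: "cadlag R"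
proof (rule cadlagI)
 fix t :: real assume t: "0 <= t"
 show "(R \<longlongrightarrow> R t) (at_right t)"
 proof (rule order_tendstoI)
  fix y assume y: "y < R t"
  have "\<forall>\<^sub>F u in at_right t. t < u" by (simp add: eventually_at_right_less)
  then show "\<forall>\<^sub>F u in at_right t. y < R u"
   by eventually_elim (use y R_mono t in \<open>auto intro: less_le_trans\<close>)
 next
  fix y assume y: "R t < y"
  then obtain d where d: "d > 0" "\<forall>s\<in>{t..<t+d}. \<bar>\<eta> s - \<eta> t\<bar> < (y - R t)/2"
   using cadlag_right_ball[OF eta_cadlag t, of "(y - R t)/2"] by auto
  have "\<forall>\<^sub>F u in at_right t. u \<in> {t<..<t+d}" using d by (intro eventually_at_right_real) simp
  then show "\<forall>\<^sub>F u in at_right t. R u < y"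
  proof eventually_elim
   case (elim u)
   have "R u <= R t + (y - R t)/2"
   proof (rule R_leI)
    fix s assume s: "0 <= s" "s <= u"
    show "max 0 (a - \<eta> s) <= R t + (y - R t)/2"
    proof (cases "s <= t")
     case True
     have "R t <= R t + (y - R t)/2" using y by simp
     with R_ge[OF s(1) True] show ?thesis by (rule order.trans)
    next
     case False
     then have "\<bar>\<eta> s - \<eta> t\<bar> < (y - R t)/2" using d s elim by auto
     then show ?thesis using R_ge[of t t] t by linarith
    qed
   qed (use elim t in auto)
   also have "... < y" using y by (simp add: field_simps)
   finally show ?case .
  qed
 qed
qed (use R_at_left in blast)

lemma Y_cadlag: "cadlag Y"
 using cadlag_add[OF eta_cadlag R_cadlag] by (simp add: Y_eq[abs_def])

definition "Yl t = Lim (at_left t) Y"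
definition "Rl t = Lim (at_left t) R"

lemma Y_left: "0 < t ==> (Y \<longlongrightarrow> Yl t) (at_left t)"
 unfolding Yl_def by (rule cadlag_at_left[OF Y_cadlag])

lemma R_left: "0 < t ==> (R \<longlongrightarrow> Rl t) (at_left t)"
 unfolding Rl_def by (rule cadlag_at_left[OF R_cadlag])

lemma R_le_Rl: "0 <= s ==> s < t ==> R s <= Rl t"
 and Rl_approx: "0 < t ==> 0 < e ==> EX s. 0 <= s & s < t & Rl t - e < R s"
 using R_at_left[of t] tendsto_Lim[of "at_left t" R] by (force simp: Rl_def trivial_limit_at_left_real)+

lemma Rl_le: "0 < t ==> Rl t <= R t"
proof -
 assume t: "0 < t"
 have "\<forall>\<^sub>F u in at_left t. u \<in> {0<..<t}" using t by (intro eventually_at_left_real) simp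
 then have "\<forall>\<^sub>F u in at_left t. R u <= R t" by eventually_elim (use R_mono in auto)
 then show ?thesis using tendsto_upperbound[OF R_left[OF t]] trivial_limit_at_left_real by blast
qed

lemma R_jump: assumes t: "0 < t" shows "R t = max (Rl t) (a - \<eta> t)"
proof (rule antisym)
 show "R t <= max (Rl t) (a - \<eta> t)"
 proof (rule R_leI)
  fix s assume s: "0 <= s" "s <= t"
  have "0 <= R 0" using R_nonneg by simp
  also have "R 0 <= Rl t" using t R_le_Rl by simp
  finally have "0 <= Rl t" .
  then show "max 0 (a - \<eta> s) <= max (Rl t) (a - \<eta> t)"
   using R_ge[of s s] R_le_Rl[of s t] s by (cases "s = t") auto
 qed (use t in auto)
 show "max (Rl t) (a - \<eta> t) <= R t" using R_ge[of t t] Rl_le[OF t] t by auto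
qed

lemma eta_left: "0 < t ==> (\<eta> \<longlongrightarrow> Yl t - Rl t) (at_left t)"
 using tendsto_diff[OF Y_left R_left, of t] by (simp add: Y_eq)

lemma L_left: "0 < t ==> (L \<longlongrightarrow> L t - (if \<exists>i\<ge>1. \<tau> i = t then max 0 (Yl t - b) else 0)) (at_left t)"
proof -
 assume t: "0 < t"
 obtain k d where d: "d > 0" "\<forall>s\<in>{t-d<..<t}. 0 <= s & n s = k" using n_left[OF t] by blast
 have "\<forall>\<^sub>F s in at_left t. s \<in> {t-d<..<t}" using d by (intro eventually_at_left_real) simp
 then have 1: "\<forall>\<^sub>F s in at_left t. L s = (\<Sum>i=1..k. c i)" by eventually_elim (use d L_eq in auto)
 have "L t = (\<Sum>i=1..k. c i) + (if \<exists>i\<ge>1. \<tau> i = t then max 0 (Yl t - b) else 0)"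
 proof (cases "\<exists>i\<ge>1. \<tau> i = t")
  case True
  then obtain i where i: "i >= 1" "\<tau> i = t" by auto
  then have "n t = i" using n_tau_eq by auto
  moreover have "k = i - 1"
  proof -
   \<comment> \<open>A point in the window left of \<open>t\<close> that is not before the previous
     arrival, so that \<open>n s\<close> is squeezed to \<open>i - 1\<close>; for
     \<open>i = 1\<close> time 0 stands in for the previous arrival.\<close>
   define s where "s = max (t - d/2) (if i = 1 then 0 else \<tau> (i - 1))"
   have s: "s < t" "t - d < s" "0 <= s"
    using t d i tau_incr[of "i-1"] tau_nonneg[of "i-1"] by (auto simp: s_def)
   then have "n s = k" using d by auto
   moreover have "n s < i" using tau_le_iff[OF s(3), of i] i s by auto
   moreover have "i - 1 <= n s"
    using tau_le_iff[OF s(3), of "i - 1"] by (cases "i = 1") (auto simp: s_def)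
   ultimately show ?thesis by simp
  qed
  ultimately have "n t = Suc k" "c (Suc k) = max 0 (Yl t - b)" using i by (auto simp: c_def Yl_def)
  then show ?thesis using t True by (simp add: L_eq)
 next
  case False
  have "n t = k"
  proof (rule antisym)
   have "n (t - d/2) = k" "0 <= t - d/2" using d(1) d(2)[rule_format, of "t - d/2"] by auto
   then show "k <= n t" using n_mono[of "t - d/2" t] d by simp
   show "n t <= k"
   proof (cases "n t = 0")
    case nt: False
    then have "\<tau> (n t) ~= t" "\<tau> (n t) <= t" using False tau_le_iff[of t "n t"] t by auto
    then have "\<tau> (n t) < t" by simp
    define s where "s = max (t - d/2) (\<tau> (n t))"
    have s: "s < t" "t - d < s" "0 <= s" "\<tau> (n t) <= s"
     using \<open>\<tau> (n t) < t\<close> d tau_nonneg[of "n t"] by (auto simp: s_def)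
    then have "n s = k" "n t <= n s" using d tau_le_iff[OF s(3), of "n t"] by auto
    then show ?thesis by simp
   qed auto
  qed
  then show ?thesis using t by (subst if_not_P[OF False]) (simp add: L_eq)
 qed
 then show ?thesis using tendsto_eventually[OF 1] by simp
qed

lemma xi_left: "0 < t ==> (\<xi> \<longlongrightarrow> Lim (at_left t) \<xi>) (at_left t)"
 by (rule cadlag_at_left[OF xi])

text \<open>The jump rule has the shape of one step of \<open>chain\<close>, with the left limit as
  the old value and the jump of the driving path as the increment. The last cell of a partition
  therefore converges to it.\<close>

lemma Y_jump:
 assumes t: "0 < t"
 shows "Y t = max a ((if \<exists>i\<ge>1. \<tau> i = t then min b (Yl t) else Yl t) + (\<xi> t - Lim (at_left t) \<xi>))"
proof -
 define J where "J = (if \<exists>i\<ge>1. \<tau> i = t then max 0 (Yl t - b) else 0)"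
 have "(\<eta> \<longlongrightarrow> Lim (at_left t) \<xi> - (L t - J)) (at_left t)"
  unfolding \<eta>_def J_def by (intro tendsto_diff xi_left L_left t)
 then have "Yl t - Rl t = Lim (at_left t) \<xi> - (L t - J)"
  using eta_left[OF t] tendsto_unique trivial_limit_at_left_real by blast
 then have "\<eta> t + Rl t = (Yl t - J) + (\<xi> t - Lim (at_left t) \<xi>)" by (simp add: \<eta>_def)
 moreover have "Yl t - J = (if \<exists>i\<ge>1. \<tau> i = t then min b (Yl t) else Yl t)" by (auto simp: J_def)
 moreover have "Y t = max a (\<eta> t + Rl t)" unfolding Y_eq R_jump[OF t] by linarith
 ultimately show ?thesis by simp
qed

lemma Y_0: "Y 0 = max a (\<xi> 0)"
 using R_eq[of 0] by (simp add: Y_eq \<eta>_def L_0)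

end

section \<open>Convergence of the sampled walk\<close>

context barrier_path
begin

definition "sampled p = chain a b (\<xi> 0) (%i. \<xi> (p (Suc i)) - \<xi> (p i)) (%i. real (n (p (Suc i))) - real (n (p i)))"
definition "sampled_push p = chain_push a b (\<xi> 0) (%i. \<xi> (p (Suc i)) - \<xi> (p i)) (%i. real (n (p (Suc i))) - real (n (p i)))"
text \<open>Indexes the cell from \<open>p k\<close> (excluded) to \<open>p (Suc k)\<close>
  (included) that contains arrival \<open>i\<close>; \<open>cc\<close> is then the discrete
  counterpart of the push \<open>c i\<close>.\<close>

definition "cell p i = (LEAST k. \<tau> i <= p (Suc k))"
definition "cc p i = max 0 (sampled p (cell p i) - b)"

end

lemma partition_mono:
 fixes p :: "nat => real"
 assumes "!!i. i < K ==> p i < p (Suc i)"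
 shows "i <= j ==> j <= K ==> p i <= p j"
proof (induction j rule: dec_induct)
 case (step j)
 then show ?case using assms[of j] by simp
qed simp

context barrier_path
begin

text \<open>With at most one arrival per cell, pushes counted by cells can be recounted by arrivals,
  and the sum becomes comparable term by term with \<open>L_eq\<close>.\<close>

lemma sampled_push_eq:
 assumes p: "p 0 = 0" "!!i. i < K ==> p i < p (Suc i)"
  and sep: "!!i. i < K ==> n (p (Suc i)) <= n (p i) + 1"
 shows "k <= K ==> sampled_push p k = (\<Sum>i=1..n (p k). cc p i)"
proof (induction k)
 case 0
 then show ?case by (simp add: sampled_push_def p n_0)
next
 case (Suc k)
 have pk: "0 <= p k" using partition_mono[of K p 0 k] p Suc by simp
 then have pk': "0 <= p (Suc k)" using p(2)[of k] Suc by simp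
 have mono: "n (p k) <= n (p (Suc k))" using n_mono[of "p k" "p (Suc k)"] pk p(2)[of k] Suc by simp
 show ?case
 proof (cases "n (p k) < n (p (Suc k))")
  case True
  then have eq: "n (p (Suc k)) = Suc (n (p k))" using sep[of k] Suc by simp
  have "cell p (Suc (n (p k))) = k"
   unfolding cell_def
  proof (rule Least_equality)
   show "\<tau> (Suc (n (p k))) <= p (Suc k)" using tau_le_iff[OF pk'] eq by simp
   fix j assume j: "\<tau> (Suc (n (p k))) <= p (Suc j)"
   show "k <= j"
   proof (rule ccontr)
    assume "\<not> k <= j"
    then have "p (Suc j) <= p k" using partition_mono[of K p "Suc j" k] p Suc by simp
    then have "\<tau> (Suc (n (p k))) <= p k" using j by simp
    then show False using tau_le_iff[OF pk] by simp
   qed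
  qed
  then have "cc p (Suc (n (p k))) = max 0 (sampled p k - b)" by (simp add: cc_def)
  then show ?thesis using Suc True eq by (simp add: sampled_push_def sampled_def)
 next
  case False
  then have "n (p (Suc k)) = n (p k)" using mono by simp
  then show ?thesis using Suc by (simp add: sampled_push_def)
 qed
qed

lemma sampled_eq:
 assumes "p 0 = 0"
 shows "sampled p k = (\<xi> (p k) - sampled_push p k) +
  Max ((%i. max 0 (a - (\<xi> (p i) - sampled_push p i))) ` {..k})"
proof -
 have "\<xi> 0 + (\<Sum>i<k. \<xi> (p (Suc i)) - \<xi> (p i)) = \<xi> (p k)" for k
  using sum_lessThan_telescope[of "%i. \<xi> (p i)" k] assms by simp
 then show ?thesis
  unfolding sampled_def sampled_push_def by (subst chain_eq_Skorokhod) simp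
qed

end

text \<open>General partitions rather than uniform grids, because the flow property joins a grid of
  [0, s] to a grid of [s, s + u] with another mesh.\<close>

locale barrier_partition = barrier_path +
 fixes P :: "nat => nat => real" and K :: "nat => nat" and t :: real
 assumes P0: "!!m. P m 0 = 0" and P_incr: "!!m i. i < K m ==> P m i < P m (Suc i)"
  and P_end: "!!m. P m (K m) = t" and t_pos: "0 < t"
  and mesh: "!!e. 0 < e ==> \<forall>\<^sub>F m in sequentially. \<forall>i<K m. P m (Suc i) - P m i < e"
begin

lemma K_pos: "0 < K m"
 using P0[of m] P_end[of m] t_pos by (cases "K m") auto

lemma P_mono: "i <= j ==> j <= K m ==> P m i <= P m j"
 using partition_mono[of "K m" "P m"] P_incr by blast

lemma P_nonneg: "i <= K m ==> 0 <= P m i"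
 using P_mono[of 0 i m] P0 by simp

lemma P_le_t: "i <= K m ==> P m i <= t"
 using P_mono[of i "K m" m] P_end by simp

lemma separated: "\<forall>\<^sub>F m in sequentially. \<forall>i<K m. n (P m (Suc i)) <= n (P m i) + 1"
proof -
 \<comment> \<open>The smallest gap that follows an arrival in [0, t]; the 1 keeps the set non-empty
   when there is no arrival.\<close>
 define g where "g = Min (insert 1 ((%j. \<tau> (Suc j) - \<tau> j) ` {1..n t}))"
 have "g > 0" unfolding g_def using tau_incr by (subst Min_gr_iff) auto
 have g: "g <= \<tau> (Suc j) - \<tau> j" if "1 <= j" "j <= n t" for j
  unfolding g_def using that by (intro Min_le) auto
 show ?thesis
  using mesh[OF \<open>g > 0\<close>]
 proof eventually_elim
  case (elim m)
  show ?case
  proof (intro allI impI, rule ccontr)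
   fix i assume i: "i < K m" "\<not> n (P m (Suc i)) <= n (P m i) + 1"
   have pos: "0 <= P m i" "0 <= P m (Suc i)" "P m (Suc i) <= t"
    using P_nonneg[of i m] P_nonneg[of "Suc i" m] P_le_t[of "Suc i" m] i by auto
   define j where "j = Suc (n (P m i))"
   have "P m i < \<tau> j" using tau_le_iff[OF pos(1), of j] by (simp add: j_def)
   moreover have "\<tau> (Suc j) <= P m (Suc i)" using tau_le_iff[OF pos(2), of "Suc j"] i by (simp add: j_def)
   moreover have "j <= n t" using i n_mono[OF pos(2,3)] by (simp add: j_def)
   ultimately show False using g[of j] elim i(1) by (force simp: j_def)
  qed
 qed
qed

text \<open>Walk and process are reflections of unreflected paths that differ by at most the
  accumulated error \<open>E m\<close> of the pushes before \<open>T\<close>, and reflection at most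
  doubles this error. Convergence of the pushes is asked only up to \<open>j\<close>, which is what
  an induction over arrivals can provide.\<close>

lemma sampled_tendsto_left:
 assumes T: "0 < T" "T <= t"
  and kk: "!!m. kk m < K m" "!!m. P m (kk m) < T" "(%m. P m (kk m)) \<longlonglongrightarrow> T"
  and j: "!!s. 0 <= s ==> s < T ==> n s <= j"
  and cc: "!!i. 1 <= i ==> i <= j ==> (%m. cc (P m) i) \<longlonglongrightarrow> c i"
 shows "(%m. sampled (P m) (kk m)) \<longlonglongrightarrow> Yl T"
proof -
 define E where "E m = (\<Sum>i=1..j. \<bar>cc (P m) i - c i\<bar>)" for m
 have E: "E \<longlonglongrightarrow> 0"
 proof -
  have "(%m. \<Sum>i=1..j. \<bar>cc (P m) i - c i\<bar>) \<longlonglongrightarrow> (\<Sum>i=1..j. \<bar>c i - c i\<bar>)"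
   by (intro tendsto_sum tendsto_rabs tendsto_diff cc tendsto_const) auto
  then show ?thesis by (simp add: E_def[abs_def])
 qed
 \<comment> \<open>The exact barrier excess maximised over the grid points only. It stays below
   \<open>Rl T\<close>, and it comes close because \<open>\<eta>\<close> is right-continuous at a
   near-maximiser \<open>u\<close> and a grid point follows \<open>u\<close> closely.\<close>
 define M where "M m = Max ((%i. max 0 (a - \<eta> (P m i))) ` {..kk m})" for m
 have lt: "filterlim (%m. P m (kk m)) (at_left T) sequentially"
  unfolding filterlim_at using kk(2,3) by (auto intro!: always_eventually simp: less_imp_neq)
 have eta: "(%m. \<eta> (P m (kk m))) \<longlonglongrightarrow> Yl T - Rl T"
  by (rule filterlim_compose[OF eta_left[OF T(1)] lt])
 have M: "M \<longlonglongrightarrow> Rl T"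
 proof (rule order_tendstoI)
  fix y assume y: "Rl T < y"
  have "M m <= Rl T" for m
   unfolding M_def
  proof (subst Max_le_iff; clarsimp)
   fix i assume i: "i <= kk m"
   then have "0 <= P m i" "P m i <= P m (kk m)"
    using P_nonneg[of i m] P_mono[of i "kk m" m] kk(1)[of m] by auto
   then have "max 0 (a - \<eta> (P m i)) <= R (P m (kk m))" "R (P m (kk m)) <= Rl T"
    using R_ge R_le_Rl[of "P m (kk m)" T] kk(2)[of m] by auto
   then show "0 <= Rl T & a - \<eta> (P m i) <= Rl T" by auto
  qed
  then show "\<forall>\<^sub>F m in sequentially. M m < y" using y by (auto intro!: always_eventually intro: le_less_trans)
 next
  fix y assume y: "y < Rl T"
  then obtain s where s: "0 <= s" "s < T" "y < R s" using Rl_approx[OF T(1), of "Rl T - y"] by auto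
  then obtain u where u: "0 <= u" "u <= s" "y < max 0 (a - \<eta> u)" using R_approx[OF s(1,3)] by auto
  obtain d where d: "d > 0" "\<forall>v\<in>{u..<u+d}. \<bar>\<eta> v - \<eta> u\<bar> < max 0 (a - \<eta> u) - y"
   using cadlag_right_ball[OF eta_cadlag u(1), of "max 0 (a - \<eta> u) - y"] u(3) by auto
  \<comment> \<open>Keeps the grid point found below both inside the window where
    \<open>\<eta>\<close> is close to \<open>\<eta> u\<close> and before \<open>T\<close>.\<close>
  define d' where "d' = min d ((T - u)/2)"
  have d': "0 < d'" "d' <= d" "u + d' < T" using d s u by (auto simp: d'_def min_def field_simps)
  have "\<forall>\<^sub>F m in sequentially. u + d' < P m (kk m)"
   using kk(3) d'(3) by (rule order_tendstoD)
  then show "\<forall>\<^sub>F m in sequentially. y < M m"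
   using mesh[OF d'(1)]
  proof eventually_elim
   case (elim m)
   define i where "i = (LEAST i. u <= P m i)"
   have ui: "u <= P m i" unfolding i_def by (rule LeastI[of _ "kk m"]) (use elim d' in auto)
   have ik: "i <= kk m" unfolding i_def by (rule Least_le) (use elim d' in auto)
   have "P m i < u + d'"
   proof (cases i)
    case 0
    then show ?thesis using P0[of m] u d' by simp
   next
    case (Suc i')
    have "\<not> u <= P m i'" using not_less_Least[of i' "%i. u <= P m i"] Suc by (simp add: i_def)
    moreover have "P m (Suc i') - P m i' < d'" using elim(2) Suc ik kk(1)[of m] by simp
    ultimately show ?thesis using Suc by simp
   qed
   then have "\<bar>\<eta> (P m i) - \<eta> u\<bar> < max 0 (a - \<eta> u) - y" using d(2) ui d'(2) by auto
   then have "y < max 0 (a - \<eta> (P m i))" by linarith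
   also have "... <= M m" unfolding M_def using ik by (intro Max_ge) auto
   finally show ?case .
  qed
 qed
 have "(%m. \<eta> (P m (kk m)) + M m) \<longlonglongrightarrow> Yl T" using tendsto_add[OF eta M] by simp
 moreover have "\<forall>\<^sub>F m in sequentially. \<bar>sampled (P m) (kk m) - (\<eta> (P m (kk m)) + M m)\<bar> <= 2 * E m"
  using separated
 proof eventually_elim
  case (elim m)
  define h where "h i = \<xi> (P m i) - sampled_push (P m) i" for i
  have h: "\<bar>h i - \<eta> (P m i)\<bar> <= E m" if i: "i <= kk m" for i
  proof -
   have Pi: "0 <= P m i" "P m i < T"
    using P_nonneg[of i m] P_mono[of i "kk m" m] kk(1,2)[of m] i by auto
   have "sampled_push (P m) i = (\<Sum>l=1..n (P m i). cc (P m) l)"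
    using i kk(1)[of m] elim by (intro sampled_push_eq[of "P m" "K m"] P0 P_incr) auto
   then have "\<bar>h i - \<eta> (P m i)\<bar> = \<bar>\<Sum>l=1..n (P m i). c l - cc (P m) l\<bar>"
    using Pi by (simp add: h_def \<eta>_def L_eq sum_subtractf)
   also have "... <= (\<Sum>l=1..n (P m i). \<bar>c l - cc (P m) l\<bar>)" by (rule sum_abs)
   also have "... <= (\<Sum>l=1..j. \<bar>c l - cc (P m) l\<bar>)"
    using j[OF Pi] by (intro sum_mono2) auto
   finally show ?thesis by (simp add: E_def abs_minus_commute)
  qed
  have "\<bar>Max ((%i. max 0 (a - h i)) ` {..kk m}) - M m\<bar> <= E m"
   unfolding M_def using h by (intro Max_diff_le) (fastforce simp: abs_le_iff max_def)
  moreover have "sampled (P m) (kk m) = h (kk m) + Max ((%i. max 0 (a - h i)) ` {..kk m})"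
   unfolding h_def by (rule sampled_eq) (rule P0)
  ultimately show ?case using h[of "kk m"] by linarith
 qed
 then have "\<forall>\<^sub>F m in sequentially. norm (sampled (P m) (kk m) - (\<eta> (P m (kk m)) + M m)) <= 2 * E m"
  by (simp only: real_norm_def)
 from Lim_null_comparison[OF this tendsto_mult_right_zero[OF E, of 2]]
 have "(%m. sampled (P m) (kk m) - (\<eta> (P m (kk m)) + M m)) \<longlonglongrightarrow> 0" .
 ultimately show ?thesis by (rule Lim_transform)
qed

text \<open>The \<open>i\<close>-th push depends on the walk just before the \<open>i\<close>-th
  arrival, and that involves only earlier pushes; hence a strong induction over arrivals.\<close>

lemma cc_tendsto: "1 <= i ==> i <= n t ==> (%m. cc (P m) i) \<longlonglongrightarrow> c i"
proof (induction i rule: less_induct)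
 case (less i)
 have T: "0 < \<tau> i" "\<tau> i <= t" using tau_pos[of i] tau_le_iff[of t i] less t_pos by auto
 define kk where "kk m = cell (P m) i" for m
 have ex: "\<tau> i <= P m (Suc (K m - 1))" for m using K_pos[of m] P_end[of m] T by simp
 have 1: "kk m < K m" for m
  unfolding kk_def cell_def using Least_le[of "%k. \<tau> i <= P m (Suc k)", OF ex[of m]] K_pos[of m] by simp
 have 2: "\<tau> i <= P m (Suc (kk m))" for m
  unfolding kk_def cell_def by (rule LeastI[of "%k. \<tau> i <= P m (Suc k)", OF ex[of m]])
 have 3: "P m (kk m) < \<tau> i" for m
 proof (cases "kk m")
  case 0
  then show ?thesis using P0[of m] T by simp
 next
  case (Suc k)
  then have "\<not> \<tau> i <= P m (Suc k)"
   using not_less_Least[of k "%k. \<tau> i <= P m (Suc k)"] by (simp add: kk_def cell_def)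
  then show ?thesis using Suc by simp
 qed
 have 4: "(%m. P m (kk m)) \<longlonglongrightarrow> \<tau> i"
 proof (rule LIMSEQ_I)
  fix e :: real assume "0 < e"
  show "EX no. \<forall>m\<ge>no. norm (P m (kk m) - \<tau> i) < e"
   unfolding eventually_sequentially[symmetric]
   using mesh[OF \<open>0 < e\<close>]
  proof eventually_elim
   case (elim m)
   then have "P m (Suc (kk m)) - P m (kk m) < e" using 1 by blast
   then show ?case using 2[of m] 3[of m] by simp
  qed
 qed
 have j: "n s <= i - 1" if "0 <= s" "s < \<tau> i" for s
  using tau_le_iff[OF that(1), of i] that by auto
 have "(%m. sampled (P m) (kk m)) \<longlonglongrightarrow> Yl (\<tau> i)"
  by (rule sampled_tendsto_left[OF T 1 3 4 j]) (use less in auto)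
 then have "(%m. max 0 (sampled (P m) (kk m) - b)) \<longlonglongrightarrow> max 0 (Yl (\<tau> i) - b)"
  by (intro tendsto_max tendsto_diff tendsto_const)
 then show ?case by (simp add: cc_def kk_def c_def Yl_def)
qed

text \<open>All but the last cell are covered by the left-limit version. The last cell is one
  explicit step of \<open>chain\<close>, and its limit is the jump rule
  \<open>Y_jump\<close>.\<close>

theorem sampled_tendsto: "(%m. sampled (P m) (K m)) \<longlonglongrightarrow> Y t"
proof -
 define kk where "kk m = K m - 1" for m
 have kk: "kk m < K m" "Suc (kk m) = K m" for m using K_pos[of m] by (auto simp: kk_def)
 have Plt: "P m (kk m) < t" for m using P_incr[OF kk(1), of m] kk(2) P_end by simp
 have Pt: "(%m. P m (kk m)) \<longlonglongrightarrow> t"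
 proof (rule LIMSEQ_I)
  fix e :: real assume "0 < e"
  show "EX no. \<forall>m\<ge>no. norm (P m (kk m) - t) < e"
   unfolding eventually_sequentially[symmetric]
   using mesh[OF \<open>0 < e\<close>]
  proof eventually_elim
   case (elim m)
   then have "P m (Suc (kk m)) - P m (kk m) < e" using kk(1) by blast
   then show ?case using Plt[of m] kk(2)[of m] P_end[of m] by simp
  qed
 qed
 have S: "(%m. sampled (P m) (kk m)) \<longlonglongrightarrow> Yl t"
  by (rule sampled_tendsto_left[where j="n t", OF t_pos order_refl kk(1) Plt Pt])
   (use n_mono cc_tendsto in auto)
 have lt: "filterlim (%m. P m (kk m)) (at_left t) sequentially"
  unfolding filterlim_at using Plt Pt by (auto intro!: always_eventually simp: less_imp_neq)
 have X: "(%m. \<xi> t - \<xi> (P m (kk m))) \<longlonglongrightarrow> \<xi> t - Lim (at_left t) \<xi>"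
  by (intro tendsto_diff tendsto_const filterlim_compose[OF xi_left[OF t_pos] lt])
 \<comment> \<open>If \<open>t\<close> is itself an arrival, every last cell sees it; otherwise the
   last arrival lies strictly before \<open>t\<close> and sufficiently fine last cells see
   none.\<close>
 define A where "A = (\<exists>i\<ge>1. \<tau> i = t)"
 have ev: "\<forall>\<^sub>F m in sequentially. (0 < real (n t) - real (n (P m (kk m)))) = A"
 proof (cases A)
  case True
  then obtain i where i: "i >= 1" "\<tau> i = t" by (auto simp: A_def)
  have "n (P m (kk m)) < n t" for m
   using tau_le_iff[of "P m (kk m)" i] tau_le_iff[of t i] i Plt[of m] P_nonneg[of "kk m" m] kk(1)[of m] t_pos by auto
  then show ?thesis using True by simp
 next
  case False
  show ?thesis
  proof (cases "n t = 0")
   case True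
   then show ?thesis using False by simp
  next
   case nt: False
   then have "\<tau> (n t) ~= t" "\<tau> (n t) <= t" using False tau_le_iff[of t "n t"] t_pos by (auto simp: A_def)
   then have "\<tau> (n t) < t" by simp
   with Pt have "\<forall>\<^sub>F m in sequentially. \<tau> (n t) < P m (kk m)" by (rule order_tendstoD)
   then show ?thesis
   proof eventually_elim
    case (elim m)
    then have "n t <= n (P m (kk m))"
     using tau_le_iff[of "P m (kk m)" "n t"] tau_nonneg[of "n t"] by auto
    then show ?case using False by simp
   qed
  qed
 qed
 have "(%m. max a ((if A then min b (sampled (P m) (kk m)) else sampled (P m) (kk m)) + (\<xi> t - \<xi> (P m (kk m)))))
   \<longlonglongrightarrow> max a ((if A then min b (Yl t) else Yl t) + (\<xi> t - Lim (at_left t) \<xi>))"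
  by (cases A) (simp_all, (intro tendsto_max tendsto_add tendsto_min tendsto_const S X)+)
 moreover have "\<forall>\<^sub>F m in sequentially. max a ((if A then min b (sampled (P m) (kk m)) else sampled (P m) (kk m)) + (\<xi> t - \<xi> (P m (kk m)))) = sampled (P m) (K m)"
  using ev
 proof eventually_elim
  case (elim m)
  have "sampled (P m) (Suc (kk m)) = max a ((if 0 < real (n (P m (Suc (kk m)))) - real (n (P m (kk m)))
    then min b (sampled (P m) (kk m)) else sampled (P m) (kk m)) + (\<xi> (P m (Suc (kk m))) - \<xi> (P m (kk m))))"
   by (simp add: sampled_def)
  then show ?case using elim by (simp add: kk(2) P_end)
 qed
 ultimately show ?thesis
  unfolding Y_jump[OF t_pos] A_def by (rule Lim_transform_eventually)
qed

theorem sampled_push_tendsto: "(%m. sampled_push (P m) (K m)) \<longlonglongrightarrow> L t"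
proof -
 have "(%m. \<Sum>i=1..n t. cc (P m) i) \<longlonglongrightarrow> L t"
  using t_pos by (simp add: L_eq) (intro tendsto_sum cc_tendsto, auto)
 moreover have "\<forall>\<^sub>F m in sequentially. (\<Sum>i=1..n t. cc (P m) i) = sampled_push (P m) (K m)"
  using separated
 proof eventually_elim
  case (elim m)
  have "sampled_push (P m) (K m) = (\<Sum>l=1..n (P m (K m)). cc (P m) l)"
   using elim by (intro sampled_push_eq[of "P m" "K m"] P0 P_incr) auto
  then show ?case by (simp add: P_end)
 qed
 ultimately show ?thesis by (rule Lim_transform_eventually)
qed

end

context barrier_path
begin

text \<open>Each of finitely many arrivals has its own window of right continuity, and the smallest
  one serves all. It is applied to a potential along the path when a grid interval contains an
  arrival.\<close>

lemma near_arrival: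
 assumes Z: "!!i. 1 <= i ==> (Z \<longlongrightarrow> Z (\<tau> i)) (at_right (\<tau> i))" and e: "0 < e"
 shows "\<exists>h>0. ALL i s t. 1 <= i --> i <= j --> s < \<tau> i --> \<tau> i <= t --> t < s + h --> \<bar>Z t - Z (\<tau> i)\<bar> < (e::real)"
proof -
 have "\<exists>d>0. \<forall>t\<in>{\<tau> i..<\<tau> i + d}. \<bar>Z t - Z (\<tau> i)\<bar> < e" if "1 <= i" for i
 proof -
  have "\<forall>\<^sub>F s in at_right (\<tau> i). dist (Z s) (Z (\<tau> i)) < e" using Z[OF that] e tendstoD by blast
  then obtain c where c: "c > \<tau> i" "!!s. \<tau> i < s ==> s < c ==> dist (Z s) (Z (\<tau> i)) < e"
   unfolding eventually_at_right_field by auto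
  show ?thesis
  proof (intro exI[of _ "c - \<tau> i"] conjI ballI)
   fix s assume "s \<in> {\<tau> i..<\<tau> i + (c - \<tau> i)}"
   then show "\<bar>Z s - Z (\<tau> i)\<bar> < e" using c(2)[of s] e by (cases "s = \<tau> i") (auto simp: dist_real_def)
  qed (use c in auto)
 qed
 then obtain d where d: "!!i. 1 <= i ==> d i > 0" "!!i t. 1 <= i ==> t \<in> {\<tau> i..<\<tau> i + d i} ==> \<bar>Z t - Z (\<tau> i)\<bar> < e"
  by metis
 define h where "h = Min (insert 1 (d ` {1..j}))"
 have "h > 0" unfolding h_def using d(1) by (subst Min_gr_iff) auto
 moreover have "h <= d i" if "1 <= i" "i <= j" for i unfolding h_def using that by (intro Min_le) auto
 ultimately show ?thesis using d(2) by (intro exI[of _ h]) (force intro!: d(2))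
qed

text \<open>If the reflection grows between \<open>s\<close> and \<open>t\<close>, its running
  maximum is nearly attained at some \<open>u\<close> in between, where the reflected path is nearly
  at \<open>a\<close>. The path \<open>L - \<xi>\<close> jumps only upwards, so it drops little from
  \<open>u\<close> to \<open>t\<close>, that is, the unreflected path rises little and
  \<open>Y t\<close> is still near \<open>a\<close>.\<close>

lemma R_growth:
 assumes up: "!!s. 0 < s ==> \<xi> s <= Lim (at_left s) \<xi>" and T: "0 <= T" and e: "0 < e"
 shows "\<exists>h>0. ALL s t. 0 <= s --> s <= t --> t <= T --> t < s + h --> R s < R t --> Y t <= a + e"
proof -
 define p where "p s = L s - \<xi> s" for s
 have p_eta: "p s = - \<eta> s" for s by (simp add: p_def \<eta>_def)
 have p: "cadlag p" unfolding p_def by (intro cadlag_diff xi L_cadlag)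
 have "Lim (at_left s) p <= p s" if s: "0 < s" for s
 proof -
  have "(p \<longlongrightarrow> L s - (if \<exists>i\<ge>1. \<tau> i = s then max 0 (Yl s - b) else 0) - Lim (at_left s) \<xi>) (at_left s)"
   unfolding p_def by (intro tendsto_diff L_left xi_left s)
  then have "Lim (at_left s) p = L s - (if \<exists>i\<ge>1. \<tau> i = s then max 0 (Yl s - b) else 0) - Lim (at_left s) \<xi>"
   by (intro tendsto_Lim) auto
  then show ?thesis using up[OF s] by (auto simp: p_def)
 qed
 then obtain h where h: "h > 0" "!!u t. 0 <= u ==> u <= t ==> t <= T ==> t < u + h ==> p u - p t <= e/2"
  using one_sided_modulus[OF p T, of "e/2"] e by auto
 have "Y t <= a + e" if st: "0 <= s" "s <= t" "t <= T" "t < s + h" "R s < R t" for s t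
 proof -
  \<comment> \<open>Exceeding \<open>R s\<close> forces the near-maximiser to lie after
    \<open>s\<close>; exceeding \<open>R t - e/2\<close> makes it good enough.\<close>
  have "max (R s) (R t - e/2) < R t" using st e by simp
  then obtain u where u: "0 <= u" "u <= t" "max (R s) (R t - e/2) < max 0 (a - \<eta> u)"
   using R_approx[of t] st by (metis atLeastAtMost_iff order.trans)
  have "s < u" using R_ge[of u s] u by linarith
  then have "p u - p t <= e/2" using h(2)[of u t] st u by simp
  moreover have "0 <= R s" using R_nonneg st by simp
  moreover have "R t - e/2 < a - \<eta> u" using u(3) \<open>0 <= R s\<close> by (cases "0 <= a - \<eta> u") auto
  ultimately show ?thesis by (simp add: Y_eq p_eta field_simps)
 qed
 then show ?thesis using h(1) by blast
qed

lemma Y_arrival_le: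
 assumes "\<xi> (\<tau> i) <= Lim (at_left (\<tau> i)) \<xi>" "1 <= i"
 shows "Y (\<tau> i) <= b"
proof -
 have "\<exists>j\<ge>1. \<tau> j = \<tau> i" using assms by blast
 then show ?thesis using Y_jump[OF tau_pos[OF assms(2)]] assms(1) ab by auto
qed

lemma Y_push_eq:
 assumes "\<xi> (\<tau> i) = Lim (at_left (\<tau> i)) \<xi>" "1 <= i" "0 < c i"
 shows "Y (\<tau> i) = b"
proof -
 have "\<exists>j\<ge>1. \<tau> j = \<tau> i" using assms by blast
 moreover have "b < Yl (\<tau> i)" using assms(3) by (auto simp: c_def Yl_def)
 ultimately show ?thesis using Y_jump[OF tau_pos[OF assms(2)]] assms(1) ab by auto
qed

lemma L_growth: "0 <= s ==> s <= t ==> L s < L t ==> \<exists>i\<in>{1..n t}. s < \<tau> i & \<tau> i <= t & 0 < c i"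
proof (rule ccontr)
 assume st: "0 <= s" "s <= t" "L s < L t" and "\<not> (\<exists>i\<in>{1..n t}. s < \<tau> i & \<tau> i <= t & 0 < c i)"
 then have "c i = 0" if "i \<in> {1..n t} - {1..n s}" for i
  using that c_nonneg[of i] tau_le_iff[of s i] tau_le_iff[of t i] by force
 then have "(\<Sum>i=1..n t. c i) = (\<Sum>i=1..n s. c i)"
  using st n_mono[of s t] by (intro sum.mono_neutral_right) auto
 then show False using st L_eq[of s] L_eq[of t] by simp
qed

end

section \<open>Independence of the past and of future increments\<close>

context prob_space
begin

lemma prob_eq_AE:
 assumes "A \<in> events" "B \<in> events" "AE w in M. w \<in> A \<longleftrightarrow> w \<in> B"
 shows "prob A = prob B"
 using assms by (intro finite_measure_eq_AE) auto

text \<open>Past and future are events of two disjoint blocks of increments along one increasing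
  time sequence. \<open>D\<close> is kept apart from \<open>Z v - Z u\<close> because for the
  counting process the two agree only almost surely.\<close>

lemma cylinder_indep_increments:
 fixes Z :: "real => 'a => real" and D :: "real => real => 'a => real"
 assumes Zm: "!!t. 0 <= t ==> Z t \<in> borel_measurable M"
  and Z0: "AE w in M. Z 0 w = 0"
  and D: "!!u v. 0 <= u ==> u <= v ==> AE w in M. D u v w = Z v w - Z u w"
  and ind: "!!ts n. mono (ts :: nat => real) ==> 0 <= ts 0 ==> indep_vars (%_. borel) (%i. D (ts i) (ts (Suc i))) {..<n}"
  and s: "0 <= s" and p: "mono p" "p 0 = 0"
  and U: "finite U" "U \<subseteq> {0..s}" and B: "!!u. u \<in> U ==> B u \<in> sets borel"
  and C: "!!k. k < K ==> C k \<in> sets borel"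
 shows "prob ({w\<in>space M. \<forall>u\<in>U. Z u w \<in> B u} Int {w\<in>space M. \<forall>k<K. D (s + p k) (s + p (Suc k)) w \<in> C k}) =
  prob {w\<in>space M. \<forall>u\<in>U. Z u w \<in> B u} * (\<Prod>k<K. prob {w\<in>space M. D (s + p k) (s + p (Suc k)) w \<in> C k})"
proof -
 \<comment> \<open>With 0 and \<open>s\<close> inserted, every \<open>Z u\<close> of the cylinder is
   a sum of increments from 0, and the future block starts exactly at \<open>s\<close>.\<close>
 define us where "us = sorted_list_of_set (insert 0 (insert s U))"
 have us: "sorted us" "set us = insert 0 (insert s U)" "us ~= []"
  using U sorted_sorted_list_of_set[of "insert 0 (insert s U)"] set_sorted_list_of_set[of "insert 0 (insert s U)"]
  by (auto simp: us_def simp del: sorted_list_of_set_insert_remove sorted_list_of_set_insert)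
 define m where "m = length us - 1"
 have len: "length us = Suc m" using us by (simp add: m_def)
 have range: "0 <= us ! i & us ! i <= s" if "i <= m" for i
  using nth_mem[of i us] that us U s len by auto
 have first: "us ! 0 = 0"
 proof -
  obtain j where "j < length us" "us ! j = 0" using us by (metis in_set_conv_nth insertI1)
  then show ?thesis using sorted_nth_mono[OF us(1), of 0 j] range[of 0] by simp
 qed
 have last: "us ! m = s"
 proof -
  obtain j where "j < length us" "us ! j = s" using us by (metis in_set_conv_nth insertI1 insertI2)
  then show ?thesis using sorted_nth_mono[OF us(1), of j m] range[of m] len by simp
 qed
 define ts where "ts i = (if i <= m then us ! i else s + p (i - m))" for i
 have p_nonneg: "0 <= p i" for i using monoD[OF p(1), of 0 i] p(2) by simp
 have ts: "mono ts"
 proof (rule monoI)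
  fix i j :: nat assume ij: "i <= j"
  consider "j <= m" | "i <= m" "\<not> j <= m" | "\<not> i <= m" "\<not> j <= m" using ij by linarith
  then show "ts i <= ts j"
  proof cases
   case 1
   then show ?thesis using ij len sorted_nth_mono[OF us(1) ij] by (simp add: ts_def)
  next
   case 2
   then have "us ! i <= s" using range by simp
   then have "us ! i <= s + p (j - m)" using p_nonneg[of "j - m"] by linarith
   then show ?thesis using 2 by (simp add: ts_def)
  next
   case 3
   then show ?thesis using ij monoD[OF p(1), of "i - m" "j - m"] by (simp add: ts_def)
  qed
 qed
 have ts0: "ts 0 = 0" using first by (simp add: ts_def)
 have ts_pos: "0 <= ts i" for i using monoD[OF ts, of 0 i] ts0 by simp
 have tsm: "ts (m + k) = s + p k" for k using last p by (cases k) (auto simp: ts_def)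
 define V where "V i = D (ts i) (ts (Suc i))" for i
 have V: "indep_vars (%_. borel) V {..<m + K}"
  unfolding V_def[abs_def] using ts ts0 by (intro ind) auto
 have Vm: "V i \<in> borel_measurable M" if "i < m + K" for i using V that by (auto simp: indep_vars_def2)
 define idx where "idx u = (SOME j. j <= m & us ! j = u)" for u
 have idx: "idx u <= m & us ! (idx u) = u" if "u \<in> U" for u
 proof -
  have "EX j. j <= m & us ! j = u" using that us len by (metis in_set_conv_nth insertI2 less_Suc_eq_le)
  then show ?thesis unfolding idx_def by (rule someI_ex)
 qed
 define S where "S = {v \<in> space (\<Pi>\<^sub>M i\<in>{..<m}. borel). \<forall>u\<in>U. (\<Sum>i<idx u. v i) \<in> B u}"
 have S: "S \<in> sets (\<Pi>\<^sub>M i\<in>{..<m}. (borel :: real measure))"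
  unfolding S_def
 proof (intro sets.sets_Collect_finite_All U(1))
  fix u assume u: "u \<in> U"
  have "(%v. \<Sum>i<idx u. v i) \<in> borel_measurable (\<Pi>\<^sub>M i\<in>{..<m}. (borel :: real measure))"
   using idx[OF u] by (intro borel_measurable_sum measurable_component_singleton) auto
  then show "{v \<in> space (\<Pi>\<^sub>M i\<in>{..<m}. borel). (\<Sum>i<idx u. v i) \<in> B u} \<in> sets (\<Pi>\<^sub>M i\<in>{..<m}. (borel :: real measure))"
   by (rule measurable_sets_Collect) (use B[OF u] in auto)
 qed
 define T where "T = {v \<in> space (\<Pi>\<^sub>M i\<in>{m..<m+K}. borel). \<forall>k\<in>{..<K}. v (m + k) \<in> C k}"
 have T: "T \<in> sets (\<Pi>\<^sub>M i\<in>{m..<m+K}. (borel :: real measure))"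
  unfolding T_def
 proof (intro sets.sets_Collect_finite_All finite_lessThan)
  fix k assume k: "k \<in> {..<K}"
  have "(%v. v (m + k)) \<in> borel_measurable (\<Pi>\<^sub>M i\<in>{m..<m+K}. (borel :: real measure))"
   using k by (intro measurable_component_singleton) auto
  then show "{v \<in> space (\<Pi>\<^sub>M i\<in>{m..<m+K}. borel). v (m + k) \<in> C k} \<in> sets (\<Pi>\<^sub>M i\<in>{m..<m+K}. (borel :: real measure))"
   by (rule measurable_sets_Collect) (use C k in auto)
 qed
 let ?A = "{w\<in>space M. \<forall>u\<in>U. Z u w \<in> B u}" and ?E = "{w\<in>space M. \<forall>k<K. D (s + p k) (s + p (Suc k)) w \<in> C k}"
 let ?A' = "(%w. \<lambda>i\<in>{..<m}. V i w) -` S Int space M"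
 have A: "?A \<in> events"
  using U Zm B by (intro sets.sets_Collect_finite_All) (auto intro!: measurable_sets_Collect[OF Zm] simp: subset_iff)
 have Vr: "(%w. \<lambda>i\<in>J. V i w) \<in> measurable M (\<Pi>\<^sub>M i\<in>J. borel)" if "J \<subseteq> {..<m+K}" for J
  using that Vm by (intro measurable_restrict) auto
 have A': "?A' \<in> events" by (rule measurable_sets[OF Vr S]) auto
 have E_eq: "(%w. \<lambda>i\<in>{m..<m+K}. V i w) -` T Int space M = ?E"
  using tsm tsm[of "Suc _"] by (auto simp: T_def V_def space_PiM)
 have E: "?E \<in> events" unfolding E_eq[symmetric] by (rule measurable_sets[OF Vr T]) auto
 have "AE w in M. \<forall>i\<in>{..<m}. V i w = Z (ts (Suc i)) w - Z (ts i) w"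
  unfolding V_def using monoD[OF ts] ts_pos by (intro AE_finite_allI) (auto intro!: D)
 then have AA: "AE w in M. w \<in> ?A \<longleftrightarrow> w \<in> ?A'"
  using Z0
 proof eventually_elim
  case (elim w)
  have 1: "(\<Sum>i<idx u. V i w) = Z u w" if u: "u \<in> U" for u
  proof -
   have "(\<Sum>i<idx u. V i w) = (\<Sum>i<idx u. Z (ts (Suc i)) w - Z (ts i) w)"
    using elim idx[OF u] by (intro sum.cong) auto
   also have "... = Z (ts (idx u)) w - Z (ts 0) w" by (rule sum_lessThan_telescope)
   also have "... = Z u w" using idx[OF u] elim ts0 by (simp add: ts_def)
   finally show ?thesis .
  qed
  have 2: "(\<Sum>i<idx u. (\<lambda>i\<in>{..<m}. V i w) i) = Z u w" if u: "u \<in> U" for u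
   unfolding 1[OF u, symmetric] using idx[OF u] by (intro sum.cong) auto
  have "(\<lambda>i\<in>{..<m}. V i w) \<in> space (\<Pi>\<^sub>M i\<in>{..<m}. (borel :: real measure))" by (simp add: space_PiM)
  then have "(\<lambda>i\<in>{..<m}. V i w) \<in> S \<longleftrightarrow> (\<forall>u\<in>U. Z u w \<in> B u)"
   unfolding S_def using 2 by (simp only: mem_Collect_eq simp_thms cong: ball_cong)
  then show ?case by blast
 qed
 have "AE w in M. w \<in> ?A Int ?E \<longleftrightarrow> w \<in> ?A' Int ?E" using AA by eventually_elim blast
 then have "prob (?A Int ?E) = prob (?A' Int ?E)"
  by (rule prob_eq_AE[OF sets.Int[OF A E] sets.Int[OF A' E]])
 also have "?A' Int ?E = (%w. (\<lambda>i\<in>{..<m}. V i w, \<lambda>i\<in>{m..<m+K}. V i w)) -` (S \<times> T) Int space M"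
  unfolding E_eq[symmetric] by blast
 also have "prob ... = prob ?A' * prob ?E"
  unfolding E_eq[symmetric] by (rule indep_varD[OF indep_var_restrict[OF V] S T]) auto
 also have "prob ?A' = prob ?A" by (rule prob_eq_AE[OF A A' AA, symmetric])
 also have "prob ?E = (\<Prod>k<K. prob {w\<in>space M. D (s + p k) (s + p (Suc k)) w \<in> C k})"
 proof (cases "K = 0")
  case False
  have "?E = (\<Inter>i\<in>{m..<m+K}. V i -` C (i - m) Int space M)"
  proof -
   have "w \<in> ?E \<longleftrightarrow> w \<in> space M & (\<forall>k<K. V (m + k) w \<in> C k)" for w
    using tsm tsm[of "Suc _"] by (auto simp: V_def)
   moreover have "(\<forall>k<K. V (m + k) w \<in> C k) \<longleftrightarrow> (\<forall>i\<in>{m..<m+K}. V i w \<in> C (i - m))" for w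
    by (metis add_diff_cancel_left' atLeastLessThan_iff le_add1 le_add_diff_inverse nat_add_left_cancel_less)
   ultimately show ?thesis using False by auto
  qed
  also have "prob ... = (\<Prod>i\<in>{m..<m+K}. prob (V i -` C (i - m) Int space M))"
   by (rule indep_varsD_finite[OF indep_vars_subset[OF V]]) (use False C in auto)
  also have "... = (\<Prod>k<K. prob (V (m + k) -` C k Int space M))"
   by (rule prod.reindex_bij_witness[of _ "%k. m + k" "%i. i - m"]) auto
  also have "... = (\<Prod>k<K. prob {w\<in>space M. D (s + p k) (s + p (Suc k)) w \<in> C k})"
   using tsm tsm[of "Suc _"] by (intro prod.cong arg_cong[where f=prob]) (auto simp: V_def)
  finally show ?thesis .
 qed (simp add: prob_space)
 finally show ?thesis .
qed

text \<open>Cylinders over finitely many times are an intersection-stable generator of the past, so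
  their product formula extends to all of it.\<close>

lemma past_indep_increments:
 fixes Z :: "real => 'a => real" and D :: "real => real => 'a => real"
 assumes Zm: "!!t. 0 <= t ==> Z t \<in> borel_measurable M"
  and Z0: "AE w in M. Z 0 w = 0"
  and Dm: "!!u v. 0 <= u ==> u <= v ==> D u v \<in> borel_measurable M"
  and D: "!!u v. 0 <= u ==> u <= v ==> AE w in M. D u v w = Z v w - Z u w"
  and ind: "!!ts n. mono (ts :: nat => real) ==> 0 <= ts 0 ==> indep_vars (%_. borel) (%i. D (ts i) (ts (Suc i))) {..<n}"
  and s: "0 <= s" and p: "mono p" "p 0 = 0"
  and C: "!!k. k < K ==> C k \<in> sets borel"
  and A: "A \<in> sigma_sets (space M) {Z u -` B Int space M |u B. u \<in> {0..s} & B \<in> sets borel}"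
 shows "prob (A Int {w\<in>space M. \<forall>k<K. D (s + p k) (s + p (Suc k)) w \<in> C k}) =
  prob A * (\<Prod>k<K. prob {w\<in>space M. D (s + p k) (s + p (Suc k)) w \<in> C k})"
proof -
 define E where "E = {w\<in>space M. \<forall>k<K. D (s + p k) (s + p (Suc k)) w \<in> C k}"
 define G where "G = {{w\<in>space M. \<forall>u\<in>U. Z u w \<in> B u} |U B. finite U & U \<subseteq> {0..s} & (\<forall>u\<in>U. B u \<in> sets borel)}"
 have p_nonneg: "0 <= p i" for i using monoD[OF p(1), of 0 i] p(2) by simp
 have E: "E \<in> events"
 proof -
  have "E = {w\<in>space M. \<forall>k\<in>{..<K}. D (s + p k) (s + p (Suc k)) w \<in> C k}" by (auto simp: E_def)
  also have "... \<in> events"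
   using s p_nonneg monoD[OF p(1)] C
   by (intro sets.sets_Collect_finite_All) (auto intro!: measurable_sets_Collect[OF Dm])
  finally show ?thesis .
 qed
 have G: "G \<subseteq> events"
  unfolding G_def using Zm
  by (auto intro!: sets.sets_Collect_finite_All measurable_sets_Collect[OF Zm] simp: subset_iff)
 have prod: "prob (g Int E) = prob g * (\<Prod>k<K. prob {w\<in>space M. D (s + p k) (s + p (Suc k)) w \<in> C k})" if "g \<in> G" for g
  using that unfolding G_def E_def
  using cylinder_indep_increments[of Z D s p, OF Zm Z0 D ind s p] C by auto
 have "space M \<in> G" unfolding G_def by (auto intro!: exI[of _ "{}"])
 from prod[OF this] have PE: "prob E = (\<Prod>k<K. prob {w\<in>space M. D (s + p k) (s + p (Suc k)) w \<in> C k})"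
  using sets.sets_into_space[OF E] by (simp add: prob_space Int_absorb1)
 have "indep_set G {E}" using G E prod PE by (intro indep_setI) auto
 moreover have "Int_stable G"
  unfolding Int_stable_def
 proof (intro ballI)
  fix x y assume "x \<in> G" "y \<in> G"
  then obtain U B V C where x: "x = {w\<in>space M. \<forall>u\<in>U. Z u w \<in> B u}" "finite U" "U \<subseteq> {0..s}" "\<forall>u\<in>U. B u \<in> sets borel"
   and y: "y = {w\<in>space M. \<forall>u\<in>V. Z u w \<in> C u}" "finite V" "V \<subseteq> {0..s}" "\<forall>u\<in>V. C u \<in> sets borel"
   unfolding G_def by blast
  \<comment> \<open>\<open>UNIV\<close> fills in at times that only one of the two cylinders
    constrains.\<close>
  have "x Int y = {w\<in>space M. \<forall>u\<in>U Un V. Z u w \<in> (if u \<in> U then B u else UNIV) Int (if u \<in> V then C u else UNIV)}"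
   using x y by auto
  then show "x Int y \<in> G" unfolding G_def using x y
   by (intro CollectI exI[of _ "U Un V"] exI[of _ "%u. (if u \<in> U then B u else UNIV) Int (if u \<in> V then C u else UNIV)"]) auto
 qed
 ultimately have "indep_set (sigma_sets (space M) G) (sigma_sets (space M) {E})"
  by (intro indep_set_sigma_sets) (auto simp: Int_stable_def)
 moreover have "A \<in> sigma_sets (space M) G"
 proof -
  have "{Z u -` B Int space M |u B. u \<in> {0..s} & B \<in> sets borel} \<subseteq> G"
  proof safe
   fix u B assume "u \<in> {0..s}" "B \<in> sets (borel :: real measure)"
   then show "Z u -` B Int space M \<in> G" unfolding G_def
    by (intro CollectI exI[of _ "{u}"] exI[of _ "%_. B"]) auto
  qed
  then show ?thesis using A sigma_sets_mono' by blast
 qed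
 ultimately have "prob (A Int E) = prob A * prob E" by (intro indep_setD) auto
 then show ?thesis unfolding PE by (simp add: E_def)
qed

end

text \<open>The preimages can differ only inside a null set, and completeness makes every part of it
  measurable.\<close>

lemma (in complete_measure) M_measurable_AE:
 assumes f: "f \<in> M \<rightarrow>\<^sub>M S" and eq: "AE w in M. f w = g w" and g: "!!w. w \<in> space M ==> g w \<in> space S"
 shows "g \<in> M \<rightarrow>\<^sub>M S"
proof (rule measurableI)
 fix B assume B: "B \<in> sets S"
 from eq obtain Z where Z: "{w\<in>space M. f w ~= g w} \<subseteq> Z" "Z \<in> null_sets M"
  by (auto elim!: AE_E simp: null_sets_def)
 define Z1 Z2 where "Z1 = {w\<in>space M. f w ~= g w & f w \<in> B}" and "Z2 = {w\<in>space M. f w ~= g w & g w \<in> B}"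
 have "Z1 \<in> sets M" "Z2 \<in> sets M"
  using Z(1) by (auto intro!: complete[OF _ Z(2)] simp: Z1_def Z2_def)
 moreover have "f -` B Int space M \<in> sets M" using f B by auto
 ultimately have "((f -` B Int space M) - Z1) Un Z2 \<in> sets M" by auto
 also have "((f -` B Int space M) - Z1) Un Z2 = g -` B Int space M"
  by (auto simp: Z1_def Z2_def)
 finally show "g -` B Int space M \<in> sets M" .
qed (use g in auto)

section \<open>The driving pair, its completed filtration and its increments\<close>

locale driving = prob_space M + complete_measure M for M :: "'w measure" +
 fixes X :: "real => 'w => real" and N :: "real => 'w => nat" and r :: real
 assumes levy: "levy_process M X" and no_up: "no_upward_jumps M X"
  and poisson: "poisson_process M r N" and indep: "indep_processes M X N" and r_pos: "0 < r"
begin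

abbreviation "F \<equiv> generated_filtration M X N"

definition "DX u v w = X v w - X u w"
text \<open>The subtraction is that of natural numbers, as in \<open>poisson_process\<close>; along
  decreasing paths it would be cut off at 0, hence the almost sure equality in
  \<open>DN_AE\<close>.\<close>

definition "DN u v w = real (N v w - N u w)"

lemma X_measurable [measurable]: "0 <= t ==> X t \<in> borel_measurable M"
 and X_0: "AE w in M. X 0 w = 0"
 and X_cadlag: "AE w in M. cadlag (%t. X t w)"
 and X_indep: "mono (ts :: nat => real) ==> 0 <= ts 0 ==> indep_vars (%_. borel) (%i. DX (ts i) (ts (Suc i))) {..<n}"
 and X_stationary: "0 <= s ==> s <= t ==> distr M borel (DX s t) = distr M borel (X (t - s))"
 using levy by (auto simp: levy_process_def DX_def[abs_def])

lemma N_measurable [measurable]: "0 <= t ==> N t \<in> M \<rightarrow>\<^sub>M count_space UNIV"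
 and N_0: "AE w in M. N 0 w = 0"
 and N_mono: "AE w in M. mono_on {0..} (%t. N t w) & cadlag (%t. real (N t w))"
 and N_poisson: "0 <= s ==> s < t ==>
  distr M (count_space UNIV) (%w. N t w - N s w) = poisson_pmf (r * (t - s))"
 using poisson by (auto simp: poisson_process_def)

lemma N_indep:
 assumes "mono (ts :: nat => real)" "0 <= ts 0"
 shows "indep_vars (%_. borel) (%i. DN (ts i) (ts (Suc i))) {..<n}"
proof -
 have "indep_vars (%_. count_space UNIV) (%i w. N (ts (Suc i)) w - N (ts i) w) {..<n}"
  using poisson assms by (auto simp: poisson_process_def)
 then have "indep_vars (%_. borel) (%i w. real (N (ts (Suc i)) w - N (ts i) w)) {..<n}"
  by (rule indep_vars_compose2) auto
 then show ?thesis by (simp add: DN_def[abs_def])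
qed

lemma DX_measurable [measurable]: "0 <= u ==> 0 <= v ==> DX u v \<in> borel_measurable M"
 unfolding DX_def[abs_def] by measurable

lemma DN_measurable [measurable]: "0 <= u ==> 0 <= v ==> DN u v \<in> borel_measurable M"
 unfolding DN_def[abs_def] by measurable

lemma DN_AE: "0 <= u ==> u <= v ==> AE w in M. DN u v w = real (N v w) - real (N u w)"
 using N_mono by eventually_elim (auto simp: DN_def mono_on_def of_nat_diff)

lemma prob_DX:
 assumes "0 <= u" "u <= v" "C \<in> sets borel"
 shows "prob {w\<in>space M. DX u v w \<in> C} = prob {w\<in>space M. DX 0 (v - u) w \<in> C}"
proof -
 have "distr M borel (DX u v) = distr M borel (DX 0 (v - u))"
  using X_stationary[of u v] X_stationary[of 0 "v - u"] assms by simp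
 then have "measure (distr M borel (DX u v)) C = measure (distr M borel (DX 0 (v - u))) C" by simp
 then show ?thesis using assms by (simp add: measure_distr vimage_def Int_def conj_commute)
qed

lemma prob_N:
 assumes "0 <= u" "u < v"
 shows "prob {w\<in>space M. P (N v w - N u w)} = measure (poisson_pmf (r * (v - u))) {k. P k}"
 using arg_cong[OF N_poisson[OF assms], of "%m. measure m {k. P k}"] assms
 by (simp add: measure_distr vimage_def Int_def conj_commute)

lemma prob_DN:
 assumes "0 <= u" "u <= v" "C \<in> sets borel"
 shows "prob {w\<in>space M. DN u v w \<in> C} = prob {w\<in>space M. DN 0 (v - u) w \<in> C}"
proof (cases "u = v")
 case False
 then show ?thesis
  using prob_N[of u v "%k. real k \<in> C"] prob_N[of 0 "v - u" "%k. real k \<in> C"] assms by (simp add: DN_def)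
qed (simp add: DN_def)

lemma space_F: "space (F s) = space M"
 by (simp add: generated_filtration_def space_measure_of_conv)

definition "GX s = {X u -` B Int space M |u B. u \<in> {0..s} & B \<in> sets borel}"
definition "GN s = {N u -` B Int space M |u B. u \<in> {0..s} & B \<in> sets (count_space UNIV)}"

lemma sets_F: "sets (F s) = sigma_sets (space M) (GX s Un GN s Un null_sets M)"
 unfolding generated_filtration_def GX_def GN_def
 by (rule sets_measure_of) (auto dest: sets.sets_into_space)

lemma GX_events: "GX s \<subseteq> events" and GN_events: "GN s \<subseteq> events"
 by (auto simp: GX_def GN_def)

lemma F_events: "sets (F s) \<subseteq> events"
 unfolding sets_F using GX_events[of s] GN_events[of s] by (intro sets.sigma_sets_subset) auto

lemma F_mono: "s <= t ==> sets (F s) \<subseteq> sets (F t)"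
proof -
 assume "s <= t"
 then have sub: "{0..s} \<subseteq> {0..t}" by auto
 have "GX s \<subseteq> GX t" "GN s \<subseteq> GN t" unfolding GX_def GN_def using sub by blast+
 then have "GX s Un GN s Un null_sets M \<subseteq> GX t Un GN t Un null_sets M" by blast
 then show ?thesis unfolding sets_F by (rule sigma_sets_mono')
qed

lemma F_measurable_mono: "s <= t ==> f \<in> F s \<rightarrow>\<^sub>M S ==> f \<in> F t \<rightarrow>\<^sub>M S"
 using F_mono[of s t] by (auto simp: measurable_def space_F)

lemma F_measurable_M: "f \<in> F s \<rightarrow>\<^sub>M S ==> f \<in> M \<rightarrow>\<^sub>M S"
 using F_events[of s] by (auto simp: measurable_def space_F)

lemma X_F: "0 <= u ==> u <= s ==> X u \<in> borel_measurable (F s)"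
 by (rule measurableI) (auto simp: space_F sets_F GX_def intro!: sigma_sets.Basic)

lemma N_F: "0 <= u ==> u <= s ==> N u \<in> F s \<rightarrow>\<^sub>M count_space UNIV"
 by (rule measurableI) (auto simp: space_F sets_F GN_def intro!: sigma_sets.Basic)

text \<open>Every sigma-algebra of the filtration contains all null sets. Limits of the grid walk,
  which are identified only almost surely, are thereby adapted.\<close>

lemma F_measurable_AE:
 assumes f: "f \<in> F s \<rightarrow>\<^sub>M S" and eq: "AE w in M. f w = g w" and g: "!!w. w \<in> space M ==> g w \<in> space S"
 shows "g \<in> F s \<rightarrow>\<^sub>M S"
proof (rule measurableI)
 fix B assume B: "B \<in> sets S"
 from eq obtain Z where Z: "{w\<in>space M. f w ~= g w} \<subseteq> Z" "Z \<in> null_sets M"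
  by (auto elim!: AE_E simp: null_sets_def)
 define Z1 Z2 where "Z1 = {w\<in>space M. f w ~= g w & f w \<in> B}" and "Z2 = {w\<in>space M. f w ~= g w & g w \<in> B}"
 have null: "W \<in> null_sets M" if "W \<subseteq> Z" for W
  using complete[OF that Z(2)] that Z(2) null_sets_subset by blast
 have "Z1 \<in> sets (F s)" "Z2 \<in> sets (F s)"
  unfolding sets_F using Z(1) by (auto intro!: sigma_sets.Basic null simp: Z1_def Z2_def)
 moreover have "f -` B Int space (F s) \<in> sets (F s)" using f B by auto
 ultimately have "((f -` B Int space (F s)) - Z1) Un Z2 \<in> sets (F s)" by auto
 also have "((f -` B Int space (F s)) - Z1) Un Z2 = g -` B Int space (F s)"
  by (auto simp: Z1_def Z2_def space_F)
 finally show "g -` B Int space (F s) \<in> sets (F s)" .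
qed (use g in \<open>auto simp: space_F\<close>)

definition "EvX s p K C = {w\<in>space M. \<forall>k<K. DX (s + p k) (s + p (Suc k)) w \<in> C k}"
definition "EvN s p K C = {w\<in>space M. \<forall>k<K. DN (s + p k) (s + p (Suc k)) w \<in> C k}"

text \<open>The two processes are independent as whole paths, so an intersection of a past event of
  \<open>X\<close> with one of \<open>N\<close> factorises against future increments one process at
  a time. Such rectangles, together with the null sets, are intersection-stable and generate the
  completed past.\<close>

lemma filtration_indep:
 assumes s: "0 <= s" and p: "mono p" "p 0 = 0"
  and C: "!!k. k < K ==> C k \<in> sets borel" and C': "!!k. k < K ==> C' k \<in> sets borel"
  and A: "A \<in> sets (F s)"
 shows "prob (A Int (EvX s p K C Int EvN s p K C')) = prob A *
  ((\<Prod>k<K. prob {w\<in>space M. DX 0 (p (Suc k) - p k) w \<in> C k}) *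
   (\<Prod>k<K. prob {w\<in>space M. DN 0 (p (Suc k) - p k) w \<in> C' k}))"
proof -
 have p_nonneg: "0 <= p i" for i using monoD[OF p(1), of 0 i] p(2) by simp
 define PX where "PX = (\<Pi>\<^sub>M t\<in>{0::real..}. borel :: real measure)"
 define PN where "PN = (\<Pi>\<^sub>M t\<in>{0::real..}. count_space UNIV :: real measure)"
 define fX where "fX w = (\<lambda>t\<in>{0..}. X t w)" for w
 \<comment> \<open>\<open>indep_var\<close> takes both families at one type, so the counts are read
   as reals; \<open>NV\<close> recovers them with the floor.\<close>
 define fN where "fN w t = real (if 0 <= t then N t w else undefined)" for w t
 have ind: "indep_var PX fX PN fN"
  using indep by (simp add: indep_processes_def PX_def PN_def fX_def[abs_def] fN_def[abs_def] restrict_def)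
 have fX: "fX \<in> space M \<rightarrow> space PX" and fN: "fN \<in> space M \<rightarrow> space PN"
  using indep_var_rv1[OF ind] indep_var_rv2[OF ind] by (auto simp: measurable_def)
 define VX where "VX = vimage_algebra (space M) fX PX"
 define VN where "VN = vimage_algebra (space M) fN PN"
 have sVX: "sets VX = {fX -` A Int space M |A. A \<in> sets PX}"
  unfolding VX_def by (rule sets_vimage_algebra2[OF fX])
 have sVN: "sets VN = {fN -` A Int space M |A. A \<in> sets PN}"
  unfolding VN_def by (rule sets_vimage_algebra2[OF fN])
 have spV [simp]: "space VX = space M" "space VN = space M" by (auto simp: VX_def VN_def)
 have rect: "prob (x Int y) = prob x * prob y" if "x \<in> sets VX" "y \<in> sets VN" for x y
  using ind that unfolding indep_var_eq sVX sVN by (auto elim!: indep_setD)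
 have XV: "X u \<in> borel_measurable VX" if "0 <= u" for u
 proof -
  have "(%w. fX w u) \<in> borel_measurable VX"
   unfolding VX_def PX_def using that fX
   by (intro measurable_compose[OF measurable_vimage_algebra1 measurable_component_singleton]) (auto simp: PX_def)
  then show ?thesis using that by (simp add: fX_def)
 qed
 have NV: "N u \<in> VN \<rightarrow>\<^sub>M count_space UNIV" if "0 <= u" for u
 proof -
  have *: "(%w. fN w u) \<in> VN \<rightarrow>\<^sub>M count_space UNIV"
   unfolding VN_def PN_def using that fN
   by (intro measurable_compose[OF measurable_vimage_algebra1 measurable_component_singleton]) (auto simp: PN_def)
  have "(%w. nat \<lfloor>fN w u\<rfloor>) \<in> VN \<rightarrow>\<^sub>M count_space UNIV" using * by (rule measurable_compose) simp
  then show ?thesis using that by (simp add: fN_def)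
 qed
 have DXV: "DX u v \<in> borel_measurable VX" and DNV: "DN u v \<in> borel_measurable VN" if "0 <= u" "0 <= v" for u v
  using XV NV that unfolding DX_def[abs_def] DN_def[abs_def] by measurable
 have EvX: "EvX s p K C \<in> sets VX"
 proof -
  have "{w\<in>space VX. \<forall>k\<in>{..<K}. DX (s + p k) (s + p (Suc k)) w \<in> C k} \<in> sets VX"
  proof (intro sets.sets_Collect_finite_All finite_lessThan)
   fix k assume k: "k \<in> {..<K}"
   show "{w\<in>space VX. DX (s + p k) (s + p (Suc k)) w \<in> C k} \<in> sets VX"
    using k by (intro measurable_sets_Collect[OF DXV] add_nonneg_nonneg s p_nonneg) (simp add: C)
  qed
  then show ?thesis by (simp only: EvX_def Ball_def lessThan_iff spV)
 qed
 have EvN: "EvN s p K C' \<in> sets VN"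
 proof -
  have "{w\<in>space VN. \<forall>k\<in>{..<K}. DN (s + p k) (s + p (Suc k)) w \<in> C' k} \<in> sets VN"
  proof (intro sets.sets_Collect_finite_All finite_lessThan)
   fix k assume k: "k \<in> {..<K}"
   show "{w\<in>space VN. DN (s + p k) (s + p (Suc k)) w \<in> C' k} \<in> sets VN"
    using k by (intro measurable_sets_Collect[OF DNV] add_nonneg_nonneg s p_nonneg) (simp add: C')
  qed
  then show ?thesis by (simp only: EvN_def Ball_def lessThan_iff spV)
 qed
 have VX_events: "sets VX \<subseteq> events" and VN_events: "sets VN \<subseteq> events"
  using indep_var_rv1[OF ind] indep_var_rv2[OF ind] by (auto simp: sVX sVN)
 define SX where "SX = sigma_sets (space M) (GX s)"
 \<comment> \<open>\<open>past_indep_increments\<close> speaks of real processes, so the past of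
   \<open>N\<close> is described through real values as well.\<close>
 define GN' where "GN' = {(%w. real (N u w)) -` B Int space M |u B. u \<in> {0..s} & B \<in> sets borel}"
 define SN where "SN = sigma_sets (space M) GN'"
 have SXV: "SX \<subseteq> sets VX"
  unfolding SX_def spV(1)[symmetric] using measurable_sets[OF XV] by (intro sets.sigma_sets_subset) (auto simp: GX_def)
 have SNV: "SN \<subseteq> sets VN"
 proof -
  have "(%w. real (N u w)) \<in> borel_measurable VN" if "0 <= u" for u using NV[OF that] by measurable
  then show ?thesis unfolding SN_def spV(2)[symmetric] 
   using measurable_sets[of _ VN borel] by (intro sets.sigma_sets_subset) (auto simp: GN'_def)
 qed
 have GN_GN': "GN s \<subseteq> GN'"
 proof
  fix x assume "x \<in> GN s"
  then obtain u B where x: "x = N u -` B Int space M" "u \<in> {0..s}" by (auto simp: GN_def)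
  have "x = (%w. real (N u w)) -` (real ` B) Int space M" using x by auto
  moreover have "real ` B \<in> sets borel" by (rule sets.countable) auto
  ultimately show "x \<in> GN'" using x by (auto simp: GN'_def)
 qed
 define PXk where "PXk = (\<Prod>k<K. prob {w\<in>space M. DX 0 (p (Suc k) - p k) w \<in> C k})"
 define PNk where "PNk = (\<Prod>k<K. prob {w\<in>space M. DN 0 (p (Suc k) - p k) w \<in> C' k})"
 have pX: "prob (x Int EvX s p K C) = prob x * PXk" if "x \<in> SX" for x
 proof -
  have "prob (x Int EvX s p K C) = prob x * (\<Prod>k<K. prob {w\<in>space M. DX (s + p k) (s + p (Suc k)) w \<in> C k})"
   unfolding EvX_def
  proof (rule past_indep_increments[where Z=X, OF X_measurable X_0 _ _ X_indep s p C])
   show "x \<in> sigma_sets (space M) {X u -` B Int space M |u B. u \<in> {0..s} & B \<in> sets borel}"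
    using that by (simp only: SX_def GX_def)
  qed (simp_all add: DX_measurable, simp add: DX_def)
  also have "(\<Prod>k<K. prob {w\<in>space M. DX (s + p k) (s + p (Suc k)) w \<in> C k}) = PXk"
   unfolding PXk_def 
  proof (intro prod.cong refl)
   fix k assume k: "k \<in> {..<K}"
   have "s + p k <= s + p (Suc k)" using monoD[OF p(1), of k "Suc k"] by simp
   from prob_DX[OF add_nonneg_nonneg[OF s p_nonneg] this C] k
   show "prob {w \<in> space M. DX (s + p k) (s + p (Suc k)) w \<in> C k} = prob {w \<in> space M. DX 0 (p (Suc k) - p k) w \<in> C k}"
    by simp
  qed
  finally show ?thesis .
 qed
 have pN: "prob (x Int EvN s p K C') = prob x * PNk" if "x \<in> SN" for x
 proof -
  have "prob (x Int EvN s p K C') = prob x * (\<Prod>k<K. prob {w\<in>space M. DN (s + p k) (s + p (Suc k)) w \<in> C' k})"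
   unfolding EvN_def
  proof (rule past_indep_increments[where Z="%t w. real (N t w)", OF _ _ _ DN_AE N_indep s p C'])
   show "x \<in> sigma_sets (space M) {(%w. real (N u w)) -` B Int space M |u B. u \<in> {0..s} & B \<in> sets borel}"
    using that by (simp only: SN_def GN'_def)
   show "AE w in M. real (N 0 w) = 0" using N_0 by simp
  qed (simp_all add: DN_measurable)
  also have "(\<Prod>k<K. prob {w\<in>space M. DN (s + p k) (s + p (Suc k)) w \<in> C' k}) = PNk"
   unfolding PNk_def 
  proof (intro prod.cong refl)
   fix k assume k: "k \<in> {..<K}"
   have "s + p k <= s + p (Suc k)" using monoD[OF p(1), of k "Suc k"] by simp
   from prob_DN[OF add_nonneg_nonneg[OF s p_nonneg] this C'] k
   show "prob {w \<in> space M. DN (s + p k) (s + p (Suc k)) w \<in> C' k} = prob {w \<in> space M. DN 0 (p (Suc k) - p k) w \<in> C' k}"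
    by simp
  qed
  finally show ?thesis .
 qed
 define E where "E = EvX s p K C Int EvN s p K C'"
 have E: "E \<in> events" using EvX EvN VX_events VN_events by (auto simp: E_def)
 define H0 where "H0 = {x Int y |x y. x \<in> SX & y \<in> SN}"
 \<comment> \<open>Null sets join as separate generators: they need not be rectangles, and
   intersecting with one gives a null set again.\<close>
 define H where "H = H0 Un null_sets M"
 have H0E: "\<exists>x\<in>SX. \<exists>y\<in>SN. h = x Int y" if "h \<in> H0" for h using that unfolding H0_def by blast
 have H0I: "x Int y \<in> H" if "x \<in> SX" "y \<in> SN" for x y using that unfolding H_def H0_def by blast
 have SE: "SX \<subseteq> events" "SN \<subseteq> events" using SXV SNV VX_events VN_events by auto
 have sm: "space M \<in> SX" "space M \<in> SN" by (auto simp: SX_def SN_def sigma_sets_top)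
 have H_events: "H \<subseteq> events" using SE by (auto simp: H_def dest!: H0E)
 have prod: "prob (h Int E) = prob h * (PXk * PNk)" if "h \<in> H" for h
 proof (cases "h \<in> null_sets M")
  case True
  then have "h Int E \<in> null_sets M" using E by (intro null_set_Int2)
  then show ?thesis using True by (simp add: measure_eq_0_null_sets)
 next
  case False
  then have "h \<in> H0" using that by (simp add: H_def)
  from H0E[OF this] obtain x y where xy: "h = x Int y" "x \<in> SX" "y \<in> SN" by auto
  have "h Int E = (x Int EvX s p K C) Int (y Int EvN s p K C')" using xy by (auto simp: E_def)
  then have "prob (h Int E) = prob (x Int EvX s p K C) * prob (y Int EvN s p K C')"
   using xy SXV SNV EvX EvN by (simp add: rect subset_iff sets.Int)
  also have "... = (prob x * prob y) * (PXk * PNk)" using xy by (simp add: pX pN)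
  also have "prob x * prob y = prob h" using xy SXV SNV by (simp add: rect subset_iff)
  finally show ?thesis .
 qed
 have "space M \<in> H" using H0I[OF sm] by simp
 from prod[OF this] have PE: "prob E = PXk * PNk"
  using sets.sets_into_space[OF E] by (simp add: prob_space Int_absorb1)
 have "indep_set H {E}" using H_events E prod PE by (intro indep_setI) auto
 moreover have "Int_stable H"
  unfolding Int_stable_def
 proof (intro ballI)
  fix h h' assume h: "h \<in> H" "h' \<in> H"
  show "h Int h' \<in> H"
  proof (cases "h \<in> null_sets M \<or> h' \<in> null_sets M")
   case True
   then have "h Int h' \<in> null_sets M" using h H_events by (auto intro: null_set_Int1 null_set_Int2)
   then show ?thesis by (simp add: H_def)
  next
   case False
   then have "h \<in> H0" "h' \<in> H0" using h by (simp_all add: H_def)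
   with H0E[of h] H0E[of h'] obtain x y x' y' where *: "h = x Int y" "x \<in> SX" "y \<in> SN" "h' = x' Int y'" "x' \<in> SX" "y' \<in> SN"
    by auto
   interpret SX: sigma_algebra "space M" SX
    unfolding SX_def by (rule sigma_algebra_sigma_sets) (auto simp: GX_def)
   interpret SN: sigma_algebra "space M" SN
    unfolding SN_def by (rule sigma_algebra_sigma_sets) (auto simp: GN'_def)
   have "x Int x' \<in> SX" "y Int y' \<in> SN" using * by auto
   moreover have "h Int h' = (x Int x') Int (y Int y')" using * by auto
   ultimately show ?thesis using H0I by simp
  qed
 qed
 ultimately have ind2: "indep_set (sigma_sets (space M) H) (sigma_sets (space M) {E})"
  by (intro indep_set_sigma_sets) (auto simp: Int_stable_def)
 have "GX s Un GN s Un null_sets M \<subseteq> H"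
 proof -
  have "x \<in> H" if "x \<in> GX s" for x
  proof -
   have "x \<in> SX" "x = x Int space M" using that by (auto simp: SX_def GX_def intro!: sigma_sets.Basic)
   then show ?thesis using sm H0I by metis
  qed
  moreover have "x \<in> H" if "x \<in> GN s" for x
  proof -
   have "x \<in> SN" "x = space M Int x" using that GN_GN' by (auto simp: SN_def GN_def)
   then show ?thesis using sm H0I by metis
  qed
  ultimately show ?thesis by (auto simp: H_def)
 qed
 then have "A \<in> sigma_sets (space M) H" using A sigma_sets_mono' unfolding sets_F by blast
 then have "prob (A Int E) = prob A * prob E" by (intro indep_setD[OF ind2]) auto
 then show ?thesis unfolding PE by (simp add: E_def PXk_def PNk_def)
qed

text \<open>The \<open>K\<close> increments of \<open>X\<close> come first and the \<open>K\<close>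
  increments of \<open>N\<close> after them, so that whatever the walk does on the cells after
  \<open>s\<close> is a function of one vector.\<close>

definition "incs p K s w = (\<lambda>j\<in>{..<K + K}. if j < K then DX (s + p j) (s + p (Suc j)) w
  else DN (s + p (j - K)) (s + p (Suc (j - K))) w)"

abbreviation "vspace K \<equiv> (\<Pi>\<^sub>M j\<in>{..<K + K}. borel :: real measure)"

lemma incs_measurable: "0 <= s ==> mono p ==> p 0 = 0 ==> incs p K s \<in> M \<rightarrow>\<^sub>M vspace K"
proof -
 assume *: "0 <= s" "mono p" "p 0 = 0"
 have p_nonneg: "0 <= p i" for i using monoD[OF *(2), of 0 i] * by simp
 show ?thesis unfolding incs_def[abs_def]
  using * p_nonneg by (intro measurable_restrict) auto
qed

lemma incs_box:
 assumes A: "!!j. j < K + K ==> A j \<in> sets borel"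
 shows "incs p K s -` (Pi\<^sub>E {..<K+K} A) Int space M = EvX s p K A Int EvN s p K (%k. A (K + k))"
proof -
 have eqv: "(\<forall>j<K+K. (if j < K then DX (s + p j) (s + p (Suc j)) w else DN (s + p (j - K)) (s + p (Suc (j - K))) w) \<in> A j) \<longleftrightarrow>
  (\<forall>k<K. DX (s + p k) (s + p (Suc k)) w \<in> A k) & (\<forall>k<K. DN (s + p k) (s + p (Suc k)) w \<in> A (K + k))" for w
 proof safe
  fix k assume *: "\<forall>j<K+K. (if j < K then DX (s + p j) (s + p (Suc j)) w else DN (s + p (j - K)) (s + p (Suc (j - K))) w) \<in> A j" "k < K"
  show "DX (s + p k) (s + p (Suc k)) w \<in> A k" using *(1)[rule_format, of k] *(2) by simp
  show "DN (s + p k) (s + p (Suc k)) w \<in> A (K + k)" using *(1)[rule_format, of "K + k"] *(2) by simp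
 next
  fix j assume *: "\<forall>k<K. DX (s + p k) (s + p (Suc k)) w \<in> A k" "\<forall>k<K. DN (s + p k) (s + p (Suc k)) w \<in> A (K + k)" "j < K + K"
  show "(if j < K then DX (s + p j) (s + p (Suc j)) w else DN (s + p (j - K)) (s + p (Suc (j - K))) w) \<in> A j"
   using *(1)[rule_format, of j] *(2)[rule_format, of "j - K"] *(3) by auto
 qed
 have mem: "incs p K s w \<in> Pi\<^sub>E {..<K+K} A \<longleftrightarrow>
   (\<forall>j<K+K. (if j < K then DX (s + p j) (s + p (Suc j)) w else DN (s + p (j - K)) (s + p (Suc (j - K))) w) \<in> A j)" for w
  unfolding incs_def PiE_iff by (simp add: Ball_def)
 show ?thesis
  by (rule set_eqI) (simp only: vimage_eq Int_iff mem_Collect_eq mem eqv EvX_def EvN_def conj_ac conj_absorb conj_left_absorb)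
qed

text \<open>The Markov property in discrete form: whatever is known at time \<open>s\<close> is
  independent of the next increments, and these have the law of the first ones. Both laws are
  compared on boxes.\<close>

lemma incs_shift:
 assumes s: "0 <= s" and p: "mono p" "p 0 = 0" and V: "V \<in> F s \<rightarrow>\<^sub>M S"
 shows "distr M (S \<Otimes>\<^sub>M vspace K) (%w. (V w, incs p K s w)) = distr M S V \<Otimes>\<^sub>M distr M (vspace K) (incs p K 0)"
proof -
 note vm = incs_measurable[OF s p, of K] incs_measurable[OF order_refl p, of K]
 have VM: "V \<in> M \<rightarrow>\<^sub>M S" by (rule F_measurable_M[OF V])
 have key: "emeasure M (A Int (incs p K s -` B Int space M)) = emeasure M A * emeasure (distr M (vspace K) (incs p K 0)) B"
  if A: "A \<in> sets (F s)" and B: "B \<in> sets (vspace K)" for A B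
 proof -
  have AM: "A \<in> events" using A F_events by blast
  \<comment> \<open>The unnormalised conditional law of the increments given \<open>A\<close>, to be
    matched with a multiple of their law at time 0.\<close>
  define m1 where "m1 = distr (density M (indicator A)) (vspace K) (incs p K s)"
  define m2 where "m2 = scale_measure (emeasure M A) (distr M (vspace K) (incs p K 0))"
  have em1: "emeasure m1 B = emeasure M (A Int (incs p K s -` B Int space M))" if "B \<in> sets (vspace K)" for B
  proof -
   have "incs p K s -` B Int space M \<in> events" using vm(1) that by auto
   then show ?thesis unfolding m1_def using vm(1) AM that
    by (simp add: emeasure_distr emeasure_restricted)
  qed
  have box: "emeasure m1 (Pi\<^sub>E {..<K+K} C) = emeasure m2 (Pi\<^sub>E {..<K+K} C)"
   if C: "!!i. i \<in> {..<K+K} ==> C i \<in> sets borel" for C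
  proof -
   have b: "Pi\<^sub>E {..<K+K} C \<in> sets (vspace K)" using C by (intro sets_PiM_I_finite) auto
   have Fsp: "space M \<in> sets (F 0)" using sets.top[of "F 0"] by (simp add: space_F)
   \<comment> \<open>Both sides are evaluated by the same formula, once at time \<open>s\<close>
     with \<open>A\<close> and once at time 0 with the whole space.\<close>
   have 1: "prob (A Int (EvX s p K C Int EvN s p K (%k. C (K + k)))) = prob A * prob (space M Int (EvX 0 p K C Int EvN 0 p K (%k. C (K + k))))"
    by (subst (1 2) filtration_indep[OF _ p]) (use s A Fsp C in \<open>auto simp: prob_space\<close>)
   have "EvX 0 p K C Int EvN 0 p K (%k. C (K + k)) \<subseteq> space M" by (auto simp: EvX_def)
   then have 2: "prob (A Int (EvX s p K C Int EvN s p K (%k. C (K + k)))) = prob A * prob (EvX 0 p K C Int EvN 0 p K (%k. C (K + k)))"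
    using 1 by (simp add: Int_absorb1)
   have "emeasure m1 (Pi\<^sub>E {..<K+K} C) = emeasure M (A Int (EvX s p K C Int EvN s p K (%k. C (K + k))))"
    unfolding em1[OF b] using C by (subst incs_box) auto
   also have "... = ennreal (prob A) * ennreal (prob (EvX 0 p K C Int EvN 0 p K (%k. C (K + k))))"
    by (simp add: emeasure_eq_measure 2 ennreal_mult)
   also have "... = emeasure m2 (Pi\<^sub>E {..<K+K} C)"
    unfolding m2_def using C b vm(2)
    by (simp add: emeasure_distr emeasure_eq_measure incs_box)
   finally show ?thesis .
  qed
  have "m1 = m2"
  proof (rule measure_eqI_PiM_finite[of "{..<K+K}" _ "%_. borel" _ "%_. space (vspace K)"])
   show "range (%_::nat. space (vspace K)) \<subseteq> prod_algebra {..<K + K} (%_. borel :: real measure)"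
    by (auto simp: space_PiM intro!: prod_algebraI_finite)
   show "emeasure m1 (space (vspace K)) ~= \<infinity>"
    by (subst em1) (auto simp: emeasure_eq_measure)
  qed (use box in \<open>auto simp: m1_def m2_def\<close>)
  then have "emeasure m1 B = emeasure m2 B" by simp
  then show ?thesis using em1[OF B] by (simp add: m2_def)
 qed
 interpret V: prob_space "distr M S V" by (rule prob_space_distr[OF VM])
 interpret W: prob_space "distr M (vspace K) (incs p K 0)" by (rule prob_space_distr[OF vm(2)])
 show ?thesis
 proof (rule pair_measure_eqI[symmetric])
  fix A B assume A: "A \<in> sets (distr M S V)" and B: "B \<in> sets (distr M (vspace K) (incs p K 0))"
  have "V -` A Int space M \<in> sets (F s)" using measurable_sets[OF V, of A] A by (simp add: space_F)
  from key[OF this, of B] B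
  have "emeasure (distr M S V) A * emeasure (distr M (vspace K) (incs p K 0)) B = emeasure M ((V -` A Int space M) Int (incs p K s -` B Int space M))"
   using A VM by (simp add: emeasure_distr)
  also have "(V -` A Int space M) Int (incs p K s -` B Int space M) = (%w. (V w, incs p K s w)) -` (A \<times> B) Int space M" by auto
  finally show "emeasure (distr M S V) A * emeasure (distr M (vspace K) (incs p K 0)) B =
   emeasure (distr M (S \<Otimes>\<^sub>M vspace K) (%w. (V w, incs p K s w))) (A \<times> B)"
   using A B VM vm(1) by (simp add: emeasure_distr)
 qed (auto intro: V.sigma_finite_measure_axioms W.sigma_finite_measure_axioms)
qed

lemma expectation_shift:
 fixes G :: "'s => (nat => real) => real"
 assumes s: "0 <= s" and p: "mono p" "p 0 = 0" and V: "V \<in> F s \<rightarrow>\<^sub>M S"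
  and G: "case_prod G \<in> borel_measurable (S \<Otimes>\<^sub>M vspace K)"
  and int: "integrable M (%w. G (V w) (incs p K s w))"
 shows "expectation (%w. G (V w) (incs p K s w)) = expectation (%w. expectation (%w'. G (V w) (incs p K 0 w')))"
proof -
 note vm [measurable] = incs_measurable[OF s p, of K] incs_measurable[OF order_refl p, of K]
 have VM [measurable]: "V \<in> M \<rightarrow>\<^sub>M S" by (rule F_measurable_M[OF V])
 interpret V: prob_space "distr M S V" by (rule prob_space_distr[OF VM])
 interpret W: prob_space "distr M (vspace K) (incs p K 0)" by (rule prob_space_distr[OF vm(2)])
 interpret VW: pair_sigma_finite "distr M S V" "distr M (vspace K) (incs p K 0)" ..
 note eq = incs_shift[OF s p V, of K]
 have pm: "(%w. (V w, incs p K s w)) \<in> M \<rightarrow>\<^sub>M S \<Otimes>\<^sub>M vspace K" by measurable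
 have int': "integrable (distr M S V \<Otimes>\<^sub>M distr M (vspace K) (incs p K 0)) (case_prod G)"
  unfolding eq[symmetric] using int by (subst integrable_distr_eq[OF pm G]) simp
 have "expectation (%w. G (V w) (incs p K s w)) = integral\<^sup>L (distr M (S \<Otimes>\<^sub>M vspace K) (%w. (V w, incs p K s w))) (case_prod G)"
  by (subst integral_distr[OF pm G]) simp
 also have "... = (\<integral>x. (\<integral>y. G x y \<partial>distr M (vspace K) (incs p K 0)) \<partial>distr M S V)"
  unfolding eq using VW.integral_fst'[OF int'] by simp
 also have "... = expectation (%w. (\<integral>y. G (V w) y \<partial>distr M (vspace K) (incs p K 0)))"
 proof (rule integral_distr[OF VM])
  have "case_prod G \<in> borel_measurable (distr M S V \<Otimes>\<^sub>M distr M (vspace K) (incs p K 0))" using G by simp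
  then show "(%x. \<integral>y. G x y \<partial>distr M (vspace K) (incs p K 0)) \<in> borel_measurable S"
   using W.borel_measurable_lebesgue_integral[of G "distr M S V"] by simp
 qed
 also have "... = expectation (%w. expectation (%w'. G (V w) (incs p K 0 w')))"
 proof (rule Bochner_Integration.integral_cong[OF refl])
  fix w assume "w \<in> space M"
  then have "V w \<in> space S" using VM by (auto simp: measurable_def)
  then have "G (V w) \<in> borel_measurable (vspace K)"
   using measurable_compose[OF measurable_Pair1' G, of "V w"] by simp
  then show "(\<integral>y. G (V w) y \<partial>distr M (vspace K) (incs p K 0)) = expectation (%w'. G (V w) (incs p K 0 w'))"
   by (intro integral_distr vm)
 qed
 finally show ?thesis .
qed

end

section \<open>Almost sure path properties\<close>

text \<open>Convergence of the probabilities to 0 suffices here, unlike in the Borel-Cantelli lemma.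
  A defect of the path shows on all sufficiently fine grids, so "eventually" is the mode in which it
  is excluded.\<close>

lemma (in prob_space) AE_not_eventually:
 assumes E: "!!n. E n \<in> events" and lim: "(%n. prob (E n)) \<longlonglongrightarrow> 0"
 shows "AE w in M. \<not> (\<forall>\<^sub>F n in sequentially. w \<in> E n)"
proof -
 have "AE w in M. w \<notin> (\<Inter>n\<in>{m..}. E n)" for m
 proof -
  have I: "(\<Inter>n\<in>{m..}. E n) \<in> events" using E by (intro sets.countable_INT') auto
  have "prob (\<Inter>n\<in>{m..}. E n) <= prob (E n)" if "m <= n" for n
   using that E by (intro finite_measure_mono) auto
  then have "prob (\<Inter>n\<in>{m..}. E n) <= 0"
   by (intro LIMSEQ_le_const[OF lim]) auto
  then have "prob (\<Inter>n\<in>{m..}. E n) = 0" using measure_nonneg[of M] by (simp add: antisym)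
  then show ?thesis using I by (intro AE_not_in) (simp add: null_sets_def emeasure_eq_measure)
 qed
 then have "AE w in M. ALL m. w \<notin> (\<Inter>n\<in>{m..}. E n)" by (simp add: AE_all_countable)
 then show ?thesis by eventually_elim (auto simp: eventually_sequentially)
qed

lemma cell_index:
 assumes "0 < (t::real)" shows "\<exists>k::nat. real k / real (Suc m) < t & t <= real (Suc k) / real (Suc m)"
proof -
 \<comment> \<open>Ceiling minus one: a grid point belongs to the cell that ends there, since jumps
   are seen from the left.\<close>
 define k where "k = nat (\<lceil>t * real (Suc m)\<rceil> - 1)"
 have pos: "0 < t * real (Suc m)" using assms by simp
 then have c: "1 <= \<lceil>t * real (Suc m)\<rceil>" by linarith
 have "real k = of_int \<lceil>t * real (Suc m)\<rceil> - 1" using c by (simp add: k_def)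
 then have "real k < t * real (Suc m)" "t * real (Suc m) <= real (Suc k)" by linarith+
 then show ?thesis by (intro exI[of _ k]) (simp only: divide_less_eq le_divide_eq, simp)
qed

context driving
begin

lemma N_unbounded: "AE w in M. ALL k. \<exists>t\<ge>0. k <= N t w"
proof -
 have "AE w in M. \<exists>t\<ge>0. k <= N t w" for k
 proof -
  define E where "E m = {w\<in>space M. N (real (Suc m)) w - N 0 w < k}" for m
  have "prob (E m) = (\<Sum>j<k. (r * real (Suc m)) ^ j / exp (r * real (Suc m)) / fact j)" for m
  proof -
   have "prob (E m) = measure (poisson_pmf (r * real (Suc m))) {j. j < k}"
    unfolding E_def using prob_N[of 0 "real (Suc m)" "%j. j < k"] by simp
   also have "{j. j < k} = {..<k}" by auto
   also have "measure (poisson_pmf (r * real (Suc m))) {..<k} = (\<Sum>j<k. pmf (poisson_pmf (r * real (Suc m))) j)"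
    by (rule measure_measure_pmf_finite) simp
   also have "... = (\<Sum>j<k. (r * real (Suc m)) ^ j / exp (r * real (Suc m)) / fact j)"

   proof (intro sum.cong refl)
    have pos: "0 < r * real (Suc m)" using r_pos by simp
    show "pmf (poisson_pmf (r * real (Suc m))) j = (r * real (Suc m)) ^ j / exp (r * real (Suc m)) / fact j" for j
     by (simp add: pmf_poisson[OF pos] exp_minus divide_inverse del: of_nat_Suc)
   qed
   finally show ?thesis .
  qed
  moreover have "(%m. \<Sum>j<k. (r * real (Suc m)) ^ j / exp (r * real (Suc m)) / fact j) \<longlonglongrightarrow> (\<Sum>j<k. 0 / fact j)"
  proof (intro tendsto_sum tendsto_divide tendsto_const)
   have "filterlim (%m. r * real (Suc m)) at_top sequentially"
    using r_pos by (intro filterlim_tendsto_pos_mult_at_top[OF tendsto_const] filterlim_compose[OF filterlim_real_sequentially filterlim_Suc]) auto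
   then show "(%m. (r * real (Suc m)) ^ j / exp (r * real (Suc m))) \<longlonglongrightarrow> 0" for j
    by (rule filterlim_compose[OF tendsto_power_div_exp_0])
  qed simp
  ultimately have lim: "(%m. prob (E m)) \<longlonglongrightarrow> 0" by simp
  have E: "E m \<in> events" for m unfolding E_def by measurable
  from AE_not_eventually[OF E lim] AE_space show ?thesis
  proof eventually_elim
   case (elim w)
   show ?case
   proof (rule ccontr)
    assume "\<not> ?thesis"
    then have "N (real (Suc m)) w < k" for m by (metis not_le of_nat_0_le_iff)
    then have "w \<in> E m" for m using elim(2) less_imp_diff_less unfolding E_def by blast
    then show False using elim(1) by simp
   qed
  qed
 qed
 then show ?thesis by (simp add: AE_all_countable)
qed

lemma poisson_ge_2:
 assumes "0 < l" shows "measure (poisson_pmf l) {k. 2 <= k} <= l\<^sup>2"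
proof -
 have "{k. 2 <= k} = UNIV - {..<2::nat}" by auto
 then have "measure (poisson_pmf l) {k. 2 <= k} = 1 - measure (poisson_pmf l) {..<2}"
  by (metis measure_pmf.prob_compl sets_measure_pmf space_measure_pmf UNIV_I)
 also have "measure (poisson_pmf l) {..<2} = (\<Sum>j<2. pmf (poisson_pmf l) j)"
  by (rule measure_measure_pmf_finite) simp
 also have "... = exp (- l) * (1 + l)" using assms by (simp add: numeral_2_eq_2 pmf_poisson[OF assms] algebra_simps)
 also have "1 - exp (- l) * (1 + l) <= 1 - (1 - l) * (1 + l)"
  using exp_ge_add_one_self[of "- l"] assms by (intro diff_left_mono mult_right_mono) auto
 also have "... = l\<^sup>2" by (simp add: power2_eq_square algebra_simps)
 finally show ?thesis .
qed

text \<open>A double jump before \<open>T\<close> shows on every grid as two arrivals in one cell.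
  There are \<open>T * Suc m\<close> cells and each has probability of order 1/m^2, so the total is
  of order 1/m.\<close>

lemma N_unit_jumps: "AE w in M. \<forall>t>0. EX s. 0 <= s & s < t & N t w <= N s w + 1"
proof -
 have "AE w in M. ALL t. 0 < t --> t <= real T --> (EX s. 0 <= s & s < t & N t w <= N s w + 1)" for T :: nat
 proof -
  define Ek where "Ek m k = {w\<in>space M. 2 <= N (real (Suc k) / real (Suc m)) w - N (real k / real (Suc m)) w}" for m k
  define E where "E m = (\<Union>k<T * Suc m. Ek m k)" for m
  have Ek: "Ek m k \<in> events" for m k unfolding Ek_def by measurable
  then have E: "E m \<in> events" for m unfolding E_def by blast
  have pk: "prob (Ek m k) <= (r / real (Suc m))\<^sup>2" for m k
  proof -
   have "prob (Ek m k) = measure (poisson_pmf (r * (real (Suc k) / real (Suc m) - real k / real (Suc m)))) {k. 2 <= k}"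
    unfolding Ek_def by (rule prob_N) (simp_all add: divide_strict_right_mono)
   also have "... <= (r * (real (Suc k) / real (Suc m) - real k / real (Suc m)))\<^sup>2"
    using r_pos by (intro poisson_ge_2 mult_pos_pos) (simp_all add: divide_strict_right_mono)
   also have "real (Suc k) / real (Suc m) - real k / real (Suc m) = 1 / real (Suc m)"
    by (simp add: diff_divide_distrib[symmetric])
   finally show ?thesis by simp
  qed
  have "prob (E m) <= real T * r\<^sup>2 / real (Suc m)" for m
  proof -
   have "prob (E m) <= (\<Sum>k<T * Suc m. prob (Ek m k))"
    unfolding E_def using Ek by (intro finite_measure_subadditive_finite) auto
   also have "... <= (\<Sum>k<T * Suc m. (r / real (Suc m))\<^sup>2)" by (intro sum_mono pk)
   also have "... = real T * r\<^sup>2 / real (Suc m)" by (simp add: power2_eq_square divide_simps del: of_nat_Suc mult_Suc_right)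
   finally show ?thesis .
  qed
  then have lim: "(%m. prob (E m)) \<longlonglongrightarrow> 0"
   by (intro tendsto_sandwich[OF _ _ tendsto_const[of 0] LIMSEQ_Suc[OF lim_const_over_n, of "real T * r\<^sup>2"]]) auto
  from AE_not_eventually[OF E lim] N_mono AE_space show ?thesis
  proof eventually_elim
   case (elim w)
   show ?case
   proof (rule ccontr)
    assume "\<not> ?thesis"
    then obtain t where t: "0 < t" "t <= real T" "!!s. 0 <= s ==> s < t ==> N s w + 2 <= N t w" by force
    have "w \<in> E m" for m
    proof -
     obtain k :: nat where k: "real k / real (Suc m) < t" "t <= real (Suc k) / real (Suc m)"
      using cell_index[OF t(1)] by blast
     have "real k < real T * real (Suc m)"
      using k(1) t(2) by (metis divide_less_eq less_le_trans mult_right_mono of_nat_0_le_iff of_nat_0_less_iff zero_less_Suc)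
     then have kT: "k < T * Suc m" by (metis of_nat_less_iff of_nat_mult)
     have "N t w <= N (real (Suc k) / real (Suc m)) w"
      using elim(2) t(1) k(2) by (auto simp: mono_on_def)
     moreover have "N (real k / real (Suc m)) w + 2 <= N t w" using t(3)[of "real k / real (Suc m)"] k(1) by simp
     ultimately have "w \<in> Ek m k" using elim(3) by (simp add: Ek_def)
     then show ?thesis using kT by (auto simp: E_def)
    qed
    then show False using elim(1) by simp
   qed
  qed
 qed
 then have "AE w in M. \<forall>T::nat. ALL t. 0 < t --> t <= real T --> (EX s. 0 <= s & s < t & N t w <= N s w + 1)"
  by (simp add: AE_all_countable)
 then show ?thesis by eventually_elim (metis real_arch_simple)
qed

lemma filtration_indep_single:
 assumes "0 <= s" "0 <= h" "A \<in> sets (F s)" "C \<in> sets borel" "C' \<in> sets borel"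
 shows "prob (A Int {w\<in>space M. DX s (s + h) w \<in> C} Int {w\<in>space M. DN s (s + h) w \<in> C'}) =
  prob A * prob {w\<in>space M. DX 0 h w \<in> C} * prob {w\<in>space M. DN 0 h w \<in> C'}"
proof -
 have p: "mono (%i::nat. if i = 0 then 0 else h)" using assms by (auto intro!: monoI)
 from filtration_indep[OF assms(1) p, of 1 "%_. C" "%_. C'" A] assms
 show ?thesis by (simp add: EvX_def EvN_def Int_assoc)
qed

lemma space_in_F: "space M \<in> sets (F s)"
 using sets.top[of "F s"] by (simp add: space_F)

lemma X_stoch_cont:
 assumes e: "0 < e" shows "(%m. prob {w\<in>space M. e < \<bar>DX 0 (1 / real (Suc m)) w\<bar>}) \<longlonglongrightarrow> 0"
proof -
 define A where "A m = {w\<in>space M. e < \<bar>DX 0 (1 / real (Suc m)) w\<bar>}" for m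
 have A: "A m \<in> events" for m unfolding A_def by measurable
 have "(%m. \<integral>w. indicat_real (A m) w \<partial>M) \<longlonglongrightarrow> (\<integral>w. 0 \<partial>M)"
 proof (rule integral_dominated_convergence[where w="%_. 1"])
  show "AE w in M. (%m. indicat_real (A m) w) \<longlonglongrightarrow> 0"
   using X_cadlag
  proof eventually_elim
   case (elim w)
   obtain d where d: "d > 0" "\<forall>s\<in>{0..<0+d}. \<bar>X s w - X 0 w\<bar> < e"
    using cadlag_right_ball[OF elim order_refl e] by blast
   have "(%m. 1 / real (Suc m)) \<longlonglongrightarrow> 0" by (rule LIMSEQ_Suc[OF lim_const_over_n])
   then have "\<forall>\<^sub>F m in sequentially. 1 / real (Suc m) < d" using d(1) by (rule order_tendstoD)
   then have "\<forall>\<^sub>F m in sequentially. indicat_real (A m) w = 0"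
   proof eventually_elim
    case (elim m)
    then have "\<bar>X (1 / real (Suc m)) w - X 0 w\<bar> < e" using d(2) by simp
    then show ?case by (simp add: A_def DX_def)
   qed
   then show ?case by (rule tendsto_eventually)
  qed
 qed (use A in auto)
 then show ?thesis using A by (simp add: A_def)
qed

text \<open>By independence, a cell of length 1/(m + 1) holds both an arrival and a large increment
  of \<open>X\<close> with probability at most \<open>q m * (r / Suc m)\<close>. Summed over the
  cells up to \<open>T\<close> this is \<open>T * r * q m\<close>, which tends to 0 because
  \<open>X\<close> is stochastically continuous at 0.\<close>

lemma no_common_jumps:
 "AE w in M. \<forall>t>0. (ALL s. 0 <= s --> s < t --> N s w < N t w) --> X t w = Lim (at_left t) (%s. X s w)"
proof -
 have "AE w in M. ALL t. 0 < t --> t <= real T --> (ALL s. 0 <= s --> s < t --> N s w < N t w) -->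
   \<bar>X t w - Lim (at_left t) (%s. X s w)\<bar> <= 1 / real (Suc e)" for T e :: nat
 proof -
  \<comment> \<open>Half the jump size to be excluded: a jump beyond \<open>2 * \<epsilon>\<close>
    is seen as an increment beyond \<open>\<epsilon>\<close> on fine grids.\<close>
  define \<epsilon> where "\<epsilon> = 1 / (2 * real (Suc e))"
  have eps: "0 < \<epsilon>" "1 / real (Suc e) = 2 * \<epsilon>" by (simp_all add: \<epsilon>_def del: of_nat_Suc)
  define Ek where "Ek m k = {w\<in>space M. DX (real k / real (Suc m)) (real k / real (Suc m) + 1 / real (Suc m)) w \<in> {x. \<epsilon> < \<bar>x\<bar>}} Int
    {w\<in>space M. DN (real k / real (Suc m)) (real k / real (Suc m) + 1 / real (Suc m)) w \<in> {0<..}}" for m k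
  define E where "E m = (\<Union>k<T * Suc m. Ek m k)" for m
  have bm [simp]: "{x::real. \<epsilon> < \<bar>x\<bar>} \<in> sets borel" by measurable
  have Ek: "Ek m k \<in> events" for m k unfolding Ek_def by measurable
  then have E: "E m \<in> events" for m unfolding E_def by blast
  define q where "q m = prob {w\<in>space M. \<epsilon> < \<bar>DX 0 (1 / real (Suc m)) w\<bar>}" for m
  have pk: "prob (Ek m k) <= q m * (r / real (Suc m))" for m k
  proof -
   have "prob (Ek m k) = q m * prob {w\<in>space M. DN 0 (1 / real (Suc m)) w \<in> {0<..}}"
    using filtration_indep_single[of "real k / real (Suc m)" "1 / real (Suc m)" "space M" "{x. \<epsilon> < \<bar>x\<bar>}" "{0<..}"]
     sets.sets_into_space[OF Ek[of m k]]
    by (simp add: space_in_F Ek_def q_def prob_space Int_assoc Int_absorb1)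
   also have "prob {w\<in>space M. DN 0 (1 / real (Suc m)) w \<in> {0<..}} = measure (poisson_pmf (r * (1 / real (Suc m)))) {k. 0 < k}"
    using prob_N[of 0 "1 / real (Suc m)" "%k. 0 < k"] by (simp add: DN_def)
   also have "{k::nat. 0 < k} = UNIV - {0}" by auto
   also have "measure (poisson_pmf (r * (1 / real (Suc m)))) (UNIV - {0}) = 1 - pmf (poisson_pmf (r * (1 / real (Suc m)))) 0"
    using measure_pmf.prob_compl[of "{0}" "poisson_pmf (r * (1 / real (Suc m)))"] by (simp add: measure_pmf_single)
   also have "... = 1 - exp (- (r / real (Suc m)))" using r_pos by simp
   also have "... <= r / real (Suc m)" using exp_ge_add_one_self[of "- (r / real (Suc m))"] by linarith
   finally show ?thesis by (simp add: mult_left_mono q_def)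
  qed
  have le: "prob (E m) <= real T * r * q m" for m
  proof -
   have "prob (E m) <= (\<Sum>k<T * Suc m. prob (Ek m k))"
    unfolding E_def using Ek by (intro finite_measure_subadditive_finite) auto
   also have "... <= (\<Sum>k<T * Suc m. q m * (r / real (Suc m)))" by (intro sum_mono pk)
   also have "... = real T * r * q m" by (simp add: divide_simps del: of_nat_Suc mult_Suc_right)
   finally show ?thesis .
  qed
  have lim0: "(%m. real T * r * q m) \<longlonglongrightarrow> 0"
   using tendsto_mult_right_zero[OF X_stoch_cont[OF eps(1)], of "real T * r"] by (simp add: q_def)
  have lim: "(%m. prob (E m)) \<longlonglongrightarrow> 0"
   by (rule tendsto_sandwich[OF _ _ tendsto_const lim0]) (simp_all add: le)
  from AE_not_eventually[OF E lim] N_mono X_cadlag AE_space show ?thesis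
  proof eventually_elim
   case (elim w)
   show ?case
   proof (rule ccontr)
    assume "\<not> ?thesis"
    then obtain t where t: "0 < t" "t <= real T" "!!s. 0 <= s ==> s < t ==> N s w < N t w"
     "2 * \<epsilon> < \<bar>X t w - Lim (at_left t) (%s. X s w)\<bar>"
     unfolding eps(2) by (auto simp: not_le)
    define l where "l = Lim (at_left t) (%s. X s w)"
    \<comment> \<open>Allows an error \<open>g\<close> at either end of the cell and still leaves an
      increment larger than \<open>\<epsilon>\<close>.\<close>
    define g where "g = (\<bar>X t w - l\<bar> - \<epsilon>) / 2"
    have g: "0 < g" using t(4) eps(1) by (simp add: g_def l_def)
    have "2 * g = \<bar>X t w - l\<bar> - \<epsilon>" by (simp add: g_def)
    obtain d1 where d1: "d1 > 0" "\<forall>s\<in>{t..<t+d1}. \<bar>X s w - X t w\<bar> < g"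
     using cadlag_right_ball[OF elim(3) _ g, of t] t(1) by auto
    obtain d2 where d2: "d2 > 0" "\<forall>s\<in>{t-d2<..<t}. \<bar>X s w - l\<bar> < g"
     using at_left_ball[OF cadlag_at_left[OF elim(3) t(1)] g] by (auto simp: l_def)
    have "(%m. 1 / real (Suc m)) \<longlonglongrightarrow> 0" by (rule LIMSEQ_Suc[OF lim_const_over_n])
    moreover have "0 < min d1 d2" using d1 d2 by simp
    ultimately have "\<forall>\<^sub>F m in sequentially. 1 / real (Suc m) < min d1 d2" by (rule order_tendstoD)
    then have "\<forall>\<^sub>F m in sequentially. w \<in> E m"
    proof eventually_elim
     case (elim m)
     obtain k :: nat where k: "real k / real (Suc m) < t" "t <= real (Suc k) / real (Suc m)"
      using cell_index[OF t(1)] by blast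
     define u where "u = real k / real (Suc m)"
     have u: "0 <= u" "u < t" "t <= u + 1 / real (Suc m)" using k by (auto simp: u_def add_divide_distrib[symmetric] add.commute)
     have "real k < real T * real (Suc m)"
      using k(1) t(2) by (metis divide_less_eq less_le_trans mult_right_mono of_nat_0_le_iff of_nat_0_less_iff zero_less_Suc)
     then have kT: "k < T * Suc m" by (metis of_nat_less_iff of_nat_mult)
     have "\<bar>X (u + 1 / real (Suc m)) w - X t w\<bar> < g" "\<bar>X u w - l\<bar> < g" using d1(2) d2(2) u elim by auto
     then have "\<epsilon> < \<bar>DX u (u + 1 / real (Suc m)) w\<bar>"
      unfolding DX_def using \<open>2 * g = \<bar>X t w - l\<bar> - \<epsilon>\<close> by arith
     moreover have "N u w < N (u + 1 / real (Suc m)) w"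
     proof -
      have "N u w < N t w" by (rule t(3)[OF u(1,2)])
      also have "N t w <= N (u + 1 / real (Suc m)) w" using \<open>mono_on {0..} (%t. N t w) & _\<close> t(1) u(3) by (auto simp: mono_on_def)
      finally show ?thesis .
     qed
     ultimately have "w \<in> Ek m k" using \<open>w \<in> space M\<close> by (simp add: Ek_def DN_def u_def)
     then show ?case using kT by (auto simp: E_def)
    qed
    then show False using elim(1) by simp
   qed
  qed
 qed
 then have "AE w in M. \<forall>T e::nat. ALL t. 0 < t --> t <= real T --> (ALL s. 0 <= s --> s < t --> N s w < N t w) -->
   \<bar>X t w - Lim (at_left t) (%s. X s w)\<bar> <= 1 / real (Suc e)"
  by (simp add: AE_all_countable)
 then show ?thesis
 proof eventually_elim
  case (elim w)
  show ?case
  proof (intro allI impI)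
   fix t assume t: "0 < t" "ALL s. 0 <= s --> s < t --> N s w < N t w"
   obtain T :: nat where "t <= real T" using real_arch_simple by blast
   then have "\<bar>X t w - Lim (at_left t) (%s. X s w)\<bar> <= 1 / real (Suc e)" for e using elim t by blast
   then have "\<bar>X t w - Lim (at_left t) (%s. X s w)\<bar> <= 0"
    by (intro LIMSEQ_le_const[OF LIMSEQ_Suc[OF lim_const_over_n[of 1]]]) auto
   then show "X t w = Lim (at_left t) (%s. X s w)" by simp
  qed
 qed
qed

text \<open>Collects the almost sure path properties, so that the deterministic results on barrier
  paths apply to one fixed set of outcomes for all starting points.\<close>

definition good :: "'w => bool" where
 "good w \<longleftrightarrow> X 0 w = 0 & cadlag (%t. X t w) & (\<forall>t>0. X t w <= Lim (at_left t) (%s. X s w)) &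
   counting_path (%t. N t w) &
   (\<forall>t>0. (ALL s. 0 <= s --> s < t --> N s w < N t w) --> X t w = Lim (at_left t) (%s. X s w))"

lemma AE_good: "AE w in M. good w"
 using X_0 X_cadlag no_up[unfolded no_upward_jumps_def] N_0 N_mono N_unit_jumps N_unbounded no_common_jumps
 by eventually_elim (auto simp: good_def counting_path_def mono_on_def)

definition "Good = {w\<in>space M. good w}"

lemma Good_events [measurable]: "Good \<in> events"
proof -
 obtain Z where Z: "{w\<in>space M. \<not> good w} \<subseteq> Z" "Z \<in> null_sets M"
  using AE_good by (auto elim!: AE_E simp: null_sets_def)
 have "space M - {w\<in>space M. \<not> good w} \<in> events" using complete[OF Z] by blast
 also have "space M - {w\<in>space M. \<not> good w} = Good" by (auto simp: Good_def)
 finally show ?thesis .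
qed

lemma AE_Good: "AE w in M. w \<in> Good"
 using AE_good AE_space by eventually_elim (simp add: Good_def)

end

section \<open>The controlled process as a Markov process\<close>

text \<open>The process is the limit of step processes that take the value at the next grid point to
  the right.\<close>

lemma borel_measurable_right_continuous:
 fixes Z :: "real => 'w => real"
 assumes G: "G \<in> sets M" and Z: "!!t. 0 <= t ==> Z t \<in> borel_measurable M"
  and right: "!!w t. w \<in> G ==> 0 <= t ==> ((%t. Z t w) \<longlongrightarrow> Z t w) (at_right t)"
 shows "(%(t, w). if w \<in> G & 0 <= t then Z t w else 0) \<in> borel_measurable (borel \<Otimes>\<^sub>M M)"
proof (rule borel_measurable_LIMSEQ_real)
 \<comment> \<open>The added 1 puts the grid point strictly to the right of \<open>t\<close>, as
   convergence within \<open>at_right\<close> demands.\<close>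
 define D where "D m t = (of_int \<lfloor>t * real (Suc m)\<rfloor> + 1) / real (Suc m)" for m t
 define f where "f m = (%(t, w). if w \<in> G & 0 <= t then Z (D m t) w else 0)" for m
 have D: "t < D m t" "D m t <= t + 1 / real (Suc m)" for t m
 proof -
  have "t * real (Suc m) < of_int \<lfloor>t * real (Suc m)\<rfloor> + 1" "of_int \<lfloor>t * real (Suc m)\<rfloor> <= t * real (Suc m)" by linarith+
  then show "t < D m t" "D m t <= t + 1 / real (Suc m)"
   by (simp add: D_def less_divide_eq del: of_nat_Suc, simp add: D_def add_divide_distrib divide_le_eq del: of_nat_Suc)
 qed
 show "f m \<in> borel_measurable (borel \<Otimes>\<^sub>M M)" for m
 proof -
  have "(%x. if snd x \<in> G & 0 <= i then Z ((of_int i + 1) / real (Suc m)) (snd x) else 0) \<in> borel_measurable (borel \<Otimes>\<^sub>M M)" for i :: int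
  proof (cases "0 <= i")
   case True
   then have [measurable]: "Z ((of_int i + 1) / real (Suc m)) \<in> borel_measurable M" by (intro Z) auto
   have [measurable]: "Measurable.pred M (%w. w \<in> G)" using G by simp
   show ?thesis by measurable
  qed simp
  then have "(%x. if snd x \<in> G & 0 <= \<lfloor>fst x * real (Suc m)\<rfloor> then Z ((of_int \<lfloor>fst x * real (Suc m)\<rfloor> + 1) / real (Suc m)) (snd x) else 0)
    \<in> borel_measurable (borel \<Otimes>\<^sub>M M)"
   by (rule measurable_compose_countable[where g="%x. \<lfloor>fst x * real (Suc m)\<rfloor>"]) measurable
  also have "(%x. if snd x \<in> G & 0 <= \<lfloor>fst x * real (Suc m)\<rfloor> then Z ((of_int \<lfloor>fst x * real (Suc m)\<rfloor> + 1) / real (Suc m)) (snd x) else 0) = f m"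
  proof
   fix x :: "real \<times> 'w"
   have "0 <= \<lfloor>fst x * real (Suc m)\<rfloor> \<longleftrightarrow> 0 <= fst x" by (simp add: zero_le_floor zero_le_mult_iff del: of_nat_Suc)
   then show "(if snd x \<in> G & 0 <= \<lfloor>fst x * real (Suc m)\<rfloor> then Z ((of_int \<lfloor>fst x * real (Suc m)\<rfloor> + 1) / real (Suc m)) (snd x) else 0) = f m x"
    by (simp only: f_def D_def split_beta)
  qed
  finally show ?thesis .
 qed
 fix x :: "real \<times> 'w" assume "x \<in> space (borel \<Otimes>\<^sub>M M)"
 obtain t w where x: "x = (t, w)" by (cases x)
 show "(%m. f m x) \<longlonglongrightarrow> (case x of (t, w) => if w \<in> G & 0 <= t then Z t w else 0)"
 proof (cases "w \<in> G & 0 <= t")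
  case True
  have up: "(%m. t + 1 / real (Suc m)) \<longlonglongrightarrow> t"
   using tendsto_add[OF tendsto_const LIMSEQ_Suc[OF lim_const_over_n[of 1]], of t] by simp
  have "(%m. D m t) \<longlonglongrightarrow> t"
   by (rule tendsto_sandwich[OF _ _ tendsto_const up]) (use D in \<open>auto intro!: always_eventually less_imp_le simp del: of_nat_Suc\<close>)
  then have "filterlim (%m. D m t) (at_right t) sequentially"
   unfolding filterlim_at using D by (auto intro!: always_eventually simp: less_imp_neq[THEN not_sym])
  from filterlim_compose[OF right this, of w] True show ?thesis by (simp add: x f_def)
 qed (auto simp: x f_def)
qed

definition chv :: "real => real => nat => real => (nat => real) => real" where
 "chv a b K y v = chain a b y v (%k. v (K + k)) K"

definition chpv :: "real => real => nat => real => (nat => real) => real" where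
 "chpv a b K y v = chain_push a b y v (%k. v (K + k)) K"

lemma chain_measurable:
 assumes f: "f \<in> borel_measurable S" and v: "!!k. k < K ==> d k \<in> borel_measurable S" "!!k. k < K ==> m k \<in> borel_measurable S"
 shows "k <= K ==> (%x. chain a b (f x) (%k. d k x) (%k. m k x) k) \<in> borel_measurable S"
proof (induction k)
 case 0
 then show ?case using f by simp
next
 case (Suc k)
 have [measurable]: "d k \<in> borel_measurable S" "m k \<in> borel_measurable S"
  "(%x. chain a b (f x) (%k. d k x) (%k. m k x) k) \<in> borel_measurable S" using Suc v by auto
 show ?case unfolding chain.simps by measurable
qed

lemma chain_push_measurable:
 assumes f: "f \<in> borel_measurable S" and v: "!!k. k < K ==> d k \<in> borel_measurable S" "!!k. k < K ==> m k \<in> borel_measurable S"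
 shows "k <= K ==> (%x. chain_push a b (f x) (%k. d k x) (%k. m k x) k) \<in> borel_measurable S"
proof (induction k)
 case (Suc k)
 have [measurable]: "d k \<in> borel_measurable S" "m k \<in> borel_measurable S"
  "(%x. chain a b (f x) (%k. d k x) (%k. m k x) k) \<in> borel_measurable S"
  "(%x. chain_push a b (f x) (%k. d k x) (%k. m k x) k) \<in> borel_measurable S"
  using Suc v chain_measurable[of f S K d m k a b] f by auto
 show ?case unfolding chain_push.simps by measurable
qed simp

lemma chv_Lipschitz: "\<bar>chv a b K y v - chv a b K z v\<bar> <= \<bar>y - z\<bar>"
 unfolding chv_def by (rule chain_Lipschitz)

definition "grid u m i = u * real i / real (Suc m)"

lemma grid: "0 <= u ==> mono (grid u m)" "grid u m 0 = 0" "grid u m (Suc m) = u" "0 < u ==> grid u m i < grid u m (Suc i)"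
 "grid u m (Suc i) - grid u m i = u / real (Suc m)"
proof -
 show "0 <= u ==> mono (grid u m)"
  by (rule monoI) (simp add: grid_def divide_right_mono mult_left_mono del: of_nat_Suc)
 show "0 < u ==> grid u m i < grid u m (Suc i)"
  unfolding grid_def by (intro divide_strict_right_mono mult_strict_left_mono) simp_all
 show "grid u m (Suc i) - grid u m i = u / real (Suc m)"
  by (simp add: grid_def diff_divide_distrib[symmetric] algebra_simps)
qed (simp_all add: grid_def)

lemma grid_mesh: "0 < e ==> \<forall>\<^sub>F m in sequentially. u / real (Suc m) < e"
 by (rule order_tendstoD(2)[OF LIMSEQ_Suc[OF lim_const_over_n]])

lemma (in prob_space) expectation_abs_le:
 fixes f :: "'a => real"
 assumes "!!w. \<bar>f w\<bar> <= B"
 shows "\<bar>expectation f\<bar> <= B"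
proof (cases "integrable M f")
 case True
 have "\<bar>expectation f\<bar> <= expectation (%w. \<bar>f w\<bar>)" by (rule integral_abs_bound)
 also have "... <= B" using True assms by (intro integral_le_const) auto
 finally show ?thesis .
next
 case False
 then show ?thesis using order.trans[OF abs_ge_zero assms] by (simp add: not_integrable_integral_eq)
qed

section \<open>The controlled process as a flow in its starting point\<close>

locale barrier = driving M X N r
 for M :: "'w measure" and X :: "real => 'w => real" and N :: "real => 'w => nat" and r :: real +
 fixes a b :: real
 assumes ab: "a < b"
begin

definition "Rb x t w = fst (barrier_strategy X N a b x) t w"
definition "Lb x t w = snd (barrier_strategy X N a b x) t w"
definition "Yb x t w = controlled X x (barrier_strategy X N a b x) t w"

lemma Yb_eq: "Yb x t w = x + X t w + Rb x t w - Lb x t w"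
 by (simp add: Yb_def Rb_def Lb_def controlled_def barrier_strategy_def)

lemma good_path: "good w ==> barrier_path (%t. N t w) a b (%t. x + X t w)"
 unfolding good_def barrier_path_def barrier_path_axioms_def
 using ab by (auto intro!: cadlag_add cadlag_const)

lemma good_arrival: "good w ==> arrival N w = counting_path.\<tau> (%t. N t w)"
 by (auto simp: arrival_def counting_path.\<tau>_def good_def)

lemma good_eqs:
 assumes "good w"
 shows "Rb x t w = barrier_path.R (%t. N t w) a b (%t. x + X t w) t"
  "Lb x t w = barrier_path.L (%t. N t w) a b (%t. x + X t w) t"
  "Yb x t w = barrier_path.Y (%t. N t w) a b (%t. x + X t w) t"
proof -
 interpret bp: barrier_path "%t. N t w" a b "%t. x + X t w" by (rule good_path[OF assms])
 show 1: "Rb x t w = bp.R t" "Lb x t w = bp.L t"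
  by (simp_all add: Rb_def Lb_def barrier_strategy_def bp.R_def bp.L_def good_arrival[OF assms])
 show "Yb x t w = bp.Y t" by (simp add: Yb_eq bp.Y_def 1)
qed

lemma Yb_ge: "good w ==> 0 <= t ==> a <= Yb x t w"
 using barrier_path.Y_ge[OF good_path] by (simp add: good_eqs)

lemma Yb_0: "good w ==> Yb x 0 w = max a x"
 using barrier_path.Y_0[OF good_path] by (simp add: good_eqs good_def)

lemma Yb_cadlag: "good w ==> cadlag (%t. Yb x t w)"
 using barrier_path.Y_cadlag[OF good_path] by (simp add: good_eqs)

lemma Rb_cadlag: "good w ==> cadlag (%t. Rb x t w)"
 using barrier_path.R_cadlag[OF good_path] by (simp add: good_eqs)

lemma Lb_cadlag: "good w ==> cadlag (%t. Lb x t w)"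
 using barrier_path.L_cadlag[OF good_path] by (simp add: good_eqs)

lemma Rb_mono: "good w ==> 0 <= s ==> s <= t ==> Rb x s w <= Rb x t w"
 using barrier_path.R_mono[OF good_path] by (simp add: good_eqs)

lemma Lb_mono: "good w ==> 0 <= s ==> s <= t ==> Lb x s w <= Lb x t w"
 using barrier_path.L_mono[OF good_path] by (simp add: good_eqs)

lemma Rb_nonneg: "good w ==> 0 <= t ==> 0 <= Rb x t w"
 using barrier_path.R_nonneg[OF good_path] by (simp add: good_eqs)

lemma Lb_nonneg: "good w ==> 0 <= t ==> 0 <= Lb x t w"
 using barrier_path.L_nonneg[OF good_path] by (simp add: good_eqs)

lemma sampled_incs:
 assumes g: "good w" and p: "mono p" "p 0 = 0" and s: "0 <= s"
 shows "chain a b y (%i. (x + X (s + p (Suc i)) w) - (x + X (s + p i) w))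
   (%i. real (N (s + p (Suc i)) w) - real (N (s + p i) w)) K = chv a b K y (incs p K s w)"
  and "chain_push a b y (%i. (x + X (s + p (Suc i)) w) - (x + X (s + p i) w))
   (%i. real (N (s + p (Suc i)) w) - real (N (s + p i) w)) K = chpv a b K y (incs p K s w)"
proof -
 have p_nonneg: "0 <= p i" for i using monoD[OF p(1), of 0 i] p(2) by simp
 have "N (s + p i) w <= N (s + p (Suc i)) w" for i
  using g s p_nonneg monoD[OF p(1), of i "Suc i"] by (auto simp: good_def counting_path_def)
 then have 1: "(0 < real (N (s + p (Suc i)) w) - real (N (s + p i) w)) = (0 < incs p K s w (K + i))" if "i < K" for i
  using that by (auto simp: incs_def DN_def)
 have 2: "(x + X (s + p (Suc i)) w) - (x + X (s + p i) w) = incs p K s w i" if "i < K" for i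
  using that by (simp add: incs_def DX_def)
 show "chain a b y (%i. (x + X (s + p (Suc i)) w) - (x + X (s + p i) w))
   (%i. real (N (s + p (Suc i)) w) - real (N (s + p i) w)) K = chv a b K y (incs p K s w)"
  unfolding chv_def by (rule chain_cong) (use 1 2 in auto)
 show "chain_push a b y (%i. (x + X (s + p (Suc i)) w) - (x + X (s + p i) w))
   (%i. real (N (s + p (Suc i)) w) - real (N (s + p i) w)) K = chpv a b K y (incs p K s w)"
  unfolding chpv_def by (rule chain_push_cong) (use 1 2 in auto)
qed

lemma grid_tendsto:
 assumes g: "good w" and t: "0 < t"
 shows "(%m. chv a b (Suc m) x (incs (grid t m) (Suc m) 0 w)) \<longlonglongrightarrow> Yb x t w"
  "(%m. chpv a b (Suc m) x (incs (grid t m) (Suc m) 0 w)) \<longlonglongrightarrow> Lb x t w"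
proof -
 interpret bp: barrier_path "%t. N t w" a b "%t. x + X t w" by (rule good_path[OF g])
 interpret bpp: barrier_partition "%t. N t w" a b "%t. x + X t w" "grid t" Suc t
 proof
  fix e :: real assume "0 < e"
  from grid_mesh[OF this, of t] show "\<forall>\<^sub>F m in sequentially. \<forall>i<Suc m. grid t m (Suc i) - grid t m i < e"
   by eventually_elim (simp add: grid(5))
 qed (use t in \<open>simp_all add: grid\<close>)
 have X0: "X 0 w = 0" using g by (simp add: good_def)
 have eq: "bp.sampled (grid t m) (Suc m) = chv a b (Suc m) x (incs (grid t m) (Suc m) 0 w)"
  "bp.sampled_push (grid t m) (Suc m) = chpv a b (Suc m) x (incs (grid t m) (Suc m) 0 w)" for m
  using sampled_incs[OF g grid(1,2)[of t m] order_refl, of x x "Suc m"] t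
  by (simp_all add: bp.sampled_def bp.sampled_push_def X0)
 show "(%m. chv a b (Suc m) x (incs (grid t m) (Suc m) 0 w)) \<longlonglongrightarrow> Yb x t w"
  using bpp.sampled_tendsto by (simp add: eq good_eqs[OF g])
 show "(%m. chpv a b (Suc m) x (incs (grid t m) (Suc m) 0 w)) \<longlonglongrightarrow> Lb x t w"
  using bpp.sampled_push_tendsto by (simp add: eq good_eqs[OF g])
qed

text \<open>A walk along the joined grid passes at time \<open>s\<close> through an approximation of
  \<open>Yb x s w\<close>. Replacing this by the exact value costs at most the distance of the two,
  by the Lipschitz bound, and the distance vanishes.\<close>

lemma flow_tendsto:
 assumes g: "good w" and s: "0 <= s" and u: "0 < u"
 shows "(%m. chv a b (Suc m) (Yb x s w) (incs (grid u m) (Suc m) s w)) \<longlonglongrightarrow> Yb x (s + u) w"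
proof (cases "s = 0")
 case True
 \<comment> \<open>Restarting at time 0 from \<open>max a x\<close> changes nothing, since the walk
   reflects its starting point at once.\<close>
 have "chv a b K (max a x) v = chv a b K x v" for K v
 proof -
  have "chain a b (max a x) d m k = chain a b x d m k" for d m k by (induction k) auto
  then show ?thesis by (simp add: chv_def)
 qed
 then show ?thesis using grid_tendsto(1)[OF g u, of x] True by (simp add: Yb_0[OF g])
next
 case False
 then have s: "0 < s" using s by simp
 interpret bp: barrier_path "%t. N t w" a b "%t. x + X t w" by (rule good_path[OF g])
 \<comment> \<open>A grid of [0, s] followed by one of [s, s + u]; the point \<open>s\<close> has
   index \<open>Suc m\<close> in both.\<close>
 define P where "P m i = (if i <= Suc m then grid s m i else s + grid u m (i - Suc m))" for m i
 have P2: "P m (Suc m + i) = s + grid u m i" for m i by (cases i) (auto simp: P_def grid)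
 interpret bpp: barrier_partition "%t. N t w" a b "%t. x + X t w" P "%m. Suc m + Suc m" "s + u"
 proof
  have inc: "P m (Suc i) - P m i = (if i < Suc m then s / real (Suc m) else u / real (Suc m))" for m i
  proof (cases "i < Suc m")
   case True
   then show ?thesis by (simp add: P_def grid(5))
  next
   case False
   then obtain j where j: "i = Suc m + j" by (metis le_iff_add not_less)
   have "P m (Suc i) - P m i = grid u m (Suc j) - grid u m j" using P2[of m j] P2[of m "Suc j"] by (simp add: j)
   then show ?thesis using False by (simp add: grid(5))
  qed
  show "P m i < P m (Suc i)" for m i using inc[of m i] s u by (smt (verit) divide_pos_pos of_nat_0_less_iff zero_less_Suc)
  fix e :: real assume "0 < e"
  from grid_mesh[OF this, of s] grid_mesh[OF this, of u]
  show "\<forall>\<^sub>F m in sequentially. \<forall>i<Suc m + Suc m. P m (Suc i) - P m i < e"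
   by eventually_elim (simp add: inc)
 qed (use s u P2[of _ "Suc _"] in \<open>auto simp: P_def grid\<close>)
 have X0: "X 0 w = 0" using g by (simp add: good_def)
 have eq: "bp.sampled (P m) (Suc m + Suc m) =
  chv a b (Suc m) (chv a b (Suc m) x (incs (grid s m) (Suc m) 0 w)) (incs (grid u m) (Suc m) s w)" for m
 proof -
  have "bp.sampled (P m) (Suc m) = bp.sampled (grid s m) (Suc m)"
   unfolding bp.sampled_def by (rule chain_cong) (auto simp: P_def)
  also have "... = chv a b (Suc m) x (incs (grid s m) (Suc m) 0 w)"
   using sampled_incs(1)[OF g grid(1,2)[of s m] order_refl, of x x "Suc m"] s by (simp add: bp.sampled_def X0)
  finally have 1: "bp.sampled (P m) (Suc m) = chv a b (Suc m) x (incs (grid s m) (Suc m) 0 w)" .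
  have "bp.sampled (P m) (Suc m + Suc m) = chain a b (bp.sampled (P m) (Suc m))
    (%i. (x + X (P m (Suc (Suc m + i))) w) - (x + X (P m (Suc m + i)) w))
    (%i. real (N (P m (Suc (Suc m + i))) w) - real (N (P m (Suc m + i)) w)) (Suc m)"
   unfolding bp.sampled_def by (rule chain_append)
  also have "... = chain a b (bp.sampled (P m) (Suc m))
    (%i. (x + X (s + grid u m (Suc i)) w) - (x + X (s + grid u m i) w))
    (%i. real (N (s + grid u m (Suc i)) w) - real (N (s + grid u m i) w)) (Suc m)"
   using P2[of m] P2[of m "Suc _"] by simp
  also have "... = chv a b (Suc m) (bp.sampled (P m) (Suc m)) (incs (grid u m) (Suc m) s w)"
   using u s by (intro sampled_incs(1)[OF g]) (auto simp: grid)
  finally show ?thesis by (simp only: 1)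
 qed
 have lim: "(%m. bp.sampled (P m) (Suc m + Suc m)) \<longlonglongrightarrow> Yb x (s + u) w"
  using bpp.sampled_tendsto by (simp add: good_eqs[OF g])
 have diff: "(%m. \<bar>Yb x s w - chv a b (Suc m) x (incs (grid s m) (Suc m) 0 w)\<bar>) \<longlonglongrightarrow> 0"
  using tendsto_rabs[OF tendsto_diff[OF tendsto_const grid_tendsto(1)[OF g s]], of "Yb x s w" x] by simp
 have "(%m. chv a b (Suc m) (Yb x s w) (incs (grid u m) (Suc m) s w) - bp.sampled (P m) (Suc m + Suc m)) \<longlonglongrightarrow> 0"
  by (rule Lim_null_comparison[OF _ diff]) (simp only: eq real_norm_def chv_Lipschitz always_eventually simp_thms)
 from Lim_transform[OF lim this] show ?thesis .
qed

lemma Yb_Lipschitz: "good w ==> 0 <= t ==> \<bar>Yb x t w - Yb y t w\<bar> <= \<bar>x - y\<bar>"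
proof (cases "t = 0")
 case False
 assume "good w" "0 <= t"
 with False have g: "good w" "0 < t" by auto
 show ?thesis
  by (rule tendsto_upperbound[OF tendsto_rabs[OF tendsto_diff[OF grid_tendsto(1)[OF g] grid_tendsto(1)[OF g]]]])
   (auto intro!: always_eventually chv_Lipschitz)
qed (auto simp: Yb_0)

lemma Yb_mono: "good w ==> 0 <= t ==> x <= y ==> Yb x t w <= Yb y t w"
proof (cases "t = 0")
 case False
 assume "good w" "0 <= t" and xy: "x <= y"
 with False have g: "good w" "0 < t" by auto
 show ?thesis
  by (rule LIMSEQ_le[OF grid_tendsto(1)[OF g] grid_tendsto(1)[OF g]])
   (use xy in \<open>auto simp: chv_def simp del: chain.simps intro!: chain_mono\<close>)
qed (auto simp: Yb_0)

lemma incs_F: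
 assumes "0 <= s" "mono p" "p 0 = 0" "s + p K <= t" "j < K + K"
 shows "(%w. incs p K s w j) \<in> borel_measurable (F t)"
proof -
 have p: "0 <= p i" for i using monoD[OF assms(2), of 0 i] assms(3) by simp
 have pK: "s + p i <= t" if "i <= K" for i using monoD[OF assms(2) that] assms(4) by simp
 have [measurable]: "X (s + p i) \<in> borel_measurable (F t)" "N (s + p i) \<in> F t \<rightarrow>\<^sub>M count_space UNIV" if "i <= K" for i
  using X_F[of "s + p i" t] N_F[of "s + p i" t] p assms(1) pK[OF that] by auto
 show ?thesis
 proof (cases "j < K")
  case True
  then have "X (s + p j) \<in> borel_measurable (F t)" "X (s + p (Suc j)) \<in> borel_measurable (F t)"
   by (auto intro!: X_F pK add_nonneg_nonneg assms(1) p)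
  then show ?thesis using True by (simp add: incs_def DX_def)
 next
  case False
  then have [measurable]: "N (s + p (j - K)) \<in> F t \<rightarrow>\<^sub>M count_space UNIV" "N (s + p (Suc (j - K))) \<in> F t \<rightarrow>\<^sub>M count_space UNIV"
   using assms(5) by (auto intro!: N_F pK add_nonneg_nonneg assms(1) p)
  have "(%w. real (N (s + p (Suc (j - K))) w - N (s + p (j - K)) w)) \<in> borel_measurable (F t)" by measurable
  then show ?thesis using False assms(5) by (simp add: incs_def DN_def)
 qed
qed

lemma Yb_F: "0 <= t ==> Yb x t \<in> borel_measurable (F t)"
 and Lb_F: "0 <= t ==> Lb x t \<in> borel_measurable (F t)"
proof -
 assume t: "0 <= t"
 have "Yb x t \<in> borel_measurable (F t) & Lb x t \<in> borel_measurable (F t)"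
 proof (cases "t = 0")
  case True
  have 1: "AE w in M. max a x = Yb x t w"
   using AE_good by eventually_elim (simp add: True Yb_0)
  have 2: "AE w in M. 0 = Lb x t w"
   using AE_good by eventually_elim (simp add: True good_eqs barrier_path.L_0[OF good_path])
  from F_measurable_AE[OF _ 1] F_measurable_AE[OF _ 2] show ?thesis by simp
 next
  case False
  then have t: "0 < t" using t by simp
  have v: "(%w. incs (grid t m) (Suc m) 0 w j) \<in> borel_measurable (F t)" if "j < Suc m + Suc m" for m j
   using t by (intro incs_F that) (auto simp: grid)
  have c: "(%w. chv a b (Suc m) x (incs (grid t m) (Suc m) 0 w)) \<in> borel_measurable (F t)"
    "(%w. chpv a b (Suc m) x (incs (grid t m) (Suc m) 0 w)) \<in> borel_measurable (F t)" for m
   unfolding chv_def chpv_def using v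
   by (intro chain_measurable[where K="Suc m"] chain_push_measurable[where K="Suc m"]; simp)+
  have "(%w. lim (%m. chv a b (Suc m) x (incs (grid t m) (Suc m) 0 w))) \<in> borel_measurable (F t)"
   "(%w. lim (%m. chpv a b (Suc m) x (incs (grid t m) (Suc m) 0 w))) \<in> borel_measurable (F t)"
   by (rule borel_measurable_lim_metric[OF c(1)], rule borel_measurable_lim_metric[OF c(2)])
  moreover have "AE w in M. lim (%m. chv a b (Suc m) x (incs (grid t m) (Suc m) 0 w)) = Yb x t w"
   using AE_good by eventually_elim (rule limI[OF grid_tendsto(1)[OF _ t]])
  moreover have "AE w in M. lim (%m. chpv a b (Suc m) x (incs (grid t m) (Suc m) 0 w)) = Lb x t w"
   using AE_good by eventually_elim (rule limI[OF grid_tendsto(2)[OF _ t]])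
  ultimately show ?thesis by (auto intro: F_measurable_AE)
 qed
 then show "Yb x t \<in> borel_measurable (F t)" "Lb x t \<in> borel_measurable (F t)" by auto
qed

lemma Rb_F: "0 <= t ==> Rb x t \<in> borel_measurable (F t)"
proof -
 assume t: "0 <= t"
 note [measurable] = Yb_F[OF t] Lb_F[OF t] X_F[OF t order_refl]
 have "(%w. Yb x t w - x - X t w + Lb x t w) \<in> borel_measurable (F t)" by measurable
 then show ?thesis by (simp add: Yb_eq)
qed

lemma Yb_measurable [measurable]: "0 <= t ==> Yb x t \<in> borel_measurable M"
 and Lb_measurable [measurable]: "0 <= t ==> Lb x t \<in> borel_measurable M"
 and Rb_measurable [measurable]: "0 <= t ==> Rb x t \<in> borel_measurable M"
 by (auto intro: F_measurable_M Yb_F Lb_F Rb_F)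

lemma chv_pair_measurable: "(%(y, v). chv a b K y v) \<in> borel_measurable (borel \<Otimes>\<^sub>M vspace K)"
 unfolding chv_def split_beta by (rule chain_measurable[where K=K]) auto

lemma chv_measurable: "f \<in> borel_measurable S ==> v \<in> S \<rightarrow>\<^sub>M vspace K ==> (%x. chv a b K (f x) (v x)) \<in> borel_measurable S"
 using measurable_compose[OF measurable_Pair chv_pair_measurable, of f S v K] by simp

text \<open>For the walk restarted at \<open>s\<close> the identity is
  \<open>expectation_shift\<close>. Both sides converge as the grid is refined, the left by the flow
  property and the right for each frozen starting point.\<close>

lemma markov_continuous:
 fixes h :: "real => real" and W :: "'w => real" and B :: real
 assumes s: "0 <= s" and u: "0 < u" and W: "W \<in> borel_measurable (F s)" "integrable M W"
  and h: "continuous_on UNIV h" "!!y. \<bar>h y\<bar> <= B"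
 shows "expectation (%w. W w * h (Yb x (s + u) w)) =
  expectation (%w. W w * expectation (%w'. h (Yb (Yb x s w) u w')))"
proof -
 have [measurable]: "h \<in> borel_measurable borel" using h(1) by (rule borel_measurable_continuous_onI)
 have Bn: "0 <= B" using order.trans[OF abs_ge_zero h(2)] .
 have bnd: "\<bar>wt * z\<bar> <= B * \<bar>wt\<bar>" if "\<bar>z\<bar> <= B" for wt z :: real
  using mult_right_mono[OF that, of "\<bar>wt\<bar>"] by (simp add: abs_mult mult.commute)
 have hc: "isCont h y" for y using h(1) by (simp add: continuous_on_eq_continuous_at)
 have [measurable]: "W \<in> borel_measurable M" using W(2) by simp
 note [measurable] = Yb_measurable[OF s, of x]
 have p: "mono (grid u m)" "grid u m 0 = 0" for m using u by (auto simp: grid)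
 have [measurable]: "incs (grid u m) (Suc m) s \<in> M \<rightarrow>\<^sub>M vspace (Suc m)" "incs (grid u m) (Suc m) 0 \<in> M \<rightarrow>\<^sub>M vspace (Suc m)" for m
  by (rule incs_measurable[OF s p], rule incs_measurable[OF order_refl p])
 define H where "H m w = expectation (%w'. h (chv a b (Suc m) (Yb x s w) (incs (grid u m) (Suc m) 0 w')))" for m w
 have chm: "(%w. chv a b (Suc m) (f w) (v w)) \<in> borel_measurable M" if "f \<in> borel_measurable M" "v \<in> M \<rightarrow>\<^sub>M vspace (Suc m)" for f v m
  by (rule chv_measurable[OF that])
 have eq: "expectation (%w. W w * h (chv a b (Suc m) (Yb x s w) (incs (grid u m) (Suc m) s w))) = expectation (%w. W w * H m w)" for m
 proof -
  define G where "G wt v = fst wt * h (chv a b (Suc m) (snd wt) v)" for wt v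
  have V: "(%w. (W w, Yb x s w)) \<in> F s \<rightarrow>\<^sub>M borel \<Otimes>\<^sub>M borel" by (intro measurable_Pair W Yb_F s)
  have chm3: "(%x. chv a b (Suc m) (snd (fst x)) (snd x)) \<in> borel_measurable ((borel \<Otimes>\<^sub>M borel) \<Otimes>\<^sub>M vspace (Suc m))"
   by (rule chv_measurable) measurable
  have G: "case_prod G \<in> borel_measurable ((borel \<Otimes>\<^sub>M borel) \<Otimes>\<^sub>M vspace (Suc m))"
   unfolding G_def[abs_def] split_beta
   by (intro borel_measurable_times measurable_compose[OF chm3 \<open>h \<in> borel_measurable borel\<close>]) measurable
  have int: "integrable M (%w. G (W w, Yb x s w) (incs (grid u m) (Suc m) s w))"
   unfolding G_def fst_conv snd_conv
  proof (rule Bochner_Integration.integrable_bound)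
   show "integrable M (%w. B * \<bar>W w\<bar>)" using W by simp
   show "AE w in M. norm (W w * h (chv a b (Suc m) (Yb x s w) (incs (grid u m) (Suc m) s w))) <= norm (B * \<bar>W w\<bar>)"
    by (rule AE_I2) (simp add: bnd[OF h(2)] abs_mult[of B] Bn)
   have [measurable]: "(%w. chv a b (Suc m) (Yb x s w) (incs (grid u m) (Suc m) s w)) \<in> borel_measurable M" by (rule chm) measurable
   show "(%w. W w * h (chv a b (Suc m) (Yb x s w) (incs (grid u m) (Suc m) s w))) \<in> borel_measurable M" by measurable
  qed
  from expectation_shift[OF s p V G int] show ?thesis by (simp add: G_def H_def)
 qed
 have HB: "\<bar>H m w\<bar> <= B" for m w
  unfolding H_def by (rule expectation_abs_le[OF h(2)])
 have lhs: "(%m. expectation (%w. W w * h (chv a b (Suc m) (Yb x s w) (incs (grid u m) (Suc m) s w)))) \<longlonglongrightarrow> expectation (%w. W w * h (Yb x (s + u) w))"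
 proof (rule integral_dominated_convergence[where w="%w. B * \<bar>W w\<bar>"])
  have [measurable]: "Yb x (s + u) \<in> borel_measurable M" using s u by simp
  show "(%w. W w * h (Yb x (s + u) w)) \<in> borel_measurable M" by measurable
  fix m
  have [measurable]: "(%w. chv a b (Suc m) (Yb x s w) (incs (grid u m) (Suc m) s w)) \<in> borel_measurable M" by (rule chm) measurable
  show "(%w. W w * h (chv a b (Suc m) (Yb x s w) (incs (grid u m) (Suc m) s w))) \<in> borel_measurable M" by measurable
  show "AE w in M. norm (W w * h (chv a b (Suc m) (Yb x s w) (incs (grid u m) (Suc m) s w))) <= B * \<bar>W w\<bar>"
   by (rule AE_I2) (simp add: bnd[OF h(2)])
 next
  show "AE w in M. (%m. W w * h (chv a b (Suc m) (Yb x s w) (incs (grid u m) (Suc m) s w))) \<longlonglongrightarrow> W w * h (Yb x (s + u) w)"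
   using AE_good by eventually_elim (intro tendsto_mult tendsto_const isCont_tendsto_compose[OF hc] flow_tendsto s u)
 qed (use W in simp)
 have Hlim: "(%m. H m w) \<longlonglongrightarrow> expectation (%w'. h (Yb (Yb x s w) u w'))" for w
  unfolding H_def
 proof (rule integral_dominated_convergence[where w="%_. B"])
  have [measurable]: "Yb (Yb x s w) u \<in> borel_measurable M" using u by simp
  show "(%w'. h (Yb (Yb x s w) u w')) \<in> borel_measurable M" by measurable
  fix m
  have [measurable]: "(%w'. chv a b (Suc m) (Yb x s w) (incs (grid u m) (Suc m) 0 w')) \<in> borel_measurable M" by (rule chm) measurable
  show "(%w'. h (chv a b (Suc m) (Yb x s w) (incs (grid u m) (Suc m) 0 w'))) \<in> borel_measurable M" by measurable
 next
  show "AE w' in M. (%m. h (chv a b (Suc m) (Yb x s w) (incs (grid u m) (Suc m) 0 w'))) \<longlonglongrightarrow> h (Yb (Yb x s w) u w')"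
   using AE_good by eventually_elim (intro isCont_tendsto_compose[OF hc] grid_tendsto u)
 qed (use h(2) in auto)
 have Hm: "H m \<in> borel_measurable M" for m
 proof -
  have "(%p. chv a b (Suc m) (Yb x s (fst p)) (incs (grid u m) (Suc m) 0 (snd p))) \<in> borel_measurable (M \<Otimes>\<^sub>M M)"
   by (rule chv_measurable) measurable
  then have [measurable]: "(%p. chv a b (Suc m) (Yb x s (fst p)) (incs (grid u m) (Suc m) 0 (snd p))) \<in> borel_measurable (M \<Otimes>\<^sub>M M)" .
  have "(%(w, w'). h (chv a b (Suc m) (Yb x s w) (incs (grid u m) (Suc m) 0 w'))) \<in> borel_measurable (M \<Otimes>\<^sub>M M)"
   unfolding split_beta by measurable
  from borel_measurable_lebesgue_integral[OF this] show ?thesis by (simp add: H_def[abs_def])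
 qed
 have rhs: "(%m. expectation (%w. W w * H m w)) \<longlonglongrightarrow> expectation (%w. W w * expectation (%w'. h (Yb (Yb x s w) u w')))"
 proof (rule integral_dominated_convergence[where w="%w. B * \<bar>W w\<bar>"])
  show "(%w. W w * expectation (%w'. h (Yb (Yb x s w) u w'))) \<in> borel_measurable M"
   by (rule borel_measurable_LIMSEQ_real[of M "%m w. W w * H m w"]) (use Hm Hlim in \<open>auto intro!: tendsto_mult\<close>)
  show "(%w. W w * H m w) \<in> borel_measurable M" for m using Hm by measurable
  show "AE w in M. norm (W w * H m w) <= B * \<bar>W w\<bar>" for m
   by (rule AE_I2) (simp add: bnd[OF HB])
  show "AE w in M. (%m. W w * H m w) \<longlonglongrightarrow> W w * expectation (%w'. h (Yb (Yb x s w) u w'))"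
   using Hlim by (auto intro!: tendsto_mult)
 qed (use W in simp)
 show ?thesis using LIMSEQ_unique[OF lhs[unfolded eq] rhs] .
qed

end

section \<open>Resolvents\<close>

text \<open>Bounded pointwise limits of continuous functions. Continuity is what limits of walks
  need; one further limit reaches exactly the two kinds of functions used later, indicators of
  half-lines and truncated right derivatives of convex functions.\<close>

definition continuous_limit :: "(real => real) => real => bool" where
 "continuous_limit \<phi> B \<longleftrightarrow> (EX h. (\<forall>k::nat. continuous_on UNIV (h k)) & (ALL k y. \<bar>h k y\<bar> <= B) &
   (ALL y. (%k. h k y) \<longlonglongrightarrow> \<phi> y))"

lemma continuous_limit_measurable: "continuous_limit \<phi> B ==> \<phi> \<in> borel_measurable borel"
proof -
 assume "continuous_limit \<phi> B"
 then obtain h where h: "!!k::nat. continuous_on UNIV (h k)" "!!y. (%k. h k y) \<longlonglongrightarrow> \<phi> y"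
  by (auto simp: continuous_limit_def)
 then show ?thesis by (intro borel_measurable_LIMSEQ_real[of borel h \<phi>] borel_measurable_continuous_onI)
qed

lemma norm_mult_le_bound:
 fixes d wt z B :: real
 assumes "\<bar>z\<bar> <= B" "0 <= d"
 shows "norm (d * (wt * z)) <= norm (B * d * \<bar>wt\<bar>)"
proof -
 have "\<bar>z\<bar> * (d * \<bar>wt\<bar>) <= \<bar>B\<bar> * (d * \<bar>wt\<bar>)" using assms by (intro mult_right_mono) auto
 then show ?thesis using assms by (simp add: abs_mult mult_ac)
qed

lemma continuous_limit_bound: "continuous_limit \<phi> B ==> \<bar>\<phi> y\<bar> <= B"
 unfolding continuous_limit_def
 by (auto intro!: LIMSEQ_le_const2[OF tendsto_rabs])

lemma continuous_limit_diff_const: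
 assumes "continuous_limit \<phi> B" shows "continuous_limit (%y. \<phi> y - c) (B + \<bar>c\<bar>)"
proof -
 obtain h where h: "!!k::nat. continuous_on UNIV (h k)" "!!k y. \<bar>h k y\<bar> <= B" "!!y. (%k. h k y) \<longlonglongrightarrow> \<phi> y"
  using assms by (auto simp: continuous_limit_def)
 have "\<bar>h k y - c\<bar> <= B + \<bar>c\<bar>" for k y using h(2)[of k y] by arith
 then show ?thesis unfolding continuous_limit_def using h
  by (intro exI[of _ "%k y. h k y - c"]) (auto intro!: continuous_intros tendsto_intros)
qed

lemma continuous_limit_greaterThan: "continuous_limit (indicator {c<..}) 1"
proof -
 have "(%k::nat. min 1 (max 0 (real k * (y - c)))) \<longlonglongrightarrow> indicator {c<..} y" for y
 proof (cases "c < y")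
  case True
  then have "filterlim (%k::nat. real k * (y - c)) at_top sequentially"
   by (intro filterlim_at_top_mult_tendsto_pos[OF tendsto_const] filterlim_real_sequentially) simp
  then have "\<forall>\<^sub>F k::nat in sequentially. 1 <= real k * (y - c)" by (simp add: filterlim_at_top)
  then have "\<forall>\<^sub>F k::nat in sequentially. min 1 (max 0 (real k * (y - c))) = indicator {c<..} y"
   by eventually_elim (use True in simp)
  then show ?thesis by (rule tendsto_eventually)
 next
  case False
  then have "max 0 (real k * (y - c)) = 0" for k :: nat by (simp add: max_absorb1 mult_nonneg_nonpos)
  then show ?thesis using False by simp
 qed
 then show ?thesis unfolding continuous_limit_def
  by (intro exI[of _ "%k y. min 1 (max 0 (real k * (y - c)))"]) (auto intro!: continuous_intros)
qed

context barrier
begin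

definition Pt :: "(real => real) => real => real => real" where
 "Pt \<phi> u y = expectation (%w. \<phi> (Yb y u w))"

lemma Pt_abs_le: "(!!y. \<bar>\<phi> y\<bar> <= B) ==> \<bar>Pt \<phi> u y\<bar> <= B"
 unfolding Pt_def by (rule expectation_abs_le)

lemma Pt_limit:
 assumes u: "0 <= u" and h: "!!k. h k \<in> borel_measurable borel" "!!k y. \<bar>h k y\<bar> <= B" "!!y. (%k. h k y) \<longlonglongrightarrow> \<phi> y"
 shows "(%k. Pt (h k) u y) \<longlonglongrightarrow> Pt \<phi> u y"
 unfolding Pt_def
proof (rule integral_dominated_convergence[where w="%_. B"])
 have [measurable]: "\<phi> \<in> borel_measurable borel" by (rule borel_measurable_LIMSEQ_real[OF h(3,1)])
 note [measurable] = h(1) Yb_measurable[OF u, of y]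
 show "(%w. \<phi> (Yb y u w)) \<in> borel_measurable M" by measurable
 show "(%w. h k (Yb y u w)) \<in> borel_measurable M" for k by measurable
qed (use h in auto)

lemma Pt_continuous:
 assumes u: "0 <= u" and h: "continuous_on UNIV h" "!!y. \<bar>h y\<bar> <= B"
 shows "isCont (Pt h u) y"
 unfolding continuous_at_sequentially comp_def
proof (intro allI impI)
 fix z assume z: "z \<longlonglongrightarrow> y"
 have [measurable]: "h \<in> borel_measurable borel" using h(1) by (rule borel_measurable_continuous_onI)
 have hc: "isCont h y" for y using h(1) by (simp add: continuous_on_eq_continuous_at)
 note [measurable] = Yb_measurable[OF u]
 show "(%n. Pt h u (z n)) \<longlonglongrightarrow> Pt h u y"
  unfolding Pt_def
 proof (rule integral_dominated_convergence[where w="%_. B"])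
  show "AE w in M. (%n. h (Yb (z n) u w)) \<longlonglongrightarrow> h (Yb y u w)"
   using AE_good
  proof eventually_elim
   case (elim w)
   have z0: "(%n. \<bar>z n - y\<bar>) \<longlonglongrightarrow> 0" using tendsto_rabs[OF tendsto_diff[OF z tendsto_const], of y] by simp
   have "(%n. Yb (z n) u w - Yb y u w) \<longlonglongrightarrow> 0"
    by (rule Lim_null_comparison[OF _ z0]) (use Yb_Lipschitz[OF elim u] in simp)
   then have "(%n. Yb (z n) u w) \<longlonglongrightarrow> Yb y u w" by (simp add: LIM_zero_iff)
   then show ?case by (rule isCont_tendsto_compose[OF hc])
  qed
 qed (use h in \<open>auto intro!: measurable_compose[OF Yb_measurable[OF u]]\<close>)
qed

lemma Pt_right_continuous:
 assumes u: "0 <= u" and h: "continuous_on UNIV h" "!!y. \<bar>h y\<bar> <= B"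
 shows "((%u. Pt h u y) \<longlongrightarrow> Pt h u y) (at_right u)"
proof (rule tendsto_at_right_sequentially[of u "u + 1"])
 fix S :: "nat => real" assume S: "!!n. u < S n" "S \<longlonglongrightarrow> u"
 have [measurable]: "h \<in> borel_measurable borel" using h(1) by (rule borel_measurable_continuous_onI)
 have hc: "isCont h y" for y using h(1) by (simp add: continuous_on_eq_continuous_at)
 have Su: "0 <= S n" for n using S(1)[of n] u by simp
 have fl: "filterlim S (at_right u) sequentially"
  unfolding filterlim_at using S by (auto intro!: always_eventually simp: less_imp_neq[THEN not_sym])
 show "(%n. Pt h (S n) y) \<longlonglongrightarrow> Pt h u y"
  unfolding Pt_def
 proof (rule integral_dominated_convergence[where w="%_. B"])
  show "AE w in M. (%n. h (Yb y (S n) w)) \<longlonglongrightarrow> h (Yb y u w)"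
   using AE_good
  proof eventually_elim
   case (elim w)
   show ?case
    by (rule isCont_tendsto_compose[OF hc filterlim_compose[OF cadlag_at_right[OF Yb_cadlag[OF elim] u] fl]])
  qed
  show "(%w. h (Yb y u w)) \<in> borel_measurable M" "(%w. h (Yb y (S n) w)) \<in> borel_measurable M" for n
   using Yb_measurable[OF u] Yb_measurable[OF Su] by measurable
 qed (use h in auto)
qed simp

lemma markov_pos:
 fixes W :: "'w => real"
 assumes s: "0 <= s" and u: "0 < u" and W: "W \<in> borel_measurable (F s)" "integrable M W" and \<phi>: "continuous_limit \<phi> B"
 shows "expectation (%w. W w * \<phi> (Yb x (s + u) w)) = expectation (%w. W w * Pt \<phi> u (Yb x s w))"
proof -
 obtain h where h: "!!k::nat. continuous_on UNIV (h k)" "!!k y. \<bar>h k y\<bar> <= B" "!!y. (%k. h k y) \<longlonglongrightarrow> \<phi> y"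
  using \<phi> by (auto simp: continuous_limit_def)
 have hm [measurable]: "h k \<in> borel_measurable borel" for k using h(1) by (rule borel_measurable_continuous_onI)
 have [measurable]: "\<phi> \<in> borel_measurable borel" using \<phi> by (rule continuous_limit_measurable)
 have [measurable]: "W \<in> borel_measurable M" using W(2) by simp
 have [measurable]: "Yb x (s + u) \<in> borel_measurable M" "Yb x s \<in> borel_measurable M" using s u by simp_all
 have bnd: "norm (wt * z) <= B * \<bar>wt\<bar>" if "\<bar>z\<bar> <= B" for wt z :: real
  using mult_right_mono[OF that, of "\<bar>wt\<bar>"] by (simp add: abs_mult mult.commute)
 have [measurable]: "Pt (h k) u \<in> borel_measurable borel" for k
  using Pt_continuous[OF _ h(1,2), of u] u by (intro borel_measurable_continuous_onI) (simp add: continuous_on_eq_continuous_at)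
 have Pl: "(%k. Pt (h k) u y) \<longlonglongrightarrow> Pt \<phi> u y" for y
  using u by (intro Pt_limit[OF _ hm h(2,3)]) simp
 have [measurable]: "Pt \<phi> u \<in> borel_measurable borel"
  by (rule borel_measurable_LIMSEQ_real[OF Pl]) simp
 have eq: "expectation (%w. W w * h k (Yb x (s + u) w)) = expectation (%w. W w * Pt (h k) u (Yb x s w))" for k
  unfolding Pt_def by (rule markov_continuous[OF s u W h(1,2)])
 have 1: "(%k. expectation (%w. W w * h k (Yb x (s + u) w))) \<longlonglongrightarrow> expectation (%w. W w * \<phi> (Yb x (s + u) w))"
  by (rule integral_dominated_convergence[where w="%w. B * \<bar>W w\<bar>"])
   (use W h bnd in \<open>auto intro!: tendsto_mult\<close>)
 have 2: "(%k. expectation (%w. W w * Pt (h k) u (Yb x s w))) \<longlonglongrightarrow> expectation (%w. W w * Pt \<phi> u (Yb x s w))"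
 proof (rule integral_dominated_convergence[where w="%w. B * \<bar>W w\<bar>"])
  show "AE w in M. norm (W w * Pt (h k) u (Yb x s w)) <= B * \<bar>W w\<bar>" for k
   by (rule AE_I2) (rule bnd[OF Pt_abs_le[OF h(2)]])
  show "AE w in M. (%k. W w * Pt (h k) u (Yb x s w)) \<longlonglongrightarrow> W w * Pt \<phi> u (Yb x s w)"
   by (rule AE_I2) (intro tendsto_mult tendsto_const Pl)
 qed (use W in auto)
 show ?thesis using LIMSEQ_unique[OF 1[unfolded eq] 2] .
qed

text \<open>For \<open>u = 0\<close> there is no grid; there \<open>Pt\<close> evaluates at
  \<open>max a y\<close>, which changes nothing since the process is already above
  \<open>a\<close>.\<close>

lemma markov:
 fixes W :: "'w => real"
 assumes s: "0 <= s" and u: "0 <= u" and W: "W \<in> borel_measurable (F s)" "integrable M W" and \<phi>: "continuous_limit \<phi> B"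
 shows "expectation (%w. W w * \<phi> (Yb x (s + u) w)) = expectation (%w. W w * Pt \<phi> u (Yb x s w))"
proof (cases "u = 0")
 case True
 have [measurable]: "\<phi> \<in> borel_measurable borel" using \<phi> by (rule continuous_limit_measurable)
 have [measurable]: "W \<in> borel_measurable M" using W by simp
 note [measurable] = Yb_measurable[OF s] Yb_measurable[OF order_refl]
 have P0: "Pt \<phi> 0 y = \<phi> (max a y)" for y
 proof -
  have "Pt \<phi> 0 y = expectation (%w. \<phi> (max a y))"
   unfolding Pt_def
  proof (rule integral_cong_AE)
   show "AE w in M. \<phi> (Yb y 0 w) = \<phi> (max a y)" using AE_good by eventually_elim (simp add: Yb_0)
  qed measurable
  then show ?thesis by (simp add: prob_space)
 qed
 show ?thesis
  unfolding True P0
 proof (rule integral_cong_AE)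
  show "AE w in M. W w * \<phi> (Yb x (s + 0) w) = W w * \<phi> (max a (Yb x s w))"
   using AE_good by eventually_elim (use Yb_ge s in \<open>simp add: max_absorb2\<close>)
 qed simp_all
next
 case False
 then show ?thesis using markov_pos[OF s _ W \<phi>] u by simp
qed

lemma Yb_joint: "(%(t, w). if w \<in> Good & 0 <= t then Yb x t w else 0) \<in> borel_measurable (borel \<Otimes>\<^sub>M M)"
 by (rule borel_measurable_right_continuous[OF Good_events Yb_measurable])
  (auto simp: Good_def intro!: cadlag_at_right Yb_cadlag)

text \<open>For continuous functions the semigroup is right-continuous in time, which gives joint
  measurability; limits inherit it. Fubini for the resolvent rests on this.\<close>

lemma Pt_joint:
 assumes s: "0 <= s" and \<phi>: "continuous_limit \<phi> B"
 shows "(%(u, w). if 0 <= u then Pt \<phi> u (Yb x s w) else 0) \<in> borel_measurable (borel \<Otimes>\<^sub>M M)"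
proof -
 obtain h where h: "!!k::nat. continuous_on UNIV (h k)" "!!k y. \<bar>h k y\<bar> <= B" "!!y. (%k. h k y) \<longlonglongrightarrow> \<phi> y"
  using \<phi> by (auto simp: continuous_limit_def)
 have hm [measurable]: "h k \<in> borel_measurable borel" for k using h(1) by (rule borel_measurable_continuous_onI)
 note [measurable] = Yb_measurable[OF s]
 have "(%(u, w). if w \<in> space M & 0 <= u then Pt (h k) u (Yb x s w) else 0) \<in> borel_measurable (borel \<Otimes>\<^sub>M M)" for k
 proof (rule borel_measurable_right_continuous)
  fix u :: real assume u: "0 <= u"
  have [measurable]: "Pt (h k) u \<in> borel_measurable borel"
   using Pt_continuous[OF u h(1,2)] by (intro borel_measurable_continuous_onI) (simp add: continuous_on_eq_continuous_at)
  show "(%w. Pt (h k) u (Yb x s w)) \<in> borel_measurable M" by measurable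
 next
  show "((%u. Pt (h k) u (Yb x s w)) \<longlongrightarrow> Pt (h k) u (Yb x s w)) (at_right u)" if "0 <= u" for u w
   by (rule Pt_right_continuous[OF that h(1,2)])
 qed simp
 then show ?thesis
 proof (rule borel_measurable_LIMSEQ_real[rotated])
  fix p :: "real \<times> 'w" assume "p \<in> space (borel \<Otimes>\<^sub>M M)"
  then have "snd p \<in> space M" by (auto simp: space_pair_measure)
  then show "(%k. (%(u, w). if w \<in> space M & 0 <= u then Pt (h k) u (Yb x s w) else 0) p) \<longlonglongrightarrow>
   (%(u, w). if 0 <= u then Pt \<phi> u (Yb x s w) else 0) p"
   using Pt_limit[OF _ hm h(2,3)] by (auto simp: split_beta)
 qed
qed

end

lemma exp_integrable_half: "0 < q ==> integrable lborel (%u::real. indicator {0..} u * exp (- q * u))"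
 and exp_integral_half: "0 < q ==> (\<integral>u. indicator {0..} u * exp (- q * u) \<partial>lborel) = 1 / (q::real)"
proof -
 assume q: "0 < q"
 have nn: "(\<integral>\<^sup>+u. ennreal (exp (- q * u)) * indicator {0..} u \<partial>lborel) = ennreal (0 - (- exp (- q * 0) / q))"
 proof (rule nn_integral_FTC_atLeast)
  fix u :: real
  show "DERIV (%u. - exp (- q * u) / q) u :> exp (- q * u)" using q by (auto intro!: derivative_eq_intros)
  have "((%u. - exp (- q * u) / q) \<longlongrightarrow> - 0 / q) at_top"
   using q by (intro tendsto_intros filterlim_compose[OF exp_at_bot] filterlim_tendsto_neg_mult_at_bot[OF tendsto_const]) (auto intro: filterlim_ident)
  then show "((%u. - exp (- q * u) / q) \<longlongrightarrow> 0) at_top" by simp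
 qed auto
 have eq: "ennreal (indicator {0..} u * exp (- q * u)) = ennreal (exp (- q * u)) * indicator {0..} u" for u
  by (auto split: split_indicator)
 have "(\<integral>\<^sup>+u. ennreal (indicator {0..} u * exp (- q * u)) \<partial>lborel) = ennreal (1 / q)"
  unfolding eq nn using q by simp
 then have "has_bochner_integral lborel (%u. indicator {0..} u * exp (- q * u)) (1 / q)"
  using q by (intro has_bochner_integral_nn_integral) auto
 then show "integrable lborel (%u::real. indicator {0..} u * exp (- q * u))"
  "(\<integral>u. indicator {0..} u * exp (- q * u) \<partial>lborel) = 1 / q"
  by (auto simp: has_bochner_integral_iff)
qed

section \<open>The q-resolvent of the controlled process\<close>

locale discounted = barrier M X N r a b
 for M :: "'w measure" and X :: "real => 'w => real" and N :: "real => 'w => nat" and r a b :: real +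
 fixes q :: real
 assumes q_pos: "0 < q"
begin

definition "dis u = indicator {0..} u * exp (- q * u)" for u :: real

lemma dis_measurable [measurable]: "dis \<in> borel_measurable borel" unfolding dis_def[abs_def] by measurable
lemma dis_nonneg: "0 <= dis u" by (simp add: dis_def)
lemma dis_integrable: "integrable lborel dis" unfolding dis_def[abs_def] by (rule exp_integrable_half[OF q_pos])
lemma dis_integral: "(\<integral>u. dis u \<partial>lborel) = 1 / q" unfolding dis_def by (rule exp_integral_half[OF q_pos])
lemma dis_neg: "u < 0 ==> dis u = 0" by (simp add: dis_def)

definition "U \<phi> y = (\<integral>u. dis u * Pt \<phi> u y \<partial>lborel)"

sublocale LM: pair_sigma_finite lborel M ..

lemma integrable_pair_mult:
 fixes f :: "real => real" and g :: "'w => real"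
 assumes "integrable lborel f" "integrable M g"
 shows "integrable (lborel \<Otimes>\<^sub>M M) (%(u, w). f u * g w)"
proof (rule LM.Fubini_integrable)
 have [measurable]: "f \<in> borel_measurable lborel" "g \<in> borel_measurable M" using assms by auto
 have "(%p. f (fst p) * g (snd p)) \<in> borel_measurable (lborel \<Otimes>\<^sub>M M)" by measurable
 then show "(%(u, w). f u * g w) \<in> borel_measurable (lborel \<Otimes>\<^sub>M M)" by (simp add: split_beta)
 show "integrable lborel (%u. \<integral>w. norm (case (u, w) of (u, w) => f u * g w) \<partial>M)"
  using assms by (simp add: abs_mult)
qed (use assms in auto)

lemma Yphi_joint:
 assumes [measurable]: "\<phi> \<in> borel_measurable borel"
 shows "(%(u, w). if w \<in> Good & 0 <= u then \<phi> (Yb x u w) else 0) \<in> borel_measurable (lborel \<Otimes>\<^sub>M M)"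
proof -
 note [measurable] = Yb_joint[of x]
 have "(%p. if snd p \<in> Good & 0 <= fst p then \<phi> ((%(t, w). if w \<in> Good & 0 <= t then Yb x t w else 0) p) else 0) \<in> borel_measurable (borel \<Otimes>\<^sub>M M)"
  by measurable
 also have "(%p. if snd p \<in> Good & 0 <= fst p then \<phi> ((%(t, w). if w \<in> Good & 0 <= t then Yb x t w else 0) p) else 0) =
  (%(u, w). if w \<in> Good & 0 <= u then \<phi> (Yb x u w) else 0)" by (auto simp: fun_eq_iff)
 finally show ?thesis by (simp cong: measurable_cong_sets)
qed

lemma swap_expectation:
 fixes W :: "'w => real"
 assumes W: "integrable M W" and \<phi>: "\<phi> \<in> borel_measurable borel" "!!y. \<bar>\<phi> y\<bar> <= B" and s: "0 <= s"
 shows "expectation (%w. W w * (\<integral>u. dis u * \<phi> (Yb x (s + u) w) \<partial>lborel)) =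
  (\<integral>u. dis u * expectation (%w. W w * \<phi> (Yb x (s + u) w)) \<partial>lborel)"
proof -
 note [measurable] = Yphi_joint[OF \<phi>(1), of x, simplified]
 have [measurable]: "W \<in> borel_measurable M" using W by simp
 \<comment> \<open>Joint measurability is known only for the version cut down to
   \<open>Good\<close>, which differs from the integrand on a null set of outcomes.\<close>
 define f where "f = (%(u, w). dis u * (W w * (%(u, w). if w \<in> Good & 0 <= u then \<phi> (Yb x u w) else 0) (s + u, w)))"
 have fm: "f \<in> borel_measurable (lborel \<Otimes>\<^sub>M M)"
 proof -
  have "(%p. (s + fst p, snd p)) \<in> lborel \<Otimes>\<^sub>M M \<rightarrow>\<^sub>M lborel \<Otimes>\<^sub>M M" by measurable
  from measurable_compose[OF this Yphi_joint[OF \<phi>(1), of x]]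
  show ?thesis unfolding f_def split_beta by measurable
 qed
 have Bn: "0 <= B" using order.trans[OF abs_ge_zero \<phi>(2)] .
 have int: "integrable (lborel \<Otimes>\<^sub>M M) f"
 proof (rule Bochner_Integration.integrable_bound[OF _ fm])
  show "integrable (lborel \<Otimes>\<^sub>M M) (%(u, w). (B * dis u) * \<bar>W w\<bar>)"
   using dis_integrable W by (intro integrable_pair_mult) auto
  have "norm (f (u, w)) <= norm ((B * dis u) * \<bar>W w\<bar>)" for u w
   unfolding f_def prod.case using \<phi>(2)[of "Yb x (s + u) w"] Bn dis_nonneg[of u]
   by (intro norm_mult_le_bound) auto
  then show "AE p in lborel \<Otimes>\<^sub>M M. norm (f p) <= norm ((%(u, w). (B * dis u) * \<bar>W w\<bar>) p)" by auto
 qed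
 have fs: "(%w. \<integral>u. f (u, w) \<partial>lborel) \<in> borel_measurable M"
  using LM.integrable_snd[of "%u w. f (u, w)"] int by (auto dest: borel_measurable_integrable)
 have AEf: "AE w in M. f (u, w) = dis u * (W w * \<phi> (Yb x (s + u) w))" for u
  using AE_Good by eventually_elim (use s dis_neg[of u] in \<open>auto simp: f_def\<close>)
 have "expectation (%w. W w * (\<integral>u. dis u * \<phi> (Yb x (s + u) w) \<partial>lborel)) = expectation (%w. \<integral>u. f (u, w) \<partial>lborel)"
 proof (rule integral_cong_AE)
  show "AE w in M. W w * (\<integral>u. dis u * \<phi> (Yb x (s + u) w) \<partial>lborel) = (\<integral>u. f (u, w) \<partial>lborel)"
   using AE_Good
  proof eventually_elim
   case (elim w)
   have "f (u, w) = W w * (dis u * \<phi> (Yb x (s + u) w))" for u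
    using elim s dis_neg[of u] by (auto simp: f_def)
   then show ?case by simp
  qed
  then show "(%w. W w * (\<integral>u. dis u * \<phi> (Yb x (s + u) w) \<partial>lborel)) \<in> borel_measurable M"
   by (intro M_measurable_AE[OF fs]) (auto simp: eq_commute)
  show "(%w. \<integral>u. f (u, w) \<partial>lborel) \<in> borel_measurable M"
   by (rule fs)
 qed
 also have "... = (\<integral>u. expectation (%w. f (u, w)) \<partial>lborel)"
  using LM.Fubini_integral[of "%u w. f (u, w)"] int by simp
 also have "... = (\<integral>u. dis u * expectation (%w. W w * \<phi> (Yb x (s + u) w)) \<partial>lborel)"
 proof (rule Bochner_Integration.integral_cong[OF refl])
  fix u :: real
  show "expectation (%w. f (u, w)) = dis u * expectation (%w. W w * \<phi> (Yb x (s + u) w))"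
  proof (cases "0 <= u")
   case True
   then have [measurable]: "Yb x (s + u) \<in> borel_measurable M" using s by simp
   note [measurable] = \<phi>(1)
   have "expectation (%w. f (u, w)) = expectation (%w. dis u * (W w * \<phi> (Yb x (s + u) w)))"
    by (rule integral_cong_AE[OF _ _ AEf]) (use measurable_compose[OF measurable_Pair1' fm, of u] in simp, measurable)
   then show ?thesis by simp
  qed (simp add: f_def dis_neg)
 qed
 finally show ?thesis .
qed

text \<open>The Markov property at each lag \<open>u\<close>, integrated against the discount, with
  Fubini on both sides.\<close>

lemma resolvent_markov:
 fixes W :: "'w => real"
 assumes s: "0 <= s" and W: "W \<in> borel_measurable (F s)" "integrable M W" and \<phi>: "continuous_limit \<phi> B"
 shows "expectation (%w. W w * (\<integral>u. dis u * \<phi> (Yb x (s + u) w) \<partial>lborel)) = expectation (%w. W w * U \<phi> (Yb x s w))"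
proof -
 note \<phi>m = continuous_limit_measurable[OF \<phi>] and \<phi>b = continuous_limit_bound[OF \<phi>]
 have [measurable]: "W \<in> borel_measurable M" using W by simp
 have "expectation (%w. W w * (\<integral>u. dis u * \<phi> (Yb x (s + u) w) \<partial>lborel)) =
  (\<integral>u. dis u * expectation (%w. W w * \<phi> (Yb x (s + u) w)) \<partial>lborel)"
  by (rule swap_expectation[OF W(2) \<phi>m \<phi>b s])
 also have "... = (\<integral>u. dis u * expectation (%w. W w * Pt \<phi> u (Yb x s w)) \<partial>lborel)"
 proof (rule Bochner_Integration.integral_cong[OF refl])
  fix u
  show "dis u * expectation (%w. W w * \<phi> (Yb x (s + u) w)) = dis u * expectation (%w. W w * Pt \<phi> u (Yb x s w))"
  proof (cases "0 <= u")
   case True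
   show ?thesis by (simp only: markov[OF s True W \<phi>])
  qed (simp add: dis_neg)
 qed
 also have "... = expectation (%w. W w * U \<phi> (Yb x s w))"
 proof -
  define f where "f = (%(u, w). dis u * (W w * (%(u, w). if 0 <= u then Pt \<phi> u (Yb x s w) else 0) (u, w)))"
  have fm: "f \<in> borel_measurable (lborel \<Otimes>\<^sub>M M)"
  proof -
   have [measurable]: "(%(u, w). if 0 <= u then Pt \<phi> u (Yb x s w) else 0) \<in> borel_measurable (lborel \<Otimes>\<^sub>M M)"
    using Pt_joint[OF s \<phi>, of x] by (simp cong: measurable_cong_sets)
   have "(%p. dis (fst p) * (W (snd p) * (%(u, w). if 0 <= u then Pt \<phi> u (Yb x s w) else 0) p)) \<in> borel_measurable (lborel \<Otimes>\<^sub>M M)"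
    by measurable
   also have "(%p. dis (fst p) * (W (snd p) * (%(u, w). if 0 <= u then Pt \<phi> u (Yb x s w) else 0) p)) = f"
    by (auto simp: f_def fun_eq_iff)
   finally show ?thesis .
  qed
  have Bn: "0 <= B" using order.trans[OF abs_ge_zero \<phi>b] .
  have int: "integrable (lborel \<Otimes>\<^sub>M M) f"
  proof (rule Bochner_Integration.integrable_bound[OF _ fm])
   show "integrable (lborel \<Otimes>\<^sub>M M) (%(u, w). (B * dis u) * \<bar>W w\<bar>)"
    using dis_integrable W by (intro integrable_pair_mult) auto
   have "norm (f (u, w)) <= norm ((B * dis u) * \<bar>W w\<bar>)" for u w
    unfolding f_def prod.case using Pt_abs_le[where \<phi>=\<phi> and B=B and u=u and y="Yb x s w", OF \<phi>b] Bn dis_nonneg[of u]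
    by (intro norm_mult_le_bound) auto
   then show "AE p in lborel \<Otimes>\<^sub>M M. norm (f p) <= norm ((%(u, w). (B * dis u) * \<bar>W w\<bar>) p)" by auto
  qed
  have feq: "f (u, w) = dis u * (W w * Pt \<phi> u (Yb x s w))" for u w
   using dis_neg[of u] by (auto simp: f_def)
  have "(\<integral>u. dis u * expectation (%w. W w * Pt \<phi> u (Yb x s w)) \<partial>lborel) = (\<integral>u. expectation (%w. f (u, w)) \<partial>lborel)"
   by (simp add: feq)
  also have "... = expectation (%w. \<integral>u. f (u, w) \<partial>lborel)"
   using LM.Fubini_integral[of "%u w. f (u, w)"] int by simp
  also have "... = expectation (%w. W w * U \<phi> (Yb x s w))"
   by (simp add: feq U_def mult.left_commute[of _ "W _"])
  finally show ?thesis .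
 qed
 finally show ?thesis .
qed

end

section \<open>The Laplace exponent\<close>

lemma exp_le_quadratic:
 assumes "u <= (0::real)" shows "exp u - 1 - u <= u\<^sup>2"
proof -
 have "1 - u <= exp (- u)" using exp_ge_add_one_self[of "- u"] by simp
 then have "exp u <= 1 / (1 - u)" using assms by (simp add: exp_minus field_simps)
 also have "1 / (1 - u) = 1 + u + u\<^sup>2 / (1 - u)" using assms by (simp add: power2_eq_square divide_simps) (simp add: algebra_simps)
 also have "u\<^sup>2 / (1 - u) <= u\<^sup>2" using assms by (simp add: divide_le_eq mult_le_cancel_left1)
 finally show ?thesis by simp
qed

text \<open>Small jumps contribute at most the square of \<open>s * z\<close> and large jumps at
  most 0. Quadratic growth is what later forces a scale \<open>s\<close> at which doubling
  \<open>s\<close> multiplies \<psi> by at most 5.\<close>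

lemma laplace_exponent_upper:
 assumes \<mu>: "levy_measure_neg \<mu>"
 shows "\<exists>C\<ge>0. \<forall>s\<ge>1. laplace_exponent \<gamma> \<sigma> \<mu> s <= C * s\<^sup>2"
proof -
 have [measurable_cong]: "sets \<mu> = sets borel" using \<mu> by (simp add: levy_measure_neg_def)
 define k where "k z = indicator {..<0} z * min 1 (z\<^sup>2)" for z :: real
 have k0: "0 <= k z" for z by (simp add: k_def)
 have km [measurable]: "k \<in> borel_measurable \<mu>" unfolding k_def[abs_def] by measurable
 have "(\<integral>\<^sup>+z. ennreal (k z) \<partial>\<mu>) = (\<integral>\<^sup>+z\<in>{..<0}. ennreal (min 1 (z\<^sup>2)) \<partial>\<mu>)"
  by (intro nn_integral_cong) (auto simp: k_def split: split_indicator)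
 also have "... < \<infinity>" using \<mu> by (simp add: levy_measure_neg_def)
 finally have k: "integrable \<mu> k" by (intro integrableI_nonneg) (auto simp: k0)
 have le: "laplace_exponent \<gamma> \<sigma> \<mu> s <= (\<bar>\<gamma>\<bar> + \<sigma>\<^sup>2 / 2 + integral\<^sup>L \<mu> k) * s\<^sup>2" if s: "1 <= s" for s
 proof -
  have "(LINT z:{..<0}|\<mu>. exp (s * z) - 1 - s * z * indicator {-1<..} z) <= (\<integral>z. s\<^sup>2 * k z \<partial>\<mu>)"
   unfolding set_lebesgue_integral_def
  \<comment> \<open>The rule asks for integrability of the non-negative majorant only; a
    non-integrable integrand would have integral 0.\<close>
  proof (rule integral_mono')
   fix z
   show "indicator {..<0} z *\<^sub>R (exp (s * z) - 1 - s * z * indicator {-1<..} z) <= s\<^sup>2 * k z"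
   proof (cases "z < 0")
    case z: True
    show ?thesis
    proof (cases "-1 < z")
     case True
     then have "z\<^sup>2 <= 1" using z by (simp add: abs_square_le_1)
     moreover have "exp (s * z) - 1 - s * z <= (s * z)\<^sup>2" using z s by (intro exp_le_quadratic) (simp add: mult_nonneg_nonpos)
     ultimately show ?thesis using z True by (simp add: k_def power_mult_distrib)
    next
     case False
     have "exp (s * z) <= 1" using z s by (simp add: mult_nonneg_nonpos)
     moreover have "0 <= s\<^sup>2 * k z" using k0 by simp
     ultimately have "exp (s * z) - 1 <= s\<^sup>2 * k z" by linarith
     then show ?thesis using z False by simp
    qed
   qed (simp add: k0)
  qed (use k k0 in auto)
  moreover have "\<gamma> * s <= \<bar>\<gamma>\<bar> * s\<^sup>2"
  proof -
   have "\<gamma> * s <= \<bar>\<gamma>\<bar> * s" using s by (intro mult_right_mono) auto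
   also have "... <= \<bar>\<gamma>\<bar> * s\<^sup>2" using s by (intro mult_left_mono) (auto simp: power2_eq_square)
   finally show ?thesis .
  qed
  ultimately show ?thesis by (simp add: laplace_exponent_def algebra_simps)
 qed
 have "0 <= integral\<^sup>L \<mu> k" using k0 by simp
 then show ?thesis using le by (intro exI[of _ "\<bar>\<gamma>\<bar> + \<sigma>\<^sup>2 / 2 + integral\<^sup>L \<mu> k"]) auto
qed

text \<open>Large negative jumps cost at most \<open>s * \<bar>z\<bar>\<close>, and the exponential
  tail makes this integrable. The linear bound at 0 expresses that the mean of \<open>X\<close> is
  finite.\<close>

lemma laplace_exponent_lower:
 assumes \<mu>: "levy_measure_neg \<mu>" and tail: "\<exists>\<theta>>0. (\<integral>\<^sup>+y\<in>{..-1}. ennreal (exp (\<theta> * \<bar>y\<bar>)) \<partial>\<mu>) < \<infinity>"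
 shows "\<exists>C\<ge>0. ALL s. 0 < s --> s <= 1 --> - C * s <= laplace_exponent \<gamma> \<sigma> \<mu> s"
proof -
 have [measurable_cong]: "sets \<mu> = sets borel" using \<mu> by (simp add: levy_measure_neg_def)
 obtain \<theta> where \<theta>: "0 < \<theta>" "(\<integral>\<^sup>+y\<in>{..-1}. ennreal (exp (\<theta> * \<bar>y\<bar>)) \<partial>\<mu>) < \<infinity>" using tail by auto
 define k where "k z = indicator {..-1} z * exp (\<theta> * \<bar>z\<bar>)" for z :: real
 have k0: "0 <= k z" for z by (simp add: k_def)
 have km [measurable]: "k \<in> borel_measurable \<mu>" unfolding k_def[abs_def] by measurable
 have "(\<integral>\<^sup>+z. ennreal (k z) \<partial>\<mu>) = (\<integral>\<^sup>+y\<in>{..-1}. ennreal (exp (\<theta> * \<bar>y\<bar>)) \<partial>\<mu>)"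
  by (intro nn_integral_cong) (auto simp: k_def split: split_indicator)
 then have k: "integrable \<mu> k" using \<theta> by (intro integrableI_nonneg) (auto simp: k0)
 have le: "- (\<bar>\<gamma>\<bar> + integral\<^sup>L \<mu> k / \<theta>) * s <= laplace_exponent \<gamma> \<sigma> \<mu> s" if s: "0 < s" "s <= 1" for s
 proof -
  have "(\<integral>z. - (indicator {..<0} z *\<^sub>R (exp (s * z) - 1 - s * z * indicator {-1<..} z)) \<partial>\<mu>) <= (\<integral>z. s / \<theta> * k z \<partial>\<mu>)"
  proof (rule integral_mono')
   fix z
   show "- (indicator {..<0} z *\<^sub>R (exp (s * z) - 1 - s * z * indicator {-1<..} z)) <= s / \<theta> * k z"
   proof (cases "z < 0")
    case z: True
    have e: "s * z <= exp (s * z) - 1" using exp_ge_add_one_self[of "s * z"] by linarith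
    show ?thesis
    proof (cases "-1 < z")
     case True
     then show ?thesis using e z s \<theta> k0[of z] by (simp add: k_def)
    next
     case False
     have ge: "\<theta> * \<bar>z\<bar> <= exp (\<theta> * \<bar>z\<bar>)" using exp_ge_add_one_self[of "\<theta> * \<bar>z\<bar>"] by linarith
     have "s * \<bar>z\<bar> = s / \<theta> * (\<theta> * \<bar>z\<bar>)" using \<theta> by simp
     also have "... <= s / \<theta> * exp (\<theta> * \<bar>z\<bar>)"
      using \<theta>(1) s by (intro mult_left_mono ge) simp
     finally show ?thesis using e z False by (simp add: k_def)
    qed
   next
    case False
    then show ?thesis using s \<theta> k0[of z] by simp
   qed
  qed (use k k0 s \<theta> in auto)
  then have "- (s / \<theta> * integral\<^sup>L \<mu> k) <= (LINT z:{..<0}|\<mu>. exp (s * z) - 1 - s * z * indicator {-1<..} z)"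
   by (simp add: set_lebesgue_integral_def)
  moreover have "- \<bar>\<gamma>\<bar> * s <= \<gamma> * s" using s by (intro mult_right_mono) auto
  moreover have "0 <= \<sigma>\<^sup>2 / 2 * s\<^sup>2" by simp
  ultimately have "- \<bar>\<gamma>\<bar> * s - s / \<theta> * integral\<^sup>L \<mu> k <= laplace_exponent \<gamma> \<sigma> \<mu> s"
   unfolding laplace_exponent_def by linarith
  then show ?thesis by (simp add: algebra_simps)
 qed
 have "0 <= integral\<^sup>L \<mu> k" using k0 by simp
 then have "0 <= \<bar>\<gamma>\<bar> + integral\<^sup>L \<mu> k / \<theta>" using \<theta> by simp
 then show ?thesis using le by blast
qed

text \<open>Enclose \<open>E\<close> in an open set of barely larger measure. A point of
  \<open>E\<close> stays in the open set under small translations, so leaving \<open>E\<close> means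
  landing in the small excess. It will be applied to the set of times that a path spends at a
  point.\<close>

lemma translation_null:
 fixes E :: "real set"
 assumes E: "E \<in> sets borel" and h: "h \<longlonglongrightarrow> 0" and T: "0 <= T"
 shows "(%j. \<integral>\<^sup>+t. indicator ({0..T} Int E) t * indicator (- E) (t + h j) \<partial>lborel) \<longlonglongrightarrow> 0"
proof (rule tendsto_zero_ennreal)
 fix e :: real assume e: "0 < e"
 obtain O' where O: "open O'" "E \<subseteq> O'" "emeasure lborel (O' - E) < ennreal (e/2)"
  using outer_regular_lborel[OF E, of "e/2"] e by auto
 have [measurable]: "O' \<in> sets borel" "E \<in> sets borel" using O E by auto
 have "(%j. \<integral>\<^sup>+t. indicator ({0..T} Int E) t * indicator (- O') (t + h j) \<partial>lborel) \<longlonglongrightarrow> (\<integral>\<^sup>+t. 0 \<partial>(lborel :: real measure))"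
 proof (rule nn_integral_dominated_convergence[where w="indicator {0..T}"])
  show "AE t in lborel. (%j. indicator ({0..T} Int E) t * indicator (- O') (t + h j) :: ennreal) \<longlonglongrightarrow> 0"
  proof (rule AE_I2)
   fix t :: real
   show "(%j. indicator ({0..T} Int E) t * indicator (- O') (t + h j) :: ennreal) \<longlonglongrightarrow> 0"
   proof (cases "t \<in> E")
    case True
    have "(%j. t + h j) \<longlonglongrightarrow> t" using tendsto_add[OF tendsto_const h, of t] by simp
    then have "\<forall>\<^sub>F j in sequentially. t + h j \<in> O'" using True O by (intro topological_tendstoD) auto
    then have "\<forall>\<^sub>F j in sequentially. (indicator ({0..T} Int E) t * indicator (- O') (t + h j) :: ennreal) = 0"
     by eventually_elim simp
    then show ?thesis by (rule tendsto_eventually)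
   qed simp
  qed
  show "(\<integral>\<^sup>+t. indicator {0..T} t \<partial>(lborel :: real measure)) < \<infinity>" using T by simp
 qed (auto split: split_indicator)
 then have "\<forall>\<^sub>F j in sequentially. (\<integral>\<^sup>+t. indicator ({0..T} Int E) t * indicator (- O') (t + h j) \<partial>lborel) < ennreal (e/2)"
  using e by (intro order_tendstoD(2)) auto
 then show "\<forall>\<^sub>F j in sequentially. (\<integral>\<^sup>+t. indicator ({0..T} Int E) t * indicator (- E) (t + h j) \<partial>lborel) < ennreal e"
 proof eventually_elim
  case (elim j)
  have "(\<integral>\<^sup>+t. indicator ({0..T} Int E) t * indicator (- E) (t + h j) \<partial>lborel)
   <= (\<integral>\<^sup>+t. indicator ({0..T} Int E) t * indicator (- O') (t + h j) + indicator (O' - E) (t + h j) \<partial>lborel)"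
   using O by (intro nn_integral_mono) (auto split: split_indicator)
  also have "... = (\<integral>\<^sup>+t. indicator ({0..T} Int E) t * indicator (- O') (t + h j) \<partial>lborel) + (\<integral>\<^sup>+t. indicator (O' - E) (t + h j) \<partial>lborel)"
   by (rule nn_integral_add) measurable
  also have "(\<integral>\<^sup>+t. indicator (O' - E) (t + h j) \<partial>lborel) = emeasure lborel (O' - E)"
   using nn_integral_real_affine[of "indicator (O' - E)" 1 "h j"] by (simp add: add.commute)
  also have "(\<integral>\<^sup>+t. indicator ({0..T} Int E) t * indicator (- O') (t + h j) \<partial>lborel) + emeasure lborel (O' - E) < ennreal (e/2) + ennreal (e/2)"
   using elim O(3) by (rule add_strict_mono)
  also have "... = ennreal e" using e by (simp flip: ennreal_plus)
  finally show ?case .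
 qed
qed

section \<open>Exponential moments of the Levy process and its positivity at small times\<close>

locale laplace = discounted M X N r a b q
 for M :: "'w measure" and X :: "real => 'w => real" and N :: "real => 'w => nat" and r a b q :: real +
 fixes \<gamma> \<sigma> :: real and \<mu> :: "real measure"
 assumes levy_measure: "levy_measure_neg \<mu>"
  and has_laplace: "has_laplace_exponent M X (laplace_exponent \<gamma> \<sigma> \<mu>)"
  and not_subordinator: "\<not> subordinator M (%t w. - X t w)"
  and tail: "\<exists>\<theta>>0. (\<integral>\<^sup>+y\<in>{..-1}. ennreal (exp (\<theta> * \<bar>y\<bar>)) \<partial>\<mu>) < \<infinity>"
begin

abbreviation "\<psi> \<equiv> laplace_exponent \<gamma> \<sigma> \<mu>"

lemma exp_X1_integrable: "0 <= s ==> integrable M (%w. exp (s * X 1 w))"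
 and exp_X1: "0 <= s ==> expectation (%w. exp (s * X 1 w)) = exp (\<psi> s)"
proof -
 assume s: "0 <= s"
 then show i: "integrable M (%w. exp (s * X 1 w))" using has_laplace by (simp add: has_laplace_exponent_def)
 have "0 < expectation (%w. exp (s * X 1 w))" using i by (intro expectation_greater) auto
 moreover have "ln (expectation (%w. exp (s * X 1 w))) = \<psi> s"
  using has_laplace s by (simp add: has_laplace_exponent_def)
 ultimately show "expectation (%w. exp (s * X 1 w)) = exp (\<psi> s)" by (metis exp_ln)
qed

text \<open>Non-negative integrals, because at times other than 1 finiteness of the exponential
  moments is still open; \<open>nn_exp_frac\<close> obtains it by taking roots.\<close>

lemma nn_exp_power:
 assumes h: "0 <= h"
 shows "(\<integral>\<^sup>+w. ennreal (exp (s * X (real j * h) w)) \<partial>M) = (\<integral>\<^sup>+w. ennreal (exp (s * X h w)) \<partial>M) ^ j"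
proof -
 have mono: "mono (%i::nat. real i * h)" using h by (auto intro!: monoI mult_right_mono)
 have ind: "indep_vars (%_. borel) (%i w. ennreal (exp (s * DX (real i * h) (real (Suc i) * h) w))) {..<j}"
  by (rule indep_vars_compose2[OF X_indep[OF mono]]) (use h in auto)
 have "(\<integral>\<^sup>+w. ennreal (exp (s * X (real j * h) w)) \<partial>M) = (\<integral>\<^sup>+w. (\<Prod>i<j. ennreal (exp (s * DX (real i * h) (real (Suc i) * h) w))) \<partial>M)"
 proof (rule nn_integral_cong_AE)
  show "AE w in M. ennreal (exp (s * X (real j * h) w)) = (\<Prod>i<j. ennreal (exp (s * DX (real i * h) (real (Suc i) * h) w)))"
   using X_0
  proof eventually_elim
   case (elim w)
   have "X (real j * h) w = (\<Sum>i<j. DX (real i * h) (real (Suc i) * h) w)"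
    using sum_lessThan_telescope[of "%i. X (real i * h) w" j] elim by (simp only: DX_def) simp
   then show ?case by (simp add: sum_distrib_left exp_sum prod_ennreal)
  qed
 qed
 also have "... = (\<Prod>i<j. \<integral>\<^sup>+w. ennreal (exp (s * DX (real i * h) (real (Suc i) * h) w)) \<partial>M)"
  by (rule indep_vars_nn_integral[OF _ ind]) auto
 also have "... = (\<Prod>i<j. \<integral>\<^sup>+w. ennreal (exp (s * X h w)) \<partial>M)"
 proof (rule prod.cong[OF refl])
  fix i
  have m: "DX (real i * h) (real (Suc i) * h) \<in> borel_measurable M" "X h \<in> borel_measurable M"
   using h by (simp_all del: of_nat_Suc)
  have "distr M borel (DX (real i * h) (real (Suc i) * h)) = distr M borel (X h)"
   using X_stationary[of "real i * h" "real (Suc i) * h"] h by (simp add: algebra_simps)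
  then have "(\<integral>\<^sup>+x. ennreal (exp (s * x)) \<partial>distr M borel (DX (real i * h) (real (Suc i) * h))) = (\<integral>\<^sup>+x. ennreal (exp (s * x)) \<partial>distr M borel (X h))" by simp
  then show "(\<integral>\<^sup>+w. ennreal (exp (s * DX (real i * h) (real (Suc i) * h) w)) \<partial>M) = (\<integral>\<^sup>+w. ennreal (exp (s * X h w)) \<partial>M)"
   using m by (simp add: nn_integral_distr)
 qed
 finally show ?thesis by simp
qed

lemma nn_exp_frac:
 assumes s: "0 <= s" and n: "0 < n"
 shows "(\<integral>\<^sup>+w. ennreal (exp (s * X (real j / real n) w)) \<partial>M) = ennreal (exp (real j / real n * \<psi> s))"
proof -
 define A where "A = (\<integral>\<^sup>+w. ennreal (exp (s * X (1 / real n) w)) \<partial>M)"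
 have "A ^ n = (\<integral>\<^sup>+w. ennreal (exp (s * X 1 w)) \<partial>M)"
  using nn_exp_power[of "1 / real n" s n] n by (simp add: A_def)
 also have "... = ennreal (exp (\<psi> s))"
  using exp_X1_integrable[OF s] by (simp add: nn_integral_eq_integral exp_X1 s)
 finally have An: "A ^ n = ennreal (exp (\<psi> s))" .
 have "A ~= \<top>"
 proof
  assume "A = \<top>"
  then have "A ^ n = \<top>" using n by (simp add: power_eq_top_ennreal)
  then show False using An by simp
 qed
 then obtain x where x: "A = ennreal x" "0 <= x" by (cases A) auto
 then have "ennreal (x ^ n) = ennreal (exp (\<psi> s))" using An by (simp add: ennreal_power)
 then have "x ^ n = exp (\<psi> s)" using x by simp
 also have "... = exp (\<psi> s / real n) ^ n" using n by (simp flip: exp_of_nat_mult)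
 finally have "x = exp (\<psi> s / real n)" using x n by (intro power_eq_imp_eq_base[of x n]) auto
 then have "A ^ j = ennreal (exp (real j / real n * \<psi> s))"
  using x by (simp add: ennreal_power flip: exp_of_nat_mult)
 then show ?thesis using nn_exp_power[of "1 / real n" s j] by (simp add: A_def)
qed

text \<open>The exponential Markov inequality bounds the probability of exceeding \<open>e\<close>
  by \<open>exp (- s * e)\<close> for every \<open>s\<close>.\<close>

lemma nn_exp_le_1_imp_nonpos:
 assumes Z: "Z \<in> borel_measurable M" and le: "!!s. 0 <= s ==> (\<integral>\<^sup>+w. ennreal (exp (s * Z w)) \<partial>M) <= 1"
 shows "AE w in M. Z w <= 0"
proof -
 have "AE w in M. Z w <= 1 / real (Suc k)" for k
 proof -
  define p where "p = prob {w\<in>space M. 1 / real (Suc k) < Z w}"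
  define e where "e = 1 / real (Suc k)"
  have e: "0 < e" by (simp add: e_def)
  have S: "{w\<in>space M. e < Z w} \<in> events" using Z by measurable
  have b: "p * exp (s * e) <= 1" if s: "0 <= s" for s
  proof -
   have "ennreal (p * exp (s * e)) = (\<integral>\<^sup>+w. ennreal (exp (s * e)) * indicator {w\<in>space M. e < Z w} w \<partial>M)"
    using S by (subst nn_integral_cmult_indicator) (auto simp: p_def e_def emeasure_eq_measure mult.commute ennreal_mult[symmetric])
   also have "... <= (\<integral>\<^sup>+w. ennreal (exp (s * Z w)) \<partial>M)"
    using s by (intro nn_integral_mono) (auto split: split_indicator intro!: ennreal_leI mult_left_mono)
   also have "... <= 1" by (rule le[OF s])
   finally show ?thesis by simp
  qed
  have "p = 0"
  proof (rule ccontr)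
   assume "p ~= 0"
   then have p: "0 < p" using measure_nonneg[of M "{w\<in>space M. 1 / real (Suc k) < Z w}"] unfolding p_def by linarith
   \<comment> \<open>Makes \<open>p * (1 + s * e)\<close> equal to \<open>p + 1\<close>, which
     exceeds the bound 1.\<close>
   define s where "s = 1 / (p * e)"
   have "p * (1 + s * e) <= p * exp (s * e)" using p by (intro mult_left_mono) auto
   also have "... <= 1" using p e by (intro b) (simp add: s_def)
   finally show False using p e by (simp add: s_def distrib_left)
  qed
  then have "AE w in M. w \<notin> {w\<in>space M. e < Z w}"
   using S by (intro AE_not_in) (simp add: null_sets_def emeasure_eq_measure p_def e_def)
  with AE_space show ?thesis by eventually_elim (auto simp: e_def)
 qed
 then have "AE w in M. ALL k. Z w <= 1 / real (Suc k)" by (simp add: AE_all_countable)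
 then show ?thesis
  by eventually_elim (rule LIMSEQ_le_const[OF LIMSEQ_Suc[OF lim_const_over_n[of 1]]], blast)
qed

text \<open>Otherwise \<psi> would be non-positive on the half-line, so by the exponential bound all
  increments over rational intervals would be non-positive. By right continuity \<open>- X\<close>
  would then be a subordinator.\<close>

lemma X1_pos: "0 < prob {w\<in>space M. 0 < X 1 w}"
proof (rule ccontr)
 assume "\<not> ?thesis"
 then have "prob {w\<in>space M. 0 < X 1 w} = 0" using measure_nonneg[of M] by (simp add: antisym not_less)
 then have "AE w in M. w \<notin> {w\<in>space M. 0 < X 1 w}"
  by (intro AE_not_in) (simp add: null_sets_def emeasure_eq_measure)
 then have X1: "AE w in M. X 1 w <= 0" using AE_space by eventually_elim auto
 have psi: "\<psi> s <= 0" if s: "0 <= s" for s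
 proof -
  have "exp (\<psi> s) <= 1" unfolding exp_X1[OF s, symmetric]
   using X1 s by (intro integral_le_const exp_X1_integrable) (auto elim!: eventually_mono simp: mult_nonneg_nonpos)
  then show ?thesis by simp
 qed
 have Xn: "AE w in M. X (real j / real (Suc n)) w <= 0" for j n
 proof (rule nn_exp_le_1_imp_nonpos)
  fix s :: real assume s: "0 <= s"
  have "real j / real (Suc n) * \<psi> s <= 0" by (intro mult_nonneg_nonpos psi s) simp
  then show "(\<integral>\<^sup>+w. ennreal (exp (s * X (real j / real (Suc n)) w)) \<partial>M) <= 1"
   by (subst nn_exp_frac[OF s]) (auto simp del: of_nat_Suc)
 qed (simp del: of_nat_Suc)
 have Dn: "AE w in M. X (real (i + j) / real (Suc n)) w <= X (real i / real (Suc n)) w" for i j n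
 proof -
  have m: "0 <= real i / real (Suc n)" "real i / real (Suc n) <= real (i + j) / real (Suc n)" by (simp_all add: divide_right_mono)
  have "distr M borel (DX (real i / real (Suc n)) (real (i + j) / real (Suc n))) = distr M borel (X (real j / real (Suc n)))"
   using X_stationary[OF m] by (simp add: diff_divide_distrib[symmetric] del: of_nat_Suc)
  moreover have "AE x in distr M borel (X (real j / real (Suc n))). x <= 0"
   using Xn[of j n] by (subst AE_distr_iff) auto
  ultimately have "AE x in distr M borel (DX (real i / real (Suc n)) (real (i + j) / real (Suc n))). x <= 0" by (simp only:)
  then have "AE w in M. DX (real i / real (Suc n)) (real (i + j) / real (Suc n)) w <= 0"
   by (subst (asm) AE_distr_iff) auto
  then show ?thesis by (simp add: DX_def)
 qed
 have "AE w in M. ALL n i j. X (real (i + j) / real (Suc n)) w <= X (real i / real (Suc n)) w"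
  using Dn by (simp add: AE_all_countable)
 then have "AE w in M. mono_on {0..} (%t. - X t w)"
  using X_cadlag
 proof eventually_elim
  case (elim w)
  define D where "D m t = real (nat \<lfloor>t * real (Suc m)\<rfloor> + 1) / real (Suc m)" for m t
  have D: "(%m. X (D m t) w) \<longlonglongrightarrow> X t w" if t: "0 <= t" for t
  proof -
   have b: "t < D m t" "D m t <= t + 1 / real (Suc m)" for m
   proof -
    have "real (nat \<lfloor>t * real (Suc m)\<rfloor>) = of_int \<lfloor>t * real (Suc m)\<rfloor>" using t by (intro of_nat_nat) (simp del: of_nat_Suc)
    then have Dq: "D m t = (of_int \<lfloor>t * real (Suc m)\<rfloor> + 1) / real (Suc m)"
     by (simp only: D_def of_nat_add of_nat_1)
    have "t * real (Suc m) < of_int \<lfloor>t * real (Suc m)\<rfloor> + 1" "of_int \<lfloor>t * real (Suc m)\<rfloor> <= t * real (Suc m)" by linarith+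
    then show "t < D m t" "D m t <= t + 1 / real (Suc m)"
     by (simp add: Dq less_divide_eq del: of_nat_Suc, simp add: Dq add_divide_distrib divide_le_eq del: of_nat_Suc)
   qed
   have up: "(%m. t + 1 / real (Suc m)) \<longlonglongrightarrow> t"
    using tendsto_add[OF tendsto_const LIMSEQ_Suc[OF lim_const_over_n[of 1]], of t] by simp
   have "(%m. D m t) \<longlonglongrightarrow> t"
    by (rule tendsto_sandwich[OF _ _ tendsto_const up]) (use b in \<open>auto intro!: always_eventually less_imp_le simp del: of_nat_Suc\<close>)
   then have "filterlim (%m. D m t) (at_right t) sequentially"
    unfolding filterlim_at using b by (auto intro!: always_eventually simp: less_imp_neq[THEN not_sym])
   then show ?thesis by (rule filterlim_compose[OF cadlag_at_right[OF elim(2) t]])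
  qed
  show ?case
  proof (rule mono_onI)
   fix s t :: real assume st: "s \<in> {0..}" "t \<in> {0..}" "s <= t"
   have "X t w <= X s w"
   proof (rule LIMSEQ_le[OF D D])
    have "X (D m t) w <= X (D m s) w" for m
    proof -
     have "nat \<lfloor>s * real (Suc m)\<rfloor> <= nat \<lfloor>t * real (Suc m)\<rfloor>" using st by (intro nat_mono floor_mono mult_right_mono) auto
     then obtain j where "nat \<lfloor>t * real (Suc m)\<rfloor> + 1 = (nat \<lfloor>s * real (Suc m)\<rfloor> + 1) + j" by (metis add.commute add.left_commute le_Suc_ex)
     then show ?thesis unfolding D_def using elim(1)[rule_format, of "nat \<lfloor>s * real (Suc m)\<rfloor> + 1" j m] by simp
    qed
    then show "EX N. \<forall>n\<ge>N. X (D n t) w <= X (D n s) w" by blast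
   qed (use st in auto)
   then show "- X s w <= - X t w" by simp
  qed
 qed
 moreover have "levy_process M (%t w. - X t w)"
  unfolding levy_process_def
 proof (intro conjI allI impI)
  show "AE w in M. - X 0 w = 0" using X_0 by simp
  show "AE w in M. cadlag (%t. - X t w)" using X_cadlag
   by eventually_elim (use cadlag_diff[OF cadlag_const[of 0]] in simp)
  fix ts :: "nat => real" and n assume "mono ts" "0 <= ts 0"
  from indep_vars_compose2[OF X_indep[OF this, of n], of "%_. uminus" "%_. borel"]
  show "indep_vars (%_. borel) (%i w. - X (ts (Suc i)) w - - X (ts i) w) {..<n}" by (simp add: DX_def)
 next
  fix s t :: real assume st: "0 <= s" "s <= t"
  then have m: "DX s t \<in> borel_measurable M" "X (t - s) \<in> borel_measurable M" by auto
  have "distr M borel (%w. - X t w - - X s w) = distr (distr M borel (DX s t)) borel uminus"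
   using m by (subst distr_distr) (auto simp: comp_def DX_def)
  also have "... = distr M borel (%w. - X (t - s) w)"
   using m by (simp add: X_stationary[OF st] distr_distr comp_def)
  finally show "distr M borel (%w. - X t w - - X s w) = distr M borel (%w. - X (t - s) w)" .
 qed auto
 ultimately show False using not_subordinator by (simp add: subordinator_def)
qed

text \<open>If \<open>X 1\<close> exceeds \<open>e\<close> with probability \<open>p > 0\<close>,
  then \<psi> is at least \<open>ln p + s * e\<close>.\<close>

lemma psi_at_top: "\<exists>s0\<ge>1. \<forall>s\<ge>s0. C <= \<psi> s"
proof -
 have "\<exists>k::nat. 0 < prob {w\<in>space M. 1 / real (Suc k) < X 1 w}"
 proof (rule ccontr)
  assume "\<not> ?thesis"
  then have "prob {w\<in>space M. 1 / real (Suc k) < X 1 w} = 0" for k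
   using measure_nonneg[of M] by (metis antisym not_less)
  then have "AE w in M. w \<notin> {w\<in>space M. 1 / real (Suc k) < X 1 w}" for k
   by (intro AE_not_in) (simp add: null_sets_def emeasure_eq_measure)
  then have "AE w in M. ALL k. w \<notin> {w\<in>space M. 1 / real (Suc k) < X 1 w}" by (simp add: AE_all_countable)
  then have "AE w in M. X 1 w <= 0" using AE_space
  proof eventually_elim
   case (elim w)
   then have "X 1 w <= 1 / real (Suc k)" for k by (auto simp: not_less)
   then show ?case by (intro LIMSEQ_le_const[OF LIMSEQ_Suc[OF lim_const_over_n[of 1]]]) blast
  qed
  then have "prob {w\<in>space M. 0 < X 1 w} = 0" by (subst prob_eq_0) (auto elim!: eventually_mono)
  then show False using X1_pos by simp
 qed
 then obtain k :: nat where k: "0 < prob {w\<in>space M. 1 / real (Suc k) < X 1 w}" by blast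
 define e where "e = 1 / real (Suc k)"
 define p where "p = prob {w\<in>space M. e < X 1 w}"
 have e: "0 < e" and p: "0 < p" using k by (simp_all add: e_def p_def)
 have lb: "ln p + s * e <= \<psi> s" if s: "0 <= s" for s
 proof -
  have "p * exp (s * e) = expectation (%w. exp (s * e) * indicator {w\<in>space M. e < X 1 w} w)"
   by (simp add: p_def)
  also have "... <= expectation (%w. exp (s * X 1 w))"
   using s by (intro integral_mono exp_X1_integrable integrable_mult_right integrable_real_indicator)
    (auto simp: emeasure_eq_measure split: split_indicator intro!: mult_left_mono)
  finally have "p * exp (s * e) <= exp (\<psi> s)" by (simp add: exp_X1 s)
  then have "ln (p * exp (s * e)) <= ln (exp (\<psi> s))" using p by (subst ln_le_cancel_iff) auto
  then show ?thesis using p by (simp add: ln_mult)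
 qed
 show ?thesis
 proof (intro exI[of _ "max 1 ((C - ln p) / e)"] conjI allI impI)
  fix s assume s: "max 1 ((C - ln p) / e) <= s"
  then have "C - ln p <= s * e" using e by (simp add: divide_le_eq)
  then show "C <= \<psi> s" using lb[of s] s by simp
 qed simp
qed

text \<open>A second moment argument in the manner of Paley and Zygmund for
  \<open>exp (s * X h)\<close>, where \<open>h\<close> is about 1 / \<psi>(s). Its mean is at least
  \<open>exp (1/2)\<close>, clearly above the value 1 that bounds it where \<open>X h\<close> is
  non-positive, and its second moment \<open>exp (h * \<psi> (2 * s))\<close> is at most
  \<open>exp 5\<close> for suitable large \<open>s\<close>.\<close>

lemma X_positive_small_times:
 "\<exists>\<epsilon>>0. \<forall>\<delta>>0. EX h. 0 < h & h < \<delta> & \<epsilon> <= prob {w\<in>space M. 0 < X h w}"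
proof -
 obtain C where C: "0 <= C" "!!s. 1 <= s ==> \<psi> s <= C * s\<^sup>2" using laplace_exponent_upper[OF levy_measure] by blast
 \<comment> \<open>Chosen so that the second-moment term \<open>l / 2 * exp 5\<close> uses half of
   the surplus \<open>exp (1/2) - 1\<close>; the other half is left for the probability.\<close>
 define l where "l = (exp (1/2) - 1) / exp (5::real)"
 have l: "0 < l" by (simp add: l_def)
 show ?thesis
 proof (rule exI[of _ "l * (exp (1/2) - 1)"], intro conjI allI impI)
  show "0 < l * (exp (1 / 2) - 1)" using l by simp
  fix \<delta> :: real assume \<delta>: "0 < \<delta>"
  \<comment> \<open>The summand 1 gives \<psi>(s) at least 1, and the summand 1 / \<delta> makes 1 /
    \<psi>(s) smaller than \<delta>.\<close>
  obtain s0 where s0: "1 <= s0" "!!s. s0 <= s ==> 1 + 1 / \<delta> <= \<psi> s" using psi_at_top[of "1 + 1 / \<delta>"] by blast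
  obtain n0 :: nat where n0: "s0 <= 2 ^ n0" using real_arch_pow[of 2 s0] by (auto intro: less_imp_le)
  have big: "1 + 1 / \<delta> <= \<psi> (2 ^ n)" if "n0 <= n" for n
   by (rule s0(2)[OF order.trans[OF n0 power_increasing[OF that]]]) simp
  \<comment> \<open>If \<psi> grew by more than the factor 5 at every doubling, it would outgrow its
    quadratic bound, which allows only the factor 4.\<close>
  have "\<exists>n\<ge>n0. \<psi> (2 ^ Suc n) <= 5 * \<psi> (2 ^ n)"
  proof (rule ccontr)
   assume no: "\<not> ?thesis"
   have neg: "5 * \<psi> (2 ^ n) <= \<psi> (2 ^ Suc n)" if "n0 <= n" for n using no that by (meson not_le less_imp_le)
   have g: "5 ^ k <= \<psi> (2 ^ (n0 + k))" for k
   proof (induction k)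
    case 0
    have "0 < 1 / \<delta>" using \<delta> by simp
    then have "1 <= \<psi> (2 ^ n0)" using big[of n0] by linarith
    then show ?case by simp
   next
    case (Suc k)
    then show ?case using neg[of "n0 + k"] by simp
   qed
   have "(5/4) ^ k <= C * 4 ^ n0" for k :: nat
   proof -
    have "(5::real) ^ k <= C * (2 ^ (n0 + k))\<^sup>2" using g[of k] C(2)[of "2 ^ (n0 + k)"] by simp
    also have "(2 ^ (n0 + k))\<^sup>2 = (4::real) ^ (n0 + k)"
    proof -
     have "(2 ^ (n0 + k))\<^sup>2 = ((2::real)\<^sup>2) ^ (n0 + k)" by (simp only: power_mult[symmetric] mult.commute)
     then show ?thesis by simp
    qed
    finally have "(5::real) ^ k <= (C * 4 ^ n0) * 4 ^ k" by (simp add: power_add mult_ac)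
    then show ?thesis by (simp add: power_divide divide_le_eq)
   qed
   moreover obtain k where "C * 4 ^ n0 < (5/4) ^ k" using real_arch_pow[of "5/4" "C * 4 ^ n0"] by auto
   ultimately show False by (meson not_less)
  qed
  then obtain n where n: "n0 <= n" "\<psi> (2 ^ Suc n) <= 5 * \<psi> (2 ^ n)" by blast
  define s where "s = (2::real) ^ n"
  have s: "0 <= s" "1 + 1 / \<delta> <= \<psi> s" "\<psi> (2 * s) <= 5 * \<psi> s" using big[OF n(1)] n(2) by (simp_all add: s_def)
  have "0 < 1 / \<delta>" using \<delta> by simp
  then have p1: "1 <= \<psi> s" using s(2) by linarith
  \<comment> \<open>Rounding up makes \<open>h = 1 / real m\<close> a time at which exponential
    moments are known, and m at most 2 * \<psi>(s) gives h * \<psi>(s) at least 1/2.\<close>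
  define m where "m = nat \<lceil>\<psi> s\<rceil>"
  have m: "\<psi> s <= real m" "real m <= \<psi> s + 1" "0 < m" using p1 by (simp_all add: m_def)
  define h where "h = 1 / real m"
  have h: "0 < h" "h < \<delta>"
  proof -
   have "1 / \<delta> < real m" using s(2) m(1) by simp
   then show "h < \<delta>" using \<delta> m(3) by (simp add: h_def field_simps)
  qed (use m in \<open>simp add: h_def\<close>)
  have nn: "(\<integral>\<^sup>+w. ennreal (exp (u * X h w)) \<partial>M) = ennreal (exp (h * \<psi> u))" if "0 <= u" for u
   using nn_exp_frac[OF that m(3), of 1] by (simp add: h_def)
  have hX [measurable]: "X h \<in> borel_measurable M" using h by simp
  have int: "has_bochner_integral M (%w. exp (u * X h w)) (exp (h * \<psi> u))" if "0 <= u" for u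
   using nn[OF that] by (intro has_bochner_integral_nn_integral) auto
  have i1: "integrable M (%w. exp (s * X h w))" "expectation (%w. exp (s * X h w)) = exp (h * \<psi> s)"
   using int[OF s(1)] by (auto simp: has_bochner_integral_iff)
  have i2: "integrable M (%w. exp ((2 * s) * X h w))" "expectation (%w. exp ((2 * s) * X h w)) = exp (h * \<psi> (2 * s))"
   using int[of "2 * s"] s(1) by (auto simp: has_bochner_integral_iff)
  define A where "A = {w\<in>space M. 0 < X h w}"
  have A [measurable]: "A \<in> events" unfolding A_def by measurable
  have "exp (1/2) <= exp (h * \<psi> s)"
   using m p1 by (simp add: h_def field_simps)
  also have "... <= expectation (%w. 1 + (l / 2 * exp ((2 * s) * X h w) + 1 / (2 * l) * indicator A w))"
   unfolding i1(2)[symmetric]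
  proof (rule integral_mono[OF i1(1)])
   show "integrable M (%w. 1 + (l / 2 * exp ((2 * s) * X h w) + 1 / (2 * l) * indicator A w))"
    using i2(1) A by (intro Bochner_Integration.integrable_add integrable_mult_right integrable_const integrable_real_indicator) (auto simp: emeasure_eq_measure)
   fix w assume w: "w \<in> space M"
   show "exp (s * X h w) <= 1 + (l / 2 * exp ((2 * s) * X h w) + 1 / (2 * l) * indicator A w)"
   proof (cases "0 < X h w")
    case True
    define z where "z = exp (s * X h w)"
    have "exp ((2 * s) * X h w) = z\<^sup>2" by (simp add: z_def power2_eq_square flip: exp_add)
    moreover have "0 <= (l * z - 1)\<^sup>2 / (2 * l)" using l by simp
    moreover have "(l * z - 1)\<^sup>2 / (2 * l) = l / 2 * z\<^sup>2 + 1 / (2 * l) - z"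
     using l by (simp add: power2_eq_square field_simps)
    ultimately show ?thesis using True w by (simp add: A_def z_def)
   next
    case False
    then have "exp (s * X h w) <= 1" using s(1) by (simp add: mult_nonneg_nonpos)
    moreover have "0 <= l / 2 * exp ((2 * s) * X h w)" using l by simp
    ultimately have "exp (s * X h w) <= 1 + l / 2 * exp ((2 * s) * X h w)" by linarith
    then show ?thesis using False by (simp add: A_def)
   qed
  qed
  also have "... = 1 + (l / 2 * exp (h * \<psi> (2 * s)) + 1 / (2 * l) * prob A)"
   using i2 A by (simp add: prob_space emeasure_eq_measure)
  also have "... <= 1 + (l / 2 * exp 5 + 1 / (2 * l) * prob A)"
  proof -
   have "h * \<psi> (2 * s) <= h * (5 * real m)" using h s(3) m(1) by (intro mult_left_mono) auto
   also have "... = 5" using m by (simp add: h_def)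
   finally show ?thesis using l by simp
  qed
  finally have main: "exp (1/2) <= 1 + (l / 2 * exp 5 + 1 / (2 * l) * prob A)" .
  have "2 * (l / 2 * exp 5) = exp (1/2) - 1" by (simp only: l_def times_divide_eq_left times_divide_eq_right) simp
  with main have "l / 2 * exp 5 <= 1 / (2 * l) * prob A" by linarith
  then have "l / 2 * exp 5 * (2 * l) <= prob A" using l by (simp add: field_simps)
  moreover have "l * exp 5 = exp (1/2) - 1" by (simp add: l_def)
  then have "l * (exp (1/2) - 1) = l / 2 * exp 5 * (2 * l)" by (simp flip: \<open>l * exp 5 = exp (1/2) - 1\<close>)
  ultimately have "l * (exp (1/2) - 1) <= prob A" by linarith
  then show "EX h. 0 < h & h < \<delta> & l * (exp (1/2) - 1) <= prob {w\<in>space M. 0 < X h w}"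
   using h by (auto simp: A_def)
 qed
qed

end

section \<open>Moment bounds\<close>

lemma nn_integral_LIMSEQ_le:
 fixes u :: "nat => 'a => ennreal"
 assumes u: "!!k. u k \<in> borel_measurable M" and lim: "AE x in M. (%k. u k x) \<longlonglongrightarrow> z x"
  and le: "\<forall>\<^sub>F k in sequentially. (\<integral>\<^sup>+x. u k x \<partial>M) <= B"
 shows "(\<integral>\<^sup>+x. z x \<partial>M) <= B"
proof -
 have "(\<integral>\<^sup>+x. z x \<partial>M) = (\<integral>\<^sup>+x. liminf (%k. u k x) \<partial>M)"
  using lim by (intro nn_integral_cong_AE) (auto elim!: eventually_mono simp: lim_imp_Liminf)
 also have "... <= liminf (%k. \<integral>\<^sup>+x. u k x \<partial>M)" using u by (rule nn_integral_liminf)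
 also have "... <= limsup (%k. \<integral>\<^sup>+x. u k x \<partial>M)" by (rule Liminf_le_Limsup) simp
 also have "... <= B" using le by (rule Limsup_bounded)
 finally show ?thesis .
qed

text \<open>\<open>exp w - w\<close>, rather than \<open>exp w\<close>, serves as Lyapunov function
  for the walk. Its minimum is at 0, so reflection to 0 never raises it, whereas a bound by
  \<open>exp w\<close> would lose a reflection term in every step. \<open>exp_le_double\<close>
  returns to the exponential.\<close>

lemma exp_minus_self_mono: "0 <= x ==> x <= y ==> exp x - x <= exp y - (y::real)"
proof -
 assume xy: "0 <= x" "x <= y"
 have "y - x <= exp (y - x) - 1" using exp_ge_add_one_self[of "y - x"] by linarith
 also have "... <= exp x * (exp (y - x) - 1)" using xy mult_right_mono[of 1 "exp x" "exp (y - x) - 1"] by simp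
 also have "... = exp y - exp x" by (simp add: algebra_simps flip: exp_add)
 finally show ?thesis by simp
qed

lemma exp_le_double: "0 <= wt ==> exp wt <= 2 * (exp wt - (wt::real))"
proof -
 assume wt: "0 <= wt"
 have "2 * wt <= exp wt"
 proof (cases "wt <= 1")
  case True
  then show ?thesis using exp_ge_add_one_self[of wt] by linarith
 next
  case False
  have "wt <= exp (wt - 1)" using exp_ge_add_one_self[of "wt - 1"] by linarith
  then have "2 * wt <= exp 1 * exp (wt - 1)" using wt exp_ge_add_one_self[of "1::real"] by (intro mult_mono) auto
  then show ?thesis by (simp flip: exp_add)
 qed
 then show ?thesis by simp
qed

context driving
begin

lemma indep_past_DX:
 assumes s: "0 <= s" "0 <= h" and U: "U \<in> borel_measurable (F s)"
 shows "indep_var borel U borel (DX s (s + h))"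
 unfolding indep_var_eq
proof (intro conjI)
 show [measurable]: "U \<in> borel_measurable M" using U by (rule F_measurable_M)
 show [measurable]: "DX s (s + h) \<in> borel_measurable M" using s by simp
 show "indep_set (sigma_sets (space M) {U -` A Int space M |A. A \<in> sets borel})
   (sigma_sets (space M) {DX s (s + h) -` A Int space M |A. A \<in> sets borel})"
 proof (rule indep_set_sigma_sets)
  show "indep_set {U -` A Int space M |A. A \<in> sets borel} {DX s (s + h) -` A Int space M |A. A \<in> sets borel}"
  proof (rule indep_setI)
   fix x y assume "x \<in> {U -` A Int space M |A. A \<in> sets borel}" "y \<in> {DX s (s + h) -` A Int space M |A. A \<in> sets borel}"
   then obtain A C where x: "x = U -` A Int space M" "A \<in> sets borel" and y: "y = DX s (s + h) -` C Int space M" "C \<in> sets borel"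
    by blast
   have xF: "x \<in> sets (F s)" using measurable_sets[OF U x(2)] x(1) by (simp add: space_F)
   have sp: "space M Int z = z" if "z \<subseteq> space M" for z using that by auto
   have eq: "y = {w\<in>space M. DX s (s + h) w \<in> C}" using y by auto
   have U': "{w\<in>space M. DN s (s + h) w \<in> UNIV} = space M" "{w\<in>space M. DN 0 h w \<in> UNIV} = space M" by auto
   have "prob (x Int y) = prob x * prob {w\<in>space M. DX 0 h w \<in> C}"
    using filtration_indep_single[OF s xF y(2), of UNIV] x(1) unfolding U' eq
    by (simp add: prob_space Int_absorb2 inf.coboundedI1 Int_assoc)
   moreover have "prob y = prob {w\<in>space M. DX 0 h w \<in> C}"
    using prob_DX[of s "s + h" C] s y(2) by (simp add: eq)
   ultimately show "prob (x Int y) = prob x * prob y" by simp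
  qed auto
 qed (auto simp: Int_stable_def intro: exI[where x="_ Int _"])
qed

lemma indep_past_DN:
 assumes s: "0 <= s" "0 <= h" and U: "U \<in> borel_measurable (F s)"
 shows "indep_var borel U borel (DN s (s + h))"
 unfolding indep_var_eq
proof (intro conjI)
 show [measurable]: "U \<in> borel_measurable M" using U by (rule F_measurable_M)
 show [measurable]: "DN s (s + h) \<in> borel_measurable M" using s by simp
 show "indep_set (sigma_sets (space M) {U -` A Int space M |A. A \<in> sets borel})
   (sigma_sets (space M) {DN s (s + h) -` A Int space M |A. A \<in> sets borel})"
 proof (rule indep_set_sigma_sets)
  show "indep_set {U -` A Int space M |A. A \<in> sets borel} {DN s (s + h) -` A Int space M |A. A \<in> sets borel}"
  proof (rule indep_setI)
   fix x y assume "x \<in> {U -` A Int space M |A. A \<in> sets borel}" "y \<in> {DN s (s + h) -` A Int space M |A. A \<in> sets borel}"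
   then obtain A C where x: "x = U -` A Int space M" "A \<in> sets borel" and y: "y = DN s (s + h) -` C Int space M" "C \<in> sets borel"
    by blast
   have xF: "x \<in> sets (F s)" using measurable_sets[OF U x(2)] x(1) by (simp add: space_F)
   have eq: "y = {w\<in>space M. DN s (s + h) w \<in> C}" using y by auto
   have U': "{w\<in>space M. DX s (s + h) w \<in> UNIV} = space M" "{w\<in>space M. DX 0 h w \<in> UNIV} = space M" by auto
   have xs: "x Int space M = x" using x by auto
   have "prob (x Int y) = prob x * prob {w\<in>space M. DN 0 h w \<in> C}"
    using filtration_indep_single[OF s xF _ y(2), of UNIV] unfolding U' eq xs by (simp add: prob_space)
   moreover have "prob y = prob {w\<in>space M. DN 0 h w \<in> C}"
    using prob_DN[of s "s + h" C] s y(2) by (simp add: eq)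
   ultimately show "prob (x Int y) = prob x * prob y" by simp
  qed auto
 qed (auto simp: Int_stable_def intro: exI[where x="_ Int _"])
qed

lemma prob_DN_pos_le: "0 <= s ==> 0 <= h ==> prob {w\<in>space M. 0 < DN s (s + h) w} <= r * h"
proof (cases "h = 0")
 case False
 assume "0 <= s" "0 <= h"
 then have h: "0 <= s" "0 < h" using False by auto
 have "prob {w\<in>space M. 0 < DN s (s + h) w} = measure (poisson_pmf (r * h)) {k. 0 < k}"
  using prob_N[of s "s + h" "%k. 0 < k"] h by (simp add: DN_def)
 also have "{k::nat. 0 < k} = UNIV - {0}" by auto
 also have "measure (poisson_pmf (r * h)) (UNIV - {0}) = 1 - pmf (poisson_pmf (r * h)) 0"
  using measure_pmf.prob_compl[of "{0}" "poisson_pmf (r * h)"] by (simp add: measure_pmf_single)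
 also have "... = 1 - exp (- (r * h))" using r_pos h by (subst pmf_poisson) auto
 also have "... <= r * h" using exp_ge_add_one_self[of "- (r * h)"] by linarith
 finally show ?thesis .
qed (simp add: DN_def)

end

section \<open>Exponential moments and mean controls of the barrier strategy\<close>

context laplace
begin

text \<open>The mean is minus the limit of (1 - E exp (s X)) / s at 0. Subtracting the quotient for
  s = 1 makes the integrands non-negative by convexity, so Fatou applies and gives integrability
  together with the bound.\<close>

lemma X_frac_mean:
 assumes C: "0 <= C" "!!s. 0 < s ==> s <= 1 ==> - C * s <= \<psi> s" and n: "0 < n"
 shows "integrable M (X (real j / real n))" "- C * (real j / real n) <= expectation (X (real j / real n))"
proof -
 define h where "h = real j / real n"
 have h: "0 <= h" by (simp add: h_def)
 have [measurable]: "X h \<in> borel_measurable M" using h by simp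
 have nn: "(\<integral>\<^sup>+w. ennreal (exp (u * X h w)) \<partial>M) = ennreal (exp (h * \<psi> u))" if "0 <= u" for u
  using nn_exp_frac[OF that n, of j] by (simp add: h_def)
 have int: "has_bochner_integral M (%w. exp (u * X h w)) (exp (h * \<psi> u))" if "0 <= u" for u
  using nn[OF that] by (intro has_bochner_integral_nn_integral) auto
 then have int: "integrable M (%w. exp (u * X h w))" "expectation (%w. exp (u * X h w)) = exp (h * \<psi> u)" if "0 <= u" for u
  using that by (auto simp: has_bochner_integral_iff)
 define s where "s k = 1 / real (Suc k)" for k
 have s: "0 < s k" "s k <= 1" for k by (simp_all add: s_def)
 define g where "g k w = (1 - exp (s k * X h w)) / s k - (1 - exp (X h w))" for k w
 have g0: "0 <= g k w" for k w
 proof -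
  have "exp ((1 - s k) *\<^sub>R 0 + s k *\<^sub>R X h w) <= (1 - s k) * exp 0 + s k * exp (X h w)"
   using s[of k] by (intro convex_onD[OF exp_convex]) auto
  then have "s k * (1 - exp (X h w)) <= 1 - exp (s k * X h w)" by (simp add: algebra_simps)
  then show ?thesis using s[of k] by (simp add: g_def pos_le_divide_eq mult.commute)
 qed
 define Z where "Z w = exp (X h w) - 1 - X h w" for w
 have Z0: "0 <= Z w" for w unfolding Z_def using exp_ge_add_one_self[of "X h w"] by linarith
 have glim: "(%k. g k w) \<longlonglongrightarrow> Z w" for w
 proof -
  have "DERIV (%u. exp (u * X h w)) 0 :> X h w" by (auto intro!: derivative_eq_intros)
  then have D: "((%u. (exp (u * X h w) - 1) / u) \<longlongrightarrow> X h w) (at 0)" by (simp add: DERIV_def)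
  have "filterlim s (at 0) sequentially"
   unfolding filterlim_at s_def using LIMSEQ_Suc[OF lim_const_over_n[of "1::real"]] by auto
  from filterlim_compose[OF D this] have "(%k. (exp (s k * X h w) - 1) / s k) \<longlonglongrightarrow> X h w" .
  from tendsto_diff[OF tendsto_minus[OF this] tendsto_const[of "1 - exp (X h w)"]]
  have "(%k. - ((exp (s k * X h w) - 1) / s k) - (1 - exp (X h w))) \<longlonglongrightarrow> - X h w - (1 - exp (X h w))" .
  also have "(%k. - ((exp (s k * X h w) - 1) / s k) - (1 - exp (X h w))) = (%k. g k w)"
   by (simp only: g_def minus_divide_left minus_diff_eq)
  finally show ?thesis by (simp add: Z_def algebra_simps)
 qed
 define B where "B = C * h - (1 - exp (h * \<psi> 1))"
 have gB: "(\<integral>\<^sup>+w. ennreal (g k w) \<partial>M) <= ennreal B" for k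
 proof -
  have gi: "integrable M (g k)" unfolding g_def[abs_def] using int(1)[of "s k"] int(1)[of 1] s[of k]
   by (intro Bochner_Integration.integrable_diff integrable_divide integrable_const) auto
  have "expectation (g k) = (1 - exp (h * \<psi> (s k))) / s k - (1 - exp (h * \<psi> 1))"
   unfolding g_def[abs_def] using int[of "s k"] int[of 1] s[of k] by (simp add: prob_space)
  moreover have "(1 - exp (h * \<psi> (s k))) / s k <= C * h"
  proof -
   have "1 - exp (h * \<psi> (s k)) <= - (h * \<psi> (s k))" using exp_ge_add_one_self[of "h * \<psi> (s k)"] by linarith
   also have "... <= h * (C * s k)" using mult_left_mono[OF C(2)[OF s, of k] h] by simp
   finally show ?thesis using s[of k] by (simp add: divide_le_eq mult_ac)
  qed
  ultimately have "expectation (g k) <= B" by (simp add: B_def)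
  then show ?thesis using gi g0 by (simp add: nn_integral_eq_integral ennreal_leI)
 qed
 have Zle: "(\<integral>\<^sup>+w. ennreal (Z w) \<partial>M) <= ennreal B"
 proof (rule nn_integral_LIMSEQ_le[where u="%k w. ennreal (g k w)"])
  show "(%w. ennreal (g k w)) \<in> borel_measurable M" for k unfolding g_def by measurable
 qed (use glim gB in auto)
 have Zm: "Z \<in> borel_measurable M" unfolding Z_def[abs_def] by measurable
 have Zi: "integrable M Z" using Zle Zm Z0 by (intro integrableI_nonneg) (auto simp: top_unique less_top[symmetric] intro: le_less_trans)
 have B0: "0 <= B"
 proof -
  have "1 - exp (h * \<psi> 1) <= - (h * \<psi> 1)" using exp_ge_add_one_self[of "h * \<psi> 1"] by linarith
  also have "... <= C * h" using mult_left_mono[OF C(2)[of 1] h] by (simp add: mult.commute)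
  finally show ?thesis by (simp add: B_def)
 qed
 have EZ: "expectation Z <= B" using Zle Zi Z0 B0 by (simp add: nn_integral_eq_integral)
 have Xeq: "X h = (%w. exp (1 * X h w) - 1 - Z w)" by (simp add: Z_def fun_eq_iff)
 have "integrable M (%w. exp (1 * X h w) - 1 - Z w)"
  using int(1)[of 1] Zi by (intro Bochner_Integration.integrable_diff integrable_const) auto
 then show "integrable M (X (real j / real n))" by (subst (asm) Xeq[symmetric]) (simp add: h_def)
 have "expectation (X h) = expectation (%w. exp (1 * X h w) - 1 - Z w)" by (subst Xeq) simp
 also have "... = exp (h * \<psi> 1) - 1 - expectation Z" using int[of 1] Zi by (simp add: prob_space)
 also have "... >= - C * h" using EZ by (simp add: B_def)
 finally show "- C * (real j / real n) <= expectation (X (real j / real n))" by (simp add: h_def)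
qed

text \<open>\<psi> tends to 0 at 0 by dominated convergence. The 16 is a budget: the walk turns
  \<psi>(\<theta>) into the growth rate 4 * \<psi>(\<theta>), and q / 4 leaves room for polynomial
  factors below q / 2.\<close>

lemma small_theta: "\<exists>\<theta>. 0 < \<theta> & \<theta> <= 1 & \<psi> \<theta> <= q / 16"
proof -
 define s where "s k = 1 / real (Suc k)" for k
 have s: "0 < s k" "s k <= 1" for k by (simp_all add: s_def)
 have "s \<longlonglongrightarrow> 0" unfolding s_def by (rule LIMSEQ_Suc[OF lim_const_over_n])
 have [measurable]: "X 1 \<in> borel_measurable M" by simp
 have "(%k. expectation (%w. exp (s k * X 1 w))) \<longlonglongrightarrow> expectation (%w. exp (0 * X 1 w))"
 proof (rule integral_dominated_convergence[where w="%w. 1 + exp (1 * X 1 w)"])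
  show "integrable M (%w. 1 + exp (1 * X 1 w))" using exp_X1_integrable[of 1] by simp
  show "AE w in M. (%k. exp (s k * X 1 w)) \<longlonglongrightarrow> exp (0 * X 1 w)"
   using \<open>s \<longlonglongrightarrow> 0\<close> by (intro AE_I2 tendsto_intros)
  show "AE w in M. norm (exp (s k * X 1 w)) <= 1 + exp (1 * X 1 w)" for k
  proof (rule AE_I2)
   fix w
   show "norm (exp (s k * X 1 w)) <= 1 + exp (1 * X 1 w)"
   proof (cases "0 <= X 1 w")
    case True
    then have "exp (s k * X 1 w) <= exp (1 * X 1 w)" using s[of k] by (simp add: mult_left_le_one_le)
    then have "exp (s k * X 1 w) <= 1 + exp (1 * X 1 w)" by linarith
    then show ?thesis by simp
   next
    case False
    then have "exp (s k * X 1 w) <= 1" using s[of k] by (simp add: mult_nonneg_nonpos)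
    then have "exp (s k * X 1 w) <= 1 + exp (1 * X 1 w)" using exp_gt_zero[of "1 * X 1 w"] by linarith
    then show ?thesis by simp
   qed
  qed
 qed measurable
 then have "(%k. exp (\<psi> (s k))) \<longlonglongrightarrow> 1" using s(1) by (simp add: exp_X1 less_imp_le prob_space)
 then have "\<forall>\<^sub>F k in sequentially. exp (\<psi> (s k)) < exp (q / 16)" using q_pos by (intro order_tendstoD(2)) auto
 then obtain k where "exp (\<psi> (s k)) < exp (q / 16)" by (auto simp: eventually_sequentially)
 then show ?thesis using s[of k] by (intro exI[of _ "s k"]) simp
qed

text \<open>A push only lowers the walk, so the Lyapunov function \<open>exp w - w\<close> with
  \<open>w = \<theta> * (c k - a)\<close> is driven by the increment alone. The mean of the pushes
  follows since the excess over \<open>b\<close> before a cell is independent of an arrival in it,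
  which has probability at most \<open>r * \<delta>\<close>.\<close>

lemma chain_moments:
 fixes x \<theta> C :: real
 assumes \<theta>: "0 < \<theta>" and C: "0 <= C" "!!s. 0 < s ==> s <= 1 ==> - C * s <= \<psi> s"
  and n: "0 < n" and \<delta>: "\<delta> = real j / real n"
 defines "c \<equiv> %k w. chain a b x (%i. DX (real i * \<delta>) (real i * \<delta> + \<delta>) w) (%i. DN (real i * \<delta>) (real i * \<delta> + \<delta>) w) k"
  and "l \<equiv> %k w. chain_push a b x (%i. DX (real i * \<delta>) (real i * \<delta> + \<delta>) w) (%i. DN (real i * \<delta>) (real i * \<delta> + \<delta>) w) k"
  and "V0 \<equiv> exp (\<theta> * (max a x - a))"
  and "\<kappa> \<equiv> 2 * (exp (\<delta> * max 0 (\<psi> \<theta>)) - 1)"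
 shows "integrable M (%w. exp (\<theta> * (c k w - a)))"
  "expectation (%w. exp (\<theta> * (c k w - a))) <= 2 * ((1 + \<kappa>) ^ k * (V0 + real k * (\<theta> * C * \<delta>)))"
  "integrable M (l k)"
  "expectation (l k) <= real k * (r * \<delta> * (2 / \<theta>)) * ((1 + \<kappa>) ^ k * (V0 + real k * (\<theta> * C * \<delta>)))"
proof -
 have d0: "0 <= \<delta>" using \<delta> by simp
 have k0: "0 <= \<kappa>" using d0 by (simp add: \<kappa>_def)
 define wt where "wt k w = \<theta> * (c k w - a)" for k w
 have w0: "0 <= wt k w" for k w using chain_ge \<theta> by (simp add: wt_def c_def)
 define d where "d k w = DX (real k * \<delta>) (real k * \<delta> + \<delta>) w" for k w
 define e where "e k w = DN (real k * \<delta>) (real k * \<delta> + \<delta>) w" for k w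
 have c_Suc: "c (Suc k) w = max a ((if 0 < e k w then min b (c k w) else c k w) + d k w)" for k w
  by (simp add: c_def d_def e_def)
 have l_Suc: "l (Suc k) w = l k w + (if 0 < e k w then max 0 (c k w - b) else 0)" for k w
  by (simp add: l_def c_def e_def)
 have incF: "d i \<in> borel_measurable (F (real k * \<delta>))" "e i \<in> borel_measurable (F (real k * \<delta>))" if "i < k" for i k
 proof -
  have b: "0 <= real i * \<delta>" "real i * \<delta> <= real k * \<delta>" "real i * \<delta> + \<delta> <= real k * \<delta>"
  proof -
   have "(real i + 1) * \<delta> <= real k * \<delta>" using that d0 by (intro mult_right_mono) auto
   then show "real i * \<delta> + \<delta> <= real k * \<delta>" by (simp add: algebra_simps)
  qed (use that d0 in \<open>auto intro!: mult_right_mono\<close>)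
  have [measurable]: "X (real i * \<delta>) \<in> borel_measurable (F (real k * \<delta>))" "X (real i * \<delta> + \<delta>) \<in> borel_measurable (F (real k * \<delta>))"
   "N (real i * \<delta>) \<in> F (real k * \<delta>) \<rightarrow>\<^sub>M count_space UNIV" "N (real i * \<delta> + \<delta>) \<in> F (real k * \<delta>) \<rightarrow>\<^sub>M count_space UNIV"
   using b d0 by (auto intro!: X_F N_F)
  show "d i \<in> borel_measurable (F (real k * \<delta>))" unfolding d_def[abs_def] DX_def by measurable
  show "e i \<in> borel_measurable (F (real k * \<delta>))" unfolding e_def[abs_def] DN_def by measurable
 qed
 have cF: "c k \<in> borel_measurable (F (real k * \<delta>))" for k
  unfolding c_def using incF by (intro chain_measurable[where K=k]) (auto simp: d_def[abs_def] e_def[abs_def])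
 have cM [measurable]: "c k \<in> borel_measurable M" for k by (rule F_measurable_M[OF cF])
 have dM [measurable]: "d k \<in> borel_measurable M" and eM [measurable]: "e k \<in> borel_measurable M" for k
  unfolding d_def[abs_def] e_def[abs_def] using d0 by simp_all
 have wM [measurable]: "wt k \<in> borel_measurable M" for k unfolding wt_def[abs_def] by measurable
 have kd: "0 <= real k * \<delta>" for k using d0 by simp
 have distr_d: "distr M borel (d k) = distr M borel (X \<delta>)" for k
  unfolding d_def using X_stationary[of "real k * \<delta>" "real k * \<delta> + \<delta>"] d0 by simp
 have X\<delta> [measurable]: "X \<delta> \<in> borel_measurable M" using d0 by simp
 have exp_d: "integrable M (%w. exp (\<theta> * d k w))" "expectation (%w. exp (\<theta> * d k w)) = exp (\<delta> * \<psi> \<theta>)" for k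
 proof -
  have "has_bochner_integral M (%w. exp (\<theta> * X \<delta> w)) (exp (\<delta> * \<psi> \<theta>))"
   using nn_exp_frac[of \<theta> n j] \<theta> n \<delta> by (intro has_bochner_integral_nn_integral) auto
  then have "integrable M (%w. exp (\<theta> * X \<delta> w))" "expectation (%w. exp (\<theta> * X \<delta> w)) = exp (\<delta> * \<psi> \<theta>)"
   by (auto simp: has_bochner_integral_iff)
  then have "integrable (distr M borel (d k)) (%x. exp (\<theta> * x))" "(\<integral>x. exp (\<theta> * x) \<partial>distr M borel (d k)) = exp (\<delta> * \<psi> \<theta>)"
   unfolding distr_d by (simp_all add: integrable_distr_eq integral_distr)
  then show "integrable M (%w. exp (\<theta> * d k w))" "expectation (%w. exp (\<theta> * d k w)) = exp (\<delta> * \<psi> \<theta>)"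
   by (simp_all add: integrable_distr_eq integral_distr)
 qed
 have mean_d: "integrable M (d k)" "- C * \<delta> <= expectation (d k)" for k
 proof -
  have "integrable M (X \<delta>)" "- C * \<delta> <= expectation (X \<delta>)" using X_frac_mean[OF C n, of j] \<delta> by auto
  then have "integrable (distr M borel (d k)) (%x. x)" "- C * \<delta> <= (\<integral>x. x \<partial>distr M borel (d k))"
   unfolding distr_d by (simp_all add: integrable_distr_eq integral_distr)
  then show "integrable M (d k)" "- C * \<delta> <= expectation (d k)"
   by (simp_all add: integrable_distr_eq integral_distr)
 qed
 have indep_exp: "indep_var borel (%w. exp (wt k w)) borel (%w. exp (\<theta> * d k w))" for k
 proof -
  have "indep_var borel (c k) borel (d k)" unfolding d_def by (rule indep_past_DX[OF kd d0 cF])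
  from indep_var_compose[OF this, of "%y. exp (\<theta> * (y - a))" borel "%y. exp (\<theta> * y)" borel]
  show ?thesis by (simp add: comp_def wt_def)
 qed
 have w_Suc: "wt (Suc k) w <= max 0 (wt k w + \<theta> * d k w)" for k w
 proof -
  have "c (Suc k) w <= max a (c k w + d k w)" unfolding c_Suc by auto
  then have "wt (Suc k) w <= \<theta> * (max a (c k w + d k w) - a)" unfolding wt_def using \<theta> by (intro mult_left_mono) auto
  also have "... = max 0 (wt k w + \<theta> * d k w)"
  proof -
   have "\<theta> * (max a z - a) = max 0 (\<theta> * (z - a))" for z
    using \<theta> by (cases "a <= z") (auto simp: max_def zero_le_mult_iff mult_le_0_iff)
   then show ?thesis by (simp add: wt_def algebra_simps)
  qed
  finally show ?thesis .
 qed
 have V_Suc: "exp (wt (Suc k) w) - wt (Suc k) w <= exp (wt k w) * exp (\<theta> * d k w) - (wt k w + \<theta> * d k w)" for k w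
 proof (cases "0 <= wt k w + \<theta> * d k w")
  case True
  then show ?thesis using exp_minus_self_mono[OF w0, of "Suc k" w "wt k w + \<theta> * d k w"] w_Suc[of k w] by (simp add: exp_add)
 next
  case False
  then have "wt (Suc k) w = 0" using w_Suc[of k w] w0[of "Suc k" w] by simp
  then show ?thesis using exp_ge_add_one_self[of "wt k w + \<theta> * d k w"] by (simp add: exp_add)
 qed
 have prod_int: "integrable M (%w. exp (wt k w) * exp (\<theta> * d k w))"
  "expectation (%w. exp (wt k w) * exp (\<theta> * d k w)) = expectation (%w. exp (wt k w)) * exp (\<delta> * \<psi> \<theta>)"
  if "integrable M (%w. exp (wt k w))" for k
  using indep_var_integrable[OF indep_exp that exp_d(1)] indep_var_lebesgue_integral[OF indep_exp that exp_d(1)] exp_d(2) by auto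
 have exp_w_int: "integrable M (%w. exp (wt k w))" for k
 proof (induction k)
  case 0
  then show ?case by (simp add: wt_def c_def)
 next
  case (Suc k)
  show ?case
  proof (rule Bochner_Integration.integrable_bound)
   show "integrable M (%w. 1 + exp (wt k w) * exp (\<theta> * d k w))" using prod_int(1)[OF Suc] by simp
   show "AE w in M. norm (exp (wt (Suc k) w)) <= norm (1 + exp (wt k w) * exp (\<theta> * d k w))"
   proof (rule AE_I2)
    fix w
    have "exp (wt (Suc k) w) <= exp (max 0 (wt k w + \<theta> * d k w))" using w_Suc by simp
    also have "... <= 1 + exp (wt k w + \<theta> * d k w)" by (simp add: max_def)
    finally show "norm (exp (wt (Suc k) w)) <= norm (1 + exp (wt k w) * exp (\<theta> * d k w))" by (simp add: exp_add)
   qed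
  qed measurable
 qed
 have w_int: "integrable M (wt k)" for k
 proof (rule Bochner_Integration.integrable_bound[OF exp_w_int[of k]])
  show "AE w in M. norm (wt k w) <= norm (exp (wt k w))"
  proof (rule AE_I2)
   fix w
   have "wt k w <= exp (wt k w)" using exp_ge_add_one_self[of "wt k w"] by linarith
   then show "norm (wt k w) <= norm (exp (wt k w))" using w0[of k w] by simp
  qed
 qed measurable
 define v where "v k = expectation (%w. exp (wt k w) - wt k w)" for k
 have v_int: "integrable M (%w. exp (wt k w) - wt k w)" for k using exp_w_int w_int by simp
 have exp_le_v: "expectation (%w. exp (wt k w)) <= 2 * v k" for k
 proof -
  have "expectation (%w. exp (wt k w)) <= expectation (%w. 2 * (exp (wt k w) - wt k w))"
   by (rule integral_mono[OF exp_w_int]) (use exp_w_int w_int exp_le_double[OF w0] in auto)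
  also have "... = 2 * v k" unfolding v_def by (rule integral_mult_right_zero)
  finally show ?thesis .
 qed
 \<comment> \<open>Both errors are of order \<delta>: the exponential moment of the increment enters
   through \<open>exp w \<le> 2 * (exp w - w)\<close>, hence the 2 in \<kappa>, and its mean through
   the lower bound \<open>- C * \<delta>\<close>.\<close>
 have v_step: "v (Suc k) <= v k * (1 + \<kappa>) + \<theta> * C * \<delta>" for k
 proof -
  have "v (Suc k) <= expectation (%w. exp (wt k w) * exp (\<theta> * d k w) - (wt k w + \<theta> * d k w))"
   unfolding v_def using V_Suc prod_int(1)[OF exp_w_int] w_int mean_d(1) v_int by (intro integral_mono) auto
  also have "... = expectation (%w. exp (wt k w)) * exp (\<delta> * \<psi> \<theta>) - (expectation (wt k) + \<theta> * expectation (d k))"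
   using prod_int[OF exp_w_int] w_int mean_d(1) by simp
  also have "... = v k + expectation (%w. exp (wt k w)) * (exp (\<delta> * \<psi> \<theta>) - 1) - \<theta> * expectation (d k)"
   using exp_w_int w_int by (simp add: v_def algebra_simps)
  finally have 0: "v (Suc k) <= v k + expectation (%w. exp (wt k w)) * (exp (\<delta> * \<psi> \<theta>) - 1) - \<theta> * expectation (d k)" .
  have 1: "expectation (%w. exp (wt k w)) * (exp (\<delta> * \<psi> \<theta>) - 1) <= expectation (%w. exp (wt k w)) * (\<kappa> / 2)"
   using d0 by (intro mult_left_mono integral_nonneg_AE) (auto simp: \<kappa>_def intro!: mult_left_mono)
  have 2: "expectation (%w. exp (wt k w)) * (\<kappa> / 2) <= 2 * v k * (\<kappa> / 2)" using exp_le_v k0 by (intro mult_right_mono) auto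
  have 3: "- (\<theta> * expectation (d k)) <= \<theta> * C * \<delta>" using mult_left_mono[OF mean_d(2)[of k], of \<theta>] \<theta> by simp
  have 4: "v k * (1 + \<kappa>) = v k + 2 * v k * (\<kappa> / 2)" by (simp add: algebra_simps)
  show ?thesis unfolding 4 using 0 1 2 3 by linarith
 qed
 have V0: "0 <= V0" by (simp add: V0_def)
 have tC: "0 <= \<theta> * C * \<delta>" using \<theta> C d0 by simp
 have v_bound: "v k <= (1 + \<kappa>) ^ k * (V0 + real k * (\<theta> * C * \<delta>))" for k
 proof (induction k)
  case 0
  have "0 <= \<theta> * (max a x - a)" using \<theta> by simp
  then show ?case by (simp add: v_def wt_def c_def V0_def prob_space)
 next
  case (Suc k)
  have 1: "v k * (1 + \<kappa>) <= (1 + \<kappa>) ^ k * (V0 + real k * (\<theta> * C * \<delta>)) * (1 + \<kappa>)"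
   using k0 by (intro mult_right_mono Suc) auto
  have 2: "1 * (\<theta> * C * \<delta>) <= (1 + \<kappa>) ^ Suc k * (\<theta> * C * \<delta>)"
   using tC k0 by (intro mult_right_mono one_le_power) auto
  have 3: "(1 + \<kappa>) ^ Suc k * (V0 + real (Suc k) * (\<theta> * C * \<delta>)) =
   (1 + \<kappa>) ^ k * (V0 + real k * (\<theta> * C * \<delta>)) * (1 + \<kappa>) + (1 + \<kappa>) ^ Suc k * (\<theta> * C * \<delta>)"
   by (simp add: algebra_simps)
  show ?case unfolding 3 using v_step[of k] 1 2 by linarith
 qed
 show "integrable M (%w. exp (\<theta> * (c k w - a)))" using exp_w_int[of k] by (simp add: wt_def)
 show "expectation (%w. exp (\<theta> * (c k w - a))) <= 2 * ((1 + \<kappa>) ^ k * (V0 + real k * (\<theta> * C * \<delta>)))"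
  using exp_le_v[of k] v_bound[of k] by (simp add: wt_def)
 have B_mono: "(1 + \<kappa>) ^ i * (V0 + real i * (\<theta> * C * \<delta>)) <= (1 + \<kappa>) ^ k * (V0 + real k * (\<theta> * C * \<delta>))" if "i <= k" for i k
 proof (rule mult_mono)
  show "(1 + \<kappa>) ^ i <= (1 + \<kappa>) ^ k" using that k0 by (intro power_increasing) auto
  show "V0 + real i * (\<theta> * C * \<delta>) <= V0 + real k * (\<theta> * C * \<delta>)"
   using that tC mult_right_mono[of "real i" "real k" "\<theta> * C * \<delta>"] by simp
  show "0 <= V0 + real i * (\<theta> * C * \<delta>)" using V0 mult_nonneg_nonneg[OF of_nat_0_le_iff tC, of i] by linarith
 qed (use k0 in simp)
 define B where "B k = (1 + \<kappa>) ^ k * (V0 + real k * (\<theta> * C * \<delta>))" for k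
 have "integrable M (l k) & expectation (l k) <= real k * (r * \<delta> * (2 / \<theta>)) * B k" for k
 proof (induction k)
  case 0
  then show ?case by (simp add: l_def)
 next
  case (Suc k)
  define u where "u w = max 0 (c k w - b)" for w
  have u0: "0 <= u w" for w by (simp add: u_def)
  have u_le: "u w <= exp (wt k w) / \<theta>" for w
  proof -
   have "u w <= c k w - a" using ab chain_ge by (auto simp: u_def c_def)
   also have "... = wt k w / \<theta>" using \<theta> by (simp add: wt_def)
   also have "... <= exp (wt k w) / \<theta>" using \<theta> exp_ge_add_one_self[of "wt k w"] by (intro divide_right_mono) linarith+
   finally show ?thesis .
  qed
  have um [measurable]: "u \<in> borel_measurable M" unfolding u_def[abs_def] by measurable
  have u_int: "integrable M u"
   by (rule Bochner_Integration.integrable_bound[of M "%w. exp (wt k w) / \<theta>"]) (use exp_w_int u0 u_le \<theta> in auto)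
  have Eu: "expectation u <= 2 / \<theta> * B k"
  proof -
   have "expectation u <= expectation (%w. exp (wt k w) / \<theta>)" using u_int exp_w_int u_le by (intro integral_mono) auto
   also have "... <= (2 * v k) / \<theta>" using exp_le_v \<theta> by (simp add: divide_right_mono)
   also have "... <= (2 * B k) / \<theta>" using v_bound[of k] \<theta> by (intro divide_right_mono) (auto simp: B_def)
   finally show ?thesis by simp
  qed
  \<comment> \<open>Marks an arrival in cell \<open>k\<close>; the new push is the product of two
    independent factors.\<close>
  define i where "i w = indicat_real {0<..} (e k w)" for w
  have im [measurable]: "i \<in> borel_measurable M" unfolding i_def[abs_def] by measurable
  have i_int: "integrable M i" by (rule integrable_const_bound[of _ 1]) (auto simp: i_def)
  have "indep_var borel (c k) borel (e k)" unfolding e_def by (rule indep_past_DN[OF kd d0 cF])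
  from indep_var_compose[OF this, of "%y. max 0 (y - b)" borel "indicat_real {0<..}" borel]
  have ind: "indep_var borel u borel i" by (simp add: comp_def u_def[abs_def] i_def[abs_def])
  have Ei: "expectation i <= r * \<delta>"
  proof -
   have "expectation i = expectation (indicator {w\<in>space M. 0 < e k w})"
    by (intro Bochner_Integration.integral_cong) (auto simp: i_def indicator_def)
   also have "... = prob {w\<in>space M. 0 < e k w}" by simp
   also have "... <= r * \<delta>" unfolding e_def by (rule prob_DN_pos_le[OF kd d0])
   finally show ?thesis .
  qed
  have lS: "l (Suc k) = (%w. l k w + u w * i w)" by (auto simp: l_Suc fun_eq_iff u_def i_def)
  have pi: "integrable M (%w. u w * i w)" "expectation (%w. u w * i w) = expectation u * expectation i"
   using indep_var_integrable[OF ind u_int i_int] indep_var_lebesgue_integral[OF ind u_int i_int] by auto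
  have B0: "0 <= B k" unfolding B_def using k0 V0 mult_nonneg_nonneg[OF of_nat_0_le_iff tC, of k] by (intro mult_nonneg_nonneg) auto
  have "expectation u * expectation i <= (2 / \<theta> * B k) * (r * \<delta>)"
   using Eu Ei u0 B0 \<theta> by (intro mult_mono) (auto simp: i_def intro!: integral_nonneg_AE)
  moreover have "B k <= B (Suc k)" unfolding B_def by (rule B_mono) simp
  moreover have rd: "0 <= r * \<delta> * (2 / \<theta>)" using r_pos d0 \<theta> by simp
  ultimately have "expectation u * expectation i <= r * \<delta> * (2 / \<theta>) * B (Suc k)"
   using mult_left_mono[of "B k" "B (Suc k)" "r * \<delta> * (2 / \<theta>)"] by (simp add: mult_ac)
  moreover have "expectation (l k) <= real k * (r * \<delta> * (2 / \<theta>)) * B (Suc k)"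
   using Suc mult_left_mono[of "B k" "B (Suc k)" "real k * (r * \<delta> * (2 / \<theta>))"] rd \<open>B k <= B (Suc k)\<close> by (meson mult_nonneg_nonneg of_nat_0_le_iff order.trans)
  ultimately have le: "expectation (l k) + expectation u * expectation i <= real k * (r * \<delta> * (2 / \<theta>)) * B (Suc k) + r * \<delta> * (2 / \<theta>) * B (Suc k)"
   by linarith
  have "expectation (l (Suc k)) = expectation (l k) + expectation u * expectation i"
   using Suc pi unfolding lS by simp
  moreover have "real (Suc k) * (r * \<delta> * (2 / \<theta>)) * B (Suc k) = real k * (r * \<delta> * (2 / \<theta>)) * B (Suc k) + r * \<delta> * (2 / \<theta>) * B (Suc k)"
   by (simp add: algebra_simps add_divide_distrib)
  moreover have "integrable M (l (Suc k))" using Suc pi unfolding lS by simp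
  ultimately show ?case using le by simp
 qed
 then show "integrable M (l k)" "expectation (l k) <= real k * (r * \<delta> * (2 / \<theta>)) * ((1 + \<kappa>) ^ k * (V0 + real k * (\<theta> * C * \<delta>)))"
  by (auto simp: B_def)
qed

end

lemma right_grid_bounds:
 fixes t :: real
 defines "D \<equiv> %m. real (nat \<lfloor>t * real (Suc m)\<rfloor> + 1) / real (Suc m)"
 assumes t: "0 <= t"
 shows "t < D m" "D m <= t + 1 / real (Suc m)" "filterlim D (at_right t) sequentially"
proof -
 have b: "t < D m" "D m <= t + 1 / real (Suc m)" for m
 proof -
  have "real (nat \<lfloor>t * real (Suc m)\<rfloor>) = of_int \<lfloor>t * real (Suc m)\<rfloor>" using t by (intro of_nat_nat) (simp del: of_nat_Suc)
  then have Dq: "D m = (of_int \<lfloor>t * real (Suc m)\<rfloor> + 1) / real (Suc m)"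
   by (simp only: D_def of_nat_add of_nat_1)
  have "t * real (Suc m) < of_int \<lfloor>t * real (Suc m)\<rfloor> + 1" "of_int \<lfloor>t * real (Suc m)\<rfloor> <= t * real (Suc m)" by linarith+
  then show "t < D m" "D m <= t + 1 / real (Suc m)"
   by (simp add: Dq less_divide_eq del: of_nat_Suc, simp add: Dq add_divide_distrib divide_le_eq del: of_nat_Suc)
 qed
 then show "t < D m" "D m <= t + 1 / real (Suc m)" by auto
 have up: "(%m. t + 1 / real (Suc m)) \<longlonglongrightarrow> t"
  using tendsto_add[OF tendsto_const LIMSEQ_Suc[OF lim_const_over_n[of 1]], of t] by simp
 have "D \<longlonglongrightarrow> t"
  by (rule tendsto_sandwich[OF _ _ tendsto_const up]) (use b in \<open>auto intro!: always_eventually less_imp_le simp del: of_nat_Suc\<close>)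
 then show "filterlim D (at_right t) sequentially"
  unfolding filterlim_at using b by (auto intro!: always_eventually simp: less_imp_neq[THEN not_sym])
qed

context laplace
begin

text \<open>Fatou along the grids of [0, t]. The time is rational because the exponential moments
  and the mean of \<open>X\<close> were computed at rational times; cells of such a grid are
  rational as well.\<close>

lemma frac_moments:
 fixes x \<theta> C :: real
 assumes \<theta>: "0 < \<theta>" "\<psi> \<theta> <= q / 16" and C: "0 <= C" "!!s. 0 < s ==> s <= 1 ==> - C * s <= \<psi> s"
  and n: "0 < n" and j: "0 < j" and t: "t = real j / real n"
 defines "Bd \<equiv> exp (q * t / 4) * (exp (\<theta> * (max a x - a)) + \<theta> * C * t)"
 shows "(\<integral>\<^sup>+w. ennreal (exp (\<theta> * (Yb x t w - a))) \<partial>M) <= ennreal (2 * Bd)"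
  "(\<integral>\<^sup>+w. ennreal (Lb x t w) \<partial>M) <= ennreal (r * t * (2 / \<theta>) * Bd)"
proof -
 have t0: "0 < t" using t n j by simp
 define \<Psi> where "\<Psi> = max 0 (\<psi> \<theta>)"
 have Psi: "0 <= \<Psi>" "\<Psi> <= q / 16" using \<theta> q_pos by (auto simp: \<Psi>_def)
 define \<delta> where "\<delta> m = t / real (Suc m)" for m
 have d0: "0 <= \<delta> m" for m using t0 by (simp add: \<delta>_def)
 have df: "\<delta> m = real j / real (n * Suc m)" for m by (simp add: \<delta>_def t of_nat_mult del: of_nat_Suc mult_Suc_right)
 have nS: "0 < n * Suc m" for m using n by simp
 define V0 where "V0 = exp (\<theta> * (max a x - a))"
 define c where "c m w = chv a b (Suc m) x (incs (grid t m) (Suc m) 0 w)" for m w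
 define l where "l m w = chpv a b (Suc m) x (incs (grid t m) (Suc m) 0 w)" for m w
 have g: "grid t m i = real i * \<delta> m" "grid t m (Suc i) = real i * \<delta> m + \<delta> m" for m i
 proof -
  show 1: "grid t m i = real i * \<delta> m" for i by (simp add: grid_def \<delta>_def)
  show "grid t m (Suc i) = real i * \<delta> m + \<delta> m" unfolding 1 by (simp add: algebra_simps)
 qed
 have ceq: "c m w = chain a b x (%i. DX (real i * \<delta> m) (real i * \<delta> m + \<delta> m) w) (%i. DN (real i * \<delta> m) (real i * \<delta> m + \<delta> m) w) (Suc m)" for m w
  unfolding c_def chv_def by (rule chain_cong) (simp_all add: incs_def g(1) algebra_simps)
 have leq: "l m w = chain_push a b x (%i. DX (real i * \<delta> m) (real i * \<delta> m + \<delta> m) w) (%i. DN (real i * \<delta> m) (real i * \<delta> m + \<delta> m) w) (Suc m)" for m w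
  unfolding l_def chpv_def by (rule chain_push_cong) (simp_all add: incs_def g(1) algebra_simps)
 define Q where "Q m = (1 + 2 * (exp (\<delta> m * \<Psi>) - 1)) ^ Suc m * (V0 + \<theta> * C * t)" for m
 have Sd: "real (Suc m) * (\<theta> * C * \<delta> m) = \<theta> * C * t" "real (Suc m) * (r * \<delta> m * (2 / \<theta>)) = r * t * (2 / \<theta>)" for m
  by (simp_all add: \<delta>_def field_simps del: of_nat_Suc)
 have lm: "l m = (%w. chain_push a b x (%i. DX (real i * \<delta> m) (real i * \<delta> m + \<delta> m) w) (%i. DN (real i * \<delta> m) (real i * \<delta> m + \<delta> m) w) (Suc m))" for m by (rule ext) (rule leq)
 have cm1: "integrable M (%w. exp (\<theta> * (c m w - a)))" for m
  unfolding ceq by (rule chain_moments(1)[OF \<theta>(1) C nS[of m] df[of m]])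
 have cm2: "expectation (%w. exp (\<theta> * (c m w - a))) <= 2 * Q m" for m
  unfolding ceq using chain_moments(2)[OF \<theta>(1) C nS[of m] df[of m], where x=x and k="Suc m", unfolded Sd]
  by (simp only: Q_def V0_def \<Psi>_def)
 have cm3: "integrable M (l m)" for m
  unfolding lm by (rule chain_moments(3)[OF \<theta>(1) C nS[of m] df[of m]])
 have cm4: "expectation (l m) <= r * t * (2 / \<theta>) * Q m" for m
  unfolding lm using chain_moments(4)[OF \<theta>(1) C nS[of m] df[of m], where x=x and k="Suc m", unfolded Sd]
  by (simp only: Q_def V0_def \<Psi>_def)
 have VC: "0 <= V0 + \<theta> * C * t" using \<theta> C t0 by (simp add: V0_def)
 have ev: "\<forall>\<^sub>F m in sequentially. Q m <= Bd"
 proof -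
  have "(%m. t * \<Psi> / real (Suc m)) \<longlonglongrightarrow> 0" by (rule LIMSEQ_Suc[OF lim_const_over_n])
  then have "\<forall>\<^sub>F m in sequentially. t * \<Psi> / real (Suc m) < 1" by (rule order_tendstoD(2)) simp
  then show ?thesis
  proof eventually_elim
   case (elim m)
   define y where "y = \<delta> m * \<Psi>"
   have y: "0 <= y" unfolding y_def using d0 Psi(1) by (rule mult_nonneg_nonneg)
   have y1: "y <= 1" using elim by (simp add: y_def \<delta>_def)
   \<comment> \<open>For y in [0, 1] this yields
     \<open>1 + 2 * (exp y - 1) \<le> 1 + 4 * y \<le> exp (4 * y)\<close>, the source of the factor
     4 in the rate.\<close>
   have "exp y <= 1 + y + y\<^sup>2" by (rule exp_bound[OF y y1])
   also have "y\<^sup>2 <= y" using y y1 by (simp add: power2_eq_square mult_left_le_one_le)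
   finally have "1 + 2 * (exp y - 1) <= 1 + 4 * y" by simp
   also have "... <= exp (4 * y)" by (rule exp_ge_add_one_self)
   finally have "(1 + 2 * (exp y - 1)) ^ Suc m <= exp (4 * y) ^ Suc m"
   proof (rule power_mono)
    have "1 <= exp y" using y by simp
    then show "0 <= 1 + 2 * (exp y - 1)" by (intro add_nonneg_nonneg mult_nonneg_nonneg) (use y in auto)
   qed
   also have "... = exp (real (Suc m) * (4 * y))" by (rule exp_of_nat_mult[symmetric])
   also have "real (Suc m) * (4 * y) = 4 * (t * \<Psi>)" by (simp add: y_def \<delta>_def field_simps del: of_nat_Suc)
   also have "exp (4 * (t * \<Psi>)) <= exp (q * t / 4)"
   proof -
    have "t * \<Psi> <= t * (q / 16)" using Psi t0 by (intro mult_left_mono) auto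
    then show ?thesis by (simp add: mult_ac)
   qed
   finally have "(1 + 2 * (exp y - 1)) ^ Suc m <= exp (q * t / 4)" .
   then show ?case unfolding Q_def Bd_def y_def[symmetric] V0_def[symmetric] using VC by (intro mult_right_mono) auto
  qed
 qed
 have cM: "c m \<in> borel_measurable M" "l m \<in> borel_measurable M" for m
 proof -
  have dm: "DX (real i * \<delta> m) (real i * \<delta> m + \<delta> m) \<in> borel_measurable M" "DN (real i * \<delta> m) (real i * \<delta> m + \<delta> m) \<in> borel_measurable M" for i
   using d0[of m] by simp_all
  show "c m \<in> borel_measurable M" unfolding ceq using dm by (intro chain_measurable[where K="Suc m"]) auto
  show "l m \<in> borel_measurable M" unfolding leq using dm by (intro chain_push_measurable[where K="Suc m"]) auto
 qed
 show "(\<integral>\<^sup>+w. ennreal (exp (\<theta> * (Yb x t w - a))) \<partial>M) <= ennreal (2 * Bd)"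
 proof (rule nn_integral_LIMSEQ_le[where u="%m w. ennreal (exp (\<theta> * (c m w - a)))"])
  show "(%w. ennreal (exp (\<theta> * (c m w - a)))) \<in> borel_measurable M" for m using cM by measurable
  show "AE w in M. (%m. ennreal (exp (\<theta> * (c m w - a)))) \<longlonglongrightarrow> ennreal (exp (\<theta> * (Yb x t w - a)))"
   using AE_good by eventually_elim (intro tendsto_intros grid_tendsto(1)[OF _ t0, where x=x, folded c_def])
  show "\<forall>\<^sub>F m in sequentially. (\<integral>\<^sup>+w. ennreal (exp (\<theta> * (c m w - a))) \<partial>M) <= ennreal (2 * Bd)"
   using ev
  proof eventually_elim
   case (elim m)
   have "(\<integral>\<^sup>+w. ennreal (exp (\<theta> * (c m w - a))) \<partial>M) = ennreal (expectation (%w. exp (\<theta> * (c m w - a))))"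
    using cm1[of m] by (intro nn_integral_eq_integral) auto
   also have "... <= ennreal (2 * Bd)" using cm2[of m] elim by (intro ennreal_leI) linarith
   finally show ?case .
  qed
 qed
 show "(\<integral>\<^sup>+w. ennreal (Lb x t w) \<partial>M) <= ennreal (r * t * (2 / \<theta>) * Bd)"
 proof (rule nn_integral_LIMSEQ_le[where u="%m w. ennreal (l m w)"])
  show "(%w. ennreal (l m w)) \<in> borel_measurable M" for m using cM by measurable
  show "AE w in M. (%m. ennreal (l m w)) \<longlonglongrightarrow> ennreal (Lb x t w)"
   using AE_good by eventually_elim (intro tendsto_intros grid_tendsto(2)[OF _ t0, where x=x, folded l_def])
  show "\<forall>\<^sub>F m in sequentially. (\<integral>\<^sup>+w. ennreal (l m w) \<partial>M) <= ennreal (r * t * (2 / \<theta>) * Bd)"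
   using ev
  proof eventually_elim
   case (elim m)
   have "(\<integral>\<^sup>+w. ennreal (l m w) \<partial>M) = ennreal (expectation (l m))"
    by (rule nn_integral_eq_integral[OF cm3]) (auto simp: leq simp del: chain_push.simps intro: chain_push_nonneg)
   also have "... <= ennreal (r * t * (2 / \<theta>) * Bd)"
   proof (rule ennreal_leI)
    have "expectation (l m) <= r * t * (2 / \<theta>) * Q m" by (rule cm4)
    also have "... <= r * t * (2 / \<theta>) * Bd" using elim r_pos t0 \<theta> by (intro mult_left_mono) auto
    finally show "expectation (l m) <= r * t * (2 / \<theta>) * Bd" .
   qed
   finally show ?case .
  qed
 qed
qed

text \<open>From rational to all times: for \<open>Yb\<close> by right continuity and Fatou, for the
  controls by monotonicity up to a later integer time. \<open>Rb\<close> is bounded through the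
  identity \<open>Yb = x + X + Rb - Lb\<close>.\<close>

lemma moments:
 "\<exists>\<theta>>0. ALL x. \<exists>K\<ge>0. \<forall>t\<ge>0.
   (\<integral>\<^sup>+w. ennreal (exp (\<theta> * (Yb x t w - a))) \<partial>M) <= ennreal (K * exp (q * t / 2)) &
   (\<integral>\<^sup>+w. ennreal (Lb x t w) \<partial>M) <= ennreal (K * exp (q * t / 2)) &
   (\<integral>\<^sup>+w. ennreal (Rb x t w) \<partial>M) <= ennreal (K * exp (q * t / 2))"
proof -
 obtain \<theta> where \<theta>: "0 < \<theta>" "\<psi> \<theta> <= q / 16" using small_theta by auto
 obtain C where C: "0 <= C" "!!s. 0 < s ==> s <= 1 ==> - C * s <= \<psi> s"
  using laplace_exponent_lower[OF levy_measure tail] by blast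
 show ?thesis
 proof (rule exI[of _ \<theta>], intro conjI allI \<theta>(1))
  fix x
  define V0 where "V0 = exp (\<theta> * (max a x - a))"
  define Bd where "Bd t = exp (q * t / 4) * (V0 + \<theta> * C * t)" for t
  have V0: "0 <= V0" by (simp add: V0_def)
  have Bd_mono: "Bd s <= Bd t" if "0 <= s" "s <= t" for s t
   unfolding Bd_def using that V0 \<theta> C q_pos by (intro mult_mono) (auto intro!: mult_left_mono)
  have Bd0: "0 <= Bd t" if "0 <= t" for t using that V0 \<theta> C by (simp add: Bd_def)
  note fm = frac_moments[OF \<theta> C, where x=x, folded V0_def]
  have Y: "(\<integral>\<^sup>+w. ennreal (exp (\<theta> * (Yb x t w - a))) \<partial>M) <= ennreal (2 * Bd (t + 1))" if t: "0 <= t" for t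
  proof -
   define D where "D m = real (nat \<lfloor>t * real (Suc m)\<rfloor> + 1) / real (Suc m)" for m
   note D = right_grid_bounds[OF t, folded D_def]
   have D1: "D m <= t + 1" for m
   proof -
    have "1 / real (Suc m) <= 1" by simp
    then show ?thesis using D(2)[of m] by linarith
   qed
   show ?thesis
   proof (rule nn_integral_LIMSEQ_le[where u="%m w. ennreal (exp (\<theta> * (Yb x (D m) w - a)))"])
    have [measurable]: "Yb x (D m) \<in> borel_measurable M" for m using D(1)[of m] t by simp
    show "(%w. ennreal (exp (\<theta> * (Yb x (D m) w - a)))) \<in> borel_measurable M" for m by measurable
    show "AE w in M. (%m. ennreal (exp (\<theta> * (Yb x (D m) w - a)))) \<longlonglongrightarrow> ennreal (exp (\<theta> * (Yb x t w - a)))"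
     using AE_good
     by eventually_elim (intro tendsto_intros filterlim_compose[OF cadlag_at_right[OF Yb_cadlag t] D(3)])
    have "(\<integral>\<^sup>+w. ennreal (exp (\<theta> * (Yb x (D m) w - a))) \<partial>M) <= ennreal (2 * Bd (t + 1))" for m
    proof -
     have "(\<integral>\<^sup>+w. ennreal (exp (\<theta> * (Yb x (D m) w - a))) \<partial>M) <= ennreal (2 * Bd (D m))"
      unfolding Bd_def by (rule fm(1)[of "Suc m" "nat \<lfloor>t * real (Suc m)\<rfloor> + 1"]) (simp_all add: D_def)
     also have "... <= ennreal (2 * Bd (t + 1))" using Bd_mono[of "D m" "t + 1"] D(1)[of m] D1[of m] t by (intro ennreal_leI) simp
     finally show ?thesis .
    qed
    then show "\<forall>\<^sub>F m in sequentially. (\<integral>\<^sup>+w. ennreal (exp (\<theta> * (Yb x (D m) w - a))) \<partial>M) <= ennreal (2 * Bd (t + 1))" by simp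
   qed
  qed
  define T where "T t = nat \<lfloor>t\<rfloor> + 1" for t :: real
  have T: "t <= real (T t)" "real (T t) <= t + 1" "0 < T t" if "0 <= t" for t using that by (auto simp: T_def) linarith+
  have LT: "(\<integral>\<^sup>+w. ennreal (Lb x (real (T t)) w) \<partial>M) <= ennreal (r * (t + 1) * (2 / \<theta>) * Bd (t + 1))" if t: "0 <= t" for t
  proof -
   have "(\<integral>\<^sup>+w. ennreal (Lb x (real (T t)) w) \<partial>M) <= ennreal (r * real (T t) * (2 / \<theta>) * Bd (real (T t)))"
    unfolding Bd_def by (rule fm(2)[of 1 "T t"]) (use T[OF t] in auto)
   also have "... <= ennreal (r * (t + 1) * (2 / \<theta>) * Bd (t + 1))"
    using T[OF t] t r_pos \<theta> Bd0 Bd_mono by (intro ennreal_leI mult_mono) auto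
   finally show ?thesis .
  qed
  have L: "(\<integral>\<^sup>+w. ennreal (Lb x t w) \<partial>M) <= ennreal (r * (t + 1) * (2 / \<theta>) * Bd (t + 1))" if t: "0 <= t" for t
  proof (rule order.trans[OF nn_integral_mono_AE LT[OF t]])
   show "AE w in M. ennreal (Lb x t w) <= ennreal (Lb x (real (T t)) w)"
    using AE_good by eventually_elim (intro ennreal_leI Lb_mono t T)
  qed
  have Rt: "(\<integral>\<^sup>+w. ennreal (Rb x t w) \<partial>M) <= ennreal (2 * Bd (t + 1) / \<theta> + \<bar>a - x\<bar> + C * (t + 1) + r * (t + 1) * (2 / \<theta>) * Bd (t + 1))" if t: "0 <= t" for t
  proof -
   define s where "s = real (T t)"
   have s: "0 <= s" "t <= s" "s <= t + 1" using T[OF t] t by (auto simp: s_def)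
   note [measurable] = Yb_measurable[OF s(1), of x] Lb_measurable[OF s(1), of x] X_measurable[OF s(1)] Rb_measurable[OF s(1), of x]
   define Z where "Z w = exp (\<theta> * (Yb x s w - a)) / \<theta>" for w
   have Zm [measurable]: "Z \<in> borel_measurable M" unfolding Z_def[abs_def] by measurable
   have Ys: "(\<integral>\<^sup>+w. ennreal (exp (\<theta> * (Yb x s w - a))) \<partial>M) <= ennreal (2 * Bd (t + 1))"
   proof -
    have "(\<integral>\<^sup>+w. ennreal (exp (\<theta> * (Yb x s w - a))) \<partial>M) <= ennreal (2 * Bd s)"
     unfolding Bd_def s_def by (rule fm(1)[of 1 "T t"]) (use T[OF t] in auto)
    also have "... <= ennreal (2 * Bd (t + 1))" using Bd_mono[of s "t + 1"] s by (intro ennreal_leI) simp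
    finally show ?thesis .
   qed
   have ei: "integrable M (%w. exp (\<theta> * (Yb x s w - a)))"
    using Ys by (intro integrableI_nonneg) (auto intro: le_less_trans)
   have eE: "expectation (%w. exp (\<theta> * (Yb x s w - a))) <= 2 * Bd (t + 1)"
    using Ys ei Bd0[of "t + 1"] t by (simp add: nn_integral_eq_integral)
   have Li: "integrable M (Lb x s)" 
    using LT[OF t] AE_good Lb_nonneg[OF _ s(1), of _ x]
    by (intro integrableI_nonneg) (auto simp: s_def elim!: eventually_mono intro: le_less_trans)
   have "AE w in M. 0 <= Lb x s w" using AE_good by eventually_elim (rule Lb_nonneg[OF _ s(1)])
   then have LE: "expectation (Lb x s) <= r * (t + 1) * (2 / \<theta>) * Bd (t + 1)"
    using LT[OF t] Li Bd0[of "t + 1"] t r_pos \<theta> by (simp add: nn_integral_eq_integral s_def)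
   have Xi: "integrable M (X s)" and XE: "- C * s <= expectation (X s)"
    using X_frac_mean[OF C, of 1 "T t"] by (simp_all add: s_def)
   \<comment> \<open>Majorises \<open>Rb = (Yb - a) + (a - x) - X + Lb\<close>, where
     \<open>Yb - a\<close> is replaced by its exponential divided by \<theta>.\<close>
   define G where "G w = Z w + \<bar>a - x\<bar> - X s w + Lb x s w" for w
   have Zi: "integrable M Z" unfolding Z_def[abs_def] using ei by simp
   have Gi: "integrable M G" unfolding G_def[abs_def] using Zi Xi Li by simp
   have le: "AE w in M. 0 <= Rb x s w & Rb x s w <= G w"
    using AE_good
   proof eventually_elim
    case (elim w)
    have "\<theta> * (Yb x s w - a) <= exp (\<theta> * (Yb x s w - a))" using exp_ge_add_one_self[of "\<theta> * (Yb x s w - a)"] by linarith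
    then have "Yb x s w - a <= Z w" using \<theta> by (simp add: Z_def pos_le_divide_eq mult.commute)
    then show ?case using Rb_nonneg[OF elim s(1), of x] Yb_eq[of x s w] by (auto simp: G_def)
   qed
   have "(\<integral>\<^sup>+w. ennreal (Rb x t w) \<partial>M) <= (\<integral>\<^sup>+w. ennreal (G w) \<partial>M)"
   proof (rule nn_integral_mono_AE)
    show "AE w in M. ennreal (Rb x t w) <= ennreal (G w)"
     using AE_good le by eventually_elim (use Rb_mono[OF _ t s(2), of _ x] in \<open>force intro!: ennreal_leI\<close>)
   qed
   also have "... = ennreal (expectation G)"
   proof (rule nn_integral_eq_integral[OF Gi])
    show "AE w in M. 0 <= G w" using le by eventually_elim (auto intro: order.trans)
   qed
   also have "expectation G = expectation Z + \<bar>a - x\<bar> - expectation (X s) + expectation (Lb x s)"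
    unfolding G_def[abs_def] using Zi Xi Li by (simp add: prob_space)
   also have "expectation Z = expectation (%w. exp (\<theta> * (Yb x s w - a))) / \<theta>" unfolding Z_def[abs_def] by simp
   also have "ennreal (expectation (%w. exp (\<theta> * (Yb x s w - a))) / \<theta> + \<bar>a - x\<bar> - expectation (X s) + expectation (Lb x s))
    <= ennreal (2 * Bd (t + 1) / \<theta> + \<bar>a - x\<bar> + C * (t + 1) + r * (t + 1) * (2 / \<theta>) * Bd (t + 1))"
   proof (rule ennreal_leI)
    have "expectation (%w. exp (\<theta> * (Yb x s w - a))) / \<theta> <= 2 * Bd (t + 1) / \<theta>" using eE \<theta> by (intro divide_right_mono) auto
    moreover have "C * s <= C * (t + 1)" using s C by (intro mult_left_mono) auto
    ultimately show "expectation (%w. exp (\<theta> * (Yb x s w - a))) / \<theta> + \<bar>a - x\<bar> - expectation (X s) + expectation (Lb x s)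
     <= 2 * Bd (t + 1) / \<theta> + \<bar>a - x\<bar> + C * (t + 1) + r * (t + 1) * (2 / \<theta>) * Bd (t + 1)"
     using LE XE by linarith
   qed
   finally show ?thesis .
  qed
  define G where "G = exp (q / 4) * (V0 + \<theta> * C)"
  define S where "S t = (1 + t)\<^sup>2 * exp (q * t / 4)" for t
  have G0: "0 <= G" using V0 \<theta> C by (simp add: G_def)
  have S: "1 + t <= S t" "1 <= S t" "(1 + t) * exp (q * t / 4) <= S t" if t: "0 <= t" for t
  proof -
   have e: "1 <= exp (q * t / 4)" using q_pos t by simp
   have p: "1 + t <= (1 + t)\<^sup>2" using t by (simp add: power2_eq_square)
   show "(1 + t) * exp (q * t / 4) <= S t" unfolding S_def using p e by (intro mult_right_mono) auto
   moreover have "(1 + t) * 1 <= (1 + t) * exp (q * t / 4)" using e t by (intro mult_left_mono) auto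
   ultimately show "1 + t <= S t" by simp
   then show "1 <= S t" using t by simp
  qed
  have BdS: "Bd (t + 1) <= G * ((1 + t) * exp (q * t / 4))" if t: "0 <= t" for t
  proof -
   have "Bd (t + 1) = exp (q / 4) * exp (q * t / 4) * (V0 + \<theta> * C * (t + 1))"
    by (simp add: Bd_def distrib_left add_divide_distrib exp_add)
   also have "V0 + \<theta> * C * (t + 1) <= (V0 + \<theta> * C) * (1 + t)" using V0 t by (simp add: algebra_simps)
   then have "exp (q / 4) * exp (q * t / 4) * (V0 + \<theta> * C * (t + 1)) <= exp (q / 4) * exp (q * t / 4) * ((V0 + \<theta> * C) * (1 + t))"
    by (intro mult_left_mono) auto
   finally show ?thesis by (simp add: G_def mult_ac)
  qed
  define K1 where "K1 = 2 * G + r * (2 / \<theta>) * G + (2 * G / \<theta> + \<bar>a - x\<bar> + C + r * (2 / \<theta>) * G)"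
  \<comment> \<open>From 1 + t at most (1 + 8 / q) * exp (q * t / 8): squaring lets a quadratic
    factor cost exp (q * t / 4) and the constant (1 + 8 / q)^2.\<close>
  define K where "K = K1 * (1 + 8 / q)\<^sup>2"
  have parts: "0 <= 2 * G" "0 <= r * (2 / \<theta>) * G" "0 <= 2 * G / \<theta>" "0 <= \<bar>a - x\<bar>" using G0 r_pos \<theta> by auto
  have K10: "0 <= K1" unfolding K1_def using parts C(1) by (intro add_nonneg_nonneg)
  have SK: "K1 * S t <= K * exp (q * t / 2)" if t: "0 <= t" for t
  proof -
   have "q * t / 8 <= exp (q * t / 8)" using exp_ge_add_one_self[of "q * t / 8"] by linarith
   then have "t <= 8 / q * exp (q * t / 8)" using q_pos by (simp add: field_simps)
   moreover have "1 <= exp (q * t / 8)" using q_pos t by simp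
   moreover have "(1 + 8 / q) * exp (q * t / 8) = exp (q * t / 8) + 8 / q * exp (q * t / 8)" by (simp add: distrib_right)
   ultimately have "1 + t <= (1 + 8 / q) * exp (q * t / 8)" by linarith
   then have "(1 + t)\<^sup>2 <= ((1 + 8 / q) * exp (q * t / 8))\<^sup>2" using t by (intro power_mono) auto
   also have "... = (1 + 8 / q)\<^sup>2 * exp (q * t / 4)"
   proof -
    have "(exp (q * t / 8))\<^sup>2 = exp (q * t / 4)" by (simp add: power2_eq_square flip: exp_add)
    then show ?thesis by (simp add: power_mult_distrib)
   qed
   finally have "S t <= (1 + 8 / q)\<^sup>2 * exp (q * t / 4) * exp (q * t / 4)" unfolding S_def by (intro mult_right_mono) auto
   also have "... = (1 + 8 / q)\<^sup>2 * exp (q * t / 2)" by (simp add: mult.assoc flip: exp_add)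
   finally have "K1 * S t <= K1 * ((1 + 8 / q)\<^sup>2 * exp (q * t / 2))" using K10 by (intro mult_left_mono) auto
   then show ?thesis by (simp add: K_def mult.assoc)
  qed
  have b1: "2 * Bd (t + 1) <= K1 * S t" and b2: "r * (t + 1) * (2 / \<theta>) * Bd (t + 1) <= K1 * S t"
   and b3: "2 * Bd (t + 1) / \<theta> + \<bar>a - x\<bar> + C * (t + 1) + r * (t + 1) * (2 / \<theta>) * Bd (t + 1) <= K1 * S t"
   if t: "0 <= t" for t
  proof -
   have B1: "Bd (t + 1) <= G * S t" using BdS[OF t] mult_left_mono[OF S(3)[OF t] G0] by linarith
   have S0: "0 <= S t" using S(2)[OF t] by simp
   have r1: "2 * Bd (t + 1) <= 2 * G * S t" using B1 by simp
   have r2: "r * (t + 1) * (2 / \<theta>) * Bd (t + 1) <= r * (2 / \<theta>) * G * S t"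
   proof -
    have "r * (2 / \<theta>) * ((1 + t) * Bd (t + 1)) <= r * (2 / \<theta>) * ((1 + t) * (G * ((1 + t) * exp (q * t / 4))))"
     using BdS[OF t] t r_pos \<theta> by (intro mult_left_mono) auto
    moreover have "r * k * ((1 + t) * Bd (t + 1)) = r * (t + 1) * k * Bd (t + 1)" for k by algebra
    moreover have "r * k * ((1 + t) * (G * ((1 + t) * e))) = r * k * G * ((1 + t)\<^sup>2 * e)" for k e by algebra
    ultimately show ?thesis by (simp only: S_def)
   qed
   have r3: "2 * Bd (t + 1) / \<theta> <= 2 * G / \<theta> * S t" using divide_right_mono[OF r1, of \<theta>] \<theta> by (simp add: mult_ac)
   have r4: "\<bar>a - x\<bar> <= \<bar>a - x\<bar> * S t" using mult_left_mono[OF S(2)[OF t], of "\<bar>a - x\<bar>"] by simp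
   have r5: "C * (t + 1) <= C * S t" using S(1)[OF t] C by (intro mult_left_mono) auto
   have n: "0 <= 2 * G * S t" "0 <= r * (2 / \<theta>) * G * S t" "0 <= 2 * G / \<theta> * S t" "0 <= \<bar>a - x\<bar> * S t" "0 <= C * S t"
    using parts C S0 by (simp_all only: mult_nonneg_nonneg)
   have eq: "K1 * S t = 2 * G * S t + r * (2 / \<theta>) * G * S t + (2 * G / \<theta> * S t + \<bar>a - x\<bar> * S t + C * S t + r * (2 / \<theta>) * G * S t)"
    unfolding K1_def by (simp only: distrib_right)
   have gen: "u1 <= p1 + p2 + (p3 + p4 + p5 + p2) & u2 <= p1 + p2 + (p3 + p4 + p5 + p2) & u3 + u4 + u5 + u2 <= p1 + p2 + (p3 + p4 + p5 + p2)"
    if "u1 <= p1" "u2 <= p2" "u3 <= p3" "u4 <= p4" "u5 <= p5" "0 <= p1" "0 <= p2" "0 <= p3" "0 <= p4" "0 <= p5"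
    for u1 u2 u3 u4 u5 p1 p2 p3 p4 p5 :: real using that by linarith
   note g = gen[OF r1 r2 r3 r4 r5 n]
   show "2 * Bd (t + 1) <= K1 * S t" unfolding eq by (rule g[THEN conjunct1])
   show "r * (t + 1) * (2 / \<theta>) * Bd (t + 1) <= K1 * S t" unfolding eq by (rule g[THEN conjunct2, THEN conjunct1])
   show "2 * Bd (t + 1) / \<theta> + \<bar>a - x\<bar> + C * (t + 1) + r * (t + 1) * (2 / \<theta>) * Bd (t + 1) <= K1 * S t"
    unfolding eq by (rule g[THEN conjunct2, THEN conjunct2])
  qed
  show "\<exists>K\<ge>0. \<forall>t\<ge>0.
   (\<integral>\<^sup>+w. ennreal (exp (\<theta> * (Yb x t w - a))) \<partial>M) <= ennreal (K * exp (q * t / 2)) &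
   (\<integral>\<^sup>+w. ennreal (Lb x t w) \<partial>M) <= ennreal (K * exp (q * t / 2)) &
   (\<integral>\<^sup>+w. ennreal (Rb x t w) \<partial>M) <= ennreal (K * exp (q * t / 2))"
  proof (rule exI[of _ K], intro conjI allI impI)
   show "0 <= K" using K10 by (simp add: K_def)
   fix t :: real assume t: "0 <= t"
   show "(\<integral>\<^sup>+w. ennreal (exp (\<theta> * (Yb x t w - a))) \<partial>M) <= ennreal (K * exp (q * t / 2))"
    by (rule order.trans[OF Y[OF t] ennreal_leI[OF order.trans[OF b1[OF t] SK[OF t]]]])
   show "(\<integral>\<^sup>+w. ennreal (Lb x t w) \<partial>M) <= ennreal (K * exp (q * t / 2))"
    by (rule order.trans[OF L[OF t] ennreal_leI[OF order.trans[OF b2[OF t] SK[OF t]]]])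
   show "(\<integral>\<^sup>+w. ennreal (Rb x t w) \<partial>M) <= ennreal (K * exp (q * t / 2))"
    by (rule order.trans[OF Rt[OF t] ennreal_leI[OF order.trans[OF b3[OF t] SK[OF t]]]])
  qed
 qed
qed

section \<open>The process does not spend time at a point\<close>

text \<open>Started at \<open>c\<close>, the process ends above \<open>c\<close> if
  \<open>X h\<close> is positive and no arrival occurs, because then nothing is pushed down and
  reflection only helps.\<close>

lemma Pt_above_ge:
 assumes h: "0 <= h" and c: "a <= c"
 shows "prob {w\<in>space M. 0 < X h w} - r * h <= Pt (indicator {c<..}) h c"
proof -
 note [measurable] = Yb_measurable[OF h, of c] X_measurable[OF h] DN_measurable[OF order_refl h]
 have "prob {w\<in>space M. 0 < X h w} <= prob ({w\<in>space M. c < Yb c h w} Un {w\<in>space M. 0 < DN 0 h w})"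
 proof (rule finite_measure_mono_AE)
  show "AE w in M. w \<in> {w\<in>space M. 0 < X h w} --> w \<in> {w\<in>space M. c < Yb c h w} Un {w\<in>space M. 0 < DN 0 h w}"
   using AE_good
  proof eventually_elim
   case (elim w)
   interpret bp: barrier_path "%t. N t w" a b "%t. c + X t w" by (rule good_path[OF elim])
   have "c < Yb c h w" if "0 < X h w" "\<not> 0 < DN 0 h w"
   proof -
    have "N h w = 0" using that(2) bp.n_0 by (simp add: DN_def)
    then have "Lb c h w = 0" using bp.L_eq[OF h] by (simp add: good_eqs[OF elim])
    then show ?thesis using Rb_nonneg[OF elim h, of c] that(1) by (simp add: Yb_eq)
   qed
   then show ?case by auto
  qed
 qed measurable
 also have "... <= prob {w\<in>space M. c < Yb c h w} + prob {w\<in>space M. 0 < DN 0 h w}"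
  by (rule measure_Un_le) measurable
 also have "prob {w\<in>space M. c < Yb c h w} = Pt (indicator {c<..}) h c"
 proof -
  have "Pt (indicator {c<..}) h c = expectation (indicator {w\<in>space M. c < Yb c h w})"
   unfolding Pt_def by (intro Bochner_Integration.integral_cong) (auto simp: indicator_def)
  then show ?thesis by simp
 qed
 finally show ?thesis using prob_DN_pos_le[OF order_refl h] by simp
qed

text \<open>From any time spent at \<open>c\<close> the process is above \<open>c\<close> after the
  lag \<open>h j\<close> with probability at least \<epsilon> / 2, by the Markov property. So
  \<epsilon> / 2 times the mean time at \<open>c\<close> is at most the mean time at
  \<open>c\<close> that is left after the lag \<open>h j\<close>, and this tends to 0 by
  \<open>translation_null\<close>.\<close>

lemma Yb_not_at: "AE w in M. AE t in lborel. 0 <= t --> Yb x t w ~= c"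
proof (cases "a <= c")
 case False
 show ?thesis using AE_good
 proof eventually_elim
  case (elim w)
  have "Yb x t w ~= c" if "0 <= t" for t using Yb_ge[OF elim that, of x] False by auto
  then show ?case by (auto intro!: AE_I2)
 qed
next
 case True
 obtain \<epsilon> where \<epsilon>: "0 < \<epsilon>" "!!\<delta>. 0 < \<delta> ==> EX h. 0 < h & h < \<delta> & \<epsilon> <= prob {w\<in>space M. 0 < X h w}"
  using X_positive_small_times by blast
 \<comment> \<open>The bound \<epsilon> / (2 r) keeps the probability of an arrival below \<epsilon>
   / 2, so that half of \<epsilon> survives.\<close>
 have "ALL j. EX h. 0 < h & h < min (1 / real (Suc j)) (\<epsilon> / (2 * r)) & \<epsilon> <= prob {w\<in>space M. 0 < X h w}"
 proof (intro allI \<epsilon>(2))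
  show "0 < min (1 / real (Suc j)) (\<epsilon> / (2 * r))" for j using \<epsilon>(1) r_pos by simp
 qed
 then obtain h where h: "!!j. 0 < h j" "!!j. h j < 1 / real (Suc j)" "!!j. h j < \<epsilon> / (2 * r)" "!!j. \<epsilon> <= prob {w\<in>space M. 0 < X (h j) w}"
  by (metis min_less_iff_conj)
 have hlim: "h \<longlonglongrightarrow> 0"
  by (rule tendsto_sandwich[OF _ _ tendsto_const LIMSEQ_Suc[OF lim_const_over_n[of 1]]])
   (use h(1,2) in \<open>auto intro!: always_eventually less_imp_le simp del: of_nat_Suc\<close>)
 define \<phi> where "\<phi> = indicat_real {c<..}"
 have P: "\<epsilon> / 2 <= Pt \<phi> (h j) c" for j
 proof -
  have "r * h j <= r * (\<epsilon> / (2 * r))" using h(3)[of j] r_pos by (intro mult_left_mono) auto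
  then have "r * h j <= \<epsilon> / 2" using r_pos by simp
  moreover have "\<epsilon> - r * h j <= Pt \<phi> (h j) c"
   using Pt_above_ge[OF less_imp_le[OF h(1)] True, of j] h(4)[of j] by (simp add: \<phi>_def)
  moreover have "\<epsilon> = \<epsilon> / 2 + \<epsilon> / 2" by simp
  ultimately show ?thesis by linarith
 qed
 define Yg where "Yg = (%(t, w). if w \<in> Good & 0 <= t then Yb x t w else 0)"
 have Yg [measurable]: "Yg \<in> borel_measurable (lborel \<Otimes>\<^sub>M M)"
  unfolding Yg_def using Yb_joint[of x] by (simp cong: measurable_cong_sets)
 have AET: "AE w in M. AE t in lborel. \<not> (0 <= t & t <= real T & Yb x t w = c)" for T :: nat
 proof -
  \<comment> \<open>\<open>f j\<close> marks times at \<open>c\<close> that are no longer at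
    \<open>c\<close> after the lag \<open>h j\<close>, and \<open>g\<close> all times at
    \<open>c\<close>; both are restricted to \<open>Good\<close>, where joint measurability is
    available.\<close>
  define f where "f j = (%(t, w). indicator {0..real T} t * (indicator {c} (Yg (t, w)) * indicator (- {c}) (Yg (t + h j, w))) * indicator Good w :: ennreal)" for j
  define g where "g = (%(t, w). indicator {0..real T} t * indicator {c} (Yg (t, w)) * indicator Good w :: ennreal)"
  have sh [measurable]: "(%p. Yg (fst p + h j, snd p)) \<in> borel_measurable (lborel \<Otimes>\<^sub>M M)" for j
  proof -
   have "(%p. (fst p + h j, snd p)) \<in> lborel \<Otimes>\<^sub>M M \<rightarrow>\<^sub>M lborel \<Otimes>\<^sub>M M" by measurable
   from measurable_compose[OF this Yg] show ?thesis .
  qed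
  have fm: "f j \<in> borel_measurable (lborel \<Otimes>\<^sub>M M)" for j
  proof -
   have "(%p. indicator {0..real T} (fst p) * (indicator {c} (Yg p) * indicator (- {c}) (Yg (fst p + h j, snd p))) * indicator Good (snd p) :: ennreal) \<in> borel_measurable (lborel \<Otimes>\<^sub>M M)"
    by measurable
   then show ?thesis by (simp add: f_def split_beta)
  qed
  have gm: "g \<in> borel_measurable (lborel \<Otimes>\<^sub>M M)"
  proof -
   have "(%p. indicator {0..real T} (fst p) * indicator {c} (Yg p) * indicator Good (snd p) :: ennreal) \<in> borel_measurable (lborel \<Otimes>\<^sub>M M)"
    by measurable
   then show ?thesis by (simp add: g_def split_beta)
  qed
  have fub: "(\<integral>\<^sup>+w. (\<integral>\<^sup>+t. F' (t, w) \<partial>lborel) \<partial>M) = (\<integral>\<^sup>+t. (\<integral>\<^sup>+w. F' (t, w) \<partial>M) \<partial>lborel)"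
   if "F' \<in> borel_measurable (lborel \<Otimes>\<^sub>M M)" for F' :: "real \<times> 'w => ennreal"
   using LM.Fubini[OF that] by simp
  have sndm: "(%w. \<integral>\<^sup>+t. F' (t, w) \<partial>lborel) \<in> borel_measurable M"
   if "F' \<in> borel_measurable (lborel \<Otimes>\<^sub>M M)" for F' :: "real \<times> 'w => ennreal"
   using lborel.borel_measurable_nn_integral[of "%w t. F' (t, w)" M] measurable_pair_swap[OF that] by simp
  define I where "I = (\<integral>\<^sup>+w. (\<integral>\<^sup>+t. g (t, w) \<partial>lborel) \<partial>M)"
  define A where "A j = (\<integral>\<^sup>+w. (\<integral>\<^sup>+t. f j (t, w) \<partial>lborel) \<partial>M)" for j
  have "A \<longlonglongrightarrow> (\<integral>\<^sup>+w. 0 \<partial>M)"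
   unfolding A_def
  proof (rule nn_integral_dominated_convergence[where w="%_. ennreal (real T)"])
   show "(%w. \<integral>\<^sup>+t. f j (t, w) \<partial>lborel) \<in> borel_measurable M" for j
    by (rule sndm[OF fm])
   show "AE w in M. (\<integral>\<^sup>+t. f j (t, w) \<partial>lborel) <= ennreal (real T)" for j
   proof (rule AE_I2)
    fix w
    have "(\<integral>\<^sup>+t. f j (t, w) \<partial>lborel) <= (\<integral>\<^sup>+t. indicator {0..real T} t \<partial>lborel)"
     by (intro nn_integral_mono) (auto simp: f_def split: split_indicator)
    then show "(\<integral>\<^sup>+t. f j (t, w) \<partial>lborel) <= ennreal (real T)" by simp
   qed
   show "AE w in M. (%j. \<integral>\<^sup>+t. f j (t, w) \<partial>lborel) \<longlonglongrightarrow> 0"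
    using AE_Good AE_space
   proof eventually_elim
    case (elim w)
    define E where "E = {t. 0 <= t & Yg (t, w) = c}"
    have "(%t. Yg (t, w)) \<in> borel_measurable lborel" by (rule measurable_compose[OF measurable_Pair2'[OF elim(2)] Yg])
    from measurable_sets[OF this, of "{c}"] have "(%t. Yg (t, w)) -` {c} \<in> sets borel" by simp
    moreover have "E = {0..} Int (%t. Yg (t, w)) -` {c}" by (auto simp: E_def)
    ultimately have E: "E \<in> sets borel" by auto
    have "(\<integral>\<^sup>+t. f j (t, w) \<partial>lborel) = (\<integral>\<^sup>+t. indicator ({0..real T} Int E) t * indicator (- E) (t + h j) \<partial>lborel)" for j
     using elim(1) h(1)[of j] by (intro nn_integral_cong) (auto simp: f_def E_def split: split_indicator)
    then show ?case using translation_null[OF E hlim, of "real T"] by simp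
   qed
  qed (auto simp: ennreal_mult_less_top emeasure_eq_measure)
  then have A: "A \<longlonglongrightarrow> 0" by simp
  have "ennreal (\<epsilon> / 2) * I <= A j" for j
  proof -
   have "ennreal (\<epsilon> / 2) * I = (\<integral>\<^sup>+t. ennreal (\<epsilon> / 2) * (\<integral>\<^sup>+w. g (t, w) \<partial>M) \<partial>lborel)"
    unfolding I_def fub[OF gm] using borel_measurable_nn_integral_fst[OF gm] by (subst nn_integral_cmult) auto
   also have "... <= (\<integral>\<^sup>+t. (\<integral>\<^sup>+w. f j (t, w) \<partial>M) \<partial>lborel)"
   proof (rule nn_integral_mono)
    fix t :: real
    show "ennreal (\<epsilon> / 2) * (\<integral>\<^sup>+w. g (t, w) \<partial>M) <= (\<integral>\<^sup>+w. f j (t, w) \<partial>M)"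
    proof (cases "t \<in> {0..real T}")
     case False
     then show ?thesis by (simp add: f_def g_def)
    next
     case tT: True
     then have t: "0 <= t" by simp
     have hj: "0 <= h j" using h(1)[of j] by simp
     note [measurable] = Yb_measurable[OF t, of x] Yb_measurable[OF add_nonneg_nonneg[OF t hj], of x]
     define W where "W w = indicat_real {c} (Yb x t w)" for w
     have WF: "W \<in> borel_measurable (F t)" unfolding W_def[abs_def] using Yb_F[OF t, of x] by measurable
     have WM [measurable]: "W \<in> borel_measurable M" by (rule F_measurable_M[OF WF])
     have Wi: "integrable M W" by (rule integrable_const_bound[of _ 1]) (auto simp: W_def)
     have 1: "(\<integral>\<^sup>+w. g (t, w) \<partial>M) = ennreal (expectation W)"
     proof -
      have "(\<integral>\<^sup>+w. g (t, w) \<partial>M) = (\<integral>\<^sup>+w. ennreal (W w) \<partial>M)"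
       using AE_Good t tT by (intro nn_integral_cong_AE) (auto elim!: eventually_mono simp: g_def W_def Yg_def indicator_def)
      also have "... = ennreal (expectation W)" by (rule nn_integral_eq_integral[OF Wi]) (auto simp: W_def)
      finally show ?thesis .
     qed
     have "expectation (%w. W w * \<phi> (Yb x (t + h j) w)) = expectation (%w. W w * Pt \<phi> (h j) (Yb x t w))"
      unfolding \<phi>_def by (rule markov[OF t hj WF Wi continuous_limit_greaterThan])
     also have "(%w. W w * Pt \<phi> (h j) (Yb x t w)) = (%w. W w * Pt \<phi> (h j) c)"
      by (auto simp: W_def fun_eq_iff indicator_def)
     finally have 2: "expectation (%w. W w * \<phi> (Yb x (t + h j) w)) = expectation W * Pt \<phi> (h j) c" by simp
     have "expectation W * (\<epsilon> / 2) <= expectation W * Pt \<phi> (h j) c"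
      using P by (intro mult_left_mono integral_nonneg_AE) (auto simp: W_def)
     then have 3: "(\<epsilon> / 2) * expectation W <= expectation (%w. W w * \<phi> (Yb x (t + h j) w))" by (simp add: 2 mult.commute)
     have \<phi>m: "(%w. \<phi> (Yb x (t + h j) w)) \<in> borel_measurable M" unfolding \<phi>_def by measurable
     have "ennreal (\<epsilon> / 2) * (\<integral>\<^sup>+w. g (t, w) \<partial>M) <= ennreal (expectation (%w. W w * \<phi> (Yb x (t + h j) w)))"
      unfolding 1 using 3 \<epsilon>(1) by (subst ennreal_mult'[symmetric]) (auto intro!: ennreal_leI)
     also have "... = (\<integral>\<^sup>+w. ennreal (W w * \<phi> (Yb x (t + h j) w)) \<partial>M)"
     proof (rule nn_integral_eq_integral[symmetric])
      show "integrable M (%w. W w * \<phi> (Yb x (t + h j) w))"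
       using \<phi>m WM by (intro integrable_const_bound[of _ 1]) (auto simp: W_def \<phi>_def indicator_def)
     qed (auto simp: W_def \<phi>_def)
     also have "... <= (\<integral>\<^sup>+w. f j (t, w) \<partial>M)"
     proof (rule nn_integral_mono_AE)
      show "AE w in M. ennreal (W w * \<phi> (Yb x (t + h j) w)) <= f j (t, w)"
       using AE_Good by eventually_elim (use t hj tT in \<open>auto simp: f_def W_def \<phi>_def Yg_def indicator_def\<close>)
     qed
     finally show ?thesis .
    qed
   qed
   also have "... = A j" unfolding A_def by (rule fub[OF fm, symmetric])
   finally show ?thesis .
  qed
  then have "ennreal (\<epsilon> / 2) * I <= 0" by (intro LIMSEQ_le_const[OF A]) auto
  then have "I = 0" using \<epsilon>(1) by (simp add: ennreal_eq_0_iff)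
  then have "AE w in M. (\<integral>\<^sup>+t. g (t, w) \<partial>lborel) = 0"
   unfolding I_def using sndm[OF gm] by (subst (asm) nn_integral_0_iff_AE) auto
  then show ?thesis using AE_Good AE_space
  proof eventually_elim
   case (elim w)
   have "(%t. g (t, w)) \<in> borel_measurable lborel" by (rule measurable_compose[OF measurable_Pair2'[OF elim(3)] gm])
   then have "AE t in lborel. g (t, w) = 0" using elim(1) by (subst (asm) nn_integral_0_iff_AE) auto
   then show ?case using elim(2) by (auto elim!: eventually_mono simp: g_def Yg_def indicator_def split: if_splits)
  qed
 qed
 have "AE w in M. \<forall>T::nat. AE t in lborel. \<not> (0 <= t & t <= real T & Yb x t w = c)"
  using AET by (simp add: AE_all_countable)
 then show ?thesis
 proof eventually_elim
  case (elim w)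
  then have "AE t in lborel. \<forall>T::nat. \<not> (0 <= t & t <= real T & Yb x t w = c)" unfolding AE_all_countable .
  then show ?case by eventually_elim (metis real_arch_simple)
 qed
qed

lemma Yb_not_in_countable:
 assumes "countable K" shows "AE w in M. AE t in lborel. 0 <= t --> Yb x t w \<notin> K"
proof -
 have "AE w in M. \<forall>c\<in>K. AE t in lborel. 0 <= t --> Yb x t w ~= c"
  unfolding AE_ball_countable[OF assms] using Yb_not_at by blast
 then show ?thesis
 proof eventually_elim
  case (elim w)
  then have "AE t in lborel. \<forall>c\<in>K. 0 <= t --> Yb x t w ~= c" unfolding AE_ball_countable[OF assms] .
  then show ?case by eventually_elim blast
 qed
qed

end

section \<open>Discounted expectations of processes\<close>

lemma norm_integral_le:
 fixes f wt :: "'a => real"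
 assumes "integrable S wt" "AE x in S. norm (f x) <= wt x"
 shows "norm (\<integral>x. f x \<partial>S) <= (\<integral>x. wt x \<partial>S)"
proof (rule order.trans[OF integral_norm_bound integral_mono_AE'[OF assms]])
 show "AE x in S. 0 <= wt x" using assms(2) by eventually_elim (rule order.trans[OF norm_ge_zero])
qed

context discounted
begin

definition "Dl = density lborel (%t. ennreal (dis t))"
text \<open>The completion admits processes that agree only almost surely with a jointly measurable
  one, as given controls do. \<open>mproc\<close> is this class, and \<open>DE\<close> is the mean
  of the discounted time integral.\<close>

definition "CQ = completion (M \<Otimes>\<^sub>M Dl)"
definition "mproc H \<longleftrightarrow> (\<exists>J\<in>borel_measurable (M \<Otimes>\<^sub>M borel). AE w in M. \<forall>t\<ge>0. H t w = J (w, t))" for H :: "real => 'w => real"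
definition "iproc H \<longleftrightarrow> mproc H & integrable CQ (%(w, t). H t w)" for H :: "real => 'w => real"
definition "DE H = (\<integral>(w, t). H t w \<partial>CQ)" for H :: "real => 'w => real"

lemma sets_Dl [measurable_cong]: "sets Dl = sets borel" by (simp add: Dl_def)
lemma space_Dl [simp]: "space Dl = UNIV" by (simp add: Dl_def)

lemma Dl_finite: "finite_measure Dl"
proof
 have "emeasure Dl (space Dl) = (\<integral>\<^sup>+t. ennreal (dis t) \<partial>lborel)"
  by (simp add: Dl_def emeasure_density cong: nn_integral_cong)
 also have "... = ennreal (\<integral>t. dis t \<partial>lborel)"
  by (rule nn_integral_eq_integral[OF dis_integrable]) (auto simp: dis_nonneg)
 finally show "emeasure Dl (space Dl) ~= \<infinity>" by simp
qed

interpretation Dl: finite_measure Dl by (rule Dl_finite)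
interpretation DM: pair_sigma_finite M Dl ..

lemma nn_integral_Dl: "h \<in> borel_measurable borel ==> (\<integral>\<^sup>+t. h t \<partial>Dl) = (\<integral>\<^sup>+t. ennreal (dis t) * h t \<partial>lborel)"
 by (simp add: Dl_def nn_integral_density)

lemma AE_Dl: "(AE t in lborel. 0 <= t --> P t) ==> (AE t in Dl. P t)"
 unfolding Dl_def by (subst AE_density) (auto elim!: eventually_mono simp: dis_def indicator_def split: if_splits)

lemma AE_CQ:
 assumes "AE w in M. \<forall>t\<ge>0. P w t"
 shows "AE z in CQ. case z of (w, t) => P w t"
proof -
 obtain Z where Z: "!!w. w \<in> space M - Z ==> \<forall>t\<ge>0. P w t" "Z \<in> null_sets M" using AE_E3[OF assms] by blast
 have [measurable]: "Z \<in> sets M" using Z(2) by auto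
 have "AE z in M \<Otimes>\<^sub>M Dl. fst z \<notin> Z & 0 <= snd z"
 proof (rule DM.AE_pair_measure)
  show "{z \<in> space (M \<Otimes>\<^sub>M Dl). fst z \<notin> Z & 0 <= snd z} \<in> sets (M \<Otimes>\<^sub>M Dl)" by measurable
  have "AE t in Dl. 0 <= t" by (rule AE_Dl) auto
  then show "AE w in M. AE t in Dl. fst (w, t) \<notin> Z & 0 <= snd (w, t)"
   using AE_not_in[OF Z(2)] by auto
 qed
 moreover have "AE z in M \<Otimes>\<^sub>M Dl. z \<in> space (M \<Otimes>\<^sub>M Dl)" by (rule AE_space)
 ultimately have "AE z in M \<Otimes>\<^sub>M Dl. case z of (w, t) => P w t"
  by eventually_elim (use Z(1) in \<open>auto simp: space_pair_measure\<close>)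
 then show ?thesis unfolding CQ_def by (rule AE_completion)
qed

lemma mproc_pair: "J \<in> borel_measurable (M \<Otimes>\<^sub>M borel) ==> mproc (%t w. J (w, t))"
 unfolding mproc_def by auto

lemma mprocI: "J \<in> borel_measurable (M \<Otimes>\<^sub>M borel) ==> AE w in M. \<forall>t\<ge>0. H t w = J (w, t) ==> mproc H"
 unfolding mproc_def by blast

lemma mprocE:
 assumes "mproc H"
 obtains J where "J \<in> borel_measurable (M \<Otimes>\<^sub>M borel)" "AE w in M. \<forall>t\<ge>0. H t w = J (w, t)"
 using assms unfolding mproc_def by blast

lemma mproc_CQ:
 assumes "mproc H" shows "(%(w, t). H t w) \<in> borel_measurable CQ"
proof -
 obtain J where J: "J \<in> borel_measurable (M \<Otimes>\<^sub>M borel)" "AE w in M. \<forall>t\<ge>0. H t w = J (w, t)" using mprocE[OF assms] by blast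
 have "J \<in> borel_measurable (M \<Otimes>\<^sub>M Dl)" using J(1) by (simp cong: measurable_cong_sets)
 then have "J \<in> borel_measurable (completion (M \<Otimes>\<^sub>M Dl))" by (rule measurable_completion)
 moreover have "AE z in completion (M \<Otimes>\<^sub>M Dl). J z = (case z of (w, t) => H t w)"
  using AE_CQ[OF J(2)] unfolding CQ_def by eventually_elim auto
 ultimately show ?thesis unfolding CQ_def by (rule completion.M_measurable_AE) auto
qed

lemma mproc_compose:
 assumes "mproc H" and [measurable]: "\<phi> \<in> borel_measurable borel" shows "mproc (%t w. \<phi> (H t w))"
proof -
 obtain J where J [measurable]: "J \<in> borel_measurable (M \<Otimes>\<^sub>M borel)" and eq: "AE w in M. \<forall>t\<ge>0. H t w = J (w, t)" using mprocE[OF assms(1)] by blast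
 have "(%z. \<phi> (J z)) \<in> borel_measurable (M \<Otimes>\<^sub>M borel)" by measurable
 moreover have "AE w in M. \<forall>t\<ge>0. \<phi> (H t w) = \<phi> (J (w, t))" using eq by eventually_elim simp
 ultimately show ?thesis by (rule mprocI[where J="%z. \<phi> (J z)"])
qed

lemma mproc_add: "mproc (%t w. H t w + H' t w)" and mproc_mult: "mproc (%t w. H t w * H' t w)"
 if H: "mproc H" and H': "mproc H'"
proof -
 obtain J where J [measurable]: "J \<in> borel_measurable (M \<Otimes>\<^sub>M borel)" and eq: "AE w in M. \<forall>t\<ge>0. H t w = J (w, t)" using mprocE[OF H] by blast
 obtain J' where J' [measurable]: "J' \<in> borel_measurable (M \<Otimes>\<^sub>M borel)" and eq': "AE w in M. \<forall>t\<ge>0. H' t w = J' (w, t)" using mprocE[OF H'] by blast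
 have "(%z. J z + J' z) \<in> borel_measurable (M \<Otimes>\<^sub>M borel)" by measurable
 moreover have "AE w in M. \<forall>t\<ge>0. H t w + H' t w = J (w, t) + J' (w, t)" using eq eq' by eventually_elim simp
 ultimately show "mproc (%t w. H t w + H' t w)" by (rule mprocI[where J="%z. J z + J' z"])
 have "(%z. J z * J' z) \<in> borel_measurable (M \<Otimes>\<^sub>M borel)" by measurable
 moreover have "AE w in M. \<forall>t\<ge>0. H t w * H' t w = J (w, t) * J' (w, t)" using eq eq' by eventually_elim simp
 ultimately show "mproc (%t w. H t w * H' t w)" by (rule mprocI[where J="%z. J z * J' z"])
qed

lemma mproc_random: "W \<in> borel_measurable M ==> mproc (%t. W)"
 using mproc_pair[of "%p. W (fst p)"] by simp

lemma mproc_cmult: "mproc H ==> mproc (%t w. c * H t w)"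
 by (rule mproc_compose[where \<phi>="%y. c * y"]) auto

lemma mproc_diff: "mproc H ==> mproc H' ==> mproc (%t w. H t w - H' t w)"
 using mproc_add[of H "%t w. -1 * H' t w"] mproc_cmult[of H' "-1"] by simp

lemma mproc_sum: "finite S ==> (!!k. k \<in> S ==> mproc (G k)) ==> mproc (%t w. \<Sum>k\<in>S. G k t w)"
 by (induction S rule: finite_induct) (auto intro: mproc_add mproc_random)

lemma mproc_step:
 assumes "W \<in> borel_measurable M"
 shows "mproc (%t w. W w * indicator {s..} t)"
proof -
 note [measurable] = assms
 have "(%p. W (fst p) * indicator {s..} (snd p)) \<in> borel_measurable (M \<Otimes>\<^sub>M borel)" by measurable
 from mproc_pair[OF this] show ?thesis by simp
qed

lemma mproc_cadlag:
 fixes Z :: "real => 'w => real"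
 assumes Z: "!!t. 0 <= t ==> Z t \<in> borel_measurable M" and cad: "AE w in M. cadlag (%t. Z t w)"
 shows "mproc Z"
proof -
 obtain N0 where N0: "!!w. w \<in> space M - N0 ==> cadlag (%t. Z t w)" "N0 \<in> null_sets M" using AE_E3[OF cad] by blast
 define G where "G = space M - N0"
 have G: "G \<in> sets M" using N0(2) by (auto simp: G_def)
 define J where "J p = (%(t, w). if w \<in> G & 0 <= t then Z t w else 0) (snd p, fst p)" for p
 have "(%(t, w). if w \<in> G & 0 <= t then Z t w else 0) \<in> borel_measurable (borel \<Otimes>\<^sub>M M)"
  using N0(1) by (intro borel_measurable_right_continuous[OF G Z]) (auto simp: G_def intro!: cadlag_at_right)
 then have "J \<in> borel_measurable (M \<Otimes>\<^sub>M borel)"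
  unfolding J_def[abs_def] by (rule measurable_compose[rotated]) measurable
 moreover have "AE w in M. \<forall>t\<ge>0. Z t w = J (w, t)"
  using AE_not_in[OF N0(2)] AE_space by eventually_elim (auto simp: J_def G_def)
 ultimately show ?thesis by (rule mprocI)
qed


lemma mproc_Yb: "mproc (Yb x)" and mproc_Rb: "mproc (Rb x)" and mproc_Lb: "mproc (Lb x)"
 using AE_good by (auto intro!: mproc_cadlag elim!: eventually_mono intro: Yb_cadlag Rb_cadlag Lb_cadlag)

lemma integrable_Dl: "h \<in> borel_measurable borel ==> integrable Dl h \<longleftrightarrow> integrable lborel (%t. dis t * h t)"
 and integral_Dl: "h \<in> borel_measurable borel ==> (\<integral>t. h t \<partial>Dl) = (\<integral>t. dis t * h t \<partial>lborel)"
 for h :: "real => real"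
 unfolding Dl_def by (simp_all add: integrable_real_density dis_nonneg integral_real_density)

lemma dis_eqI: "\<forall>t\<ge>0. h t = h' t ==> (%t. dis t * h t) = (%t. dis t * h' t)"
 by (auto simp: fun_eq_iff dis_def indicator_def)

lemma section_measurable: "J \<in> borel_measurable (M \<Otimes>\<^sub>M borel) ==> w \<in> space M ==> (%t. J (w, t)) \<in> borel_measurable borel"
 by (rule measurable_compose[OF measurable_Pair1'])

text \<open>Both orders of integration: outcomes outside match the definition of admissibility,
  times outside match moment bounds given for each time.\<close>

lemma nn_DE:
 assumes "mproc H"
 shows "(\<integral>\<^sup>+z. ennreal \<bar>case z of (w, t) => H t w\<bar> \<partial>CQ) = (\<integral>\<^sup>+w. (\<integral>\<^sup>+t. ennreal (dis t * \<bar>H t w\<bar>) \<partial>lborel) \<partial>M)"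
  and "(\<integral>\<^sup>+z. ennreal \<bar>case z of (w, t) => H t w\<bar> \<partial>CQ) = (\<integral>\<^sup>+t. ennreal (dis t) * (\<integral>\<^sup>+w. ennreal \<bar>H t w\<bar> \<partial>M) \<partial>lborel)"
proof -
 obtain J where J: "J \<in> borel_measurable (M \<Otimes>\<^sub>M borel)" "AE w in M. \<forall>t\<ge>0. H t w = J (w, t)" using mprocE[OF assms] by blast
 have JD [measurable]: "J \<in> borel_measurable (M \<Otimes>\<^sub>M Dl)" using J(1) by (simp cong: measurable_cong_sets)
 have c: "AE z in completion (M \<Otimes>\<^sub>M Dl). (case z of (w, t) => H t w) = J z"
  using AE_CQ[OF J(2)] unfolding CQ_def by eventually_elim auto
 have 0: "(\<integral>\<^sup>+z. ennreal \<bar>case z of (w, t) => H t w\<bar> \<partial>CQ) = (\<integral>\<^sup>+z. ennreal \<bar>J z\<bar> \<partial>(M \<Otimes>\<^sub>M Dl))"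
  unfolding CQ_def nn_integral_completion by (rule nn_integral_cong_AE) (use c in \<open>auto simp: AE_completion_iff elim!: eventually_mono\<close>)
 also have "... = (\<integral>\<^sup>+w. (\<integral>\<^sup>+t. ennreal \<bar>J (w, t)\<bar> \<partial>Dl) \<partial>M)" by (rule Dl.nn_integral_fst[symmetric]) measurable
 also have "... = (\<integral>\<^sup>+w. (\<integral>\<^sup>+t. ennreal (dis t * \<bar>H t w\<bar>) \<partial>lborel) \<partial>M)"
 proof (rule nn_integral_cong_AE)
  show "AE w in M. (\<integral>\<^sup>+t. ennreal \<bar>J (w, t)\<bar> \<partial>Dl) = (\<integral>\<^sup>+t. ennreal (dis t * \<bar>H t w\<bar>) \<partial>lborel)"
   using J(2) AE_space
  proof eventually_elim
   case (elim w)
   have "\<forall>t\<ge>0. \<bar>H t w\<bar> = \<bar>J (w, t)\<bar>" using elim(1) by simp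
   from dis_eqI[OF this] have "dis t * \<bar>H t w\<bar> = dis t * \<bar>J (w, t)\<bar>" for t by (rule fun_cong)
   then have e: "ennreal (dis t * \<bar>H t w\<bar>) = ennreal (dis t) * ennreal \<bar>J (w, t)\<bar>" for t
    by (simp only: ennreal_mult abs_ge_zero dis_nonneg)
   have m: "(%t. ennreal \<bar>J (w, t)\<bar>) \<in> borel_measurable borel" using section_measurable[OF J(1) elim(2)] by measurable
   show ?case by (simp only: nn_integral_Dl[OF m] e)
  qed
 qed
 finally show "(\<integral>\<^sup>+z. ennreal \<bar>case z of (w, t) => H t w\<bar> \<partial>CQ) = (\<integral>\<^sup>+w. (\<integral>\<^sup>+t. ennreal (dis t * \<bar>H t w\<bar>) \<partial>lborel) \<partial>M)" .
 have m2: "(%t. \<integral>\<^sup>+w. ennreal \<bar>J (w, t)\<bar> \<partial>M) \<in> borel_measurable borel"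
 proof -
  have "(%t. \<integral>\<^sup>+w. ennreal \<bar>J (w, t)\<bar> \<partial>M) \<in> borel_measurable Dl" by measurable
  then show ?thesis by (simp cong: measurable_cong_sets)
 qed
 have "(\<integral>\<^sup>+z. ennreal \<bar>J z\<bar> \<partial>(M \<Otimes>\<^sub>M Dl)) = (\<integral>\<^sup>+t. (\<integral>\<^sup>+w. ennreal \<bar>J (w, t)\<bar> \<partial>M) \<partial>Dl)"
  by (rule DM.nn_integral_snd[symmetric]) measurable
 also have "... = (\<integral>\<^sup>+t. ennreal (dis t) * (\<integral>\<^sup>+w. ennreal \<bar>J (w, t)\<bar> \<partial>M) \<partial>lborel)" by (rule nn_integral_Dl[OF m2])
 also have "... = (\<integral>\<^sup>+t. ennreal (dis t) * (\<integral>\<^sup>+w. ennreal \<bar>H t w\<bar> \<partial>M) \<partial>lborel)"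
 proof (rule nn_integral_cong)
  fix t
  show "ennreal (dis t) * (\<integral>\<^sup>+w. ennreal \<bar>J (w, t)\<bar> \<partial>M) = ennreal (dis t) * (\<integral>\<^sup>+w. ennreal \<bar>H t w\<bar> \<partial>M)"
  proof (cases "0 <= t")
   case True
   have "(\<integral>\<^sup>+w. ennreal \<bar>J (w, t)\<bar> \<partial>M) = (\<integral>\<^sup>+w. ennreal \<bar>H t w\<bar> \<partial>M)"
    by (rule nn_integral_cong_AE) (use J(2) True in \<open>auto elim!: eventually_mono\<close>)
   then show ?thesis by simp
  qed (simp add: dis_neg)
 qed
 finally show "(\<integral>\<^sup>+z. ennreal \<bar>case z of (w, t) => H t w\<bar> \<partial>CQ) = (\<integral>\<^sup>+t. ennreal (dis t) * (\<integral>\<^sup>+w. ennreal \<bar>H t w\<bar> \<partial>M) \<partial>lborel)"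
  by (simp only: 0)
qed

lemma iproc_iff: "iproc H \<longleftrightarrow> mproc H & (\<integral>\<^sup>+w. (\<integral>\<^sup>+t. ennreal (dis t * \<bar>H t w\<bar>) \<partial>lborel) \<partial>M) < \<infinity>"
 unfolding iproc_def using nn_DE(1)[of H] mproc_CQ[of H] by (auto simp: integrable_iff_bounded)

lemma iproc_mproc: "iproc H ==> mproc H" by (simp add: iproc_def)

lemma exp_half_dis: "dis t * exp (q * t / 2) = indicator {0..} t * exp (- (q / 2) * t)"
 by (auto simp: dis_def indicator_def field_simps simp flip: exp_add)

lemma iproc_growth:
 assumes H: "mproc H" and K: "0 <= K" "!!t. 0 <= t ==> (\<integral>\<^sup>+w. ennreal \<bar>H t w\<bar> \<partial>M) <= ennreal (K * exp (q * t / 2))"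
 shows "iproc H"
proof -
 have i: "integrable lborel (%t. indicator {0..} t * exp (- (q / 2) * t))" by (rule exp_integrable_half) (use q_pos in simp)
 have "(\<integral>\<^sup>+t. ennreal (dis t) * (\<integral>\<^sup>+w. ennreal \<bar>H t w\<bar> \<partial>M) \<partial>lborel) <= (\<integral>\<^sup>+t. ennreal (K * (indicator {0..} t * exp (- (q / 2) * t))) \<partial>lborel)"
 proof (rule nn_integral_mono)
  fix t
  show "ennreal (dis t) * (\<integral>\<^sup>+w. ennreal \<bar>H t w\<bar> \<partial>M) <= ennreal (K * (indicator {0..} t * exp (- (q / 2) * t)))"
  proof (cases "0 <= t")
   case True
   have "ennreal (dis t) * (\<integral>\<^sup>+w. ennreal \<bar>H t w\<bar> \<partial>M) <= ennreal (dis t) * ennreal (K * exp (q * t / 2))"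
    by (rule mult_left_mono[OF K(2)[OF True]]) simp
   also have "... = ennreal (dis t * (K * exp (q * t / 2)))" using K(1) by (simp add: ennreal_mult dis_nonneg)
   also have "dis t * (K * exp (q * t / 2)) = K * (dis t * exp (q * t / 2))" by simp
   finally show ?thesis by (simp only: exp_half_dis)
  qed (simp add: dis_neg)
 qed
 also have "... = ennreal (\<integral>t. K * (indicator {0..} t * exp (- (q / 2) * t)) \<partial>lborel)"
  by (rule nn_integral_eq_integral) (use i K(1) in auto)
 also have "... < \<infinity>" by simp
 finally show ?thesis using H nn_DE[OF H] by (simp add: iproc_iff)
qed

lemma DE_iterated:
 assumes "iproc H"
 shows "integrable M (%w. \<integral>t. dis t * H t w \<partial>lborel)"
  and "AE w in M. integrable lborel (%t. dis t * H t w)"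
  and "DE H = expectation (%w. \<integral>t. dis t * H t w \<partial>lborel)"
proof -
 obtain J where J: "J \<in> borel_measurable (M \<Otimes>\<^sub>M borel)" "AE w in M. \<forall>t\<ge>0. H t w = J (w, t)" using mprocE[OF iproc_mproc[OF assms]] by blast
 have JD [measurable]: "J \<in> borel_measurable (M \<Otimes>\<^sub>M Dl)" using J(1) by (simp cong: measurable_cong_sets)
 have JC: "J \<in> borel_measurable CQ" unfolding CQ_def by (rule measurable_completion[OF JD])
 have c: "AE z in CQ. (case z of (w, t) => H t w) = J z" using AE_CQ[OF J(2)] by eventually_elim auto
 note HC = mproc_CQ[OF iproc_mproc[OF assms]]
 have "integrable CQ J" using assms integrable_cong_AE[OF HC JC c] by (simp add: iproc_def)
 then have Ji: "integrable (M \<Otimes>\<^sub>M Dl) J" unfolding CQ_def by (simp add: integrable_completion JD)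
 have sec: "AE w in M. (\<integral>t. J (w, t) \<partial>Dl) = (\<integral>t. dis t * H t w \<partial>lborel) &
   (integrable Dl (%t. J (w, t)) \<longleftrightarrow> integrable lborel (%t. dis t * H t w))"
  using J(2) AE_space
 proof eventually_elim
  case (elim w)
  show ?case unfolding dis_eqI[OF elim(1)]
   using section_measurable[OF J(1) elim(2)] by (simp add: integral_Dl integrable_Dl)
 qed
 have JM: "integrable M (%w. \<integral>t. J (w, t) \<partial>Dl)" by (rule DM.integrable_fst'[OF Ji])
 have eq: "AE w in M. (\<integral>t. J (w, t) \<partial>Dl) = (\<integral>t. dis t * H t w \<partial>lborel)" using sec by eventually_elim simp
 have m: "(%w. \<integral>t. dis t * H t w \<partial>lborel) \<in> borel_measurable M"
  by (rule M_measurable_AE[OF _ eq]) (use JM in auto)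
 show "integrable M (%w. \<integral>t. dis t * H t w \<partial>lborel)"
  using integrable_cong_AE[OF _ m eq] JM by auto
 show "AE w in M. integrable lborel (%t. dis t * H t w)" using sec DM.AE_integrable_fst'[OF Ji] by eventually_elim simp
 have "DE H = (\<integral>z. J z \<partial>CQ)" unfolding DE_def by (rule integral_cong_AE[OF HC JC c])
 also have "... = (\<integral>z. J z \<partial>(M \<Otimes>\<^sub>M Dl))" unfolding CQ_def by (rule integral_completion[OF JD])
 also have "... = expectation (%w. \<integral>t. J (w, t) \<partial>Dl)" by (rule DM.integral_fst'[OF Ji, symmetric])
 also have "... = expectation (%w. \<integral>t. dis t * H t w \<partial>lborel)" by (rule integral_cong_AE[OF _ m eq]) (use JM in auto)
 finally show "DE H = expectation (%w. \<integral>t. dis t * H t w \<partial>lborel)" .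
qed

lemma iproc_add: "iproc H ==> iproc H' ==> iproc (%t w. H t w + H' t w)"
 and DE_add: "iproc H ==> iproc H' ==> DE (%t w. H t w + H' t w) = DE H + DE H'"
 and iproc_diff: "iproc H ==> iproc H' ==> iproc (%t w. H t w - H' t w)"
 and DE_diff: "iproc H ==> iproc H' ==> DE (%t w. H t w - H' t w) = DE H - DE H'"
 and iproc_cmult: "iproc H ==> iproc (%t w. c * H t w)"
 and DE_cmult: "DE (%t w. c * H t w) = c * DE H"
 unfolding iproc_def DE_def split_beta by (auto intro: mproc_add mproc_diff mproc_cmult)

lemma DE_sum: "finite S ==> (!!k. k \<in> S ==> iproc (G k)) ==> DE (%t w. \<Sum>k\<in>S. G k t w) = (\<Sum>k\<in>S. DE (G k))"
 unfolding iproc_def DE_def split_beta by (auto intro!: mproc_sum Bochner_Integration.integral_sum)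

lemma iproc_bound:
 assumes "mproc H" "iproc K" "AE w in M. \<forall>t\<ge>0. \<bar>H t w\<bar> <= K t w"
 shows "iproc H"
 unfolding iproc_def
proof (intro conjI assms(1) Bochner_Integration.integrable_bound[OF _ mproc_CQ[OF assms(1)]])
 show "integrable CQ (%(w, t). K t w)" using assms(2) by (simp add: iproc_def)
 show "AE z in CQ. norm (case z of (w, t) => H t w) <= norm (case z of (w, t) => K t w)"
  using AE_CQ[OF assms(3)] by eventually_elim auto
qed

lemma DE_mono:
 assumes "iproc H" "iproc K" "AE w in M. \<forall>t\<ge>0. H t w <= K t w"
 shows "DE H <= DE K"
 unfolding DE_def
proof (rule integral_mono_AE)
 show "AE z in CQ. (case z of (w, t) => H t w) <= (case z of (w, t) => K t w)"
  using AE_CQ[OF assms(3)] by eventually_elim auto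
qed (use assms in \<open>auto simp: iproc_def\<close>)

text \<open>Convergence is asked at almost every time only. Monotone controls provide it off a
  countable set of times, and paths of \<open>Yb\<close> avoid a countable set of points at almost
  all times.\<close>

lemma DE_dominated_convergence:
 assumes "!!n. mproc (H n)" "mproc H'" "iproc K" "AE w in M. \<forall>t\<ge>0. ALL n. \<bar>H n t w\<bar> <= K t w"
  and "AE w in M. \<forall>t\<ge>0. \<bar>H' t w\<bar> <= K t w"
  and lim: "AE w in M. AE t in lborel. 0 <= t --> (%n. H n t w) \<longlonglongrightarrow> H' t w"
 shows "(%n. DE (H n)) \<longlonglongrightarrow> DE H'"
proof -
 have b: "AE w in M. \<forall>t\<ge>0. \<bar>H n t w\<bar> <= K t w" for n using assms(4) by eventually_elim auto
 have iH: "iproc (H n)" for n by (rule iproc_bound[OF assms(1,3) b])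
 have iH': "iproc H'" by (rule iproc_bound[OF assms(2,3,5)])
 note [measurable] = DE_iterated(1)[OF iH, THEN borel_measurable_integrable] DE_iterated(1)[OF iH', THEN borel_measurable_integrable]
 have all: "AE w in M. ALL n. integrable lborel (%t. dis t * H n t w)" using DE_iterated(2)[OF iH] by (simp add: AE_all_countable)
 have ineq: "norm (dis t * h) <= dis t * k" if "0 <= t --> \<bar>h\<bar> <= k" for t h k
  using that dis_nonneg[of t] dis_neg[of t] by (cases "0 <= t") (auto simp: abs_mult intro!: mult_left_mono)
 show ?thesis unfolding DE_iterated(3)[OF iH] DE_iterated(3)[OF iH']
 proof (rule integral_dominated_convergence[where w="%w. \<integral>t. dis t * K t w \<partial>lborel"])
  show "integrable M (%w. \<integral>t. dis t * K t w \<partial>lborel)" by (rule DE_iterated(1)[OF assms(3)])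
  show "AE w in M. norm (\<integral>t. dis t * H n t w \<partial>lborel) <= (\<integral>t. dis t * K t w \<partial>lborel)" for n
   using b[of n] DE_iterated(2)[OF assms(3)]
  proof eventually_elim
   case (elim w)
   show ?case by (rule norm_integral_le) (use elim ineq in auto)
  qed
  show "AE w in M. (%n. \<integral>t. dis t * H n t w \<partial>lborel) \<longlonglongrightarrow> (\<integral>t. dis t * H' t w \<partial>lborel)"
   using lim assms(4) all DE_iterated(2)[OF assms(3)] DE_iterated(2)[OF iH']
  proof eventually_elim
   case (elim w)
   show ?case
   proof (rule integral_dominated_convergence[where w="%t. dis t * K t w"])
    show "AE t in lborel. (%n. dis t * H n t w) \<longlonglongrightarrow> dis t * H' t w"
     using elim(1)
    proof eventually_elim
     case (elim t)
     then show ?case by (cases "0 <= t") (auto simp: dis_neg intro!: tendsto_mult_left)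
    qed
    show "AE t in lborel. norm (dis t * H n t w) <= dis t * K t w" for n
     using elim(2) ineq by auto
    show "(%t. dis t * H n t w) \<in> borel_measurable lborel" for n
     by (rule borel_measurable_integrable) (use elim(3) in blast)
    show "(%t. dis t * H' t w) \<in> borel_measurable lborel"
     by (rule borel_measurable_integrable[OF elim(5)])
   qed (use elim in auto)
  qed
 qed measurable
qed

lemma U_abs_le:
 assumes "!!y. \<bar>\<phi> y\<bar> <= B" shows "\<bar>U \<phi> y\<bar> <= B / q"
proof -
 have "norm (\<integral>u. dis u * Pt \<phi> u y \<partial>lborel) <= (\<integral>u. B * dis u \<partial>lborel)"
 proof (rule norm_integral_le)
  show "integrable lborel (%u. B * dis u)" using dis_integrable by simp
  have "norm (dis u * Pt \<phi> u y) <= B * dis u" for u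
   using mult_left_mono[OF Pt_abs_le[of \<phi> B u y, OF assms] dis_nonneg[of u]] dis_nonneg[of u] by (simp add: abs_mult mult.commute)
  then show "AE u in lborel. norm (dis u * Pt \<phi> u y) <= B * dis u" by simp
 qed
 then show ?thesis by (simp add: U_def dis_integral)
qed

lemma dis_shift: "0 <= s ==> (\<integral>t. dis t * (h t * indicator {s..} t) \<partial>lborel) = exp (- q * s) * (\<integral>u. dis u * h (s + u) \<partial>lborel)" for h :: "real => real"
proof -
 assume s: "0 <= s"
 have "(\<integral>t. dis t * (h t * indicator {s..} t) \<partial>lborel) = (\<integral>u. dis (s + 1 * u) * (h (s + 1 * u) * indicator {s..} (s + 1 * u)) \<partial>lborel)"
  by (subst lborel_integral_real_affine[where c=1 and t=s]) auto
 also have "... = (\<integral>u. exp (- q * s) * (dis u * h (s + u)) \<partial>lborel)"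
  using s by (intro Bochner_Integration.integral_cong) (auto simp: dis_def indicator_def algebra_simps exp_add exp_minus exp_diff field_simps)
 finally show ?thesis by simp
qed

lemma iproc_step:
 assumes W: "integrable M W"
 shows "iproc (%t w. W w * indicator {s..} t)"
proof (rule iproc_growth)
 show "mproc (%t w. W w * indicator {s..} t)" using W by (intro mproc_step) auto
 show "0 <= expectation (%w. \<bar>W w\<bar>)" by simp
 fix t :: real assume t: "0 <= t"
 have "(\<integral>\<^sup>+w. ennreal \<bar>W w * indicator {s..} t\<bar> \<partial>M) <= (\<integral>\<^sup>+w. ennreal \<bar>W w\<bar> \<partial>M)"
  by (intro nn_integral_mono) (auto simp: indicator_def)
 also have "... = ennreal (expectation (%w. \<bar>W w\<bar>))" using W by (intro nn_integral_eq_integral) auto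
 also have "... <= ennreal (expectation (%w. \<bar>W w\<bar>) * exp (q * t / 2))"
 proof (rule ennreal_leI)
  have "1 <= exp (q * t / 2)" using q_pos t by simp
  from mult_left_mono[OF this, of "expectation (%w. \<bar>W w\<bar>)"]
  show "expectation (%w. \<bar>W w\<bar>) <= expectation (%w. \<bar>W w\<bar>) * exp (q * t / 2)" by simp
 qed
 finally show "(\<integral>\<^sup>+w. ennreal \<bar>W w * indicator {s..} t\<bar> \<partial>M) <= ennreal (expectation (%w. \<bar>W w\<bar>) * exp (q * t / 2))" .
qed

lemma DE_step:
 assumes W: "integrable M W" and s: "0 <= s"
 shows "DE (%t w. W w * indicator {s..} t) = exp (- q * s) / q * expectation W"
proof -
 have "(\<integral>t. dis t * (W w * indicator {s..} t) \<partial>lborel) = exp (- q * s) / q * W w" for w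
  using dis_shift[OF s, of "%_. W w"] dis_integral by simp
 then show ?thesis unfolding DE_iterated(3)[OF iproc_step[OF W]] by simp
qed

text \<open>The effect of a single control increment \<open>W\<close> made at time \<open>s\<close>:
  its contribution to the discounted mean of \<open>\<phi> (Y t) * Z t\<close> is the potential at
  \<open>Y s\<close>, discounted from \<open>s\<close>.\<close>

lemma DE_resolvent:
 assumes s: "0 <= s" and W: "W \<in> borel_measurable (F s)" "integrable M W" and \<phi>: "continuous_limit \<phi> B"
 shows "iproc (%t w. \<phi> (Yb x t w) * (W w * indicator {s..} t))"
  and "DE (%t w. \<phi> (Yb x t w) * (W w * indicator {s..} t)) = exp (- q * s) * expectation (%w. W w * U \<phi> (Yb x s w))"
proof -
 show i: "iproc (%t w. \<phi> (Yb x t w) * (W w * indicator {s..} t))"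
 proof (rule iproc_bound)
  show "mproc (%t w. \<phi> (Yb x t w) * (W w * indicator {s..} t))"
   using W(2) by (intro mproc_mult mproc_compose[OF mproc_Yb] mproc_step continuous_limit_measurable[OF \<phi>]) auto
  show "iproc (%t w. B * (\<bar>W w\<bar> * indicator {s..} t))" using W(2) by (intro iproc_cmult iproc_step) auto
  have "\<bar>\<phi> (Yb x t w) * (W w * indicator {s..} t)\<bar> <= B * (\<bar>W w\<bar> * indicator {s..} t)" for t w
   using mult_right_mono[OF continuous_limit_bound[OF \<phi>, of "Yb x t w"], of "\<bar>W w\<bar> * indicator {s..} t"]
   by (simp add: abs_mult)
  then show "AE w in M. \<forall>t\<ge>0. \<bar>\<phi> (Yb x t w) * (W w * indicator {s..} t)\<bar> <= B * (\<bar>W w\<bar> * indicator {s..} t)" by simp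
 qed
 have "(\<integral>t. dis t * (\<phi> (Yb x t w) * (W w * indicator {s..} t)) \<partial>lborel) = exp (- q * s) * (W w * (\<integral>u. dis u * \<phi> (Yb x (s + u) w) \<partial>lborel))" for w
  using dis_shift[OF s, of "%t. W w * \<phi> (Yb x t w)"] by (simp add: mult_ac)
 then show "DE (%t w. \<phi> (Yb x t w) * (W w * indicator {s..} t)) = exp (- q * s) * expectation (%w. W w * U \<phi> (Yb x s w))"
  unfolding DE_iterated(3)[OF i] using resolvent_markov[OF s W \<phi>, of x] by simp
qed

text \<open>By monotonicity \<open>Z t\<close> is a lower bound for all later values, so its
  discounted tail, a multiple of \<open>Z t\<close>, is below the whole integral.\<close>

lemma iproc_time_integrable:
 assumes Z: "iproc Z" "!!t. 0 <= t ==> Z t \<in> borel_measurable M" and path: "AE w in M. 0 <= Z 0 w & mono_on {0..} (%t. Z t w)"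
  and t: "0 <= t"
 shows "integrable M (Z t)"
proof (rule Bochner_Integration.integrable_bound)
 show "integrable M (%w. q / exp (- q * t) * (\<integral>u. dis u * Z u w \<partial>lborel))"
  using DE_iterated(1)[OF Z(1)] by simp
 show "AE w in M. norm (Z t w) <= norm (q / exp (- q * t) * (\<integral>u. dis u * Z u w \<partial>lborel))"
  using path DE_iterated(2)[OF Z(1)]
 proof eventually_elim
  case (elim w)
  have Z0: "0 <= Z u w" if "0 <= u" for u using order.trans[OF conjunct1[OF elim(1)] mono_onD[OF conjunct2[OF elim(1)], of 0 u]] that by simp
  have "exp (- q * t) / q * Z t w = (\<integral>u. dis u * (Z t w * indicator {t..} u) \<partial>lborel)"
   using dis_shift[OF t, of "%_. Z t w"] dis_integral by simp
  also have "... <= (\<integral>u. dis u * Z u w \<partial>lborel)"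
  proof (rule integral_mono_AE'[OF elim(2)])
   have "dis u * (Z t w * indicator {t..} u) <= dis u * Z u w" for u
   proof (cases "t <= u")
    case True
    then have "Z t w <= Z u w" using mono_onD[OF conjunct2[OF elim(1)], of t u] t by simp
    then show ?thesis using True by (simp add: mult_left_mono dis_nonneg)
   next
    case False
    then show ?thesis using Z0[of u] dis_nonneg[of u] dis_neg[of u] by (cases "0 <= u") auto
   qed
   then show "AE u in lborel. dis u * (Z t w * indicator {t..} u) <= dis u * Z u w" by simp
   have "0 <= dis u * Z u w" for u using Z0[of u] dis_nonneg[of u] dis_neg[of u] by (cases "0 <= u") auto
   then show "AE u in lborel. 0 <= dis u * Z u w" by simp
  qed
  finally have "exp (- q * t) / q * Z t w <= (\<integral>u. dis u * Z u w \<partial>lborel)" .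
  then have "q / exp (- q * t) * (exp (- q * t) / q * Z t w) <= q / exp (- q * t) * (\<integral>u. dis u * Z u w \<partial>lborel)"
   using q_pos by (intro mult_left_mono) auto
  then have "Z t w <= q / exp (- q * t) * (\<integral>u. dis u * Z u w \<partial>lborel)" using q_pos by simp
  then show ?case using Z0[OF t] unfolding real_norm_def by linarith
 qed
qed (use Z t in auto)

text \<open>Discretise \<open>Z\<close> by step processes with increments \<open>V\<close> on the
  grid. For a step process the discounted mean is a sum of increments times potentials. The
  hypothesis \<open>growth\<close> evaluates the potential at the right end of a short interval
  because the increment of a grid interval is placed there; it makes the negative part of the sum
  vanish in the limit.\<close>

theorem growth_nonneg:
 fixes Z :: "real => 'w => real"
 assumes \<phi>: "continuous_limit \<phi> B" and g: "U \<phi> \<in> borel_measurable borel"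
  and Z: "!!t. 0 <= t ==> Z t \<in> borel_measurable (F t)" "iproc Z"
  and path: "AE w in M. 0 <= Z 0 w & mono_on {0..} (%t. Z t w)"
  and start: "AE w in M. 0 < Z 0 w --> 0 <= U \<phi> (Yb x 0 w)"
  and growth: "AE w in M. \<forall>T\<ge>0. \<forall>e>0. \<exists>h>0. ALL s t. 0 <= s --> s <= t --> t <= T --> t < s + h --> Z s w < Z t w --> - e <= U \<phi> (Yb x t w)"
 shows "0 <= DE (%t w. \<phi> (Yb x t w) * Z t w)"
proof -
 define s where "s m k = real k / real (Suc m)" for m k
 \<comment> \<open>The grid of mesh 1 / (m + 1) reaches up to time m + 1, so every time is
   eventually covered.\<close>
 define K where "K m = Suc m * Suc m" for m
 \<comment> \<open>The increment at index 0 is the whole initial value, in accordance with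
   \<open>Z(0-) = 0\<close>.\<close>
 define V where "V m k w = Z (s m k) w - (if k = 0 then 0 else Z (s m (k - 1)) w)" for m k w
 define H where "H m t w = (\<Sum>k\<le>K m. V m k w * indicator {s m k..} t)" for m t w
 define A where "A m t w = (\<Sum>k\<le>K m. (V m k w * U \<phi> (Yb x (s m k) w)) * indicator {s m k..} t)" for m t w
 have s0: "0 <= s m k" for m k by (simp add: s_def)
 have sm: "s m k <= s m j" if "k <= j" for m k j using that by (simp add: s_def divide_right_mono)
 have ZM: "0 <= t ==> Z t \<in> borel_measurable M" for t by (rule F_measurable_M[OF Z(1)])
 have Zi: "integrable M (Z t)" if "0 <= t" for t by (rule iproc_time_integrable[OF Z(2) ZM path that])
 have Bn: "0 <= B" using order.trans[OF abs_ge_zero continuous_limit_bound[OF \<phi>]] .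
 have Ub: "\<bar>U \<phi> y\<bar> <= B / q" for y by (rule U_abs_le) (rule continuous_limit_bound[OF \<phi>])
 have VF: "V m k \<in> borel_measurable (F (s m k))" for m k
 proof -
  have "Z (s m k) \<in> borel_measurable (F (s m k))" by (rule Z(1)[OF s0])
  moreover have "Z (s m (k - 1)) \<in> borel_measurable (F (s m k))" by (rule F_measurable_mono[OF sm Z(1)[OF s0]]) simp
  ultimately show ?thesis unfolding V_def[abs_def] by (cases "k = 0") auto
 qed
 have Vi: "integrable M (V m k)" for m k unfolding V_def[abs_def] using Zi[OF s0] by (cases "k = 0") auto
 note [measurable] = g
 have VUm: "(%w. V m k w * U \<phi> (Yb x (s m k) w)) \<in> borel_measurable M" for m k
  using Yb_measurable[OF s0[of m k], of x] Vi[of m k, THEN borel_measurable_integrable] by measurable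
 have VUi: "integrable M (%w. V m k w * U \<phi> (Yb x (s m k) w))" for m k
 proof (rule Bochner_Integration.integrable_bound[OF _ VUm])
  show "integrable M (%w. B / q * V m k w)" using Vi by simp
  have "norm (V m k w * U \<phi> (Yb x (s m k) w)) <= norm (B / q * V m k w)" for w
   using mult_right_mono[OF Ub[of "Yb x (s m k) w"], of "\<bar>V m k w\<bar>"] Bn q_pos by (simp add: abs_mult mult.commute)
  then show "AE w in M. norm (V m k w * U \<phi> (Yb x (s m k) w)) <= norm (B / q * V m k w)" by simp
 qed
 have tele: "(\<Sum>k\<le>n. V m k w) = Z (s m n) w" for m n w
  by (induction n) (simp_all add: V_def)
 \<comment> \<open>The last grid index not after \<open>t\<close>, capped at the end of the grid;
   the step process at \<open>t\<close> telescopes to \<open>Z\<close> at this grid time.\<close>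
 define J where "J m t = min (nat \<lfloor>t * real (Suc m)\<rfloor>) (K m)" for m t
 have sle: "s m k <= t \<longleftrightarrow> k <= nat \<lfloor>t * real (Suc m)\<rfloor>" if "0 <= t" for m k t
 proof -
  have "s m k <= t \<longleftrightarrow> real k <= t * real (Suc m)" by (simp add: s_def field_simps)
  also have "... \<longleftrightarrow> k <= nat \<lfloor>t * real (Suc m)\<rfloor>"
  proof
   assume "k <= nat \<lfloor>t * real (Suc m)\<rfloor>"
   then have "real k <= real (nat \<lfloor>t * real (Suc m)\<rfloor>)" by (simp only: of_nat_le_iff)
   also have "... <= t * real (Suc m)" using that by (intro of_nat_floor mult_nonneg_nonneg) auto
   finally show "real k <= t * real (Suc m)" .
  qed (rule le_nat_floor)
  finally show ?thesis .
 qed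
 have sJ: "s m (J m t) <= t" if "0 <= t" for m t using sle[OF that] by (simp add: J_def)
 have Hs: "(\<Sum>k\<le>K m. c k * indicator {s m k..} t) = (\<Sum>k\<le>J m t. c k)" if "0 <= t" for m t and c :: "nat => real"
 proof (rule sum.mono_neutral_cong_right)
  show "\<forall>i\<in>{..K m} - {..J m t}. c i * indicator {s m i..} t = 0" using sle[OF that] by (auto simp: J_def indicator_def)
  show "!!k. k \<in> {..J m t} ==> c k * indicator {s m k..} t = c k" using sle[OF that] by (auto simp: J_def indicator_def)
 qed (auto simp: J_def)
 have HZ: "H m t w = Z (s m (J m t)) w" if "0 <= t" for m t w
  unfolding H_def Hs[OF that] tele ..
 have HE: "iproc (%t w. \<phi> (Yb x t w) * (V m k w * indicator {s m k..} t))"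
  "DE (%t w. \<phi> (Yb x t w) * (V m k w * indicator {s m k..} t)) = q * DE (%t w. (V m k w * U \<phi> (Yb x (s m k) w)) * indicator {s m k..} t)" for m k
  \<comment> \<open>The factor \<open>q\<close> arises because a unit step at time s has discounted
    integral exp (- q s) / q, not exp (- q s).\<close>
  using DE_resolvent[OF s0[of m k] VF[of m k] Vi[of m k] \<phi>, where x=x] DE_step[OF VUi[of m k] s0[of m k]] q_pos by simp_all
 have eqm: "DE (%t w. \<phi> (Yb x t w) * H m t w) = q * DE (A m)" for m
 proof -
  have "DE (%t w. \<phi> (Yb x t w) * H m t w) = DE (%t w. \<Sum>k\<le>K m. \<phi> (Yb x t w) * (V m k w * indicator {s m k..} t))"
   unfolding H_def by (simp only: sum_distrib_left)
  also have "... = (\<Sum>k\<le>K m. q * DE (%t w. (V m k w * U \<phi> (Yb x (s m k) w)) * indicator {s m k..} t))"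
   by (subst DE_sum) (simp_all only: HE finite_atMost)
  also have "... = q * DE (A m)"
   unfolding A_def[abs_def] by (subst DE_sum) (simp_all only: finite_atMost iproc_step[OF VUi] sum_distrib_left)
  finally show ?thesis .
 qed
 have V0: "AE w in M. ALL m k. 0 <= V m k w"
  using path
 proof eventually_elim
  case (elim w)
  show ?case
  proof (intro allI)
   fix m k show "0 <= V m k w"
   proof (cases k)
    case 0
    then show ?thesis using elim by (simp add: V_def s_def)
   next
    case (Suc j)
    have "Z (s m j) w <= Z (s m (Suc j)) w" using mono_onD[OF conjunct2[OF elim], of "s m j" "s m (Suc j)"] s0 sm[of j "Suc j" m] by simp
    then show ?thesis by (simp add: V_def Suc)
   qed
  qed
 qed
 have HZle: "AE w in M. \<forall>t\<ge>0. ALL m. 0 <= H m t w & H m t w <= Z t w"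
  using path V0
 proof eventually_elim
  case (elim w)
  show ?case
  proof (intro allI impI conjI)
   fix t :: real and m assume t: "0 <= t"
   show "0 <= H m t w" unfolding H_def using elim(2) by (intro sum_nonneg) auto
   show "H m t w <= Z t w" unfolding HZ[OF t] using mono_onD[OF conjunct2[OF elim(1)], of "s m (J m t)" t] s0 sJ[OF t] t by simp
  qed
 qed
 have Z0: "AE w in M. \<forall>t\<ge>0. 0 <= Z t w" using HZle by eventually_elim (meson order.trans)
 have mH: "mproc (H m)" for m unfolding H_def[abs_def] using Vi by (intro mproc_sum mproc_step) auto
 have mA: "mproc (A m)" for m unfolding A_def[abs_def] using VUm by (intro mproc_sum mproc_step) auto
 have m\<phi>: "mproc (%t w. \<phi> (Yb x t w))" by (rule mproc_compose[OF mproc_Yb continuous_limit_measurable[OF \<phi>]])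
 have b\<phi>: "\<bar>\<phi> y * h\<bar> <= B * z" if "0 <= h" "h <= z" for y h z
  using mult_mono[OF continuous_limit_bound[OF \<phi>, of y] that(2) Bn that(1)] that(1) by (simp add: abs_mult)
 have sJlim: "(%m. s m (J m t)) \<longlonglongrightarrow> t" if t: "0 <= t" for t
 proof (rule tendsto_sandwich[where f="%m. t - 1 / real (Suc m)" and h="%_. t"])
  show "(%m. t - 1 / real (Suc m)) \<longlonglongrightarrow> t"
   using tendsto_diff[OF tendsto_const LIMSEQ_Suc[OF lim_const_over_n[of 1]], of t] by simp
  show "\<forall>\<^sub>F m in sequentially. s m (J m t) <= t" using sJ[OF t] by simp
  obtain m0 :: nat where m0: "t <= real m0" using real_arch_simple by blast
  show "\<forall>\<^sub>F m in sequentially. t - 1 / real (Suc m) <= s m (J m t)"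
   using eventually_ge_at_top[of m0]
  proof eventually_elim
   case (elim m)
   have "t <= real (Suc m)" using m0 elim by simp
   then have "t * real (Suc m) <= real (K m)" unfolding K_def of_nat_mult by (intro mult_right_mono) auto
   then have "nat \<lfloor>t * real (Suc m)\<rfloor> <= K m" by (simp add: nat_le_iff floor_le_iff)
   then have "real (J m t) = of_int \<lfloor>t * real (Suc m)\<rfloor>" using t by (simp add: J_def)
   then have "t * real (Suc m) - 1 <= real (J m t)" by linarith
   then have "(t * real (Suc m) - 1) / real (Suc m) <= s m (J m t)" unfolding s_def by (rule divide_right_mono) simp
   moreover have "(t * real (Suc m) - 1) / real (Suc m) = t - 1 / real (Suc m)" by (simp add: diff_divide_distrib del: of_nat_Suc)
   ultimately show ?case by simp
  qed
 qed simp
 have lim1: "(%m. DE (%t w. \<phi> (Yb x t w) * H m t w)) \<longlonglongrightarrow> DE (%t w. \<phi> (Yb x t w) * Z t w)"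
 proof (rule DE_dominated_convergence[where K="%t w. B * Z t w"])
  show "mproc (%t w. \<phi> (Yb x t w) * H m t w)" for m by (rule mproc_mult[OF m\<phi> mH])
  show "mproc (%t w. \<phi> (Yb x t w) * Z t w)" by (rule mproc_mult[OF m\<phi> iproc_mproc[OF Z(2)]])
  show "iproc (%t w. B * Z t w)" by (rule iproc_cmult[OF Z(2)])
  show "AE w in M. \<forall>t\<ge>0. ALL n. \<bar>\<phi> (Yb x t w) * H n t w\<bar> <= B * Z t w"
   using HZle by eventually_elim (use b\<phi> in blast)
  show "AE w in M. \<forall>t\<ge>0. \<bar>\<phi> (Yb x t w) * Z t w\<bar> <= B * Z t w"
   using Z0 by eventually_elim (use b\<phi> in blast)
  show "AE w in M. AE t in lborel. 0 <= t --> (%m. \<phi> (Yb x t w) * H m t w) \<longlonglongrightarrow> \<phi> (Yb x t w) * Z t w"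
   using path
  proof eventually_elim
   case (elim w)
   \<comment> \<open>A monotone path has countably many discontinuities, so sampling just before
     \<open>t\<close> finds \<open>Z t\<close> for almost every \<open>t\<close>.\<close>
   define C where "C = {t\<in>{0..}. \<not> continuous (at t within {0..}) (%t. Z t w)}"
   have "countable C" unfolding C_def by (rule mono_on_ctble_discont) (use elim in simp)
   then have "AE t in lborel. t \<notin> C" by (intro AE_not_in countable_imp_null_set_lborel)
   then show ?case
   proof eventually_elim
    case (elim t)
    show ?case
    proof
     assume t: "0 <= t"
     then have "continuous (at t within {0..}) (%t. Z t w)" using elim by (auto simp: C_def)
     then have "(%m. Z (s m (J m t)) w) \<longlonglongrightarrow> Z t w"
      by (rule continuous_within_tendsto_compose') (use s0 sJlim[OF t] in auto)
     then show "(%m. \<phi> (Yb x t w) * H m t w) \<longlonglongrightarrow> \<phi> (Yb x t w) * Z t w"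
      unfolding HZ[OF t] by (rule tendsto_mult_left)
    qed
   qed
  qed
 qed
 have bA: "AE w in M. \<forall>t\<ge>0. ALL m. \<bar>A m t w\<bar> <= B / q * Z t w"
  using V0 HZle
 proof eventually_elim
  case (elim w)
  show ?case
  proof (intro allI impI)
   fix t :: real and m assume t: "0 <= t"
   have "\<bar>A m t w\<bar> <= (\<Sum>k\<le>K m. \<bar>(V m k w * U \<phi> (Yb x (s m k) w)) * indicator {s m k..} t\<bar>)"
    unfolding A_def by (rule sum_abs)
   also have "... <= (\<Sum>k\<le>K m. B / q * (V m k w * indicator {s m k..} t))"
   proof (rule sum_mono)
    fix k
    have "0 <= V m k w * indicator {s m k..} t" using elim(1) by simp
    from mult_right_mono[OF Ub[of "Yb x (s m k) w"] this] show "\<bar>(V m k w * U \<phi> (Yb x (s m k) w)) * indicator {s m k..} t\<bar> <= B / q * (V m k w * indicator {s m k..} t)"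
     using elim(1) by (simp add: abs_mult mult_ac)
   qed
   also have "... = B / q * H m t w" by (simp only: H_def sum_distrib_left)
   also have "... <= B / q * Z t w" using elim(2) t Bn q_pos by (intro mult_left_mono) auto
   finally show "\<bar>A m t w\<bar> <= B / q * Z t w" .
  qed
 qed
 have bAm: "AE w in M. \<forall>t\<ge>0. \<bar>A m t w\<bar> <= B / q * Z t w" for m using bA by eventually_elim blast
 have iA: "iproc (A m)" for m by (rule iproc_bound[OF mA iproc_cmult[OF Z(2)] bAm])
 \<comment> \<open>Only a lower bound for \<open>A m\<close> is at hand, so it is the minimum with 0
   that has a limit.\<close>
 have min_abs: "\<bar>min y 0\<bar> <= \<bar>y\<bar>" for y :: real by auto
 have bA': "AE w in M. \<forall>t\<ge>0. ALL m. \<bar>min (A m t w) 0\<bar> <= B / q * Z t w"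
  using bA by eventually_elim (meson min_abs order.trans)
 have bAm': "AE w in M. \<forall>t\<ge>0. \<bar>min (A m t w) 0\<bar> <= B / q * Z t w" for m using bA' by eventually_elim blast
 have mA': "mproc (%t w. min (A m t w) 0)" for m by (rule mproc_compose[OF mA, where \<phi>="%y. min y 0"]) measurable
 have iA': "iproc (%t w. min (A m t w) 0)" for m by (rule iproc_bound[OF mA' iproc_cmult[OF Z(2)] bAm'])
 have lim2: "(%m. DE (%t w. min (A m t w) 0)) \<longlonglongrightarrow> DE (%t w. 0)"
 proof (rule DE_dominated_convergence[OF mA' mproc_random iproc_cmult[OF Z(2), where c="B / q"]])
  show "AE w in M. \<forall>t\<ge>0. ALL m. \<bar>min (A m t w) 0\<bar> <= B / q * Z t w" by (rule bA')
  show "AE w in M. \<forall>t\<ge>0. \<bar>0\<bar> <= B / q * Z t w" using Z0 by eventually_elim (use Bn q_pos in simp)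
  show "AE w in M. AE t in lborel. 0 <= t --> (%m. min (A m t w) 0) \<longlonglongrightarrow> 0"
   using V0 HZle start growth Z0
  proof eventually_elim
   case (elim w)
   have "(%m. min (A m t w) 0) \<longlonglongrightarrow> 0" if t: "0 <= t" for t
   proof (rule LIMSEQ_I)
    fix \<epsilon> :: real assume \<epsilon>: "0 < \<epsilon>"
    define e where "e = \<epsilon> / (Z t w + 1)"
    have Zt: "0 <= Z t w" using elim(5) t by simp
    have e: "0 < e" "e * Z t w < \<epsilon>" using \<epsilon> Zt by (auto simp: e_def field_simps)
    obtain h where h: "0 < h" "!!u v. 0 <= u ==> u <= v ==> v <= t ==> v < u + h ==> Z u w < Z v w ==> - e <= U \<phi> (Yb x v w)"
     using elim(4) t e(1) by meson
    obtain m0 :: nat where m0: "1 / h < real m0" using reals_Archimedean2 by blast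
    show "EX m0. \<forall>m\<ge>m0. norm (min (A m t w) 0 - 0) < \<epsilon>"
    proof (intro exI[of _ m0] allI impI)
     fix m assume m: "m0 <= m"
     have "1 / h < real (Suc m)" using m0 m by simp
     then have mesh: "1 / real (Suc m) < h" using h(1) by (simp add: field_simps)
     have "- e * H m t w = (\<Sum>k\<le>J m t. - e * V m k w)" unfolding H_def Hs[OF t] sum_distrib_left ..
     also have "... <= (\<Sum>k\<le>J m t. V m k w * U \<phi> (Yb x (s m k) w))"
     proof (rule sum_mono)
      fix k assume k: "k \<in> {..J m t}"
      have V: "0 <= V m k w" using elim(1) by simp
      have "- e <= U \<phi> (Yb x (s m k) w)" if pos: "0 < V m k w"
      proof (cases k)
       case 0
       then have "0 <= U \<phi> (Yb x (s m k) w)" using elim(3) pos by (simp add: V_def s_def)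
       then show ?thesis using e(1) by linarith
      next
       case (Suc j)
       have "s m (Suc j) = s m j + 1 / real (Suc m)" by (simp add: s_def add_divide_distrib del: of_nat_Suc) (simp add: add_divide_distrib)
       moreover have "s m (Suc j) <= t" using order.trans[OF sm sJ[OF t]] k Suc by simp
       moreover have "Z (s m j) w < Z (s m (Suc j)) w" using pos by (simp add: V_def Suc)
       ultimately show ?thesis unfolding Suc using h(2)[of "s m j" "s m (Suc j)"] s0 sm[of j "Suc j" m] mesh by simp
      qed
      then show "- e * V m k w <= V m k w * U \<phi> (Yb x (s m k) w)"
       using V mult_left_mono[of "- e" "U \<phi> (Yb x (s m k) w)" "V m k w"] by (cases "V m k w = 0") (auto simp: mult.commute)
     qed
     also have "... = A m t w" unfolding A_def Hs[OF t] ..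
     finally have "- (e * H m t w) <= A m t w" by simp
     moreover have "e * H m t w <= e * Z t w" using elim(2) t e(1) by (intro mult_left_mono) auto
     ultimately have "- \<epsilon> < A m t w" using e(2) by linarith
     then show "norm (min (A m t w) 0 - 0) < \<epsilon>" using \<epsilon> by (auto simp: min_def)
    qed
   qed
   then show ?case by simp
  qed
 qed simp_all
 have "DE (%t w. min (A m t w) 0) <= DE (A m)" for m by (rule DE_mono[OF iA' iA]) simp
 then have "q * DE (%t w. min (A m t w) 0) <= DE (%t w. \<phi> (Yb x t w) * H m t w)" for m
  unfolding eqm using q_pos by (intro mult_left_mono) auto
 then have "q * DE (%t w. 0) <= DE (%t w. \<phi> (Yb x t w) * Z t w)"
  by (intro LIMSEQ_le[OF tendsto_mult_left[OF lim2] lim1]) auto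
 then show ?thesis by (simp add: DE_def case_prod_unfold)
qed

end

section \<open>Convex functions on the line\<close>

text \<open>The right derivative of a convex function. It exists everywhere, also at kinks, and it
  is monotone and a subgradient, which is all that the first-order inequality needs of f'.\<close>

definition right_slope :: "(real => real) => real => real" where
 "right_slope f y = Inf ((%t. (f y - f t) / (y - t)) ` {y<..})"

context
 fixes f :: "real => real"
 assumes convex: "convex_on UNIV f"
begin

lemma right_slope_subgradient: "f y + right_slope f y * (z - y) <= f z"
 using convex_le_Inf_differential[OF convex, of y z] by (simp add: right_slope_def)

lemma right_slope_mono:
 assumes "y <= z" shows "right_slope f y <= right_slope f z"
proof (cases "y = z")
 case False
 have "right_slope f y * (z - y) <= right_slope f z * (z - y)"
  using right_slope_subgradient[of y z] right_slope_subgradient[of z y] by (simp add: algebra_simps)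
 then show ?thesis using False assms by simp
qed simp

lemma right_slope_le_quotient: "0 < h ==> right_slope f y <= (f (y + h) - f y) / h"
 and quotient_le_right_slope: "0 < h ==> (f (y + h) - f y) / h <= right_slope f (y + h)"
 using right_slope_subgradient[of y "y + h"] right_slope_subgradient[of "y + h" y] by (simp_all add: field_simps)

lemma right_slope_tendsto: "(%n. (f (y + 1 / real (Suc n)) - f y) / (1 / real (Suc n))) \<longlonglongrightarrow> right_slope f y"
proof (rule order_tendstoI)
 fix u assume u: "u < right_slope f y"
 have "u < (f (y + 1 / real (Suc n)) - f y) / (1 / real (Suc n))" for n
  by (rule less_le_trans[OF u right_slope_le_quotient]) simp
 then show "\<forall>\<^sub>F n in sequentially. u < (f (y + 1 / real (Suc n)) - f y) / (1 / real (Suc n))" by simp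
next
 fix u assume u: "right_slope f y < u"
 then have "\<exists>v\<in>(%t. (f y - f t) / (y - t)) ` {y<..}. v < u"
  unfolding right_slope_def by (intro cInf_lessD) auto
 then obtain t where t: "y < t" "(f y - f t) / (y - t) < u" by auto
 have "(%n. 1 / real (Suc n)) \<longlonglongrightarrow> 0" by (rule LIMSEQ_Suc[OF lim_const_over_n])
 then have "\<forall>\<^sub>F n in sequentially. 1 / real (Suc n) < t - y" by (rule order_tendstoD(2)) (use t in simp)
 then show "\<forall>\<^sub>F n in sequentially. (f (y + 1 / real (Suc n)) - f y) / (1 / real (Suc n)) < u"
 proof eventually_elim
  case (elim n)
  define h where "h = 1 / real (Suc n)"
  have h: "0 < h" "y + h < t" using elim by (auto simp: h_def)
  have "(f y - f (y + h)) / (y - (y + h)) <= (f y - f t) / (y - t)"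
   by (rule convex_on_slope_le(1)[OF convex]) (use h in auto)
  moreover have "(f y - f (y + h)) / (y - (y + h)) = (f (y + h) - f y) / h" using h by (simp add: field_simps)
  ultimately have "(f (y + h) - f y) / h < u" using t(2) by linarith
  then show ?case by (simp only: h_def)
 qed
qed

text \<open>Subtracting the supporting line leaves a function with a minimum at
  \<open>y\<close>.\<close>

lemma deriv_eq_right_slope:
 assumes "f differentiable (at y)" shows "deriv f y = right_slope f y"
proof -
 have "DERIV f y :> deriv f y" using assms DERIV_deriv_iff_real_differentiable by blast
 then have "DERIV (%z. f z - right_slope f y * z) y :> deriv f y - right_slope f y"
  by (auto intro!: derivative_eq_intros)
 then have "deriv f y - right_slope f y = 0"
  by (rule DERIV_local_min[of _ _ _ 1]) (use right_slope_subgradient[of y] in \<open>auto simp: algebra_simps\<close>)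
 then show ?thesis by simp
qed

lemma countable_kinks:
 assumes pw: "!!u v. f piecewise_C1_differentiable_on {u..v}"
 shows "countable {y. \<not> f differentiable (at y)}"
proof -
 have "\<forall>n::nat. EX S. finite S & (\<forall>y\<in>{- real n..real n} - S. f differentiable (at y))"
 proof
  fix n :: nat
  have "f piecewise_C1_differentiable_on {- real n..real n}" by (rule pw)
  then show "EX S. finite S & (\<forall>y\<in>{- real n..real n} - S. f differentiable (at y))"
   unfolding piecewise_C1_differentiable_on_def C1_differentiable_on_eq by blast
 qed
 then obtain S where S: "!!n. finite (S n)" "!!n y. y \<in> {- real n..real n} - S n ==> f differentiable (at y)"
  using choice[of "%n S. finite S & (\<forall>y\<in>{- real n..real n} - S. f differentiable (at y))"] by blast
 have "{y. \<not> f differentiable (at y)} \<subseteq> (\<Union>n. S n)"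
 proof
  fix y assume y: "y \<in> {y. \<not> f differentiable (at y)}"
  obtain n :: nat where "\<bar>y\<bar> <= real n" using real_arch_simple by blast
  then have "y \<in> {- real n..real n}" by auto
  then show "y \<in> (\<Union>n. S n)" using S(2)[of y n] y by blast
 qed
 moreover have "countable (\<Union>n. S n)" by (rule countable_UN) (auto intro: countable_finite S(1))
 ultimately show ?thesis by (rule countable_subset)
qed

lemma convex_continuous: "continuous_on UNIV f"
 by (rule convex_on_continuous[OF open_UNIV convex])

text \<open>Forward difference quotients of \<open>f\<close> are continuous and converge to the
  right derivative. Steps are at most 1, so the slope at \<open>k + 1\<close> bounds all of
  them.\<close>

lemma truncated_slope_continuous_limit:
 assumes "a <= k"
 shows "continuous_limit (%y. right_slope f (max a (min y k))) (\<bar>right_slope f a\<bar> + \<bar>right_slope f (k + 1)\<bar>)"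
 unfolding continuous_limit_def
proof (intro exI[of _ "%n y. (f (max a (min y k) + 1 / real (Suc n)) - f (max a (min y k))) / (1 / real (Suc n))"] conjI allI)
 fix n :: nat
 have c: "continuous_on UNIV (%y. f (g y))" if "continuous_on UNIV g" for g :: "real => real"
  by (rule continuous_on_compose2[OF convex_continuous that]) simp
 show "continuous_on UNIV (%y. (f (max a (min y k) + 1 / real (Suc n)) - f (max a (min y k))) / (1 / real (Suc n)))"
  by (intro continuous_intros c) auto
 fix y
 define wt where "wt = max a (min y k)"
 have wt: "a <= wt" "wt <= k" using assms by (auto simp: wt_def)
 have n1: "0 < 1 / real (Suc n)" "1 / real (Suc n) <= 1" by (auto simp: field_simps)
 have "right_slope f a <= (f (wt + 1 / real (Suc n)) - f wt) / (1 / real (Suc n))"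
  using right_slope_mono[OF wt(1)] right_slope_le_quotient[OF n1(1), of wt] by linarith
 moreover have "(f (wt + 1 / real (Suc n)) - f wt) / (1 / real (Suc n)) <= right_slope f (k + 1)"
  by (rule order.trans[OF quotient_le_right_slope[OF n1(1)] right_slope_mono]) (use wt n1 in linarith)
 ultimately show "\<bar>(f (max a (min y k) + 1 / real (Suc n)) - f (max a (min y k))) / (1 / real (Suc n))\<bar> <= \<bar>right_slope f a\<bar> + \<bar>right_slope f (k + 1)\<bar>"
  unfolding wt_def by linarith
next
 fix y
 show "(%n. (f (max a (min y k) + 1 / real (Suc n)) - f (max a (min y k))) / (1 / real (Suc n))) \<longlonglongrightarrow> right_slope f (max a (min y k))"
  by (rule right_slope_tendsto)
qed

text \<open>If no slope is positive, \<open>f\<close> is decreasing and a tangent bounds it from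
  below. Otherwise \<open>f\<close> tends to infinity, and regular variation at the factor 2 bounds
  it by a power, hence by any growing exponential.\<close>

lemma regularly_varying_growth:
 fixes a \<theta> :: real
 assumes rv: "filterlim (%x. \<bar>f x\<bar>) at_top at_top --> regularly_varying_at at_top f" and \<theta>: "0 < \<theta>"
 shows "\<exists>C\<ge>0. \<forall>y\<ge>a. \<bar>f y\<bar> <= C * exp (\<theta> * (y - a))"
proof -
 have lin: "y - a <= 1 / \<theta> * exp (\<theta> * (y - a))" if "a <= y" for y
  using exp_ge_add_one_self[of "\<theta> * (y - a)"] \<theta> by (simp add: field_simps)
 have lin_top: "filterlim (%x. c + d * (x - y)) at_top at_top" if "0 < d" for c d y :: real using that by real_asymp
 have one: "1 <= exp (\<theta> * (y - a))" if "a <= y" for y using that \<theta> by simp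
 show ?thesis
 proof (cases "EX y0. 0 < right_slope f y0")
  case False
  define C where "C = \<bar>f a\<bar> + \<bar>right_slope f a\<bar> / \<theta>"
  have "\<bar>f y\<bar> <= C * exp (\<theta> * (y - a))" if y: "a <= y" for y
  proof -
   have "right_slope f y * (a - y) >= 0" using False y by (intro mult_nonpos_nonpos) (auto simp: not_less)
   then have 1: "f y <= f a" using right_slope_subgradient[of y a] by linarith
   have "- \<bar>right_slope f a\<bar> * (y - a) <= right_slope f a * (y - a)" using y by (intro mult_right_mono) auto
   then have 2: "f a - \<bar>right_slope f a\<bar> * (y - a) <= f y" using right_slope_subgradient[of a y] by linarith
   have "\<bar>right_slope f a\<bar> * (y - a) <= \<bar>right_slope f a\<bar> * (1 / \<theta> * exp (\<theta> * (y - a)))"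
    using lin[OF y] by (intro mult_left_mono) auto
   moreover have "\<bar>f a\<bar> <= \<bar>f a\<bar> * exp (\<theta> * (y - a))" using mult_left_mono[OF one[OF y], of "\<bar>f a\<bar>"] by simp
   moreover have "C * exp (\<theta> * (y - a)) = \<bar>f a\<bar> * exp (\<theta> * (y - a)) + \<bar>right_slope f a\<bar> * (1 / \<theta> * exp (\<theta> * (y - a)))"
    by (simp add: C_def distrib_right)
   moreover have "0 <= \<bar>right_slope f a\<bar> * (y - a)" using y by simp
   ultimately show ?thesis using 1 2 by linarith
  qed
  moreover have "0 <= C" using \<theta> by (simp add: C_def)
  ultimately show ?thesis by blast
 next
  case True
  then obtain y0 where y0: "0 < right_slope f y0" by blast
  have "filterlim (%x. f y0 + right_slope f y0 * (x - y0)) at_top at_top"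
   using lin_top[OF y0] .
  then have "filterlim f at_top at_top"
   by (rule filterlim_at_top_mono) (use right_slope_subgradient in auto)
  then have top: "filterlim (%x. \<bar>f x\<bar>) at_top at_top"
   by (rule filterlim_at_top_mono) (intro always_eventually allI abs_ge_self)
  then obtain c where c: "!!\<alpha>. 0 < \<alpha> ==> ((%x. f (\<alpha> * x) / f x) \<longlongrightarrow> \<alpha> powr c) at_top"
   using rv unfolding regularly_varying_at_def by blast
  \<comment> \<open>2 ^ p exceeds the limit of f (2 x) / f x with a margin, so a bound of the form B
    * y ^ p at y / 2 carries over to y.\<close>
  obtain p :: nat where p: "2 powr c + 1 <= 2 ^ p"
   using real_arch_pow[of 2 "2 powr c + 1"] by (auto intro: less_imp_le)
  have "\<forall>\<^sub>F x in at_top. f (2 * x) / f x < 2 powr c + 1 & - (2 powr c + 1) < f (2 * x) / f x & 1 <= \<bar>f x\<bar>"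
   using order_tendstoD(2)[OF c[of 2], of "2 powr c + 1"] order_tendstoD(1)[OF c[of 2], of "- (2 powr c + 1)"]
    filterlim_at_top[THEN iffD1, OF top] by (simp add: eventually_conj_iff add_pos_pos pos_add_strict less_trans[of _ 0])
  then obtain x1 where x1: "!!x. x1 <= x ==> f (2 * x) / f x < 2 powr c + 1 & - (2 powr c + 1) < f (2 * x) / f x & 1 <= \<bar>f x\<bar>"
   unfolding eventually_at_top_linorder by blast
  define x0 where "x0 = max x1 (max 1 a)"
  have dbl: "\<bar>f (2 * x)\<bar> <= 2 ^ p * \<bar>f x\<bar>" if "x0 <= x" for x
  proof -
   have x: "f (2 * x) / f x < 2 powr c + 1" "- (2 powr c + 1) < f (2 * x) / f x" "1 <= \<bar>f x\<bar>" using x1[of x] that by (auto simp: x0_def)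
   then have "\<bar>f (2 * x) / f x\<bar> <= 2 ^ p" using p by linarith
   then have "\<bar>f (2 * x)\<bar> / \<bar>f x\<bar> <= 2 ^ p" by (simp only: abs_divide)
   then show ?thesis using x(3) by (simp add: divide_le_eq split: if_splits)
  qed
  have bdd: "\<exists>B\<ge>0. \<forall>y\<in>{u..v}. \<bar>f y\<bar> <= B" for u v
  proof -
   have "compact (f ` {u..v})" by (rule compact_continuous_image[OF continuous_on_subset[OF convex_continuous]]) auto
   then obtain B where "\<forall>z\<in>f ` {u..v}. norm z <= B" using compact_imp_bounded bounded_iff by blast
   then have "\<bar>f y\<bar> <= max 0 B" if "y \<in> {u..v}" for y using that by (simp add: le_max_iff_disj)
   moreover have "0 <= max 0 B" by simp
   ultimately show ?thesis by blast
  qed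
  obtain B where B: "0 <= B" "!!y. y \<in> {a..2 * x0} ==> \<bar>f y\<bar> <= B" using bdd[of a "2 * x0"] by blast
  have x01: "1 <= x0" "a <= x0" by (auto simp: x0_def)
  have poly: "\<bar>f y\<bar> <= B * y ^ p" if "x0 <= y" "y <= 2 ^ Suc n * x0" for n y
   using that
  proof (induction n arbitrary: y)
   case 0
   have "1 <= y ^ p" using 0 x01 by (intro one_le_power) linarith
   from mult_left_mono[OF this B(1)] have "B <= B * y ^ p" by simp
   moreover have "\<bar>f y\<bar> <= B" using 0 x01 by (intro B(2)) auto
   ultimately show ?case by linarith
  next
   case (Suc n)
   show ?case
   proof (cases "y <= 2 ^ Suc n * x0")
    case True
    then show ?thesis using Suc by blast
   next
    case False
    have "2 ^ 1 * x0 <= 2 ^ Suc n * x0" using x01 by (intro mult_right_mono power_increasing) auto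
    then have h: "x0 <= y / 2" "y / 2 <= 2 ^ Suc n * x0" using False Suc.prems by auto
    have "\<bar>f y\<bar> <= 2 ^ p * \<bar>f (y / 2)\<bar>" using dbl[OF h(1)] by simp
    also have "... <= 2 ^ p * (B * (y / 2) ^ p)" using Suc.IH[OF h] by (intro mult_left_mono) auto
    also have "... = B * y ^ p" by (simp add: power_divide)
    finally show ?thesis .
   qed
  qed
  have "((%y. y ^ p / exp (\<theta> * (y - a))) \<longlongrightarrow> 0) at_top" using \<theta> by real_asymp
  then have "\<forall>\<^sub>F y in at_top. y ^ p / exp (\<theta> * (y - a)) < 1" by (rule order_tendstoD(2)) simp
  then obtain x2 where x2: "!!y. x2 <= y ==> y ^ p / exp (\<theta> * (y - a)) < 1" unfolding eventually_at_top_linorder by blast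
  obtain B2 where B2: "0 <= B2" "!!y. y \<in> {a..max x0 x2} ==> \<bar>f y\<bar> <= B2" using bdd[of a "max x0 x2"] by blast
  have "\<bar>f y\<bar> <= (B + B2) * exp (\<theta> * (y - a))" if y: "a <= y" for y
  proof (cases "y <= max x0 x2")
   case True
   have "\<bar>f y\<bar> <= B2" by (rule B2(2)) (use True y in auto)
   then have "\<bar>f y\<bar> <= (B + B2) * 1" using B(1) by simp
   also have "(B + B2) * 1 <= (B + B2) * exp (\<theta> * (y - a))" using B(1) B2(1) one[OF y] by (intro mult_left_mono) auto
   finally show ?thesis .
  next
   case False
   obtain n where n: "y / x0 < 2 ^ n" using real_arch_pow[of 2 "y / x0"] by auto
   then have "y < 2 ^ n * x0" using x01 by (simp add: divide_less_eq)
   moreover have "2 ^ n * x0 <= 2 ^ Suc n * x0" using x01 by (intro mult_right_mono power_increasing) auto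
   ultimately have "\<bar>f y\<bar> <= B * y ^ p" using False by (intro poly[of y n]) auto
   also have "... <= B * exp (\<theta> * (y - a))" 
   proof (rule mult_left_mono[OF _ B(1)])
    have "y ^ p / exp (\<theta> * (y - a)) < 1" by (rule x2) (use False in auto)
    then show "y ^ p <= exp (\<theta> * (y - a))" by (simp add: divide_less_eq)
   qed
   also have "... <= (B + B2) * exp (\<theta> * (y - a))" using B2(1) by (intro mult_right_mono) auto
   finally show ?thesis .
  qed
  moreover have "0 <= B + B2" using B(1) B2(1) by simp
  ultimately show ?thesis by blast
 qed
qed

end

section \<open>Lebesgue--Stieltjes integrals of paths\<close>

text \<open>The left limits of a cadlag path are what a strategy may observe at an arrival; this
  supplies the integrand \<nu> of the barrier strategy.\<close>

lemma caglad_left_limits: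
 assumes g: "cadlag g"
 shows "caglad (%t. if 0 < t then Lim (at_left t) g else g 0)" (is "caglad ?l")
proof -
 \<comment> \<open>Bounds for \<open>g\<close> on an interval just left of \<open>s\<close> pass to
   its left limit at \<open>s\<close>, so both one-sided limits of the new path reduce to those of
   \<open>g\<close>.\<close>
 have near: "\<bar>?l s - L\<bar> <= e" if s: "0 < s" and d: "0 < d" "!!u. s - d < u ==> u < s ==> \<bar>g u - L\<bar> <= e" for s d L e
 proof -
  have "((%u. \<bar>g u - L\<bar>) \<longlongrightarrow> \<bar>Lim (at_left s) g - L\<bar>) (at_left s)"
   by (intro tendsto_intros cadlag_at_left[OF g s])
  moreover have "\<forall>\<^sub>F u in at_left s. \<bar>g u - L\<bar> <= e"
   unfolding eventually_at_left_field by (rule exI[of _ "s - d"]) (use d in auto)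
  ultimately show ?thesis using s by (simp add: tendsto_upperbound)
 qed
 show ?thesis unfolding caglad_def
 proof (intro conjI allI impI)
  fix t :: real assume t: "0 < t"
  have "(?l \<longlongrightarrow> ?l t) (at_left t)"
  proof (rule tendstoI)
   fix e :: real assume e: "0 < e"
   obtain d where d: "0 < d" "\<forall>s\<in>{t-d<..<t}. \<bar>g s - Lim (at_left t) g\<bar> < e / 2"
    using at_left_ball[OF cadlag_at_left[OF g t], of "e / 2"] e by auto
   show "\<forall>\<^sub>F s in at_left t. dist (?l s) (?l t) < e"
    unfolding eventually_at_left_field
   proof (intro exI[of _ "max 0 (t - d)"] conjI allI impI)
    fix s assume s: "max 0 (t - d) < s" "s < t"
    have "\<bar>?l s - Lim (at_left t) g\<bar> <= e / 2"
     by (rule near[of s "s - (t - d)"]) (use s d(2) in \<open>auto intro: less_imp_le\<close>)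
    then have "\<bar>?l s - Lim (at_left t) g\<bar> < e" using e by linarith
    then show "dist (?l s) (?l t) < e" using t by (simp add: dist_real_def)
   qed (use t d in auto)
  qed
  then show "continuous (at_left t) ?l" by (simp add: continuous_within)
 next
  fix t :: real assume t: "0 <= t"
  have "(?l \<longlongrightarrow> g t) (at_right t)"
  proof (rule tendstoI)
   fix e :: real assume e: "0 < e"
   obtain d where d: "0 < d" "\<forall>s\<in>{t..<t+d}. \<bar>g s - g t\<bar> < e / 2"
    using cadlag_right_ball[OF g t, of "e / 2"] e by auto
   show "\<forall>\<^sub>F s in at_right t. dist (?l s) (g t) < e"
    unfolding eventually_at_right_field
   proof (intro exI[of _ "t + d"] conjI allI impI)
    fix s assume s: "t < s" "s < t + d"
    have "\<bar>?l s - g t\<bar> <= e / 2"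
     by (rule near[of s "s - t"]) (use s t d(2) in \<open>auto intro: less_imp_le\<close>)
    then show "dist (?l s) (g t) < e" using e unfolding dist_real_def by linarith
   qed (use d in auto)
  qed
  then show "EX l. (?l \<longlongrightarrow> l) (at_right t)" by blast
 qed
qed

context
 fixes g :: "real => real"
 assumes g_mono: "mono_on {0..} g" and g_cadlag: "cadlag g" and g_0: "0 <= g 0"
begin

private definition "G t = (if t < 0 then 0 else g t)"

private lemma G_mono: "s <= t ==> G s <= G t"
 using mono_onD[OF g_mono, of s t] mono_onD[OF g_mono, of 0 t] g_0 by (auto simp: G_def)

private lemma G_right: "continuous (at_right t) G"
proof (cases "t < 0")
 case True
 have "\<forall>\<^sub>F s in at_right t. G s = 0"
  unfolding eventually_at_right_field using True by (intro exI[of _ 0]) (auto simp: G_def)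
 then have "(G \<longlongrightarrow> 0) (at_right t)" by (rule tendsto_eventually)
 then show ?thesis using True by (simp add: continuous_within G_def)
next
 case False
 have "\<forall>\<^sub>F s in at_right t. g s = G s"
  unfolding eventually_at_right_field using False by (intro exI[of _ "t + 1"]) (auto simp: G_def)
 then have "(G \<longlongrightarrow> g t) (at_right t)" using cadlag_at_right[OF g_cadlag, of t] False by (simp add: tendsto_cong)
 then show ?thesis using False by (simp add: continuous_within G_def)
qed

private lemma stieltjes_G: "stieltjes g = interval_measure G"
 unfolding stieltjes_def G_def[abs_def] ..

lemma stieltjes_sets [measurable_cong]: "sets (stieltjes g) = sets borel" by (simp add: stieltjes_def)

lemma stieltjes_sigma_finite: "sigma_finite_measure (stieltjes g)"
 unfolding stieltjes_G by (rule sigma_finite_interval_measure[OF G_mono G_right])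

lemma stieltjes_Ioc: "0 <= s ==> s <= t ==> emeasure (stieltjes g) {s<..t} = ennreal (g t - g s)"
 unfolding stieltjes_G by (subst emeasure_interval_measure_Ioc[OF _ G_mono G_right]) (auto simp: G_def)

lemma stieltjes_neg: "emeasure (stieltjes g) {..<0} = 0"
proof -
 have "emeasure (stieltjes g) (\<Union>n. {- real (Suc n)<..- (1 / real (Suc n))}) = 0"
 proof (rule emeasure_UN_eq_0)
  fix n
  have n: "1 / real (Suc n) <= real (Suc n)"
   by (rule order.trans[of _ 1]) (auto simp: field_simps)
  show "emeasure (stieltjes g) {- real (Suc n)<..- (1 / real (Suc n))} = 0"
   unfolding stieltjes_G by (subst emeasure_interval_measure_Ioc[OF _ G_mono G_right]) (use n in \<open>auto simp: G_def\<close>)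
 qed (auto simp: stieltjes_sets)
 moreover have "{..<0} \<subseteq> (\<Union>n. {- real (Suc n)<..- (1 / real (Suc n))})"
 proof
  fix s :: real assume "s \<in> {..<0}"
  then have s: "s < 0" by simp
  obtain n :: nat where n: "max (- s) (1 / (- s)) < real n" using reals_Archimedean2 by blast
  then have 1: "- s < real (Suc n)" "1 / (- s) < real (Suc n)" by auto
  have "(1 / (- s)) * (- s) < real (Suc n) * (- s)" using 1(2) s by (intro mult_strict_right_mono) auto
  moreover have "(1 / (- s)) * (- s) = 1" using s by simp
  ultimately have "1 < real (Suc n) * (- s)" by (simp only:)
  then have "1 / real (Suc n) < - s" by (simp add: divide_less_eq mult.commute del: of_nat_Suc)
  then show "s \<in> (\<Union>n. {- real (Suc n)<..- (1 / real (Suc n))})" using 1(1) by (intro UN_I[of n]) auto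
 qed
 moreover have "(\<Union>n. {- real (Suc n)<..- (1 / real (Suc n))}) \<in> sets (stieltjes g)"
  unfolding stieltjes_sets by (intro sets.countable_UN) auto
 ultimately show ?thesis using emeasure_mono[of "{..<0}" "\<Union>n. {- real (Suc n)<..- (1 / real (Suc n))}" "stieltjes g"] by simp
qed

lemma stieltjes_Icc:
 assumes "0 <= t" shows "emeasure (stieltjes g) {0..t} = ennreal (g t)"
proof -
 have e: "emeasure (stieltjes g) {-1<..t} = ennreal (g t)"
  unfolding stieltjes_G using assms by (subst emeasure_interval_measure_Ioc[OF _ G_mono G_right]) (auto simp: G_def)
 have "AE s in stieltjes g. \<not> s < 0"
  by (rule AE_I[of _ _ "{..<0}"]) (auto simp: stieltjes_neg stieltjes_sets)
 then have "emeasure (stieltjes g) {0..t} = emeasure (stieltjes g) {-1<..t}"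
  by (intro emeasure_eq_AE) (auto simp: stieltjes_sets elim!: eventually_mono)
 then show ?thesis by (simp only: e)
qed

lemma g_measurable: "(%t. indicator {0..} t * g t) \<in> borel_measurable borel"
proof -
 have "mono G" by (rule monoI) (rule G_mono)
 then have "G \<in> borel_measurable borel" by (rule borel_measurable_mono)
 moreover have "(%t. indicator {0..} t * g t) = G" by (auto simp: fun_eq_iff G_def indicator_def)
 ultimately show ?thesis by simp
qed

text \<open>Write exp (- q s) as the integral of q exp (- q t) over t from s on and exchange the
  order of integration. Control costs thus become time integrals of the controls, on the same
  footing as running costs.\<close>

lemma stieltjes_discounted:
 fixes q :: real
 assumes q: "0 < q"
 shows "(\<integral>\<^sup>+t\<in>{0..}. ennreal (exp (- q * t)) \<partial>stieltjes g) = (\<integral>\<^sup>+t. ennreal (q * (indicator {0..} t * exp (- q * t) * g t)) \<partial>lborel)"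
  and "(LINT t:{0..}|stieltjes g. exp (- q * t)) = q * (\<integral>t. indicator {0..} t * exp (- q * t) * g t \<partial>lborel)"
proof -
 interpret S: sigma_finite_measure "stieltjes g" by (rule stieltjes_sigma_finite)
 interpret P: pair_sigma_finite "stieltjes g" lborel ..
 have g0: "0 <= g t" if "0 <= t" for t using mono_onD[OF g_mono, of 0 t] g_0 that by simp
 have tail: "(\<integral>\<^sup>+t. ennreal (q * exp (- q * t)) * indicator {s..} t \<partial>lborel) = ennreal (exp (- q * s))" for s
 proof -
  have "((%t. - exp (- q * t)) \<longlongrightarrow> 0) at_top" using q by real_asymp
  then have "(\<integral>\<^sup>+t. ennreal (q * exp (- q * t)) * indicator {s..} t \<partial>lborel) = ennreal (0 - (- exp (- q * s)))"
   using q by (intro nn_integral_FTC_atLeast) (auto intro!: derivative_eq_intros)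
  then show ?thesis by simp
 qed
 let ?k = "%s t. indicator {0..} s * (ennreal (q * exp (- q * t)) * (if s <= t then 1 else 0)) :: ennreal"
 have "(\<integral>\<^sup>+t\<in>{0..}. ennreal (exp (- q * t)) \<partial>stieltjes g) = (\<integral>\<^sup>+s. (\<integral>\<^sup>+t. ?k s t \<partial>lborel) \<partial>stieltjes g)"
 proof (rule nn_integral_cong)
  fix s
  have "(\<integral>\<^sup>+t. ?k s t \<partial>lborel) = indicator {0..} s * (\<integral>\<^sup>+t. ennreal (q * exp (- q * t)) * (if s <= t then 1 else 0) \<partial>lborel)"
   by (rule nn_integral_cmult) measurable
  also have "(\<integral>\<^sup>+t. ennreal (q * exp (- q * t)) * (if s <= t then 1 else 0) \<partial>lborel) = (\<integral>\<^sup>+t. ennreal (q * exp (- q * t)) * indicator {s..} t \<partial>lborel)"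
   by (rule nn_integral_cong) (simp add: indicator_def)
  also have "... = ennreal (exp (- q * s))" by (rule tail)
  finally have e: "(\<integral>\<^sup>+t. ?k s t \<partial>lborel) = indicator {0..} s * ennreal (exp (- q * s))" .
  show "ennreal (exp (- q * s)) * indicator {0..} s = (\<integral>\<^sup>+t. ?k s t \<partial>lborel)" unfolding e by (rule mult.commute)
 qed
 also have "... = (\<integral>\<^sup>+t. (\<integral>\<^sup>+s. ?k s t \<partial>stieltjes g) \<partial>lborel)"
  by (rule P.Fubini'[symmetric]) measurable
 also have "... = (\<integral>\<^sup>+t. ennreal (q * (indicator {0..} t * exp (- q * t) * g t)) \<partial>lborel)"
 proof (rule nn_integral_cong)
  fix t
  have "(\<integral>\<^sup>+s. ?k s t \<partial>stieltjes g) = (\<integral>\<^sup>+s. ennreal (q * exp (- q * t)) * indicator {0..t} s \<partial>stieltjes g)"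
   by (rule nn_integral_cong) (auto simp: indicator_def)
  also have "... = ennreal (q * exp (- q * t)) * emeasure (stieltjes g) {0..t}"
   by (rule nn_integral_cmult_indicator) (simp add: stieltjes_sets)
  also have "... = ennreal (q * (indicator {0..} t * exp (- q * t) * g t))"
  proof (cases "0 <= t")
   case True
   then show ?thesis using q g0[OF True] by (simp add: stieltjes_Icc flip: ennreal_mult)
  qed simp
  finally show "(\<integral>\<^sup>+s. ?k s t \<partial>stieltjes g) = ennreal (q * (indicator {0..} t * exp (- q * t) * g t))" .
 qed
 finally show nn: "(\<integral>\<^sup>+t\<in>{0..}. ennreal (exp (- q * t)) \<partial>stieltjes g) = (\<integral>\<^sup>+t. ennreal (q * (indicator {0..} t * exp (- q * t) * g t)) \<partial>lborel)" .
 have "(LINT t:{0..}|stieltjes g. exp (- q * t)) = enn2real (\<integral>\<^sup>+t. ennreal (indicator {0..} t *\<^sub>R exp (- q * t)) \<partial>stieltjes g)"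
  unfolding set_lebesgue_integral_def by (rule integral_eq_nn_integral) auto
 also have "(\<integral>\<^sup>+t. ennreal (indicator {0..} t *\<^sub>R exp (- q * t)) \<partial>stieltjes g) = (\<integral>\<^sup>+t\<in>{0..}. ennreal (exp (- q * t)) \<partial>stieltjes g)"
  by (rule nn_integral_cong) (simp add: indicator_def)
 also have "enn2real ... = (\<integral>t. q * (indicator {0..} t * exp (- q * t) * g t) \<partial>lborel)"
  unfolding nn
 proof (rule integral_eq_nn_integral[symmetric])
  note [measurable] = g_measurable
  have "(%t. q * (exp (- q * t) * (indicator {0..} t * g t))) \<in> borel_measurable lborel" by measurable
  then show "(%t. q * (indicator {0..} t * exp (- q * t) * g t)) \<in> borel_measurable lborel" by (simp only: mult_ac)
  show "AE t in lborel. 0 <= q * (indicator {0..} t * exp (- q * t) * g t)"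
   using q g0 by (auto simp: indicator_def)
 qed
 finally show "(LINT t:{0..}|stieltjes g. exp (- q * t)) = q * (\<integral>t. indicator {0..} t * exp (- q * t) * g t \<partial>lborel)" by simp
qed

end

context counting_path

\<comment> \<open>The measure induced by the counting path\<close>
begin

lemma n_path: "mono_on {0..} (%t. real (n t))" "cadlag (%t. real (n t))" "0 <= real (n 0)"
 using n_mono n_cadlag by (auto intro!: mono_onI)

abbreviation "S \<equiv> stieltjes (%t. real (n t))"

lemma S_sets [measurable_cong]: "sets S = sets borel" by (rule stieltjes_sets[OF n_path])

lemma S_gap: "0 <= s ==> s <= t ==> n s = n t ==> emeasure S {s<..t} = 0"
 using stieltjes_Ioc[OF n_path, of s t] by simp

text \<open>Between arrivals the measure has no mass, and the points after \<open>base i\<close> and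
  before the next arrival are covered by countably many intervals with rational right ends. Time 0
  has no atom since \<open>n 0 = 0\<close>.\<close>

lemma AE_arrival: "AE s in S. 0 <= s --> (\<exists>i\<ge>1. s = \<tau> i)"
proof -
 define base where "base i = (if i = 0 then 0 else \<tau> i)" for i
 have base: "n (base i) = i" "0 <= base i" for i using n_tau_eq[of i] n_0 tau_nonneg by (auto simp: base_def)
 define N0 where "N0 = {0} Un (\<Union>i. \<Union>p\<in>{p\<in>\<rat>. base i <= p & n p = i}. {base i<..p})"
 have ctb: "countable {p\<in>\<rat>. base i <= p & n p = i}" for i using countable_rat by (rule countable_subset[rotated]) auto
 have "(\<Union>i. \<Union>p\<in>{p\<in>\<rat>. base i <= p & n p = i}. {base i<..p}) \<in> null_sets S"
 proof (intro null_sets_UN' null_setsI ctb)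
  fix i p assume "p \<in> {p\<in>\<rat>. base i <= p & n p = i}"
  then show "emeasure S {base i<..p} = 0" using base by (intro S_gap) auto
 qed (auto simp: S_sets)
 moreover have "{0} \<in> null_sets S"
  using stieltjes_Icc[OF n_path, of 0] n_0 by (intro null_setsI) (auto simp: S_sets)
 ultimately have N0: "N0 \<in> null_sets S" unfolding N0_def by (intro null_sets.Un)
 have cov: "s \<in> N0" if s: "0 <= s" "\<not> (\<exists>i\<ge>1. s = \<tau> i)" for s
 proof (cases "s = 0")
  case False
  define i where "i = n s"
  have bs: "base i < s"
  proof (cases "i = 0")
   case False
   then have "s ~= \<tau> i" using s(2) by auto
   moreover have "\<tau> i <= s" using tau_le_iff[OF s(1), of i] by (simp add: i_def)
   ultimately show ?thesis using False by (simp add: base_def)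
  qed (use s \<open>s ~= 0\<close> in \<open>simp add: base_def\<close>)
  obtain d where d: "0 < d" "\<forall>u\<in>{s..<s + d}. n u = n s" using n_right[OF s(1)] by blast
  obtain p where p: "p \<in> \<rat>" "s < p" "p < s + d" using Rats_dense_in_real[of s "s + d"] d(1) by auto
  have np: "n p = i" using bspec[OF d(2), of p] p by (simp add: i_def)
  have "p \<in> {p\<in>\<rat>. base i <= p & n p = i}" "s \<in> {base i<..p}" using p bs np by simp_all
  then show ?thesis unfolding N0_def by blast
 qed (simp add: N0_def)
 show ?thesis using AE_not_in[OF N0] by eventually_elim (use cov in blast)
qed

lemma S_arrival:
 assumes i: "1 <= i" shows "emeasure S {\<tau> i} = 1"
proof -
 define s where "s = (if i = 1 then 0 else \<tau> (i - 1))"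
 have s: "0 <= s" "n s = i - 1" "s < \<tau> i"
 proof -
  show "0 <= s" by (simp add: s_def tau_nonneg)
  show "n s = i - 1" using n_tau_eq[of "i - 1"] i n_0 by (auto simp: s_def)
  then show "s < \<tau> i" using tau_le_iff[OF \<open>0 <= s\<close>, of i] i by auto
 qed
 have "emeasure S {\<tau> i} = emeasure S {s<..\<tau> i}"
 proof (rule emeasure_eq_AE)
  show "AE u in S. u \<in> {\<tau> i} \<longleftrightarrow> u \<in> {s<..\<tau> i}"
   using AE_arrival
  proof eventually_elim
   case (elim u)
   have "u = \<tau> i" if u: "s < u" "u <= \<tau> i"
   proof -
    obtain j where j: "1 <= j" "u = \<tau> j" using elim u s(1) by auto
    have "j <= i" using tau_le_iff[OF tau_nonneg, of j i] u j n_tau_eq[OF i] by simp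
    moreover have "\<not> j <= i - 1" using tau_le_iff[OF s(1), of j] u j s(2) by auto
    ultimately have "j = i" using i by arith
    then show ?thesis using j by simp
   qed
   then show ?case using s by auto
  qed
 qed (auto simp: S_sets)
 also have "... = ennreal (real (n (\<tau> i)) - real (n s))" using s by (intro stieltjes_Ioc[OF n_path]) auto
 also have "real (n (\<tau> i)) - real (n s) = 1" using n_tau_eq[OF i] s(2) i by (simp add: of_nat_diff)
 finally show ?thesis by simp
qed

text \<open>The measure is carried by the arrivals and gives each of them mass 1.\<close>

lemma S_integral:
 fixes \<nu> :: "real => real"
 assumes \<nu>: "(%s. indicator {0..} s * \<nu> s) \<in> borel_measurable borel" and t: "0 <= t"
 shows "(LINT s:{0..t}|S. \<nu> s) = (\<Sum>i=1..n t. \<nu> (\<tau> i))"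
proof -
 note [measurable] = \<nu>
 have fin: "integrable S (%s. indicator {\<tau> i} s * c)" "(\<integral>s. indicator {\<tau> i} s * c \<partial>S) = c" if "i \<in> {1..n t}" for i and c :: real
  using S_arrival[of i] that by (auto simp: S_sets measure_def intro!: integrable_mult_left)
 have "(LINT s:{0..t}|S. \<nu> s) = (\<integral>s. (\<Sum>i=1..n t. indicator {\<tau> i} s * \<nu> (\<tau> i)) \<partial>S)"
  unfolding set_lebesgue_integral_def
 proof (rule integral_cong_AE)
  have "(%s. indicator {0..t} s * (indicator {0..} s * \<nu> s)) \<in> borel_measurable S" by measurable
  also have "(%s. indicator {0..t} s * (indicator {0..} s * \<nu> s)) = (%s. indicator {0..t} s *\<^sub>R \<nu> s)"
   by (auto simp: fun_eq_iff indicator_def)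
  finally show "(%s. indicator {0..t} s *\<^sub>R \<nu> s) \<in> borel_measurable S" .
  show "AE s in S. indicator {0..t} s *\<^sub>R \<nu> s = (\<Sum>i=1..n t. indicator {\<tau> i} s * \<nu> (\<tau> i))"
   using AE_arrival
  proof eventually_elim
   case (elim s)
   show ?case
   proof (cases "s \<in> {0..t}")
    case True
    then obtain j where j: "1 <= j" "s = \<tau> j" using elim by auto
    have jn: "j \<in> {1..n t}" using tau_le_iff[OF t, of j] True j by auto
    have inj: "\<tau> i = \<tau> j \<longleftrightarrow> i = j" if "1 <= i" for i using n_tau_eq[OF that] n_tau_eq[OF j(1)] by metis
    have "(\<Sum>i=1..n t. indicator {\<tau> i} s * \<nu> (\<tau> i)) = (\<Sum>i=1..n t. if i = j then \<nu> (\<tau> j) else 0)"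
    proof (rule sum.cong[OF refl])
     fix i assume "i \<in> {1..n t}"
     then have "\<tau> i = \<tau> j \<longleftrightarrow> i = j" by (intro inj) auto
     then show "indicator {\<tau> i} s * \<nu> (\<tau> i) = (if i = j then \<nu> (\<tau> j) else 0)" by (auto simp: j(2) indicator_def)
    qed
    also have "... = \<nu> s" using jn j by simp
    finally show ?thesis using True by simp
   next
    case False
    have "indicator {\<tau> i} s = (0::real)" if "i \<in> {1..n t}" for i
     using that False tau_le_iff[OF t, of i] tau_nonneg[of i] by (auto simp: indicator_def)
    then show ?thesis using False by simp
   qed
  qed
 qed measurable
 also have "... = (\<Sum>i=1..n t. \<nu> (\<tau> i))"
  using fin by (subst Bochner_Integration.integral_sum) (auto intro!: sum.cong)
 finally show ?thesis .
qed

text \<open>A non-measurable integrand has integral \<open>0\<close>, so that measurability of \<open>\<nu>\<close> need not be assumed.\<close>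

lemma integral_const_between_arrivals:
 fixes \<nu> :: "real => real"
 assumes l: "!!t. 0 <= t ==> l t = (LINT s:{0..t}|S. \<nu> s)" and l0: "!!t. 0 <= t ==> 0 <= l t"
 shows "l 0 = 0" and "0 <= s ==> s <= t ==> l s < l t ==> n s < n t"
proof -
 \<comment> \<open>Measurability is required on the larger set only and is inherited by the smaller
   one; the difference carries no mass.\<close>
 have *: "(\<integral>u. indicator A u *\<^sub>R \<nu> u \<partial>S) = (\<integral>u. indicator B u *\<^sub>R \<nu> u \<partial>S)"
  if m: "(%u. indicator B u *\<^sub>R \<nu> u) \<in> borel_measurable S" and A: "A \<in> sets borel" "A \<subseteq> B" and N: "AE u in S. u \<notin> B - A" for A B
 proof (rule integral_cong_AE[OF _ m])
  note [measurable] = m A(1)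
  have "(%u. indicator A u * (indicator B u *\<^sub>R \<nu> u)) \<in> borel_measurable S" by measurable
  also have "(%u. indicator A u * (indicator B u *\<^sub>R \<nu> u)) = (%u. indicator A u *\<^sub>R \<nu> u)"
   using A(2) by (auto simp: fun_eq_iff indicator_def)
  finally show "(%u. indicator A u *\<^sub>R \<nu> u) \<in> borel_measurable S" .
  show "AE u in S. indicator A u *\<^sub>R \<nu> u = indicator B u *\<^sub>R \<nu> u"
   using N by eventually_elim (use A(2) in \<open>auto simp: indicator_def\<close>)
 qed
 have nm: "(LINT u:B|S. \<nu> u) = 0" if "(%u. indicator B u *\<^sub>R \<nu> u) \<notin> borel_measurable S" for B
  unfolding set_lebesgue_integral_def using that by (intro not_integrable_integral_eq) auto
 show "l 0 = 0"
 proof (cases "(%u. indicator {0..0} u *\<^sub>R \<nu> u) \<in> borel_measurable S")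
  case True
  have "AE u in S. u \<notin> {0..0} - {}"
   using stieltjes_Icc[OF n_path, of 0] n_0 by (intro AE_not_in null_setsI) (auto simp: S_sets)
  from *[OF True _ _ this] show ?thesis using l[of 0] by (simp add: set_lebesgue_integral_def)
 next
  case False
  from nm[OF this] show ?thesis using l[of 0] by simp
 qed
 assume st: "0 <= s" "s <= t" and lt: "l s < l t"
 show "n s < n t"
 proof (rule ccontr)
  assume "\<not> n s < n t"
  then have eq: "n s = n t" using n_mono[OF st] by simp
  show False
  proof (cases "(%u. indicator {0..t} u *\<^sub>R \<nu> u) \<in> borel_measurable S")
   case True
   have "AE u in S. u \<notin> {s<..t}" using S_gap[OF st eq] by (intro AE_not_in null_setsI) (auto simp: S_sets)
   then have "AE u in S. u \<notin> {0..t} - {0..s}" by eventually_elim auto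
   from *[OF True _ _ this] show False using l[of s] l[of t] st lt by (simp add: set_lebesgue_integral_def)
  next
   case False
   from nm[OF this] show False using l[of t] l0[of s] st lt by simp
  qed
 qed
qed

end

section \<open>Monotone potentials and growth of the controls\<close>

lemma (in complete_measure) integral_cong_AE_measurable:
 fixes h h' :: "'a => real"
 assumes "h' \<in> borel_measurable M" "AE w in M. h' w = h w"
 shows "integral\<^sup>L M h = integral\<^sup>L M h'"
proof (rule integral_cong_AE)
 show "h \<in> borel_measurable M" by (rule M_measurable_AE[OF assms]) simp
qed (use assms in auto)

lemma continuous_limit_const_diff:
 assumes "continuous_limit \<phi> B" shows "continuous_limit (%y. c - \<phi> y) (B + \<bar>c\<bar>)"
proof -
 obtain h where h: "!!k::nat. continuous_on UNIV (h k)" "!!k y. \<bar>h k y\<bar> <= B" "!!y. (%k. h k y) \<longlonglongrightarrow> \<phi> y"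
  using assms unfolding continuous_limit_def by blast
 show ?thesis unfolding continuous_limit_def
 proof (intro exI[of _ "%k y. c - h k y"] conjI allI)
  fix k y
  show "continuous_on UNIV (%y. c - h k y)" by (intro continuous_intros h(1))
  show "\<bar>c - h k y\<bar> <= B + \<bar>c\<bar>" using h(2)[of k y] by linarith
 next
  fix y show "(%k. c - h k y) \<longlonglongrightarrow> c - \<phi> y" by (intro tendsto_intros h(3))
 qed
qed

context discounted
begin

lemma iproc_const: "iproc (%t w. c)"
proof (rule iproc_growth)
 show "mproc (%t w. c)" by (rule mproc_random) simp
 fix t :: real assume t: "0 <= t"
 have "1 <= exp (q * t / 2)" using t q_pos by simp
 from mult_left_mono[OF this, of "\<bar>c\<bar>"] show "(\<integral>\<^sup>+w. ennreal \<bar>c\<bar> \<partial>M) <= ennreal (\<bar>c\<bar> * exp (q * t / 2))"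
  by (simp add: emeasure_space_1 ennreal_leI)
qed simp

lemma DE_const: "DE (%t w. c) = c / q"
 by (simp add: DE_iterated(3)[OF iproc_const] dis_integral prob_space)

lemma iproc_continuous_limit:
 assumes "continuous_limit \<phi> B" shows "iproc (%t w. \<phi> (Yb x t w))"
 by (rule iproc_bound[OF mproc_compose[OF mproc_Yb continuous_limit_measurable[OF assms]] iproc_const[of B]])
  (simp add: continuous_limit_bound[OF assms])

lemma U_eq_DE:
 assumes "continuous_limit \<phi> B" shows "U \<phi> y = DE (%t w. \<phi> (Yb y t w))"
proof -
 have "integrable M (%w::'w. 1::real)" by simp
 from swap_expectation[OF this continuous_limit_measurable[OF assms] continuous_limit_bound[OF assms], of 0 y]
 show ?thesis unfolding DE_iterated(3)[OF iproc_continuous_limit[OF assms]] by (simp add: U_def Pt_def)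
qed

lemma U_diff_const: "continuous_limit \<phi> B ==> U (%y. \<phi> y - c) y = U \<phi> y - c / q"
 and U_const_diff: "continuous_limit \<phi> B ==> U (%y. c - \<phi> y) y = c / q - U \<phi> y"
 by (simp_all add: U_eq_DE U_eq_DE[OF continuous_limit_diff_const] U_eq_DE[OF continuous_limit_const_diff]
   DE_diff[OF iproc_continuous_limit iproc_const] DE_diff[OF iproc_const iproc_continuous_limit] DE_const)

lemma iproc_bounded_mult:
 assumes "continuous_limit \<phi> B" "iproc Z" shows "iproc (%t w. \<phi> (Yb x t w) * Z t w)"
proof -
 have "integrable CQ (%(w, t). \<bar>Z t w\<bar>)"
  using integrable_abs[of CQ "%(w, t). Z t w"] assms(2) by (simp add: iproc_def case_prod_unfold)
 moreover have mZ: "mproc (%t w. \<bar>Z t w\<bar>)" by (rule mproc_compose[OF iproc_mproc[OF assms(2)]]) measurable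
 ultimately have "iproc (%t w. \<bar>Z t w\<bar>)" by (simp add: iproc_def)
 then have "iproc (%t w. B * \<bar>Z t w\<bar>)" by (rule iproc_cmult)
 then show ?thesis
 proof (rule iproc_bound[rotated])
  show "mproc (%t w. \<phi> (Yb x t w) * Z t w)"
   by (rule mproc_mult[OF mproc_compose[OF mproc_Yb continuous_limit_measurable[OF assms(1)]] iproc_mproc[OF assms(2)]])
  show "AE w in M. \<forall>t\<ge>0. \<bar>\<phi> (Yb x t w) * Z t w\<bar> <= B * \<bar>Z t w\<bar>"
   using continuous_limit_bound[OF assms(1)] by (simp add: abs_mult mult_right_mono)
 qed
qed

text \<open>\<open>growth_nonneg\<close> for \<open>\<phi> - q * u\<close>, since the resolvent of
  the constant \<open>q * u\<close> is \<open>u\<close>.\<close>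

lemma growth_lower:
 assumes \<phi>: "continuous_limit \<phi> B" and g: "continuous_on UNIV (U \<phi>)"
  and Z: "!!t. 0 <= t ==> Z t \<in> borel_measurable (F t)" "iproc Z"
  and path: "AE w in M. 0 <= Z 0 w & mono_on {0..} (%t. Z t w)"
  and start: "AE w in M. 0 < Z 0 w --> u <= U \<phi> (Yb x 0 w)"
  and growth: "AE w in M. \<forall>T\<ge>0. \<forall>e>0. \<exists>h>0. ALL s t. 0 <= s --> s <= t --> t <= T --> t < s + h --> Z s w < Z t w --> - e <= U \<phi> (Yb x t w) - u"
 shows "q * u * DE Z <= DE (%t w. \<phi> (Yb x t w) * Z t w)"
proof -
 have q: "q * u / q = u" using q_pos by simp
 have "0 <= DE (%t w. (\<phi> (Yb x t w) - q * u) * Z t w)"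
 proof (rule growth_nonneg[OF continuous_limit_diff_const[OF \<phi>] _ Z path, of "q * u" x])
  show "U (%y. \<phi> y - q * u) \<in> borel_measurable borel"
   unfolding U_diff_const[OF \<phi>, abs_def] by (intro borel_measurable_continuous_onI continuous_intros g)
 qed (use start growth in \<open>simp_all only: U_diff_const[OF \<phi>] q diff_ge_0_iff_ge\<close>)
 also have "(%t w. (\<phi> (Yb x t w) - q * u) * Z t w) = (%t w. \<phi> (Yb x t w) * Z t w - q * u * Z t w)"
  by (simp add: left_diff_distrib)
 also have "DE ... = DE (%t w. \<phi> (Yb x t w) * Z t w) - q * u * DE Z"
  by (simp add: DE_diff[OF iproc_bounded_mult[OF \<phi> Z(2)] iproc_cmult[OF Z(2)]] DE_cmult)
 finally show ?thesis by simp
qed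

lemma growth_upper:
 assumes \<phi>: "continuous_limit \<phi> B" and g: "continuous_on UNIV (U \<phi>)"
  and Z: "!!t. 0 <= t ==> Z t \<in> borel_measurable (F t)" "iproc Z"
  and path: "AE w in M. 0 <= Z 0 w & mono_on {0..} (%t. Z t w)"
  and start: "AE w in M. 0 < Z 0 w --> U \<phi> (Yb x 0 w) <= u"
  and growth: "AE w in M. \<forall>T\<ge>0. \<forall>e>0. \<exists>h>0. ALL s t. 0 <= s --> s <= t --> t <= T --> t < s + h --> Z s w < Z t w --> - e <= u - U \<phi> (Yb x t w)"
 shows "DE (%t w. \<phi> (Yb x t w) * Z t w) <= q * u * DE Z"
proof -
 have q: "q * u / q = u" using q_pos by simp
 have "0 <= DE (%t w. (q * u - \<phi> (Yb x t w)) * Z t w)"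
 proof (rule growth_nonneg[OF continuous_limit_const_diff[OF \<phi>] _ Z path, of "q * u" x])
  show "U (%y. q * u - \<phi> y) \<in> borel_measurable borel"
   unfolding U_const_diff[OF \<phi>, abs_def] by (intro borel_measurable_continuous_onI continuous_intros g)
 qed (use start growth in \<open>simp_all only: U_const_diff[OF \<phi>] q diff_ge_0_iff_ge\<close>)
 also have "(%t w. (q * u - \<phi> (Yb x t w)) * Z t w) = (%t w. q * u * Z t w - \<phi> (Yb x t w) * Z t w)"
  by (simp add: left_diff_distrib)
 also have "DE ... = q * u * DE Z - DE (%t w. \<phi> (Yb x t w) * Z t w)"
  by (simp add: DE_diff[OF iproc_cmult[OF Z(2)] iproc_bounded_mult[OF \<phi> Z(2)]] DE_cmult)
 finally show ?thesis by simp
qed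

lemma good_at_left: "good w ==> 0 < t ==> Lim (at_left t) (%s. x + X s w) = x + Lim (at_left t) (%s. X s w)"
 unfolding good_def by (intro tendsto_Lim trivial_limit_at_left_real tendsto_intros cadlag_at_left) auto

lemma good_no_up: "good w ==> 0 < t ==> x + X t w <= Lim (at_left t) (%s. x + X s w)"
 by (subst good_at_left) (auto simp: good_def)

lemma good_counting: "good w ==> counting_path (%t. N t w)"
 by (simp add: good_def)

lemma good_arrival_continuous:
 assumes g: "good w" and i: "1 <= i"
 shows "x + X (counting_path.\<tau> (%t. N t w) i) w = Lim (at_left (counting_path.\<tau> (%t. N t w) i)) (%s. x + X s w)"
proof -
 interpret counting_path "%t. N t w" by (rule good_counting[OF g])
 have "N s w < N (\<tau> i) w" if "0 <= s" "s < \<tau> i" for s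
  using tau_le_iff[OF that(1), of i] n_tau_eq[OF i] that(2) by simp
 then have "X (\<tau> i) w = Lim (at_left (\<tau> i)) (%s. X s w)"
  using g tau_pos[OF i] unfolding good_def by blast
 then show ?thesis using good_at_left[OF g tau_pos[OF i]] by simp
qed

lemma Lb_0: "good w ==> Lb x 0 w = 0"
 using barrier_path.L_0[OF good_path] by (simp add: good_eqs)

lemma Rb_0_pos: "good w ==> 0 < Rb x 0 w ==> Yb x 0 w = a"
 using Yb_eq[of x 0 w] Yb_0[of w x] Lb_0[of w x] by (auto simp: good_def)

lemma Yb_path: "good w ==> (%t. Yb x t w) = barrier_path.Y (%t. N t w) a b (%t. x + X t w)"
 by (rule ext) (rule good_eqs)

lemma near_arrival_potential:
 assumes g: "good w" and c: "continuous_on UNIV h" and e: "0 < e"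
 shows "\<exists>\<delta>>0. ALL i s t. 1 <= i --> i <= j --> s < counting_path.\<tau> (%t. N t w) i --> counting_path.\<tau> (%t. N t w) i <= t --> t < s + \<delta> -->
  \<bar>h (Yb x t w) - h (Yb x (counting_path.\<tau> (%t. N t w) i) w)\<bar> < (e::real)"
proof -
 interpret bp: barrier_path "%t. N t w" a b "%t. x + X t w" by (rule good_path[OF g])
 have "((%t. h (Yb x t w)) \<longlongrightarrow> h (Yb x (bp.\<tau> i) w)) (at_right (bp.\<tau> i))" for i
 proof (rule isCont_tendsto_compose[where g=h])
  show "isCont h (Yb x (bp.\<tau> i) w)" using c by (simp add: continuous_on_eq_continuous_at)
  show "((%t. Yb x t w) \<longlongrightarrow> Yb x (bp.\<tau> i) w) (at_right (bp.\<tau> i))"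
   by (rule cadlag_at_right[OF Yb_cadlag[OF g] bp.tau_nonneg])
 qed
 from bp.near_arrival[OF this e, where j=j] show ?thesis .
qed

section \<open>Four inequalities between controls and a monotone potential\<close>

context
 fixes \<phi> :: "real => real" and B :: real
 assumes \<phi>: "continuous_limit \<phi> B" and U_cont: "continuous_on UNIV (U \<phi>)" and U_mono: "!!y z. y <= z ==> U \<phi> y <= U \<phi> z"
begin

text \<open>Wherever the control acts, \<open>Yb\<close> is at least \<open>a\<close>, so its
  potential is at least that at \<open>a\<close>.\<close>

lemma control_up_lower:
 assumes Z: "!!t. 0 <= t ==> Z t \<in> borel_measurable (F t)" "iproc Z"
  and path: "AE w in M. 0 <= Z 0 w & mono_on {0..} (%t. Z t w)"
 shows "q * U \<phi> a * DE Z <= DE (%t w. \<phi> (Yb x t w) * Z t w)"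
proof (rule growth_lower[OF \<phi> U_cont Z path])
 have ge: "U \<phi> a <= U \<phi> (Yb x t w)" if "good w" "0 <= t" for t w by (rule U_mono[OF Yb_ge[OF that]])
 show "AE w in M. 0 < Z 0 w --> U \<phi> a <= U \<phi> (Yb x 0 w)"
  using AE_good by eventually_elim (simp add: ge)
 show "AE w in M. \<forall>T\<ge>0. \<forall>e>0. \<exists>h>0. ALL s t. 0 <= s --> s <= t --> t <= T --> t < s + h --> Z s w < Z t w --> - e <= U \<phi> (Yb x t w) - U \<phi> a"
  using AE_good
 proof eventually_elim
  case (elim w)
  have "- e <= U \<phi> (Yb x t w) - U \<phi> a" if "0 < e" "0 <= s" "s <= t" for e s t using ge[OF elim, of t] that by linarith
  then show ?case by (meson zero_less_one)
 qed
qed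

text \<open>By \<open>R_growth\<close> the reflection acts only while \<open>Yb\<close> is close to
  \<open>a\<close>, and there the continuous potential is close to its value at \<open>a\<close>. An
  initial push puts the process exactly at \<open>a\<close>.\<close>

lemma reflection_upper: "DE (%t w. \<phi> (Yb x t w) * Rb x t w) <= q * U \<phi> a * DE (Rb x)" if iR: "iproc (Rb x)"
proof (rule growth_upper[OF \<phi> U_cont Rb_F iR])
 show "AE w in M. 0 <= Rb x 0 w & mono_on {0..} (%t. Rb x t w)"
  using AE_good by eventually_elim (auto intro!: mono_onI Rb_mono Rb_nonneg)
 show "AE w in M. 0 < Rb x 0 w --> U \<phi> (Yb x 0 w) <= U \<phi> a"
  using AE_good by eventually_elim (simp add: Rb_0_pos)
 show "AE w in M. \<forall>T\<ge>0. \<forall>e>0. \<exists>h>0. ALL s t. 0 <= s --> s <= t --> t <= T --> t < s + h --> Rb x s w < Rb x t w --> - e <= U \<phi> a - U \<phi> (Yb x t w)"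
  using AE_good
 proof eventually_elim
  case (elim w)
  interpret bp: barrier_path "%t. N t w" a b "%t. x + X t w" by (rule good_path[OF elim])
  show ?case
  proof (intro allI impI)
   fix T e :: real assume T: "0 <= T" and e: "0 < e"
   have "isCont (U \<phi>) a" using U_cont by (simp add: continuous_on_eq_continuous_at)
   then obtain d where d: "0 < d" "!!y. \<bar>y - a\<bar> < d ==> \<bar>U \<phi> y - U \<phi> a\<bar> < e"
    using e unfolding isCont_def LIM_eq by (metis abs_zero cancel_comm_monoid_add_class.diff_cancel real_norm_def)
   have "\<exists>h>0. ALL s t. 0 <= s --> s <= t --> t <= T --> t < s + h --> bp.R s < bp.R t --> bp.Y t <= a + d / 2"
    by (rule bp.R_growth[OF good_no_up[OF elim] T half_gt_zero[OF d(1)]])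
   then obtain h where h: "0 < h" "!!s t. 0 <= s ==> s <= t ==> t <= T ==> t < s + h ==> bp.R s < bp.R t ==> bp.Y t <= a + d / 2" by blast
   show "\<exists>h>0. ALL s t. 0 <= s --> s <= t --> t <= T --> t < s + h --> Rb x s w < Rb x t w --> - e <= U \<phi> a - U \<phi> (Yb x t w)"
   proof (rule exI[of _ h], intro conjI h(1) allI impI)
    fix s t assume st: "0 <= s" "s <= t" "t <= T" "t < s + h" "Rb x s w < Rb x t w"
    have "Yb x t w <= a + d / 2" using h(2)[OF st(1-4)] st(5) by (simp add: good_eqs[OF elim])
    moreover have "a <= Yb x t w" using Yb_ge[OF elim] st by simp
    ultimately have "\<bar>Yb x t w - a\<bar> < d" using d(1) by linarith
    from d(2)[OF this] show "- e <= U \<phi> a - U \<phi> (Yb x t w)" by linarith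
   qed
  qed
 qed
qed

text \<open>An interval in which \<open>Z\<close> grows contains an arrival, at which the barrier
  strategy has left \<open>Yb\<close> at most at \<open>b\<close>; right continuity extends this to
  the end of a short interval. The arrivals are common to all strategies, so the competitor acts at
  these times as well.\<close>

lemma control_down_upper:
 assumes Z: "!!t. 0 <= t ==> Z t \<in> borel_measurable (F t)" "iproc Z"
  and path: "AE w in M. 0 <= Z 0 w & mono_on {0..} (%t. Z t w)"
  and arr: "AE w in M. Z 0 w = 0 & (ALL s t. 0 <= s --> s <= t --> Z s w < Z t w --> N s w < N t w)"
 shows "DE (%t w. \<phi> (Yb x t w) * Z t w) <= q * U \<phi> b * DE Z"
proof (rule growth_upper[OF \<phi> U_cont Z path])
 show "AE w in M. 0 < Z 0 w --> U \<phi> (Yb x 0 w) <= U \<phi> b" using arr by eventually_elim simp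
 show "AE w in M. \<forall>T\<ge>0. \<forall>e>0. \<exists>h>0. ALL s t. 0 <= s --> s <= t --> t <= T --> t < s + h --> Z s w < Z t w --> - e <= U \<phi> b - U \<phi> (Yb x t w)"
  using AE_good arr
 proof eventually_elim
  case (elim w)
  interpret bp: barrier_path "%t. N t w" a b "%t. x + X t w" by (rule good_path[OF elim(1)])
  show ?case
  proof (intro allI impI)
   fix T e :: real assume T: "0 <= T" and e: "0 < e"
   obtain h where h: "0 < h" "!!i s t. 1 <= i ==> i <= N T w ==> s < bp.\<tau> i ==> bp.\<tau> i <= t ==> t < s + h ==> \<bar>U \<phi> (Yb x t w) - U \<phi> (Yb x (bp.\<tau> i) w)\<bar> < e"
    using near_arrival_potential[OF elim(1) U_cont e, where x=x and j="N T w"] by blast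
   show "\<exists>h>0. ALL s t. 0 <= s --> s <= t --> t <= T --> t < s + h --> Z s w < Z t w --> - e <= U \<phi> b - U \<phi> (Yb x t w)"
   proof (rule exI[of _ h], intro conjI h(1) allI impI)
    fix s t assume st: "0 <= s" "s <= t" "t <= T" "t < s + h" "Z s w < Z t w"
    have "N s w < N t w" using elim(2) st by blast
    then obtain i where i: "i \<in> {1..N t w}" "s < bp.\<tau> i" "bp.\<tau> i <= t" using bp.arrival_between[OF st(1) _ st(2)] by blast
    have i1: "1 <= i" "i <= N T w" using i(1) bp.n_mono[of t T] st by auto
    have "\<bar>U \<phi> (Yb x t w) - U \<phi> (Yb x (bp.\<tau> i) w)\<bar> < e" by (rule h(2)[OF i1 i(2,3) st(4)])
    moreover have "Yb x (bp.\<tau> i) w <= b"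
     unfolding good_eqs(3)[OF elim(1)] using bp.Y_arrival_le[OF good_no_up[OF elim(1) bp.tau_pos[OF i1(1)]] i1(1)] .
    then have "U \<phi> (Yb x (bp.\<tau> i) w) <= U \<phi> b" by (rule U_mono)
    ultimately show "- e <= U \<phi> b - U \<phi> (Yb x t w)" by linarith
   qed
  qed
 qed
qed

text \<open>Here the interval contains an arrival with a positive push, where \<open>Yb\<close>
  equals \<open>b\<close> exactly because \<open>X\<close> almost surely does not jump at
  arrivals.\<close>

lemma push_lower: "q * U \<phi> b * DE (Lb x) <= DE (%t w. \<phi> (Yb x t w) * Lb x t w)" if iL: "iproc (Lb x)"
proof (rule growth_lower[OF \<phi> U_cont Lb_F iL])
 show "AE w in M. 0 <= Lb x 0 w & mono_on {0..} (%t. Lb x t w)"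
  using AE_good by eventually_elim (auto intro!: mono_onI Lb_mono Lb_nonneg)
 show "AE w in M. 0 < Lb x 0 w --> U \<phi> b <= U \<phi> (Yb x 0 w)"
  using AE_good by eventually_elim (simp add: Lb_0)
 show "AE w in M. \<forall>T\<ge>0. \<forall>e>0. \<exists>h>0. ALL s t. 0 <= s --> s <= t --> t <= T --> t < s + h --> Lb x s w < Lb x t w --> - e <= U \<phi> (Yb x t w) - U \<phi> b"
  using AE_good
 proof eventually_elim
  case (elim w)
  interpret bp: barrier_path "%t. N t w" a b "%t. x + X t w" by (rule good_path[OF elim])
  show ?case
  proof (intro allI impI)
   fix T e :: real assume T: "0 <= T" and e: "0 < e"
   obtain h where h: "0 < h" "!!i s t. 1 <= i ==> i <= N T w ==> s < bp.\<tau> i ==> bp.\<tau> i <= t ==> t < s + h ==> \<bar>U \<phi> (Yb x t w) - U \<phi> (Yb x (bp.\<tau> i) w)\<bar> < e"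
    using near_arrival_potential[OF elim U_cont e, where x=x and j="N T w"] by blast
   show "\<exists>h>0. ALL s t. 0 <= s --> s <= t --> t <= T --> t < s + h --> Lb x s w < Lb x t w --> - e <= U \<phi> (Yb x t w) - U \<phi> b"
   proof (rule exI[of _ h], intro conjI h(1) allI impI)
    fix s t assume st: "0 <= s" "s <= t" "t <= T" "t < s + h" "Lb x s w < Lb x t w"
    obtain i where i: "i \<in> {1..N t w}" "s < bp.\<tau> i" "bp.\<tau> i <= t" "0 < bp.c i"
     using bp.L_growth[OF st(1,2)] st(5) unfolding good_eqs(2)[OF elim] by blast
    have i1: "1 <= i" "i <= N T w" using i(1) bp.n_mono[of t T] st by auto
    have "\<bar>U \<phi> (Yb x t w) - U \<phi> (Yb x (bp.\<tau> i) w)\<bar> < e" by (rule h(2)[OF i1 i(2,3) st(4)])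
    moreover have "Yb x (bp.\<tau> i) w = b"
     unfolding good_eqs(3)[OF elim] by (rule bp.Y_push_eq[OF good_arrival_continuous[OF elim i1(1)] i1(1) i(4)])
    ultimately show "- e <= U \<phi> (Yb x t w) - U \<phi> b" by simp
   qed
  qed
 qed
qed

end

section \<open>Admissible strategies\<close>

lemma dis_exp: "indicator {0..} t * exp (- q * t) = dis t" by (simp add: dis_def)

lemma path_cost:
 assumes "0 <= g 0" "mono_on {0..} g" "cadlag g"
 shows "(\<integral>\<^sup>+t\<in>{0..}. ennreal (exp (- q * t)) \<partial>stieltjes g) = (\<integral>\<^sup>+t. ennreal (dis t * \<bar>q * g t\<bar>) \<partial>lborel)"
  and "(LINT t:{0..}|stieltjes g. exp (- q * t)) = q * (\<integral>t. dis t * g t \<partial>lborel)"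
proof -
 have g0: "0 <= g t" if "0 <= t" for t using mono_onD[OF assms(2), of 0 t] assms(1) that by simp
 have eq: "q * (dis t * g t) = dis t * \<bar>q * g t\<bar>" for t
  using g0[of t] dis_neg[of t] q_pos by (cases "0 <= t") (auto simp: abs_mult)
 show "(\<integral>\<^sup>+t\<in>{0..}. ennreal (exp (- q * t)) \<partial>stieltjes g) = (\<integral>\<^sup>+t. ennreal (dis t * \<bar>q * g t\<bar>) \<partial>lborel)"
  unfolding stieltjes_discounted(1)[OF assms(2,3,1) q_pos] dis_exp eq ..
 show "(LINT t:{0..}|stieltjes g. exp (- q * t)) = q * (\<integral>t. dis t * g t \<partial>lborel)"
  unfolding stieltjes_discounted(2)[OF assms(2,3,1) q_pos] dis_exp ..
qed

lemma running_nn: "(\<integral>\<^sup>+t\<in>{0..}. ennreal (exp (- q * t) * \<bar>h t\<bar>) \<partial>lborel) = (\<integral>\<^sup>+t. ennreal (dis t * \<bar>h t\<bar>) \<partial>lborel)"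
 by (rule nn_integral_cong) (auto simp: dis_def indicator_def)

lemma running_lint: "(LINT t:{0..}|lborel. exp (- q * t) * h t) = (\<integral>t. dis t * h t \<partial>lborel)" for h :: "real => real"
 unfolding set_lebesgue_integral_def by (rule Bochner_Integration.integral_cong) (auto simp: dis_def indicator_def)

context
 fixes f :: "real => real"
 assumes f_measurable: "f \<in> borel_measurable borel"
begin

lemma strategy_processes:
 assumes "is_strategy M X N (R, L)"
 shows "!!t. 0 <= t ==> R t \<in> borel_measurable (F t)" "!!t. 0 <= t ==> L t \<in> borel_measurable (F t)"
  and "AE w in M. 0 <= R 0 w & mono_on {0..} (%t. R t w) & cadlag (%t. R t w)"
  and "AE w in M. 0 <= L 0 w & mono_on {0..} (%t. L t w) & cadlag (%t. L t w)"
  and "mproc R" "mproc L" "mproc (controlled X x (R, L))"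
  and "AE w in M. L 0 w = 0 & (ALL s t. 0 <= s --> s <= t --> L s w < L t w --> N s w < N t w)"
proof -
 show RF: "R t \<in> borel_measurable (F t)" and LF: "L t \<in> borel_measurable (F t)" if "0 <= t" for t
  using assms that by (auto simp: is_strategy_def adapted_def)
 show Rp: "AE w in M. 0 <= R 0 w & mono_on {0..} (%t. R t w) & cadlag (%t. R t w)"
  and Lp: "AE w in M. 0 <= L 0 w & mono_on {0..} (%t. L t w) & cadlag (%t. L t w)"
  using assms by (auto simp: is_strategy_def)
 show R: "mproc R" by (rule mproc_cadlag[OF F_measurable_M[OF RF]]) (use Rp in \<open>auto elim!: eventually_mono\<close>)
 show L: "mproc L" by (rule mproc_cadlag[OF F_measurable_M[OF LF]]) (use Lp in \<open>auto elim!: eventually_mono\<close>)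
 have "mproc X" by (rule mproc_cadlag[OF X_measurable X_cadlag])
 then have "mproc (%t w. x + X t w + R t w - L t w)"
  by (intro mproc_diff mproc_add R L mproc_random) auto
 then show "mproc (controlled X x (R, L))" by (simp add: controlled_def[abs_def])
 obtain \<nu> where \<nu>: "AE w in M. \<forall>t\<ge>0. L t w = (LINT s:{0..t}|stieltjes (%u. real (N u w)). \<nu> s w)"
  using assms by (auto simp: is_strategy_def)
 show "AE w in M. L 0 w = 0 & (ALL s t. 0 <= s --> s <= t --> L s w < L t w --> N s w < N t w)"
  using \<nu> Lp AE_good
 proof eventually_elim
  case (elim w)
  interpret counting_path "%t. N t w" by (rule good_counting[OF elim(3)])
  have l: "L t w = (LINT s:{0..t}|S. \<nu> s w)" if "0 <= t" for t using elim(1) that by simp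
  have l0: "0 <= L t w" if "0 <= t" for t using elim(2) mono_onD[of "{0..}" "%t. L t w" 0 t] that by force
  show ?case using integral_const_between_arrivals[of "%t. L t w" "%s. \<nu> s w", OF l l0] by blast
 qed
qed

text \<open>Integration by parts pathwise turns the control condition into integrability of
  \<open>q * R\<close> and \<open>q * L\<close> against the discount; both are non-negative, so the
  sum splits.\<close>

lemma admissible_iproc:
 assumes st: "is_strategy M X N (R, L)"
 shows "(R, L) \<in> admissible M X N q f x \<longleftrightarrow> iproc (%t w. f (controlled X x (R, L) t w)) & iproc R & iproc L"
proof -
 note sp = strategy_processes[OF st]
 have mf: "mproc (%t w. f (controlled X x (R, L) t w))" by (rule mproc_compose[OF sp(7) f_measurable])
 let ?r = "%Z w. \<integral>\<^sup>+t. ennreal (dis t * \<bar>q * Z t w\<bar>) \<partial>lborel"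
 have cost: "AE w in M. (\<integral>\<^sup>+t\<in>{0..}. ennreal (exp (- q * t)) \<partial>stieltjes (%t. R t w)) + (\<integral>\<^sup>+t\<in>{0..}. ennreal (exp (- q * t)) \<partial>stieltjes (%t. L t w)) = ?r R w + ?r L w"
  using sp(3,4) by eventually_elim (simp only: path_cost(1))
 have scale: "iproc Z \<longleftrightarrow> (\<integral>\<^sup>+w. ?r Z w \<partial>M) < \<infinity>" if "mproc Z" for Z
 proof -
  have "iproc (%t w. q * Z t w) \<longleftrightarrow> (\<integral>\<^sup>+w. ?r Z w \<partial>M) < \<infinity>" using mproc_cmult[OF that, of q] by (simp add: iproc_iff)
  moreover have "iproc (%t w. q * Z t w) \<longleftrightarrow> iproc Z"
   using iproc_cmult[of Z q] iproc_cmult[of "%t w. q * Z t w" "1 / q"] q_pos by auto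
  ultimately show ?thesis by simp
 qed
 have sum: "iproc R & iproc L \<longleftrightarrow> (\<integral>\<^sup>+w. ?r R w + ?r L w \<partial>M) < \<infinity>"
 proof
  assume "(\<integral>\<^sup>+w. ?r R w + ?r L w \<partial>M) < \<infinity>"
  moreover have "(\<integral>\<^sup>+w. ?r R w \<partial>M) <= (\<integral>\<^sup>+w. ?r R w + ?r L w \<partial>M)" "(\<integral>\<^sup>+w. ?r L w \<partial>M) <= (\<integral>\<^sup>+w. ?r R w + ?r L w \<partial>M)"
   by (auto intro!: nn_integral_mono)
  ultimately show "iproc R & iproc L" using scale[OF sp(5)] scale[OF sp(6)] by (auto intro: le_less_trans)
 next
  assume "iproc R & iproc L"
  then have "iproc (%t w. q * (R t w + L t w))" by (intro iproc_cmult iproc_add) auto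
  then have "(\<integral>\<^sup>+w. \<integral>\<^sup>+t. ennreal (dis t * \<bar>q * (R t w + L t w)\<bar>) \<partial>lborel \<partial>M) < \<infinity>"
   unfolding iproc_iff by (rule conjunct2)
  also have "(\<integral>\<^sup>+w. \<integral>\<^sup>+t. ennreal (dis t * \<bar>q * (R t w + L t w)\<bar>) \<partial>lborel \<partial>M) = (\<integral>\<^sup>+w. ?r R w + ?r L w \<partial>M)"
  proof (rule nn_integral_cong_AE)
   show "AE w in M. (\<integral>\<^sup>+t. ennreal (dis t * \<bar>q * (R t w + L t w)\<bar>) \<partial>lborel) = ?r R w + ?r L w"
    using sp(3,4)
   proof eventually_elim
    case (elim w)
    have m: "(%t. ennreal (dis t * \<bar>q * g t\<bar>)) \<in> borel_measurable lborel" if "0 <= g 0" "mono_on {0..} g" "cadlag g" for g :: "real => real"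
    proof -
     note [measurable] = g_measurable[OF that(2,3,1)]
     have "(%t. ennreal (dis t * \<bar>q * (indicator {0..} t * g t)\<bar>)) \<in> borel_measurable lborel" by measurable
     also have "(%t. ennreal (dis t * \<bar>q * (indicator {0..} t * g t)\<bar>)) = (%t. ennreal (dis t * \<bar>q * g t\<bar>))"
      by (auto simp: fun_eq_iff dis_def indicator_def)
     finally show ?thesis .
    qed
    have nonneg: "0 <= g t" if "0 <= g 0" "mono_on {0..} g" "0 <= t" for g :: "real => real" and t
     using that mono_onD[OF that(2), of 0 t] by simp
    have "ennreal (dis t * \<bar>q * (R t w + L t w)\<bar>) = ennreal (dis t * \<bar>q * R t w\<bar>) + ennreal (dis t * \<bar>q * L t w\<bar>)" for t
    proof (cases "0 <= t")
     case True
     then have "0 <= R t w" "0 <= L t w" using nonneg[of "%t. R t w" t] nonneg[of "%t. L t w" t] elim by auto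
     then show ?thesis using q_pos dis_nonneg by (simp add: abs_mult distrib_left flip: ennreal_plus)
    qed (simp add: dis_neg)
    then show ?case using elim by (simp add: nn_integral_add[OF m m])
   qed
  qed
  finally show "(\<integral>\<^sup>+w. ?r R w + ?r L w \<partial>M) < \<infinity>" .
 qed
 show ?thesis unfolding sum
  unfolding admissible_def mem_Collect_eq fst_conv snd_conv running_nn nn_integral_cong_AE[OF cost] using st mf by (simp add: iproc_iff)
qed

lemma npv_eq_DE:
 assumes st: "is_strategy M X N (R, L)" and i: "iproc (%t w. f (controlled X x (R, L) t w))" "iproc R" "iproc L"
 shows "npv M X q CU CD f x (R, L) = DE (%t w. f (controlled X x (R, L) t w)) + (CU * (q * DE R) + CD * (q * DE L))"
proof -
 note sp = strategy_processes[OF st]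
 let ?i = "%H w. \<integral>t. dis t * H t w \<partial>lborel"
 let ?h = "%w. ?i (%t w. f (controlled X x (R, L) t w)) w + (CU * (q * ?i R w) + CD * (q * ?i L w))"
 have "npv M X q CU CD f x (R, L) = expectation ?h"
  unfolding npv_def running_lint fst_conv snd_conv
 proof (rule integral_cong_AE_measurable)
  show "?h \<in> borel_measurable M" using DE_iterated(1)[OF i(1)] DE_iterated(1)[OF i(2)] DE_iterated(1)[OF i(3)] by simp
  show "AE w in M. ?h w = ?i (%t w. f (controlled X x (R, L) t w)) w + (CU * (LINT t:{0..}|stieltjes (%t. R t w). exp (- q * t)) + CD * (LINT t:{0..}|stieltjes (%t. L t w). exp (- q * t)))"
   using sp(3,4) by eventually_elim (simp only: path_cost(2))
 qed
 also have "... = DE (%t w. f (controlled X x (R, L) t w)) + (CU * (q * DE R) + CD * (q * DE L))"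
  using DE_iterated(1)[OF i(1)] DE_iterated(1)[OF i(2)] DE_iterated(1)[OF i(3)]
  by (simp add: DE_iterated(3)[OF i(1)] DE_iterated(3)[OF i(2)] DE_iterated(3)[OF i(3)])
 finally show ?thesis .
qed

end

text \<open>The integrand is the excess of the left limit of \<open>Yb\<close> over
  \<open>b\<close>. It is adapted as a limit of earlier values, and its integral against the
  counting measure is the sum of the pushes.\<close>

lemma barrier_is_strategy: "is_strategy M X N (Rb x, Lb x)"
proof -
 define l where "l w s = (if 0 < s then Lim (at_left s) (%s. Yb x s w) else Yb x 0 w)" for w s
 \<comment> \<open>Times that increase to \<open>s\<close> without leaving [0, s], strictly before
   \<open>s\<close> unless \<open>s = 0\<close>.\<close>
 define u where "u n s = s - s / real (n + 2)" for n and s :: real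
 define \<nu> where "\<nu> s w = max 0 (l w s - b)" for s w
 have u: "0 <= u n s" "u n s <= s" if "0 <= s" for n s using that by (auto simp: u_def field_simps)
 have conv: "(%n. Yb x (u n s) w) \<longlonglongrightarrow> l w s" if g: "good w" and s: "0 <= s" for w s
 proof (cases "s = 0")
  case False
  then have s0: "0 < s" using s by simp
  have "filterlim (%n. u n s) (at_left s) sequentially"
   unfolding filterlim_at
  proof
   show "\<forall>\<^sub>F n in sequentially. u n s \<in> {..<s} & u n s ~= s" using s0 by (simp add: u_def)
   have "(%n. s - s * (1 / real (n + 2))) \<longlonglongrightarrow> s - s * 0"
    by (intro tendsto_intros LIMSEQ_ignore_initial_segment[OF lim_const_over_n])
   then show "(%n. u n s) \<longlonglongrightarrow> s" by (simp add: u_def)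
  qed
  from filterlim_compose[OF cadlag_at_left[OF Yb_cadlag[OF g] s0] this] show ?thesis using s0 by (simp add: l_def)
 qed (simp add: u_def l_def)
 have adapt: "\<nu> s \<in> borel_measurable (F s)" if s: "0 <= s" for s
 proof -
  have m: "Yb x (u n s) \<in> borel_measurable (F s)" for n by (rule F_measurable_mono[OF u(2)[OF s] Yb_F[OF u(1)[OF s]]])
  have "(%w. lim (%n. Yb x (u n s) w)) \<in> borel_measurable (F s)" by (rule borel_measurable_lim_metric[OF m])
  then have "(%w. max 0 (lim (%n. Yb x (u n s) w) - b)) \<in> borel_measurable (F s)" by measurable
  moreover have "AE w in M. max 0 (lim (%n. Yb x (u n s) w) - b) = \<nu> s w"
   using AE_good by eventually_elim (simp add: \<nu>_def limI[OF conv[OF _ s]])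
  ultimately show ?thesis by (rule F_measurable_AE) simp
 qed
 have cag: "AE w in M. caglad (%t. \<nu> t w)"
  using AE_good
 proof eventually_elim
  case (elim w)
  have "caglad (l w)" using caglad_left_limits[OF Yb_cadlag[OF elim, of x]] by (simp add: l_def[abs_def])
  then have l: "!!t. 0 < t ==> continuous (at_left t) (l w)" "!!t. 0 <= t ==> EX z. (l w \<longlongrightarrow> z) (at_right t)"
   by (auto simp: caglad_def)
  show ?case unfolding caglad_def \<nu>_def
  proof (intro conjI allI impI)
   fix t :: real assume "0 < t"
   then show "continuous (at_left t) (%t. max 0 (l w t - b))" by (intro continuous_intros l(1))
  next
   fix t :: real assume "0 <= t"
   then obtain z where "(l w \<longlongrightarrow> z) (at_right t)" using l(2) by blast
   then have "((%t. max 0 (l w t - b)) \<longlongrightarrow> max 0 (z - b)) (at_right t)" by (intro tendsto_intros)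
   then show "EX z. ((%t. max 0 (l w t - b)) \<longlongrightarrow> z) (at_right t)" by blast
  qed
 qed
 have int: "AE w in M. \<forall>t\<ge>0. Lb x t w = (LINT s:{0..t}|stieltjes (%u. real (N u w)). \<nu> s w)"
  using AE_Good
 proof eventually_elim
  case (elim w)
  have g: "good w" "w \<in> space M" using elim by (auto simp: Good_def)
  interpret bp: barrier_path "%t. N t w" a b "%t. x + X t w" by (rule good_path[OF g(1)])
  have "(%t. if w \<in> Good & 0 <= t then Yb x t w else 0) \<in> borel_measurable borel"
   using measurable_compose[OF measurable_Pair2'[OF g(2)] Yb_joint[of x]] by simp
  then have Y [measurable]: "(%t. if 0 <= t then Yb x t w else 0) \<in> borel_measurable borel" using elim by simp
  have "(%s. indicator {0..} s * \<nu> s w) \<in> borel_measurable borel"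
  proof (rule borel_measurable_LIMSEQ_real)
   show "(%s. indicator {0..} s * max 0 ((if 0 <= u n s then Yb x (u n s) w else 0) - b)) \<in> borel_measurable borel" for n
   proof -
    have "u n \<in> borel_measurable borel" unfolding u_def[abs_def] by measurable
    from measurable_compose[OF this Y] show ?thesis by measurable
   qed
   fix s :: real
   show "(%n. indicator {0..} s * max 0 ((if 0 <= u n s then Yb x (u n s) w else 0) - b)) \<longlonglongrightarrow> indicator {0..} s * \<nu> s w"
   proof (cases "0 <= s")
    case True
    then show ?thesis unfolding \<nu>_def using u(1)[OF True] by (auto intro!: tendsto_intros conv[OF g(1)])
   qed simp
  qed
  note SI = bp.S_integral[OF this]
  show ?case
  proof (intro allI impI)
   fix t :: real assume t: "0 <= t"
   have "bp.c i = \<nu> (bp.\<tau> i) w" if "i \<in> {1..N t w}" for i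
    using bp.tau_pos[of i] that unfolding bp.c_def \<nu>_def l_def Yb_path[OF g(1), symmetric] by simp
   then have "Lb x t w = (\<Sum>i=1..N t w. \<nu> (bp.\<tau> i) w)"
    unfolding good_eqs(2)[OF g(1)] bp.L_eq[OF t] by (intro sum.cong) auto
   then show "Lb x t w = (LINT s:{0..t}|stieltjes (%u. real (N u w)). \<nu> s w)" using SI[OF t] by simp
  qed
 qed
 have "AE w in M. 0 <= Rb x 0 w & mono_on {0..} (%t. Rb x t w) & cadlag (%t. Rb x t w)"
  "AE w in M. 0 <= Lb x 0 w & mono_on {0..} (%t. Lb x t w) & cadlag (%t. Lb x t w)"
  using AE_good by (eventually_elim, auto intro!: mono_onI Rb_mono Rb_nonneg Rb_cadlag Lb_mono Lb_nonneg Lb_cadlag)+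
 moreover have "adapted M X N (Rb x)" "adapted M X N (Lb x)" "adapted M X N \<nu>"
  using Rb_F Lb_F adapt by (auto simp: adapted_def)
 ultimately show ?thesis unfolding is_strategy_def prod.case using cag int by blast
qed

end

section \<open>Verification\<close>

locale verification = laplace M X N r a b q \<gamma> \<sigma> \<mu>
 for M :: "'w measure" and X :: "real => 'w => real" and N :: "real => 'w => nat" and r a b q \<gamma> \<sigma> :: real and \<mu> :: "real measure" +
 fixes f :: "real => real" and CU CD :: real
 assumes convex: "convex_on UNIV f" and pw: "!!u v. f piecewise_C1_differentiable_on {u..v}"
  and rv: "filterlim (%x. \<bar>f x\<bar>) at_top at_top --> regularly_varying_at at_top f"
  and eq_a: "npv_running M X q (deriv f) a (barrier_strategy X N a b a) = - CU"
  and eq_b: "npv_running M X q (deriv f) b (barrier_strategy X N a b b) = CD"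
begin

section \<open>Integrability of the running cost, its slope and the controls\<close>

abbreviation "D \<equiv> right_slope f"

lemma D_mono: "y <= z ==> D y <= D z" by (rule right_slope_mono[OF convex])
lemma D_measurable: "D \<in> borel_measurable borel" by (rule borel_measurable_mono) (rule monoI, rule D_mono)
lemma f_borel: "f \<in> borel_measurable borel" by (rule borel_measurable_continuous_onI[OF convex_continuous[OF convex]])

text \<open>One exponent serves the process, the cost and its slope. The slope is controlled by the
  cost one unit further to the right, since D y is at most f (y + 1) - f y.\<close>

lemma growth_bounds:
 obtains \<theta> C where "0 <= C" "!!x. iproc (%t w. exp (\<theta> * (Yb x t w - a)))" "!!x. iproc (Lb x)" "!!x. iproc (Rb x)"
  "!!y. a <= y ==> \<bar>f y\<bar> <= C * exp (\<theta> * (y - a))" "!!y. a <= y ==> \<bar>D y\<bar> + \<bar>D a\<bar> <= C * exp (\<theta> * (y - a))"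
  "!!y. a <= y ==> \<bar>f a\<bar> + \<bar>D a\<bar> * (y - a) <= C * exp (\<theta> * (y - a))"
proof -
 obtain \<theta> where \<theta>: "0 < \<theta>" and mom: "!!x. \<exists>K\<ge>0. \<forall>t\<ge>0.
   (\<integral>\<^sup>+w. ennreal (exp (\<theta> * (Yb x t w - a))) \<partial>M) <= ennreal (K * exp (q * t / 2)) &
   (\<integral>\<^sup>+w. ennreal (Lb x t w) \<partial>M) <= ennreal (K * exp (q * t / 2)) &
   (\<integral>\<^sup>+w. ennreal (Rb x t w) \<partial>M) <= ennreal (K * exp (q * t / 2))"
  using moments by blast
 obtain C where C: "0 <= C" "!!y. a <= y ==> \<bar>f y\<bar> <= C * exp (\<theta> * (y - a))"
  using regularly_varying_growth[OF convex rv \<theta>, of a] by blast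
 have i: "iproc (%t w. exp (\<theta> * (Yb x t w - a))) & iproc (Lb x) & iproc (Rb x)" for x
 proof -
  obtain K where K: "0 <= K" "!!t. 0 <= t ==> (\<integral>\<^sup>+w. ennreal (exp (\<theta> * (Yb x t w - a))) \<partial>M) <= ennreal (K * exp (q * t / 2))"
   "!!t. 0 <= t ==> (\<integral>\<^sup>+w. ennreal (Lb x t w) \<partial>M) <= ennreal (K * exp (q * t / 2))"
   "!!t. 0 <= t ==> (\<integral>\<^sup>+w. ennreal (Rb x t w) \<partial>M) <= ennreal (K * exp (q * t / 2))" using mom[of x] by blast
  have "iproc (%t w. exp (\<theta> * (Yb x t w - a)))"
   by (rule iproc_growth[OF mproc_compose[OF mproc_Yb] K(1)]) (simp_all add: K(2))
  moreover have "(\<integral>\<^sup>+w. ennreal \<bar>Lb x t w\<bar> \<partial>M) = (\<integral>\<^sup>+w. ennreal (Lb x t w) \<partial>M)"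
   "(\<integral>\<^sup>+w. ennreal \<bar>Rb x t w\<bar> \<partial>M) = (\<integral>\<^sup>+w. ennreal (Rb x t w) \<partial>M)" if t: "0 <= t" for t
  proof -
   have "AE w in M. ennreal \<bar>Lb x t w\<bar> = ennreal (Lb x t w)" "AE w in M. ennreal \<bar>Rb x t w\<bar> = ennreal (Rb x t w)"
    using AE_good by (eventually_elim, simp add: Lb_nonneg Rb_nonneg t)+
   then show "(\<integral>\<^sup>+w. ennreal \<bar>Lb x t w\<bar> \<partial>M) = (\<integral>\<^sup>+w. ennreal (Lb x t w) \<partial>M)"
    "(\<integral>\<^sup>+w. ennreal \<bar>Rb x t w\<bar> \<partial>M) = (\<integral>\<^sup>+w. ennreal (Rb x t w) \<partial>M)" by (auto intro: nn_integral_cong_AE)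
  qed
  then have "iproc (Lb x)" "iproc (Rb x)"
   by (auto intro!: iproc_growth[OF _ K(1)] mproc_Lb mproc_Rb K(3,4))
  ultimately show ?thesis by blast
 qed
 \<comment> \<open>The sum of the constants of the three bounds, so that each of them holds with
   \<open>C'\<close>.\<close>
 define C' where "C' = C + (2 * \<bar>D a\<bar> + C * exp \<theta> + C) + (\<bar>f a\<bar> + \<bar>D a\<bar> / \<theta>)"
 have parts: "0 <= 2 * \<bar>D a\<bar> + C * exp \<theta> + C" "0 <= \<bar>f a\<bar> + \<bar>D a\<bar> / \<theta>" using C(1) \<theta> by auto
 have up: "c * exp (\<theta> * (y - a)) <= C' * exp (\<theta> * (y - a))" if "c <= C'" for c y using that by (intro mult_right_mono) auto
 show ?thesis
 proof (rule that[of C' \<theta>])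
  show "0 <= C'" using parts C(1) by (simp add: C'_def)
  fix y assume y: "a <= y"
  have one: "1 <= exp (\<theta> * (y - a))" using y \<theta> by simp
  show "\<bar>f y\<bar> <= C' * exp (\<theta> * (y - a))"
   by (rule order.trans[OF C(2)[OF y] up]) (use parts in \<open>simp add: C'_def\<close>)
  have "exp (\<theta> * (y + 1 - a)) = exp \<theta> * exp (\<theta> * (y - a))" by (simp add: algebra_simps flip: exp_add)
  then have f1: "\<bar>f (y + 1)\<bar> <= C * exp \<theta> * exp (\<theta> * (y - a))" using C(2)[of "y + 1"] y by simp
  have "D y <= f (y + 1) - f y" using right_slope_le_quotient[OF convex, of 1 y] by simp
  moreover have "D a <= D y" by (rule D_mono[OF y])
  ultimately have "\<bar>D y\<bar> + \<bar>D a\<bar> <= 2 * \<bar>D a\<bar> + \<bar>f (y + 1)\<bar> + \<bar>f y\<bar>" by linarith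
  also have "... <= 2 * \<bar>D a\<bar> * exp (\<theta> * (y - a)) + C * exp \<theta> * exp (\<theta> * (y - a)) + C * exp (\<theta> * (y - a))"
   using mult_left_mono[OF one, of "2 * \<bar>D a\<bar>"] f1 C(2)[OF y] by (intro add_mono) auto
  also have "... = (2 * \<bar>D a\<bar> + C * exp \<theta> + C) * exp (\<theta> * (y - a))" by (simp only: distrib_right)
  also have "... <= C' * exp (\<theta> * (y - a))" by (rule up) (use parts C(1) in \<open>simp add: C'_def\<close>)
  finally show "\<bar>D y\<bar> + \<bar>D a\<bar> <= C' * exp (\<theta> * (y - a))" .
  have "y - a <= 1 / \<theta> * exp (\<theta> * (y - a))" using exp_ge_add_one_self[of "\<theta> * (y - a)"] \<theta> by (simp add: field_simps)
  then have "\<bar>D a\<bar> * (y - a) <= \<bar>D a\<bar> * (1 / \<theta> * exp (\<theta> * (y - a)))" by (rule mult_left_mono) simp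
  then have "\<bar>f a\<bar> + \<bar>D a\<bar> * (y - a) <= \<bar>f a\<bar> * exp (\<theta> * (y - a)) + \<bar>D a\<bar> * (1 / \<theta> * exp (\<theta> * (y - a)))"
   using mult_left_mono[OF one, of "\<bar>f a\<bar>"] by (intro add_mono) auto
  also have "... = (\<bar>f a\<bar> + \<bar>D a\<bar> / \<theta>) * exp (\<theta> * (y - a))" by (simp add: distrib_right)
  also have "... <= C' * exp (\<theta> * (y - a))" by (rule up) (use parts C(1) in \<open>simp add: C'_def\<close>)
  finally show "\<bar>f a\<bar> + \<bar>D a\<bar> * (y - a) <= C' * exp (\<theta> * (y - a))" .
 qed (use i in auto)
qed

lemma iproc_Lb: "iproc (Lb x)" and iproc_Rb: "iproc (Rb x)"
 using growth_bounds by metis+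

lemma iproc_dominated:
 assumes h: "h \<in> borel_measurable borel" "!!y. a <= y ==> \<bar>h y\<bar> <= C * exp (\<theta> * (y - a))"
  and e: "iproc (%t w. exp (\<theta> * (Yb x t w - a)))"
 shows "iproc (%t w. h (Yb x t w))"
proof (rule iproc_bound[OF mproc_compose[OF mproc_Yb h(1)] iproc_cmult[OF e, where c=C]])
 show "AE w in M. \<forall>t\<ge>0. \<bar>h (Yb x t w)\<bar> <= C * exp (\<theta> * (Yb x t w - a))"
  using AE_good by eventually_elim (auto intro!: h(2) Yb_ge)
qed

lemma iproc_f: "iproc (%t w. f (Yb x t w))"
proof -
 obtain \<theta> C where "!!y. a <= y ==> \<bar>f y\<bar> <= C * exp (\<theta> * (y - a))" "!!x. iproc (%t w. exp (\<theta> * (Yb x t w - a)))"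
  using growth_bounds by metis
 then show ?thesis by (rule iproc_dominated[OF f_borel])
qed

text \<open>The right derivative frozen outside [a, a + m]: bounded, still monotone, and a bounded
  limit of continuous functions. Freezing below \<open>a\<close> is invisible to a process that
  stays above \<open>a\<close>.\<close>

definition "slope m y = D (max a (min y (a + real m)))" for m :: nat and y

lemma slope_limit: "EX B. continuous_limit (slope m) B"
 using truncated_slope_continuous_limit[OF convex, of a "a + real m"] unfolding slope_def[abs_def] by auto

lemma slope_mono: "y <= z ==> slope m y <= slope m z"
 unfolding slope_def by (rule D_mono) auto

lemma slope_bound: "a <= y ==> \<bar>slope m y\<bar> <= \<bar>D y\<bar> + \<bar>D a\<bar>"
 using D_mono[of a "max a (min y (a + real m))"] D_mono[of "max a (min y (a + real m))" y] unfolding slope_def by auto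

lemma eventually_untruncated: "\<forall>\<^sub>F m in sequentially. y <= a + real m"
proof -
 obtain m0 :: nat where "y - a <= real m0" using real_arch_simple by blast
 then have "y <= a + real m" if "m0 <= m" for m using that by simp
 then show ?thesis unfolding eventually_sequentially by blast
qed

lemma slope_tendsto: "a <= y ==> (%m. slope m y) \<longlonglongrightarrow> D y"
 by (rule tendsto_eventually, use eventually_untruncated[of y] in eventually_elim) (simp add: slope_def)

lemma U_slope_tendsto: "(%m. U (slope m) y) \<longlonglongrightarrow> DE (%t w. D (Yb y t w))"
proof -
 obtain \<theta> C where C: "!!y. a <= y ==> \<bar>D y\<bar> + \<bar>D a\<bar> <= C * exp (\<theta> * (y - a))" and e: "iproc (%t w. exp (\<theta> * (Yb y t w - a)))"
  using growth_bounds by metis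
 have eq: "U (slope m) y = DE (%t w. slope m (Yb y t w))" for m using slope_limit[of m] U_eq_DE by blast
 show ?thesis unfolding eq
 proof (rule DE_dominated_convergence[OF _ mproc_compose[OF mproc_Yb D_measurable] iproc_cmult[OF e, where c=C]])
  show "mproc (%t w. slope m (Yb y t w))" for m
   using slope_limit[of m] by (blast intro: mproc_compose[OF mproc_Yb] continuous_limit_measurable)
  show "AE w in M. \<forall>t\<ge>0. ALL n. \<bar>slope n (Yb y t w)\<bar> <= C * exp (\<theta> * (Yb y t w - a))"
   using AE_good by eventually_elim (blast intro: order.trans[OF slope_bound C] Yb_ge)
  show "AE w in M. \<forall>t\<ge>0. \<bar>D (Yb y t w)\<bar> <= C * exp (\<theta> * (Yb y t w - a))"
  proof -
   have h: "\<bar>D z\<bar> <= C * exp (\<theta> * (z - a))" if "a <= z" for z using C[OF that] by linarith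
   show ?thesis using AE_good by eventually_elim (blast intro: h Yb_ge)
  qed
  show "AE w in M. AE t in lborel. 0 <= t --> (%n. slope n (Yb y t w)) \<longlonglongrightarrow> D (Yb y t w)"
   using AE_good by eventually_elim (auto intro!: slope_tendsto Yb_ge)
 qed
qed

text \<open>Whatever value \<open>deriv\<close> takes at a kink, kinks are countably many and the
  process spends no time at them.\<close>

lemma npv_running_eq: "npv_running M X q (deriv f) y (barrier_strategy X N a b y) = DE (%t w. D (Yb y t w))"
proof -
 obtain \<theta> C where C: "!!y. a <= y ==> \<bar>D y\<bar> + \<bar>D a\<bar> <= C * exp (\<theta> * (y - a))" and e: "iproc (%t w. exp (\<theta> * (Yb y t w - a)))"
  using growth_bounds by metis
 have "\<bar>D z\<bar> <= C * exp (\<theta> * (z - a))" if "a <= z" for z using C[OF that] by linarith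
 then have iD: "iproc (%t w. D (Yb y t w))" using e by (rule iproc_dominated[OF D_measurable])
 have ctb: "countable {y. \<not> f differentiable (at y)}" by (rule countable_kinks[OF convex pw])
 have dm: "deriv f \<in> borel_measurable borel"
  by (rule measurable_discrete_difference[OF D_measurable ctb]) (auto simp: deriv_eq_right_slope[OF convex])
 have eq: "AE w in M. (\<integral>t. dis t * D (Yb y t w) \<partial>lborel) = (\<integral>t. dis t * deriv f (Yb y t w) \<partial>lborel)"
  using AE_Good Yb_not_in_countable[OF ctb, of y]
 proof eventually_elim
  case (elim w)
  have w: "w \<in> space M" using elim(1) by (simp add: Good_def)
  have m: "(%t. dis t * h (Yb y t w)) \<in> borel_measurable lborel" if "h \<in> borel_measurable borel" for h
  proof -
   have "(%t. if w \<in> Good & 0 <= t then h (Yb y t w) else 0) \<in> borel_measurable lborel"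
    using measurable_compose[OF measurable_Pair2'[OF w] Yphi_joint[OF that, of y]] by simp
   then have "(%t. dis t * (if w \<in> Good & 0 <= t then h (Yb y t w) else 0)) \<in> borel_measurable lborel"
    by (intro borel_measurable_times) auto
   also have "(%t. dis t * (if w \<in> Good & 0 <= t then h (Yb y t w) else 0)) = (%t. dis t * h (Yb y t w))"
    using elim(1) by (auto simp: fun_eq_iff dis_neg)
   finally show ?thesis .
  qed
  show ?case
  proof (rule integral_cong_AE[OF m[OF D_measurable] m[OF dm]])
   show "AE t in lborel. dis t * D (Yb y t w) = dis t * deriv f (Yb y t w)"
    using elim(2)
   proof eventually_elim
    case (elim t)
    then show ?case by (cases "0 <= t") (auto simp: dis_neg deriv_eq_right_slope[OF convex])
   qed
  qed
 qed
 show ?thesis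
  unfolding npv_running_def running_lint Yb_def[symmetric] DE_iterated(3)[OF iD]
  by (rule integral_cong_AE_measurable[OF borel_measurable_integrable[OF DE_iterated(1)[OF iD]] eq])
qed

lemma U_slope_a: "(%m. U (slope m) a) \<longlonglongrightarrow> - CU" and U_slope_b: "(%m. U (slope m) b) \<longlonglongrightarrow> CD"
 using U_slope_tendsto[of a] U_slope_tendsto[of b] by (simp_all only: npv_running_eq[symmetric] eq_a eq_b)

lemma U_slope_mono: "y <= z ==> U (slope m) y <= U (slope m) z"
proof -
 assume yz: "y <= z"
 obtain B where B: "continuous_limit (slope m) B" using slope_limit by blast
 show ?thesis unfolding U_eq_DE[OF B]
 proof (rule DE_mono[OF iproc_continuous_limit[OF B] iproc_continuous_limit[OF B]])
  show "AE w in M. \<forall>t\<ge>0. slope m (Yb y t w) <= slope m (Yb z t w)"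
   using AE_good by eventually_elim (auto intro!: slope_mono Yb_mono yz)
 qed
qed

text \<open>The monotone \<open>slope m\<close> has only countably many discontinuities, and the
  process spends no time at them. The flow is Lipschitz in its starting point, so dominated
  convergence applies.\<close>

lemma U_slope_continuous: "continuous_on UNIV (U (slope m))"
 unfolding continuous_on_sequentially
proof (intro allI ballI impI)
 fix xs :: "nat => real" and y :: real assume "y \<in> UNIV" and xs: "(ALL n. xs n \<in> UNIV) & xs \<longlonglongrightarrow> y"
 obtain B where B: "continuous_limit (slope m) B" using slope_limit by blast
 have ctb: "countable {z. \<not> isCont (slope m) z}" by (rule mono_ctble_discont) (rule monoI, rule slope_mono)
 have "(%n. DE (%t w. slope m (Yb (xs n) t w))) \<longlonglongrightarrow> DE (%t w. slope m (Yb y t w))"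
 proof (rule DE_dominated_convergence[OF _ _ iproc_const[of B]])
  show "AE w in M. AE t in lborel. 0 <= t --> (%n. slope m (Yb (xs n) t w)) \<longlonglongrightarrow> slope m (Yb y t w)"
   using AE_good Yb_not_in_countable[OF ctb, of y]
  proof eventually_elim
   case (elim w)
   show ?case using elim(2)
   proof eventually_elim
    case t: (elim t)
    show ?case
    proof
     assume t0: "0 <= t"
     have "(%n. Yb (xs n) t w) \<longlonglongrightarrow> Yb y t w"
     proof (rule LIM_zero_cancel, rule tendsto_rabs_zero_cancel, rule tendsto_sandwich[where f="%_. 0"])
      show "(%n. \<bar>xs n - y\<bar>) \<longlonglongrightarrow> 0" using xs by (intro tendsto_rabs_zero LIM_zero) auto
     qed (auto intro!: always_eventually Yb_Lipschitz elim(1) t0)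
     then show "(%n. slope m (Yb (xs n) t w)) \<longlonglongrightarrow> slope m (Yb y t w)"
      using t t0 by (intro isCont_tendsto_compose[where g="slope m"]) auto
    qed
   qed
  qed
 qed (use continuous_limit_bound[OF B] iproc_mproc[OF iproc_continuous_limit[OF B]] in auto)
 then show "(U (slope m) \<circ> xs) \<longlonglongrightarrow> U (slope m) y" by (simp add: o_def U_eq_DE[OF B])
qed

definition "trunc m y = f (min y (a + real m)) + slope m y * (y - min y (a + real m))" for m :: nat and y

lemma trunc_tangent: "a <= y ==> trunc m y + slope m y * (z - y) <= f z"
proof -
 assume "a <= y"
 then have wt: "max a (min y (a + real m)) = min y (a + real m)" by auto
 show ?thesis using right_slope_subgradient[OF convex, of "min y (a + real m)" z]
  unfolding trunc_def slope_def wt by (simp add: algebra_simps)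
qed

lemma trunc_bound: "a <= y ==> \<bar>trunc m y\<bar> <= \<bar>f y\<bar> + (\<bar>f a\<bar> + \<bar>D a\<bar> * (y - a))"
proof -
 assume y: "a <= y"
 define wt where "wt = min y (a + real m)"
 have wt: "a <= wt" "wt <= y" "max a wt = wt" using y by (auto simp: wt_def)
 have up: "trunc m y <= f y" using trunc_tangent[OF y, of m y] by simp
 have "D a * (wt - a) + D a * (y - wt) <= D a * (wt - a) + D wt * (y - wt)"
  using wt by (intro add_left_mono mult_right_mono D_mono) auto
 then have "f a + D a * (y - a) <= trunc m y"
  using right_slope_subgradient[OF convex, of a wt] wt unfolding trunc_def slope_def wt_def[symmetric] by (simp add: algebra_simps)
 moreover have "- \<bar>D a\<bar> * (y - a) <= D a * (y - a)" using y by (intro mult_right_mono) auto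
 moreover have "0 <= \<bar>D a\<bar> * (y - a)" using y by simp
 ultimately show ?thesis using up by linarith
qed

lemma trunc_DE:
 shows "iproc (%t w. trunc m (Yb x t w))" and "(%m. DE (%t w. trunc m (Yb x t w))) \<longlonglongrightarrow> DE (%t w. f (Yb x t w))"
proof -
 obtain \<theta> C where f: "!!y. a <= y ==> \<bar>f y\<bar> <= C * exp (\<theta> * (y - a))" and e: "iproc (%t w. exp (\<theta> * (Yb x t w - a)))"
  and C: "!!y. a <= y ==> \<bar>f a\<bar> + \<bar>D a\<bar> * (y - a) <= C * exp (\<theta> * (y - a))" and C0: "0 <= C"
  using growth_bounds by metis
 have tm: "trunc m \<in> borel_measurable borel" for m
 proof -
  have [measurable]: "slope m \<in> borel_measurable borel" using slope_limit[of m] continuous_limit_measurable by blast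
  note [measurable] = f_borel
  show ?thesis unfolding trunc_def[abs_def] by measurable
 qed
 have b: "\<bar>trunc m y\<bar> <= 2 * C * exp (\<theta> * (y - a))" if "a <= y" for m y
  using trunc_bound[OF that, of m] f[OF that] C[OF that] by linarith
 show "iproc (%t w. trunc m (Yb x t w))" for m by (rule iproc_dominated[OF tm b e])
 show "(%m. DE (%t w. trunc m (Yb x t w))) \<longlonglongrightarrow> DE (%t w. f (Yb x t w))"
 proof (rule DE_dominated_convergence[OF mproc_compose[OF mproc_Yb tm] mproc_compose[OF mproc_Yb f_borel] iproc_cmult[OF e, where c="2 * C"]])
  show "AE w in M. \<forall>t\<ge>0. ALL n. \<bar>trunc n (Yb x t w)\<bar> <= 2 * C * exp (\<theta> * (Yb x t w - a))"
   using AE_good by eventually_elim (blast intro: b Yb_ge)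
  have h: "\<bar>f y\<bar> <= 2 * C * exp (\<theta> * (y - a))" if "a <= y" for y
  proof -
   have "0 <= C * exp (\<theta> * (y - a))" using C0 by simp
   then show ?thesis using f[OF that] by linarith
  qed
  show "AE w in M. \<forall>t\<ge>0. \<bar>f (Yb x t w)\<bar> <= 2 * C * exp (\<theta> * (Yb x t w - a))"
   using AE_good by eventually_elim (blast intro: h Yb_ge)
  have "(%n. trunc n y) \<longlonglongrightarrow> f y" for y
   by (rule tendsto_eventually, use eventually_untruncated[of y] in eventually_elim) (simp add: trunc_def)
  then show "AE w in M. AE t in lborel. 0 <= t --> (%n. trunc n (Yb x t w)) \<longlonglongrightarrow> f (Yb x t w)" by simp
 qed
qed

lemma controlled_barrier: "controlled X x (Rb x, Lb x) = Yb x"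
 by (intro ext) (simp add: controlled_def Yb_eq)

lemma barrier_admissible: "(Rb x, Lb x) \<in> admissible M X N q f x"
 unfolding admissible_iproc[OF f_borel barrier_is_strategy] controlled_barrier
 by (intro conjI iproc_f iproc_Rb iproc_Lb)

text \<open>The difference of the controlled processes is the difference of the controls, and each
  of its four terms is estimated by the potential at \<open>a\<close> or \<open>b\<close>. In the
  limit these potentials are \<open>- CU\<close> and \<open>CD\<close>, so the bounds cancel exactly
  against the control costs.\<close>

lemma barrier_optimal:
 assumes "\<pi> \<in> admissible M X N q f x"
 shows "npv M X q CU CD f x (Rb x, Lb x) <= npv M X q CU CD f x \<pi>"
proof -
 obtain R L where \<pi>: "\<pi> = (R, L)" by (cases \<pi>)
 have st: "is_strategy M X N (R, L)" using assms by (simp add: \<pi> admissible_def)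
 note sp = strategy_processes[OF f_borel st]
 let ?Y = "controlled X x (R, L)"
 have i: "iproc (%t w. f (?Y t w))" "iproc R" "iproc L"
  using assms unfolding \<pi> admissible_iproc[OF f_borel st] by auto
 have Rp: "AE w in M. 0 <= R 0 w & mono_on {0..} (%t. R t w)" using sp(3) by eventually_elim simp
 have Lp: "AE w in M. 0 <= L 0 w & mono_on {0..} (%t. L t w)" using sp(4) by eventually_elim simp
 have ineq: "DE (%t w. trunc m (Yb x t w)) + (q * U (slope m) a * (DE R - DE (Rb x)) - q * U (slope m) b * (DE L - DE (Lb x))) <= DE (%t w. f (?Y t w))" for m
 proof -
  obtain B where B: "continuous_limit (slope m) B" using slope_limit by blast
  note U = B U_slope_continuous U_slope_mono
  let ?s = "%Z t w. slope m (Yb x t w) * Z t w"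
  have s: "iproc (?s R)" "iproc (?s (Rb x))" "iproc (?s L)" "iproc (?s (Lb x))"
   by (intro iproc_bounded_mult[OF B] i iproc_Rb iproc_Lb)+
  have "DE (%t w. trunc m (Yb x t w) + ((?s R t w - ?s (Rb x) t w) - (?s L t w - ?s (Lb x) t w))) <= DE (%t w. f (?Y t w))"
  proof (rule DE_mono[OF _ i(1)])
   show "iproc (%t w. trunc m (Yb x t w) + ((?s R t w - ?s (Rb x) t w) - (?s L t w - ?s (Lb x) t w)))"
    by (intro iproc_add iproc_diff trunc_DE(1) s)
   show "AE w in M. \<forall>t\<ge>0. trunc m (Yb x t w) + ((?s R t w - ?s (Rb x) t w) - (?s L t w - ?s (Lb x) t w)) <= f (?Y t w)"
    using AE_good
   proof eventually_elim
    case (elim w)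
    show ?case
    proof (intro allI impI)
     fix t :: real assume t: "0 <= t"
     have "trunc m (Yb x t w) + slope m (Yb x t w) * (?Y t w - Yb x t w) <= f (?Y t w)"
      by (rule trunc_tangent[OF Yb_ge[OF elim t]])
     moreover have "?Y t w - Yb x t w = (R t w - Rb x t w) - (L t w - Lb x t w)" by (simp add: controlled_def Yb_eq)
     ultimately show "trunc m (Yb x t w) + ((?s R t w - ?s (Rb x) t w) - (?s L t w - ?s (Lb x) t w)) <= f (?Y t w)"
      by (simp add: right_diff_distrib)
    qed
   qed
  qed
  also have "DE (%t w. trunc m (Yb x t w) + ((?s R t w - ?s (Rb x) t w) - (?s L t w - ?s (Lb x) t w))) =
    DE (%t w. trunc m (Yb x t w)) + ((DE (?s R) - DE (?s (Rb x))) - (DE (?s L) - DE (?s (Lb x))))"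
   by (simp only: DE_add[OF trunc_DE(1) iproc_diff[OF iproc_diff[OF s(1,2)] iproc_diff[OF s(3,4)]]]
     DE_diff[OF iproc_diff[OF s(1,2)] iproc_diff[OF s(3,4)]] DE_diff[OF s(1,2)] DE_diff[OF s(3,4)])
  finally have main: "DE (%t w. trunc m (Yb x t w)) + ((DE (?s R) - DE (?s (Rb x))) - (DE (?s L) - DE (?s (Lb x)))) <= DE (%t w. f (?Y t w))" .
  have 1: "q * U (slope m) a * DE R <= DE (?s R)" by (rule control_up_lower[OF U sp(1) i(2) Rp])
  have 2: "DE (?s (Rb x)) <= q * U (slope m) a * DE (Rb x)" by (rule reflection_upper[OF U iproc_Rb])
  have 3: "DE (?s L) <= q * U (slope m) b * DE L" by (rule control_down_upper[OF U sp(2) i(3) Lp sp(8)])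
  have 4: "q * U (slope m) b * DE (Lb x) <= DE (?s (Lb x))" by (rule push_lower[OF U iproc_Lb])
  show ?thesis unfolding right_diff_distrib using main 1 2 3 4 by linarith
 qed
 \<comment> \<open>The truncation is removed only now, after the estimates that need a bounded
   function; their outcome involves the slope only through two numbers with known limits.\<close>
 have "(%m. DE (%t w. trunc m (Yb x t w)) + (q * U (slope m) a * (DE R - DE (Rb x)) - q * U (slope m) b * (DE L - DE (Lb x))))
  \<longlonglongrightarrow> DE (%t w. f (Yb x t w)) + (q * (- CU) * (DE R - DE (Rb x)) - q * CD * (DE L - DE (Lb x)))"
  by (intro tendsto_intros trunc_DE(2) U_slope_a U_slope_b)
 then have "DE (%t w. f (Yb x t w)) + (q * (- CU) * (DE R - DE (Rb x)) - q * CD * (DE L - DE (Lb x))) <= DE (%t w. f (?Y t w))"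
  by (rule LIMSEQ_le_const2) (use ineq in blast)
 moreover have "npv M X q CU CD f x (Rb x, Lb x) = DE (%t w. f (Yb x t w)) + (CU * (q * DE (Rb x)) + CD * (q * DE (Lb x)))"
  using npv_eq_DE[OF f_borel barrier_is_strategy, of x x CU CD] by (simp add: controlled_barrier iproc_f iproc_Rb iproc_Lb)
 moreover have "npv M X q CU CD f x \<pi> = DE (%t w. f (?Y t w)) + (CU * (q * DE R) + CD * (q * DE L))"
  unfolding \<pi> by (rule npv_eq_DE[OF f_borel st i])
 ultimately show ?thesis by (simp add: algebra_simps)
qed

lemma barrier_strategy_eq: "barrier_strategy X N a b x = (Rb x, Lb x)"
 by (simp add: Rb_def[abs_def] Lb_def[abs_def] prod_eq_iff)

end

theorem theorem4p7:
  fixes M :: "'w measure" and X :: "real \<Rightarrow> 'w \<Rightarrow> real" and N :: "real \<Rightarrow> 'w \<Rightarrow> nat"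
    and \<mu> :: "real measure" and f :: "real \<Rightarrow> real"
    and q r \<gamma>\<^sub>0 \<sigma> C\<^sub>U C\<^sub>D a b :: real
  assumes "0 < q" and "0 < r"
    and "prob_space M" and "complete_measure M"
    and "levy_process M X" and "no_upward_jumps M X"
    and "levy_measure_neg \<mu>" and "0 \<le> \<sigma>"
    and "has_laplace_exponent M X (laplace_exponent \<gamma>\<^sub>0 \<sigma> \<mu>)"
    and "\<not> subordinator M (\<lambda>t \<omega>. - X t \<omega>)"
    and "\<exists>\<theta>>0. (\<integral>\<^sup>+y\<in>{..-1}. ennreal (exp (\<theta> * \<bar>y\<bar>)) \<partial>\<mu>) < \<infinity>"
    and "poisson_process M r N" and "indep_processes M X N"
    and "0 < C\<^sub>U + C\<^sub>D" and "running_cost q C\<^sub>U C\<^sub>D f"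
    and "a < b"
    and "npv_running M X q (deriv f) a (barrier_strategy X N a b a) = - C\<^sub>U"
    and "npv_running M X q (deriv f) b (barrier_strategy X N a b b) = C\<^sub>D"
  shows "\<forall>x. barrier_strategy X N a b x \<in> admissible M X N q f x \<and>
     ereal (npv M X q C\<^sub>U C\<^sub>D f x (barrier_strategy X N a b x)) =
       (INF \<pi>\<in>admissible M X N q f x. ereal (npv M X q C\<^sub>U C\<^sub>D f x \<pi>))"
proof -
 interpret prob_space M by fact
 interpret complete_measure M by fact
 interpret verification M X N r a b q \<gamma>\<^sub>0 \<sigma> \<mu> f C\<^sub>U C\<^sub>D
  by unfold_locales (use assms in \<open>auto simp: running_cost_def\<close>)
 show ?thesis
 proof (intro allI conjI antisym)
  fix x
  show adm: "barrier_strategy X N a b x \<in> admissible M X N q f x"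
   unfolding barrier_strategy_eq by (rule barrier_admissible)
  show "ereal (npv M X q C\<^sub>U C\<^sub>D f x (barrier_strategy X N a b x)) \<le> (INF \<pi>\<in>admissible M X N q f x. ereal (npv M X q C\<^sub>U C\<^sub>D f x \<pi>))"
   unfolding barrier_strategy_eq by (intro INF_greatest) (simp add: barrier_optimal)
  show "(INF \<pi>\<in>admissible M X N q f x. ereal (npv M X q C\<^sub>U C\<^sub>D f x \<pi>)) \<le> ereal (npv M X q C\<^sub>U C\<^sub>D f x (barrier_strategy X N a b x))"
   by (rule INF_lower[OF adm])
 qed
qed

end
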